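(* In the setting of a threaded code with $n_t=T=n$ decoded by the sphere decoder with thread-wise symbol ordering, suppose the code is DMT optimal, i.e. its diversity gain $d(r)$ equals the optimal tradeoff $d^*(r)$ for all $r\in[0,n]$. Then its SD complexity exponent is $$c(r)=r(n-\lfloor r\rfloor-1)+\big(n\lfloor r\rfloor-r(n-1)\big)^+,\qquad r\in[0,n],$$ and in particular $c(k)=k(n-k)$ for integer $k\in\{0,\dots,n\}$.
   Context: $(a)^+=\max(a,0)$. The optimal DMT $d^*(r)$ is the piecewise linear function connecting $(k,(n-k)(n_r-k))$, $k=0,\dots,n$. Threaded code: $\kappa=n^2$; thread $l\in\{1,\dots,n\}$ is the set of positions $\{(j,\mathrm{mod}(j-l,n)+1):j=1,\dots,n\}$ of an $n\times n$ matrix; the symbol vector consists of blocks $\mathbf s^{(l)}\in\mathcal Q_\eta^n$ and the vector of the entries of $\mathbf X$ in thread $l$ (ordered by row) equals $\theta\mathbf A_l\mathbf s^{(l)}$ with invertible $\mathbf A_l\in\mathbb C^{n\times n}$; the sphere decoder uses a thread-wise ordering $\mathbf s=(\mathbf s^{(l_1)},\dots,\mathbf s^{(l_n)})$, giving $\mathrm{vec}(\mathbf X)=\theta\mathbf G\mathbf s$. Standing setup: $\rho\to\infty$; $\log$ base 2; $f\doteq\rho^a$ means $\lim\log f/\log\rho=a$. $\mathbf Y=\mathbf H\mathbf X+\mathbf W$, $\mathbf H\in\mathbb C^{n_r\times n}$ ($n_r\ge n$) and $\mathbf W\in\mathbb C^{n_r\times n}$ with i.i.d. $\mathcal{CN}(0,1)$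 entries, independent. Symbols uniform on $\mathcal Q_\eta=\{s:\Re s,\Im s\in\mathbb Z\cap[-\eta,\eta]\}$, $\eta\doteq\rho^{r/(2n)}$, $\theta^2\doteq\rho^{1-r/n}$. $d(r)=-\lim\log\Pr(\hat{\mathbf X}_{\mathrm{ML}}\ne\mathbf X)/\log\rho$. Sphere decoder: $\mathbf M=\theta(\mathbf I_n\otimes\mathbf H)\mathbf G=\mathbf Q\mathbf R$ (thin QR), $\mathbf r=\mathbf Q^H\mathrm{vec}(\mathbf Y)$, $\mathbf r_k$ last $k$ entries, $\mathbf R_k$ lower-right $k\times k$ block, $N=\sum_{k=1}^{\kappa}|\{\hat{\mathbf s}_k\in\mathcal Q_\eta^k:\|\mathbf r_k-\mathbf R_k\hat{\mathbf s}_k\|^2\le\xi^2\}|$, $\xi^2=z\log\rho$, $z>d(r)$. $\Psi(x)=-\lim\log\Pr(N\ge\rho^x)/\log\rho$, $c(r)=\inf\{x:\Psi(x)>d(r)\}$ (limits assumed to exist). *)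

theory Defs
  imports "HOL-Probability.Probability"
begin

section \<open>Matrices as index functions (0-based indices, explicit dimensions)\<close>

type_synonym cmat = "nat \<Rightarrow> nat \<Rightarrow> complex"

definition mmul :: "nat \<Rightarrow> cmat \<Rightarrow> cmat \<Rightarrow> cmat" where
  "mmul k P Q = (\<lambda>i j. \<Sum>l<k. P i l * Q l j)"

definition invertible_cmat :: "nat \<Rightarrow> cmat \<Rightarrow> bool" where
  "invertible_cmat n P \<longleftrightarrow>
     (\<exists>B. \<forall>i<n. \<forall>j<n. mmul n B P i j = (if i = j then 1 else 0))"

definition vec_of :: "nat \<Rightarrow> cmat \<Rightarrow> nat \<Rightarrow> complex" where
  "vec_of m X p = X (p mod m) (p div m)"

definition kron_id :: "nat \<Rightarrow> nat \<Rightarrow> nat \<Rightarrow> cmat \<Rightarrow> cmat" where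
  "kron_id n nr nt H = (\<lambda>p q. if p div nr = q div nt \<and> p div nr < n
                               then H (p mod nr) (q mod nt) else 0)"

definition QAM :: "real \<Rightarrow> complex set" where
  "QAM eta = {s. Re s \<in> \<int> \<and> Im s \<in> \<int> \<and> \<bar>Re s\<bar> \<le> eta \<and> \<bar>Im s\<bar> \<le> eta}"

definition symvecs :: "nat \<Rightarrow> real \<Rightarrow> (nat \<Rightarrow> complex) set" where
  "symvecs kappa eta = {s. (\<forall>k<kappa. s k \<in> QAM eta) \<and> (\<forall>k\<ge>kappa. s k = 0)}"

text \<open>Thread l (0-based) occupies positions (j, (j - l) mod n), j < n; hence entry (j,c)
  belongs to thread (j - c) mod n.  (1-based in the paper: (j, mod(j-l,n)+1).)\<close>
definition thread_of :: "nat \<Rightarrow> nat \<Rightarrow> nat \<Rightarrow> nat" where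
  "thread_of n j c = (j + n - c) mod n"

text \<open>Thread-wise ordering: ord b = l_(b+1) is the thread stored in block b of the symbol
  vector s; thread l's block s^(l) is s restricted to the block holding l.\<close>
definition thread_block :: "nat \<Rightarrow> (nat \<Rightarrow> nat) \<Rightarrow> (nat \<Rightarrow> complex) \<Rightarrow> nat \<Rightarrow> nat \<Rightarrow> complex" where
  "thread_block n ord s l = (\<lambda>i. s (inv_into {..<n} ord l * n + i))"

text \<open>Codeword X: entries of thread l, ordered by row, equal theta * A_l s^(l)\<close>
definition codeword :: "nat \<Rightarrow> (nat \<Rightarrow> cmat) \<Rightarrow> (nat \<Rightarrow> nat) \<Rightarrow> real \<Rightarrow> (nat \<Rightarrow> complex) \<Rightarrow> cmat" where
  "codeword n A ord \<theta> s = (\<lambda>j c. if j < n \<and> c < n then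
      complex_of_real \<theta> * (\<Sum>i<n. A (thread_of n j c) j i * thread_block n ord s (thread_of n j c) i)
      else 0)"

text \<open>Generator G: vec(X) = theta * G s\<close>
definition Gmat :: "nat \<Rightarrow> (nat \<Rightarrow> cmat) \<Rightarrow> (nat \<Rightarrow> nat) \<Rightarrow> cmat" where
  "Gmat n A ord = (\<lambda>p k. vec_of n (codeword n A ord 1 (\<lambda>q. if q = k then 1 else 0)) p)"

definition cgauss :: "complex measure" where
  "cgauss = distr (density lborel (normal_density 0 (sqrt (1/2)))
                   \<Otimes>\<^sub>M density lborel (normal_density 0 (sqrt (1/2))))
                  borel (\<lambda>(a, b). Complex a b)"

definition gauss_mat :: "nat \<Rightarrow> nat \<Rightarrow> (nat \<times> nat \<Rightarrow> complex) measure" where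
  "gauss_mat m k = PiM ({..<m} \<times> {..<k}) (\<lambda>_. cgauss)"

definition to_mat :: "(nat \<times> nat \<Rightarrow> complex) \<Rightarrow> cmat" where
  "to_mat h = (\<lambda>i j. h (i, j))"

text \<open>Sample space (H, W, s), completed (so a.s.-well-defined events are measurable)\<close>
definition sample :: "nat \<Rightarrow> nat \<Rightarrow> real \<Rightarrow>
    ((nat \<times> nat \<Rightarrow> complex) \<times> (nat \<times> nat \<Rightarrow> complex) \<times> (nat \<Rightarrow> complex)) measure" where
  "sample n nr eta = completion
     (gauss_mat nr n \<Otimes>\<^sub>M gauss_mat nr n \<Otimes>\<^sub>M uniform_count_measure (symvecs (n * n) eta))"

definition received :: "nat \<Rightarrow> nat \<Rightarrow> (nat \<Rightarrow> cmat) \<Rightarrow> (nat \<Rightarrow> nat) \<Rightarrow> real \<Rightarrow>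
    cmat \<Rightarrow> cmat \<Rightarrow> (nat \<Rightarrow> complex) \<Rightarrow> cmat" where
  "received n nr A ord \<theta> H W s = (\<lambda>i c. mmul n H (codeword n A ord \<theta> s) i c + W i c)"

definition fro_dist2 :: "nat \<Rightarrow> nat \<Rightarrow> cmat \<Rightarrow> cmat \<Rightarrow> real" where
  "fro_dist2 m k P Q = (\<Sum>i<m. \<Sum>c<k. (cmod (P i c - Q i c))\<^sup>2)"

definition ml_error :: "nat \<Rightarrow> nat \<Rightarrow> (nat \<Rightarrow> cmat) \<Rightarrow> (nat \<Rightarrow> nat) \<Rightarrow> real \<Rightarrow> real \<Rightarrow>
    cmat \<Rightarrow> cmat \<Rightarrow> (nat \<Rightarrow> complex) \<Rightarrow> bool" where
  "ml_error n nr A ord \<theta> eta H W s =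
    (let Y = received n nr A ord \<theta> H W s;
         S = symvecs (n * n) eta;
         dist = (\<lambda>s'. fro_dist2 nr n Y (mmul n H (codeword n A ord \<theta> s')));
         shat = (SOME s'. s' \<in> S \<and> (\<forall>s''\<in>S. dist s' \<le> dist s''))
     in (\<exists>j<n. \<exists>c<n. codeword n A ord \<theta> shat j c \<noteq> codeword n A ord \<theta> s j c))"

definition is_thin_QR :: "nat \<Rightarrow> nat \<Rightarrow> cmat \<Rightarrow> cmat \<Rightarrow> cmat \<Rightarrow> bool" where
  "is_thin_QR m k M Q R \<longleftrightarrow>
     (\<forall>i<k. \<forall>j<k. (\<Sum>p<m. cnj (Q p i) * Q p j) = (if i = j then 1 else 0)) \<and>
     (\<forall>i<k. \<forall>j<k. j < i \<longrightarrow> R i j = 0) \<and>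
     (\<forall>p<m. \<forall>j<k. M p j = (\<Sum>i<k. Q p i * R i j))"

definition sd_count :: "nat \<Rightarrow> nat \<Rightarrow> (nat \<Rightarrow> cmat) \<Rightarrow> (nat \<Rightarrow> nat) \<Rightarrow> real \<Rightarrow> real \<Rightarrow> real \<Rightarrow>
    cmat \<Rightarrow> cmat \<Rightarrow> (nat \<Rightarrow> complex) \<Rightarrow> nat" where
  "sd_count n nr A ord \<theta> eta xi2 H W s =
    (let \<kappa> = n * n; m = nr * n;
         M = (\<lambda>p q. complex_of_real \<theta> * mmul (n * n) (kron_id n nr n H) (Gmat n A ord) p q);
         y = vec_of nr (received n nr A ord \<theta> H W s);
         QR = (SOME QR. is_thin_QR m \<kappa> M (fst QR) (snd QR));
         Q = fst QR; R = snd QR;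
         r = (\<lambda>i. \<Sum>p<m. cnj (Q p i) * y p)
     in \<Sum>k = 1..\<kappa>. card {t. (\<forall>j. (\<kappa> - k \<le> j \<and> j < \<kappa>) \<longrightarrow> t j \<in> QAM eta) \<and>
                              (\<forall>j. \<not> (\<kappa> - k \<le> j \<and> j < \<kappa>) \<longrightarrow> t j = 0) \<and>
              (\<Sum>i\<in>{\<kappa> - k..<\<kappa>}. (cmod (r i - (\<Sum>j\<in>{\<kappa> - k..<\<kappa>}. R i j * t j)))\<^sup>2) \<le> xi2})"

definition exp_equal :: "(real \<Rightarrow> real) \<Rightarrow> real \<Rightarrow> bool" where
  "exp_equal f a \<longleftrightarrow> ((\<lambda>\<rho>. log 2 (f \<rho>) / log 2 \<rho>) \<longlongrightarrow> a) at_top"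

definition neg_exponent :: "(real \<Rightarrow> real) \<Rightarrow> ereal \<Rightarrow> bool" where
  "neg_exponent P L \<longleftrightarrow>
     ((\<lambda>\<rho>. if P \<rho> = 0 then \<infinity> else ereal (- log 2 (P \<rho>) / log 2 \<rho>)) \<longlongrightarrow> L) at_top"

text \<open>optimal DMT: piecewise linear through (k, (n-k)(nr-k)), k = 0..n\<close>
definition dstar :: "nat \<Rightarrow> nat \<Rightarrow> real \<Rightarrow> real" where
  "dstar n nr r = (let k = min (nat \<lfloor>r\<rfloor>) (n - 1);
                      a = (real n - real k) * (real nr - real k);
                      b = (real n - real k - 1) * (real nr - real k - 1)
                   in a + (r - real k) * (b - a))"

definition err_prob where
  "err_prob n nr A ord \<theta> eta =
     measure (sample n nr eta)
       {\<omega> \<in> space (sample n nr eta).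
          ml_error n nr A ord \<theta> eta (to_mat (fst \<omega>)) (to_mat (fst (snd \<omega>))) (snd (snd \<omega>))}"

definition sd_tail_prob where
  "sd_tail_prob n nr A ord \<theta> eta xi2 x \<rho> =
     measure (sample n nr eta)
       {\<omega> \<in> space (sample n nr eta).
          real (sd_count n nr A ord \<theta> eta xi2 (to_mat (fst \<omega>)) (to_mat (fst (snd \<omega>))) (snd (snd \<omega>)))
            \<ge> \<rho> powr x}"

end

theory Submission
  imports Defs "Jordan_Normal_Form.Determinant" "HOL-Real_Asymp.Real_Asymp"
begin

text \<open>
  The singular values of \<open>H\<close> are replaced by its pivots \<open>p\<^sub>0, p\<^sub>1, \<dots>\<close> under Gaussian elimination with
  complete pivoting. Stage \<open>l\<close> removes \<open>nr + n - 2l - 1\<close> entries, each of them translated by a function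
  of the entries removed earlier, and the Gaussian density is bounded. Hence pivots
  \<open>|p\<^sub>l|\<^sup>2\<close> of exponents \<open>-\<alpha>\<^sub>l\<close> or less have probability exponent at least \<open>\<Sum> (nr + n - 2l - 1) \<alpha>\<^sub>l\<close>.

  Upper bound: every level count is at most the number of Gaussian integer vectors whose codeword has
  small image under \<open>H\<close>, and the pivots bound its exponent by \<open>n \<Sum> (\<alpha>\<^sub>l - (1 - r/n))\<^sup>+\<close>. Maximising this
  convex function subject to cost at most \<open>d\<^sup>*(r)\<close> is a knapsack problem with optimum \<open>c(r)\<close>.

  Lower bound: take channels with \<open>p\<close> large pivots, a pivot of size \<open>\<sigma>\<close> and a negligible rest, for which
  any \<open>p\<close> columns of the first \<open>p\<close> triangular rows are well conditioned. In the thread-wise ordering the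
  last \<open>n(n - p)\<close> symbols determine all but \<open>p\<close> entries of each codeword column, and those \<open>p\<close> entries can
  be chosen such that \<open>H\<close> maps the column to a vector with one component of size \<open>\<sigma>\<close> and
  negligible others. The pigeonhole principle applied to these \<open>n\<close> components yields many tails inside the
  sphere for at least half of the transmitted vectors.
\<close>

section \<open>Gaussian elimination with complete pivoting\<close>

text \<open>Pivots replace singular values because no joint density is needed: given the entries
  used earlier, a stage only translates fresh independent entries, so Fubini and one bound per entry
  suffice. An upper estimate has to cover whatever order complete pivoting selects and takes a union
  over the finitely many orders; the lower estimate prescribes the diagonal order and forces its
  multipliers to be small. The weight \<open>nr + n - 2l - 1\<close> is a difference of consecutive
  values of \<open>(n - k)(nr - k)\<close>, so \<open>dstar\<close> is the least cost of total
  exponent \<open>n - r\<close>, which ties the knapsack problem to the tradeoff. Three obstacles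
  lie outside the counting. \<open>sd_count\<close> takes an arbitrary QR decomposition, so the
  count is shown to be independent of it and is compared almost surely with a measurable
  Gram-Schmidt version. The exponent conditions alone do not give \<open>1 \<le> \<eta>\<close> or a
  nonzero \<open>\<theta>\<close>; a finite diversity gain does. On the last segment of the
  tradeoff, where \<open>c(r)\<close> can vanish, the pigeonhole channel is replaced by the remark
  that the transmitted vector itself survives.\<close>

definition mvec :: "nat \<Rightarrow> cmat \<Rightarrow> (nat \<Rightarrow> complex) \<Rightarrow> nat \<Rightarrow> complex" where
  "mvec n S x a = (\<Sum>b<n. S a b * x b)"

text \<open>The pivot row and column are cleared instead of deleted, so all stages live on one index
  set. Since \<open>x / 0 = 0\<close>, a zero pivot leaves \<open>S\<close> unchanged.\<close>

definition schur :: "cmat \<Rightarrow> nat \<times> nat \<Rightarrow> cmat" where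
  "schur S ij = (\<lambda>a b. S a b - S a (snd ij) * S (fst ij) b / S (fst ij) (snd ij))"

fun gauss_elim :: "cmat \<Rightarrow> (nat \<Rightarrow> nat \<times> nat) \<Rightarrow> nat \<Rightarrow> cmat" where
  "gauss_elim H \<pi> 0 = H"
| "gauss_elim H \<pi> (Suc l) = schur (gauss_elim H \<pi> l) (\<pi> l)"

definition pivot :: "cmat \<Rightarrow> (nat \<Rightarrow> nat \<times> nat) \<Rightarrow> nat \<Rightarrow> complex" where
  "pivot H \<pi> l = gauss_elim H \<pi> l (fst (\<pi> l)) (snd (\<pi> l))"

definition cross :: "(nat \<Rightarrow> nat \<times> nat) \<Rightarrow> nat \<Rightarrow> (nat \<times> nat) set" where
  "cross \<pi> l = {(a, b). \<exists>l'<l. a = fst (\<pi> l') \<or> b = snd (\<pi> l')}"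

lemma mvec_schur:
  "mvec n (schur S ij) x a = mvec n S x a - S a (snd ij) / S (fst ij) (snd ij) * mvec n S x (fst ij)"
  unfolding mvec_def schur_def
  by (simp add: algebra_simps sum_subtractf sum_distrib_left)

lemma gauss_elim_cong:
  assumes "\<And>l'. l' < l \<Longrightarrow> \<pi> l' = \<pi>' l'"
  shows "gauss_elim H \<pi> l = gauss_elim H \<pi>' l"
  using assms by (induction l) auto

lemma cross_cong:
  assumes "\<And>l'. l' < l \<Longrightarrow> \<pi> l' = \<pi>' l'"
  shows "cross \<pi> l = cross \<pi>' l"
  using assms unfolding cross_def by auto

lemma cross_Suc:
  "(a, b) \<in> cross \<pi> (Suc l) \<longleftrightarrow> (a, b) \<in> cross \<pi> l \<or> a = fst (\<pi> l) \<or> b = snd (\<pi> l)"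
  unfolding cross_def by (auto simp: less_Suc_eq)

text \<open>Each step subtracts a product of entries from the pivot row and column, so the
  accumulated correction is a function of the crossed entries alone. Hence a fresh entry is merely
  translated by earlier ones, which is what makes Fubini applicable stage by stage.\<close>

lemma gauss_elim_local:
  assumes "\<And>a b. a \<in> R \<Longrightarrow> b \<in> C \<Longrightarrow> (a, b) \<in> cross \<pi> l \<Longrightarrow> H a b = H' a b"
    "\<And>l'. l' < l \<Longrightarrow> fst (\<pi> l') \<in> R \<and> snd (\<pi> l') \<in> C" "a \<in> R" "b \<in> C"
  shows "gauss_elim H \<pi> l a b - H a b = gauss_elim H' \<pi> l a b - H' a b"
  using assms
proof (induction l arbitrary: a b)
  case 0
  then show ?case by simp
next
  case (Suc l)
  have IH: "gauss_elim H \<pi> l a b - H a b = gauss_elim H' \<pi> l a b - H' a b" if "a \<in> R" "b \<in> C" for a b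
    by (rule Suc.IH) (use Suc.prems that in \<open>auto simp: cross_Suc\<close>)
  have eq: "gauss_elim H \<pi> l a b = gauss_elim H' \<pi> l a b"
    if "a = fst (\<pi> l) \<or> b = snd (\<pi> l)" "a \<in> R" "b \<in> C" for a b
    using IH[of a b] Suc.prems(1)[of a b] that by (simp add: cross_Suc)
  have ij: "fst (\<pi> l) \<in> R" "snd (\<pi> l) \<in> C" using Suc.prems(2)[of l] by auto
  show ?case
    using IH[OF Suc.prems(3,4)] Suc.prems(3,4) ij by (simp add: schur_def eq algebra_simps)
qed

text \<open>The pivot is the largest entry outside the used rows and columns; the used ones hold
  zeros, so it is largest in the whole box. Old zeros survive a step because one factor of the
  subtracted product is itself an old zero.\<close>

lemma complete_pivoting_steps:
  assumes "n \<le> nr" "L \<le> n"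
  shows "\<exists>\<pi>. (\<forall>l<L. fst (\<pi> l) < nr \<and> snd (\<pi> l) < n \<and>
             (\<forall>a<nr. \<forall>b<n. cmod (gauss_elim H \<pi> l a b) \<le> cmod (pivot H \<pi> l))) \<and>
           inj_on (\<lambda>l. fst (\<pi> l)) {..<L} \<and> inj_on (\<lambda>l. snd (\<pi> l)) {..<L} \<and>
           (\<forall>l\<le>L. \<forall>a<nr. \<forall>b<n. (a, b) \<in> cross \<pi> l \<longrightarrow> gauss_elim H \<pi> l a b = 0)"
  using assms(2)
proof (induction L)
  case 0
  then show ?case by (auto simp: cross_def)
next
  case (Suc L)
  then have "L \<le> n" by simp
  from Suc.IH[OF this] obtain \<pi> where
    A: "\<forall>l<L. fst (\<pi> l) < nr \<and> snd (\<pi> l) < n \<and>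
             (\<forall>a<nr. \<forall>b<n. cmod (gauss_elim H \<pi> l a b) \<le> cmod (pivot H \<pi> l))"
    and i1: "inj_on (\<lambda>l. fst (\<pi> l)) {..<L}" and i2: "inj_on (\<lambda>l. snd (\<pi> l)) {..<L}"
    and Z: "\<forall>l\<le>L. \<forall>a<nr. \<forall>b<n. (a, b) \<in> cross \<pi> l \<longrightarrow> gauss_elim H \<pi> l a b = 0"
    by (elim exE conjE) rule
  have bd: "\<And>l. l < L \<Longrightarrow> fst (\<pi> l) < nr" "\<And>l. l < L \<Longrightarrow> snd (\<pi> l) < n"
    and mx: "\<And>l a b. l < L \<Longrightarrow> a < nr \<Longrightarrow> b < n \<Longrightarrow> cmod (gauss_elim H \<pi> l a b) \<le> cmod (pivot H \<pi> l)"
    using A by auto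
  have z: "gauss_elim H \<pi> l a b = 0" if "l \<le> L" "a < nr" "b < n" "(a, b) \<in> cross \<pi> l" for l a b
    using Z that by auto
  define Rm where "Rm = ({..<nr} - (\<lambda>l. fst (\<pi> l)) ` {..<L}) \<times> ({..<n} - (\<lambda>l. snd (\<pi> l)) ` {..<L})"
  have c: "card ((\<lambda>l. fst (\<pi> l)) ` {..<L}) \<le> L" "card ((\<lambda>l. snd (\<pi> l)) ` {..<L}) \<le> L"
    using card_image_le[of "{..<L}"] by auto
  have "{..<nr} - (\<lambda>l. fst (\<pi> l)) ` {..<L} \<noteq> {}" "{..<n} - (\<lambda>l. snd (\<pi> l)) ` {..<L} \<noteq> {}"
    using c Suc.prems assms(1)
    by (metis Diff_eq_empty_iff card_lessThan card_mono finite_imageI finite_lessThan le_trans not_less_eq_eq)+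
  then have ne: "Rm \<noteq> {}" unfolding Rm_def by auto
  have fin: "finite Rm" unfolding Rm_def by auto
  define S where "S = gauss_elim H \<pi> L"
  \<comment> \<open>The sign turns \<open>arg_min_on\<close> into the choice of a largest
    entry.\<close>
  define f where "f e = - cmod (S (fst e) (snd e))" for e
  obtain i j where ij': "arg_min_on f Rm = (i, j)" by (cases "arg_min_on f Rm")
  have ij: "(i, j) \<in> Rm" using arg_min_if_finite(1)[OF fin ne, of f] by (simp add: ij')
  have max: "cmod (S a b) \<le> cmod (S i j)" if "(a, b) \<in> Rm" for a b
  proof -
    have "\<not> f (a, b) < f (i, j)" using arg_min_if_finite(2)[OF fin ne, of f] that unfolding ij' by blast
    then show ?thesis by (simp add: f_def)
  qed
  have zS: "S a b = 0" if "a < nr" "b < n" "(a, b) \<notin> Rm" for a b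
  proof -
    have "(a, b) \<in> cross \<pi> L" using that unfolding Rm_def cross_def by auto
    then show ?thesis using that z[of L a b] unfolding S_def by simp
  qed
  have maxS: "cmod (S a b) \<le> cmod (S i j)" if "a < nr" "b < n" for a b
    using max[of a b] zS[of a b] that by (cases "(a, b) \<in> Rm") auto
  define \<pi>' where "\<pi>' = \<pi>(L := (i, j))"
  have ge: "gauss_elim H \<pi>' l = gauss_elim H \<pi> l" if "l \<le> L" for l
    by (rule gauss_elim_cong) (use that in \<open>auto simp: \<pi>'_def\<close>)
  have cr: "cross \<pi>' l = cross \<pi> l" if "l \<le> L" for l
    by (rule cross_cong) (use that in \<open>auto simp: \<pi>'_def\<close>)
  have pv: "pivot H \<pi>' l = (if l = L then S i j else pivot H \<pi> l)" if "l \<le> L" for l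
    unfolding pivot_def ge[OF that] by (auto simp: \<pi>'_def S_def)
  have ijl: "i < nr" "j < n" "i \<notin> (\<lambda>l. fst (\<pi> l)) ` {..<L}" "j \<notin> (\<lambda>l. snd (\<pi> l)) ` {..<L}"
    using ij unfolding Rm_def by auto
  have im: "(\<lambda>l. fst (\<pi>' l)) ` {..<L} = (\<lambda>l. fst (\<pi> l)) ` {..<L}" "(\<lambda>l. snd (\<pi>' l)) ` {..<L} = (\<lambda>l. snd (\<pi> l)) ` {..<L}"
    by (intro image_cong; auto simp: \<pi>'_def)+
  have in1: "inj_on (\<lambda>l. fst (\<pi>' l)) {..<L}" "inj_on (\<lambda>l. snd (\<pi>' l)) {..<L}"
    using i1 i2 unfolding inj_on_def \<pi>'_def by auto
  show ?case
  proof (rule exI[of _ \<pi>'], intro conjI allI impI)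
    fix l assume l: "l < Suc L"
    then show "fst (\<pi>' l) < nr" "snd (\<pi>' l) < n"
      using bd ijl by (auto simp: \<pi>'_def less_Suc_eq)
    fix a b assume "a < nr" "b < n"
    then show "cmod (gauss_elim H \<pi>' l a b) \<le> cmod (pivot H \<pi>' l)"
      using l mx[of l a b] maxS[of a b] by (auto simp: ge pv S_def less_Suc_eq)
  next
    show "inj_on (\<lambda>l. fst (\<pi>' l)) {..<Suc L}" "inj_on (\<lambda>l. snd (\<pi>' l)) {..<Suc L}"
      unfolding lessThan_Suc inj_on_insert using in1 ijl im by (auto simp: \<pi>'_def)
  next
    fix l a b assume l: "l \<le> Suc L" and ab: "a < nr" "b < n" and "(a, b) \<in> cross \<pi>' l"
    show "gauss_elim H \<pi>' l a b = 0"
    proof (cases "l \<le> L")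
      case True
      then show ?thesis using z[of l a b] ab \<open>(a, b) \<in> cross \<pi>' l\<close> by (simp add: ge cr)
    next
      case False
      with l have l: "l = Suc L" by simp
      have "(a, b) \<in> cross \<pi> L \<or> a = i \<or> b = j"
        using \<open>(a, b) \<in> cross \<pi>' l\<close> unfolding l cross_Suc cr[OF order.refl] by (simp add: \<pi>'_def)
      moreover have "S a b - S a j * S i b / S i j = 0" if "(a, b) \<in> cross \<pi> L"
      proof -
        from that obtain l' where l': "l' < L" "a = fst (\<pi> l') \<or> b = snd (\<pi> l')"
          unfolding cross_def by auto
        then have "S a b = 0" "S a j = 0 \<or> S i b = 0"
          using ab ijl unfolding S_def by (auto intro!: z simp: cross_def)
        then show ?thesis by auto
      qed
      moreover have "S a b - S a j * S i b / S i j = 0" if "a = i \<or> b = j"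
      \<comment> \<open>If the largest entry is 0, then \<open>S\<close> vanishes on the whole box,
        so the convention for division by 0 does no harm.\<close>
      proof (cases "S i j = 0")
        case True
        then show ?thesis using maxS[OF ab] by simp
      next
        case False
        then show ?thesis using that by (auto simp: field_simps)
      qed
      ultimately have "S a b - S a j * S i b / S i j = 0" by blast
      then show ?thesis
        unfolding l by (simp add: ge schur_def S_def[symmetric]) (simp add: \<pi>'_def)
    qed
  qed
qed

definition complete_pivots :: "nat \<Rightarrow> nat \<Rightarrow> cmat \<Rightarrow> (nat \<Rightarrow> nat \<times> nat) \<Rightarrow> bool" where
  "complete_pivots nr n H \<pi> \<longleftrightarrow> (\<forall>l<n. \<forall>a<nr. \<forall>b<n. cmod (gauss_elim H \<pi> l a b) \<le> cmod (pivot H \<pi> l)) \<and>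
     (\<forall>l\<le>n. \<forall>a<nr. \<forall>b<n. (a, b) \<in> cross \<pi> l \<longrightarrow> gauss_elim H \<pi> l a b = 0)"

text \<open>The value \<open>(0, 0)\<close> from \<open>n\<close> on makes the set finite, as union
  bounds over all orders require.\<close>

definition pivot_orders :: "nat \<Rightarrow> nat \<Rightarrow> (nat \<Rightarrow> nat \<times> nat) set" where
  "pivot_orders nr n = {\<pi>. (\<forall>l<n. fst (\<pi> l) < nr \<and> snd (\<pi> l) < n) \<and> (\<forall>l\<ge>n. \<pi> l = (0, 0)) \<and>
     inj_on (\<lambda>l. fst (\<pi> l)) {..<n} \<and> inj_on (\<lambda>l. snd (\<pi> l)) {..<n}}"

lemma finite_pivot_orders: "finite (pivot_orders nr n)"
proof (rule finite_subset)
  show "pivot_orders nr n \<subseteq> {\<pi>. \<forall>l. (l \<in> {..<n} \<longrightarrow> \<pi> l \<in> {..<nr} \<times> {..<n}) \<and> (l \<notin> {..<n} \<longrightarrow> \<pi> l = (0, 0))}"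
    unfolding pivot_orders_def by (auto simp: mem_Times_iff)
  show "finite \<dots>" by (rule finite_set_of_finite_funs) auto
qed

lemma complete_pivoting:
  assumes "n \<le> nr"
  obtains \<pi> where "\<pi> \<in> pivot_orders nr n" "complete_pivots nr n H \<pi>"
proof -
  obtain \<pi> where p: "\<forall>l<n. fst (\<pi> l) < nr \<and> snd (\<pi> l) < n \<and>
             (\<forall>a<nr. \<forall>b<n. cmod (gauss_elim H \<pi> l a b) \<le> cmod (pivot H \<pi> l))"
           "inj_on (\<lambda>l. fst (\<pi> l)) {..<n}" "inj_on (\<lambda>l. snd (\<pi> l)) {..<n}"
           "\<forall>l\<le>n. \<forall>a<nr. \<forall>b<n. (a, b) \<in> cross \<pi> l \<longrightarrow> gauss_elim H \<pi> l a b = 0"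
    using complete_pivoting_steps[OF assms order.refl, of H] by blast
  define \<pi>' where "\<pi>' = (\<lambda>l. if l < n then \<pi> l else (0, 0))"
  have ge: "gauss_elim H \<pi>' l = gauss_elim H \<pi> l" if "l \<le> n" for l
    by (rule gauss_elim_cong) (use that in \<open>auto simp: \<pi>'_def\<close>)
  have cr: "cross \<pi>' l = cross \<pi> l" if "l \<le> n" for l
    by (rule cross_cong) (use that in \<open>auto simp: \<pi>'_def\<close>)
  have pv: "pivot H \<pi>' l = pivot H \<pi> l" if "l < n" for l
    unfolding pivot_def using that by (simp add: ge) (simp add: \<pi>'_def)
  have "\<pi>' \<in> pivot_orders nr n"
    using p unfolding pivot_orders_def \<pi>'_def inj_on_def by auto
  moreover have "complete_pivots nr n H \<pi>'"
    using p unfolding complete_pivots_def by (auto simp: ge pv cr)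
  ultimately show ?thesis by (rule that)
qed

text \<open>Both factors of the subtracted product are at most the pivot in modulus, so its quotient
  by the pivot is too, and no entry grows beyond twice the pivot. In particular a zero pivot forces
  all later ones to be zero.\<close>

lemma pivot_Suc_le:
  assumes "complete_pivots nr n H \<pi>" "\<pi> \<in> pivot_orders nr n" "Suc l < n"
  shows "cmod (pivot H \<pi> (Suc l)) \<le> 2 * cmod (pivot H \<pi> l)"
proof -
  define S where "S = gauss_elim H \<pi> l"
  have mx: "cmod (S a b) \<le> cmod (pivot H \<pi> l)" if "a < nr" "b < n" for a b
    using assms that unfolding complete_pivots_def S_def by auto
  obtain a b where ab: "\<pi> (Suc l) = (a, b)" "a < nr" "b < n"
    using assms unfolding pivot_orders_def by (metis (mono_tags, lifting) mem_Collect_eq prod.collapse)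
  obtain i j where ij: "\<pi> l = (i, j)" "i < nr" "j < n"
    using assms unfolding pivot_orders_def
    by (metis (mono_tags, lifting) Suc_lessD mem_Collect_eq prod.collapse)
  have pl: "pivot H \<pi> l = S i j" unfolding pivot_def S_def ij by simp
  have "cmod (S a j) * cmod (S i b) \<le> cmod (S i j) * cmod (S i j)"
    using mx[of a j] mx[of i b] ab ij unfolding pl by (intro mult_mono) auto
  then have "cmod (S a j * S i b / S i j) \<le> cmod (S i j)"
    by (cases "S i j = 0") (auto simp: norm_mult norm_divide field_simps)
  then have "cmod (S a b - S a j * S i b / S i j) \<le> cmod (S i j) + cmod (S i j)"
    using mx[of a b] ab unfolding pl by (intro order.trans[OF norm_triangle_ineq4] add_mono) auto
  then show ?thesis
    unfolding pl by (simp add: pivot_def ab schur_def ij S_def[symmetric])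
qed

lemma pivot_nonzero:
  assumes "complete_pivots nr n H \<pi>" "\<pi> \<in> pivot_orders nr n" "pivot H \<pi> (n - 1) \<noteq> 0" "l < n"
  shows "pivot H \<pi> l \<noteq> 0"
proof (rule ccontr)
  assume "\<not> pivot H \<pi> l \<noteq> 0"
  then have "l + k < n \<Longrightarrow> pivot H \<pi> (l + k) = 0" for k
  proof (induction k)
    case (Suc k)
    then show ?case using pivot_Suc_le[OF assms(1,2), of "l + k"] by simp
  qed simp
  from this[of "n - 1 - l"] show False using assms by simp
qed

text \<open>Complete pivoting keeps all multipliers at modulus at most 1, so a step at most doubles
  the sup norm of the image. The factor depends on \<open>l\<close> only, never on
  \<open>H\<close>.\<close>

lemma mvec_gauss_elim_bound:
  assumes "complete_pivots nr n H \<pi>" "\<pi> \<in> pivot_orders nr n"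
    and "\<And>a. a < nr \<Longrightarrow> cmod (mvec n H x a) \<le> \<tau>" "l \<le> n" "a < nr"
  shows "cmod (mvec n (gauss_elim H \<pi> l) x a) \<le> 2 ^ l * \<tau>"
  using assms(4,5)
proof (induction l arbitrary: a)
  case 0
  then show ?case using assms by simp
next
  case (Suc l)
  define S where "S = gauss_elim H \<pi> l"
  have b: "fst (\<pi> l) < nr" "snd (\<pi> l) < n"
    using assms(2) Suc.prems unfolding pivot_orders_def by auto
  have "cmod (S a (snd (\<pi> l))) \<le> cmod (S (fst (\<pi> l)) (snd (\<pi> l)))"
    using assms(1) b Suc.prems unfolding complete_pivots_def S_def pivot_def by auto
  then have "cmod (S a (snd (\<pi> l)) / S (fst (\<pi> l)) (snd (\<pi> l))) \<le> 1"
    by (cases "S (fst (\<pi> l)) (snd (\<pi> l)) = 0") (auto simp: norm_divide field_simps)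
  moreover have "cmod (mvec n S x (fst (\<pi> l))) \<le> 2 ^ l * \<tau>" "cmod (mvec n S x a) \<le> 2 ^ l * \<tau>"
    using Suc b unfolding S_def by auto
  ultimately have "cmod (S a (snd (\<pi> l)) / S (fst (\<pi> l)) (snd (\<pi> l)) * mvec n S x (fst (\<pi> l))) \<le> 1 * (2 ^ l * \<tau>)"
    unfolding norm_mult by (intro mult_mono) auto
  then have "cmod (mvec n (schur S (\<pi> l)) x a) \<le> 2 ^ l * \<tau> + 1 * (2 ^ l * \<tau>)"
    unfolding mvec_schur using \<open>cmod (mvec n S x a) \<le> 2 ^ l * \<tau>\<close>
    by (intro order.trans[OF norm_triangle_ineq4] add_mono)
  then show ?case by (simp add: S_def mult_ac)
qed

text \<open>Writing \<open>H = L D U\<close> in the permuted order with the pivots on the diagonal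
  of \<open>D\<close>, this is coordinate \<open>l\<close> of \<open>U x\<close>.\<close>

definition pivot_coord :: "nat \<Rightarrow> cmat \<Rightarrow> (nat \<Rightarrow> nat \<times> nat) \<Rightarrow> (nat \<Rightarrow> complex) \<Rightarrow> nat \<Rightarrow> complex" where
  "pivot_coord n H \<pi> x l = mvec n (gauss_elim H \<pi> l) x (fst (\<pi> l)) / pivot H \<pi> l"

text \<open>Up to a permutation of columns, \<open>U\<close> is unit upper triangular with entries
  of modulus at most 1. Back substitution from the last pivot column adds at most \<open>n\<close>
  known rows per step, so coefficients grow by a factor \<open>n + 1\<close> at most, uniformly in
  \<open>H\<close>.\<close>

lemma pivot_coords_determine:
  assumes cp: "complete_pivots nr n H \<pi>" and po: "\<pi> \<in> pivot_orders nr n"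
    and nz: "\<And>l. l < n \<Longrightarrow> pivot H \<pi> l \<noteq> 0"
  obtains E :: "nat \<Rightarrow> nat \<Rightarrow> complex" where "\<And>b i. cmod (E b i) \<le> real (n + 1) ^ n"
    "\<And>x b. b < n \<Longrightarrow> x b = (\<Sum>i<n. E b i * pivot_coord n H \<pi> x i)"
proof -
  have inj: "inj_on (\<lambda>l. snd (\<pi> l)) {..<n}" and rng: "\<And>l. l < n \<Longrightarrow> fst (\<pi> l) < nr" "\<And>l. l < n \<Longrightarrow> snd (\<pi> l) < n"
    using po unfolding pivot_orders_def by auto
  have surj: "(\<lambda>l. snd (\<pi> l)) ` {..<n} = {..<n}"
    using inj rng by (intro card_subset_eq) (auto simp: card_image)
  have *: "k \<le> n \<Longrightarrow> \<exists>E. (\<forall>b i. cmod (E b i) \<le> real (n + 1) ^ k) \<and>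
      (\<forall>x. \<forall>b\<in>(\<lambda>l. snd (\<pi> l)) ` {n - k..<n}. x b = (\<Sum>i<n. E b i * pivot_coord n H \<pi> x i))" for k
  proof (induction k)
    case 0
    then show ?case by (intro exI[of _ "\<lambda>_ _. 0"]) auto
  next
    case (Suc k)
    then have "k \<le> n" by simp
    from Suc.IH[OF this] obtain E where Eb': "\<forall>b i. cmod (E b i) \<le> real (n + 1) ^ k"
      and E': "\<forall>x. \<forall>b\<in>(\<lambda>l. snd (\<pi> l)) ` {n - k..<n}. x b = (\<Sum>i<n. E b i * pivot_coord n H \<pi> x i)"
      by (elim exE conjE) rule
    note Eb = Eb'[rule_format] and E = E'[rule_format]
    define l where "l = n - Suc k"
    have l: "l < n" "{n - Suc k..<n} = insert l {n - k..<n}" "n - k = Suc l"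
      using Suc.prems unfolding l_def by auto
    define j where "j = snd (\<pi> l)"
    define S where "S = gauss_elim H \<pi> l"
    define B where "B = (\<lambda>l. snd (\<pi> l)) ` {Suc l..<n}"
    define \<mu> where "\<mu> b = S (fst (\<pi> l)) b / S (fst (\<pi> l)) j" for b
    have pj: "S (fst (\<pi> l)) j \<noteq> 0" "pivot H \<pi> l = S (fst (\<pi> l)) j"
      using nz[OF l(1)] unfolding pivot_def S_def j_def by auto
    have \<mu>1: "cmod (\<mu> b) \<le> 1" if "b < n" for b
      using cp l(1) rng[OF l(1)] that pj unfolding complete_pivots_def \<mu>_def S_def
      by (auto simp: norm_divide field_simps)
    \<comment> \<open>Columns of earlier pivots are already cleared, so row \<open>l\<close>
      involves only its own pivot column and those of later pivots.\<close>
    have \<mu>0: "\<mu> b = 0" if "b < n" "b \<notin> B" "b \<noteq> j" for b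
    proof -
      have "b \<in> (\<lambda>l. snd (\<pi> l)) ` {..<n}" using that(1) surj by simp
      then obtain l' where l': "l' < n" "b = snd (\<pi> l')" by auto
      have "l' < l" using l' that unfolding B_def j_def by (cases l l' rule: linorder_cases) auto
      then have "(fst (\<pi> l), b) \<in> cross \<pi> l" unfolding cross_def l' by auto
      then show ?thesis
        using cp l(1) rng[OF l(1)] that(1) unfolding complete_pivots_def \<mu>_def S_def by auto
    qed
    have Bn: "B \<subseteq> {..<n}" "j < n" "finite B" unfolding B_def j_def using rng l(1) by auto
    have jB: "j \<notin> B"
    proof
      assume "j \<in> B"
      then obtain l' where "Suc l \<le> l'" "l' < n" "snd (\<pi> l') = snd (\<pi> l)"
        unfolding B_def j_def by auto
      then show False using inj_onD[OF inj, of l' l] l(1) by auto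
    qed
    have xj: "x j = pivot_coord n H \<pi> x l - (\<Sum>b\<in>B. \<mu> b * x b)" for x
    proof -
      have "pivot_coord n H \<pi> x l = (\<Sum>b<n. \<mu> b * x b)"
        unfolding pivot_coord_def mvec_def pj S_def[symmetric] \<mu>_def by (simp add: sum_divide_distrib)
      also have "\<dots> = (\<Sum>b\<in>insert j B. \<mu> b * x b)"
        using \<mu>0 Bn by (intro sum.mono_neutral_right) auto
      also have "\<dots> = x j + (\<Sum>b\<in>B. \<mu> b * x b)"
        using jB Bn pj by (simp add: \<mu>_def)
      finally show ?thesis by simp
    qed
    define E' where "E' b i = (if b = j then (if i = l then 1 else 0) - (\<Sum>b\<in>B. \<mu> b * E b i) else E b i)" for b i
    have cB: "card B \<le> n" using card_mono[OF _ Bn(1)] by simp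
    have "cmod (E' b i) \<le> real (n + 1) ^ Suc k" for b i
    proof (cases "b = j")
      case True
      have "cmod (\<Sum>b\<in>B. \<mu> b * E b i) \<le> (\<Sum>b\<in>B. 1 * real (n + 1) ^ k)"
      proof (rule sum_norm_le)
        fix x assume "x \<in> B"
        then have "cmod (\<mu> x) \<le> 1" using \<mu>1 Bn by auto
        then show "cmod (\<mu> x * E x i) \<le> 1 * real (n + 1) ^ k"
          unfolding norm_mult by (intro mult_mono Eb) auto
      qed
      also have "\<dots> \<le> real n * real (n + 1) ^ k" using cB by (simp add: mult_right_mono)
      finally have "cmod (E' b i) \<le> 1 + real n * real (n + 1) ^ k"
        using True unfolding E'_def by (auto intro!: order.trans[OF norm_triangle_ineq4] add_mono)
      also have "\<dots> \<le> real (n + 1) ^ k + real n * real (n + 1) ^ k" by simp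
      finally show ?thesis by (simp add: algebra_simps)
    next
      case False
      have "real (n + 1) ^ k \<le> real (n + 1) ^ Suc k" by (intro power_increasing) auto
      then show ?thesis using False order.trans[OF Eb[of b i]] unfolding E'_def by simp
    qed
    moreover have "x b = (\<Sum>i<n. E' b i * pivot_coord n H \<pi> x i)" if "b \<in> insert j B" for x b
    proof (cases "b = j")
      case True
      have "(\<Sum>i<n. E' j i * pivot_coord n H \<pi> x i) =
          (\<Sum>i<n. (if i = l then pivot_coord n H \<pi> x i else 0) - (\<Sum>b\<in>B. \<mu> b * (E b i * pivot_coord n H \<pi> x i)))"
        unfolding E'_def by (intro sum.cong) (auto simp: algebra_simps sum_distrib_left sum_distrib_right)
      also have "\<dots> = pivot_coord n H \<pi> x l - (\<Sum>b\<in>B. \<mu> b * (\<Sum>i<n. E b i * pivot_coord n H \<pi> x i))"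
        using l(1) by (simp add: sum_subtractf sum_distrib_left sum.swap[of _ B])
      also have "(\<Sum>b\<in>B. \<mu> b * (\<Sum>i<n. E b i * pivot_coord n H \<pi> x i)) = (\<Sum>b\<in>B. \<mu> b * x b)"
        using E[of _ x] unfolding B_def l(3) by (intro sum.cong) auto
      finally show ?thesis using xj[of x] True by simp
    next
      case False
      then show ?thesis using that E[of b x] unfolding E'_def B_def l(3) by simp
    qed
    moreover have "(\<lambda>l. snd (\<pi> l)) ` {n - Suc k..<n} = insert j B"
      unfolding l B_def j_def by auto
    ultimately show ?case by (intro exI[of _ E']) blast
  qed
  have img: "(\<lambda>l. snd (\<pi> l)) ` {n - n..<n} = {..<n}" using surj by (simp add: atLeast0LessThan)
  from *[OF order.refl] obtain E where E1: "\<forall>b i. cmod (E b i) \<le> real (n + 1) ^ n"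
    and E2: "\<forall>x. \<forall>b\<in>{..<n}. x b = (\<Sum>i<n. E b i * pivot_coord n H \<pi> x i)"
    unfolding img by (elim exE conjE) rule
  show ?thesis by (rule that[of E]) (use E1 E2 in blast)+
qed

section \<open>Counting lattice points\<close>

definition gauss_int :: "complex \<Rightarrow> bool" where
  "gauss_int w \<longleftrightarrow> Re w \<in> \<int> \<and> Im w \<in> \<int>"

lemma gauss_int_small_eq:
  assumes "gauss_int w" "gauss_int v" "cmod (w - v) < 1"
  shows "w = v"
proof -
  have "\<bar>Re (w - v)\<bar> < 1" "\<bar>Im (w - v)\<bar> < 1"
    using assms(3) abs_Re_le_cmod[of "w - v"] abs_Im_le_cmod[of "w - v"] by linarith+
  moreover have "Re (w - v) \<in> \<int>" "Im (w - v) \<in> \<int>"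
    using assms(1,2) unfolding gauss_int_def by auto
  ultimately have "Re (w - v) = 0" "Im (w - v) = 0"
    using Ints_nonzero_abs_ge1 by (metis linorder_not_less)+
  then show ?thesis by (simp add: complex_eq_iff)
qed

lemma card_int_interval_le:
  assumes "0 \<le> (T::real)"
  shows "real (card {\<lfloor>- T\<rfloor>..\<lfloor>T\<rfloor>}) \<le> 2 * T + 2"
proof -
  have "\<lfloor>- T\<rfloor> \<le> \<lfloor>T\<rfloor>" using assms by (intro floor_mono) simp
  then have "real (card {\<lfloor>- T\<rfloor>..\<lfloor>T\<rfloor>}) = real_of_int \<lfloor>T\<rfloor> - real_of_int \<lfloor>- T\<rfloor> + 1"
    by simp
  then show ?thesis using floor_correct[of T] floor_correct[of "-T"] by linarith
qed

lemma card_image_inverse_le: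
  assumes "finite B" "\<And>x. x \<in> A \<Longrightarrow> f x \<in> B" "inj_on f A"
  shows "finite A \<and> card A \<le> card B"
  by (metis assms card_inj_on_le image_subsetI inj_on_finite)

text \<open>Rounding the coordinates \<open>y a\<close> to a fine grid is injective on
  \<open>S\<close>: two lattice points with the same rounded coordinates differ by less than 1 in
  every component. So the grid cells bound the number of lattice points.\<close>

lemma card_lattice_image_le:
  fixes S :: "(nat \<Rightarrow> complex) set" and I :: "'a set"
  assumes I: "finite I" and C: "0 \<le> C"
    and D: "\<And>j a. j \<in> J \<Longrightarrow> a \<in> I \<Longrightarrow> cmod (D j a) \<le> C"
    and supp: "\<And>u j. u \<in> S \<Longrightarrow> j \<notin> J \<Longrightarrow> u j = 0"
    and int: "\<And>u j. u \<in> S \<Longrightarrow> gauss_int (u j)"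
    and tau: "\<And>a. a \<in> I \<Longrightarrow> 0 \<le> \<tau> a"
    and rep: "\<And>u v. u \<in> S \<Longrightarrow> v \<in> S \<Longrightarrow> \<exists>y. (\<forall>a\<in>I. cmod (y a) \<le> \<tau> a) \<and> (\<forall>j\<in>J. u j - v j = (\<Sum>a\<in>I. D j a * y a))"
  shows "finite S \<and> real (card S) \<le> (\<Prod>a\<in>I. (2 * (2 * C * card I + 1) * (1 + \<tau> a))\<^sup>2)"
proof (cases "S = {}")
  case True
  then show ?thesis by (auto intro!: prod_nonneg)
next
  case False
  then obtain v where v: "v \<in> S" by auto
  \<comment> \<open>Mesh \<open>1 / N\<close> makes equal keys differ by less than
    \<open>2 / N\<close> per coordinate, and then
    \<open>C * card I * (2 / N) = (N - 1) / N < 1\<close>.\<close>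
  define N where "N = 2 * C * card I + 1"
  have N: "N \<ge> 1" unfolding N_def using C by simp
  obtain y where y: "\<And>u a. u \<in> S \<Longrightarrow> a \<in> I \<Longrightarrow> cmod (y u a) \<le> \<tau> a"
    and yu: "\<And>u j. u \<in> S \<Longrightarrow> j \<in> J \<Longrightarrow> u j - v j = (\<Sum>a\<in>I. D j a * y u a)"
    using bchoice[of S "\<lambda>u y. (\<forall>a\<in>I. cmod (y a) \<le> \<tau> a) \<and> (\<forall>j\<in>J. u j - v j = (\<Sum>a\<in>I. D j a * y a))"]
      rep[OF _ v] by metis
  define key where "key u = (\<lambda>a\<in>I. (\<lfloor>Re (y u a) * N\<rfloor>, \<lfloor>Im (y u a) * N\<rfloor>))" for u
  define K where "K a = {\<lfloor>- (\<tau> a * N)\<rfloor>..\<lfloor>\<tau> a * N\<rfloor>} \<times> {\<lfloor>- (\<tau> a * N)\<rfloor>..\<lfloor>\<tau> a * N\<rfloor>}" for a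
  have fl: "\<lfloor>t * N\<rfloor> \<in> {\<lfloor>- (\<tau> a * N)\<rfloor>..\<lfloor>\<tau> a * N\<rfloor>}" if "\<bar>t\<bar> \<le> \<tau> a" for t a
  proof -
    have "t * N \<le> \<tau> a * N" "- \<tau> a * N \<le> t * N"
      using that N by (intro mult_right_mono; simp)+
    then show ?thesis by (auto intro!: floor_mono)
  qed
  have "key u \<in> Pi\<^sub>E I K" if "u \<in> S" for u
    unfolding key_def K_def
    by (intro restrict_PiE_iff[THEN iffD2] ballI SigmaI fl
        order.trans[OF abs_Re_le_cmod] order.trans[OF abs_Im_le_cmod] y that)
  moreover have "inj_on key S"
  proof (rule inj_onI)
    fix u u' assume uu: "u \<in> S" "u' \<in> S" "key u = key u'"
    have "u j = u' j" for j
    proof (cases "j \<in> J")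
      case True
      have close: "cmod (y u a - y u' a) < 2 / N" if a: "a \<in> I" for a
      proof -
        have "key u a = key u' a" using uu by simp
        then have "\<lfloor>Re (y u a) * N\<rfloor> = \<lfloor>Re (y u' a) * N\<rfloor>" "\<lfloor>Im (y u a) * N\<rfloor> = \<lfloor>Im (y u' a) * N\<rfloor>"
          unfolding key_def using a by auto
        then have "\<bar>Re (y u a) * N - Re (y u' a) * N\<bar> < 1" "\<bar>Im (y u a) * N - Im (y u' a) * N\<bar> < 1"
          by linarith+
        then have "\<bar>Re (y u a - y u' a)\<bar> * N < 1" "\<bar>Im (y u a - y u' a)\<bar> * N < 1"
          using N by (simp_all add: abs_mult flip: left_diff_distrib)
        then have "\<bar>Re (y u a - y u' a)\<bar> < 1 / N" "\<bar>Im (y u a - y u' a)\<bar> < 1 / N"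
          using N by (auto simp: field_simps)
        then show ?thesis
          using cmod_le[of "y u a - y u' a"] by simp
      qed
      have "u j - u' j = (u j - v j) - (u' j - v j)" by simp
      also have "\<dots> = (\<Sum>a\<in>I. D j a * (y u a - y u' a))"
        unfolding yu[OF uu(1) True] yu[OF uu(2) True] by (simp add: sum_subtractf right_diff_distrib)
      finally have "cmod (u j - u' j) \<le> (\<Sum>a\<in>I. C * (2 / N))"
        using D[OF True] close C
        by (simp only:) (intro sum_norm_le, simp only: norm_mult, rule mult_mono, auto intro: less_imp_le)
      also have "\<dots> < 1" using N unfolding N_def by (simp add: field_simps)
      finally show ?thesis using gauss_int_small_eq int uu by blast
    next
      case False
      then show ?thesis using supp[OF uu(1) False] supp[OF uu(2) False] by simp
    qed
    then show "u = u'" by auto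
  qed
  moreover have "finite (Pi\<^sub>E I K)" unfolding K_def using I by (intro finite_PiE) auto
  ultimately have *: "finite S \<and> card S \<le> card (Pi\<^sub>E I K)"
    by (intro card_image_inverse_le)
  have "real (card (Pi\<^sub>E I K)) = (\<Prod>a\<in>I. real (card (K a)))"
    using I by (simp add: card_PiE)
  also have "\<dots> \<le> (\<Prod>a\<in>I. (2 * N * (1 + \<tau> a))\<^sup>2)"
  proof (intro prod_mono conjI)
    fix a assume a: "a \<in> I"
    have "0 \<le> \<tau> a * N" using tau[OF a] N by simp
    from card_int_interval_le[OF this]
    have "real (card {\<lfloor>- (\<tau> a * N)\<rfloor>..\<lfloor>\<tau> a * N\<rfloor>}) \<le> 2 * N * (1 + \<tau> a)"
      using N by (simp add: algebra_simps)
    then show "real (card (K a)) \<le> (2 * N * (1 + \<tau> a))\<^sup>2"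
      unfolding K_def card_cartesian_product of_nat_mult power2_eq_square by (intro mult_mono) auto
  qed auto
  finally show ?thesis using * unfolding N_def by linarith
qed

text \<open>A coordinate in \<open>I2\<close> carries no size bound. It is eliminated by fixing one
  symbol \<open>u k\<close>, which costs a factor \<open>card Q\<close>; taking \<open>k\<close>
  with the largest coefficient keeps multipliers at most 1, so \<open>C\<close> doubles with each
  elimination.\<close>

lemma card_lattice_image_clipped_le:
  fixes S :: "(nat \<Rightarrow> complex) set" and I :: "'a set"
  assumes "finite I" "finite I2" "I \<inter> I2 = {}" "finite J" "finite Q" and J: "J \<noteq> {}" and C: "0 \<le> C"
    and "\<And>j a. j \<in> J \<Longrightarrow> a \<in> I \<union> I2 \<Longrightarrow> cmod (D j a) \<le> C"
    and "\<And>u j. u \<in> S \<Longrightarrow> j \<notin> J \<Longrightarrow> u j = 0"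
    and "\<And>u j. u \<in> S \<Longrightarrow> j \<in> J \<Longrightarrow> u j \<in> Q"
    and "\<And>u j. u \<in> S \<Longrightarrow> gauss_int (u j)"
    and "\<And>a. a \<in> I \<Longrightarrow> 0 \<le> \<tau> a"
    and "\<And>u v. u \<in> S \<Longrightarrow> v \<in> S \<Longrightarrow> \<exists>y. (\<forall>a\<in>I. cmod (y a) \<le> \<tau> a) \<and> (\<forall>j\<in>J. u j - v j = (\<Sum>a\<in>I\<union>I2. D j a * y a))"
  shows "finite S \<and> real (card S) \<le> real (card Q) ^ card I2 *
     (\<Prod>a\<in>I. (2 * (2 * (2 ^ card I2 * C) * card I + 1) * (1 + \<tau> a))\<^sup>2)"
  using assms(2,3,7-13)
proof (induction I2 arbitrary: S C D rule: finite_induct)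
  case empty
  show ?case
    using card_lattice_image_le[OF assms(1) empty(2), of J D S \<tau>] empty by simp
next
  case (insert i I2)
  define P where "P = (\<Prod>a\<in>I. (2 * (2 * (2 ^ card I2 * (2 * C)) * card I + 1) * (1 + \<tau> a))\<^sup>2)"
  have P0: "P \<ge> 0" unfolding P_def by (intro prod_nonneg) auto
  have goal: "real (card Q) ^ card (insert i I2) *
     (\<Prod>a\<in>I. (2 * (2 * (2 ^ card (insert i I2) * C) * card I + 1) * (1 + \<tau> a))\<^sup>2) = real (card Q) * (real (card Q) ^ card I2 * P)"
    using insert(1,2) unfolding P_def by (simp add: mult_ac)
  have disj: "I \<inter> I2 = {}" and iI: "i \<notin> I" using insert.prems(1) by auto
  have split: "(\<Sum>a\<in>I \<union> insert i I2. F a) = F i + (\<Sum>a\<in>I \<union> I2. F a)" for F :: "'a \<Rightarrow> complex"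
    using insert(1,2) iI assms(1) by simp
  show ?case
  proof (cases "\<exists>j\<in>J. D j i \<noteq> 0")
    case False
    have IH: "finite S \<and> real (card S) \<le> real (card Q) ^ card I2 * P"
      unfolding P_def
    proof (rule insert.IH[of "2 * C" D S, OF disj])
      fix j a assume "j \<in> J" "a \<in> I \<union> I2"
      then show "cmod (D j a) \<le> 2 * C" using insert.prems(3)[of j a] insert.prems(2) by force
    next
      fix u v assume "u \<in> S" "v \<in> S"
      from insert.prems(8)[OF this] show "\<exists>y. (\<forall>a\<in>I. cmod (y a) \<le> \<tau> a) \<and> (\<forall>j\<in>J. u j - v j = (\<Sum>a\<in>I\<union>I2. D j a * y a))"
        unfolding split using False by auto
    qed (use insert.prems in auto)
    show ?thesis
    proof (cases "S = {}")
      case True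
      then show ?thesis unfolding goal using P0 by simp
    next
      case False
      then obtain u where "u \<in> S" by auto
      moreover obtain j where "j \<in> J" using J by auto
      ultimately have "u j \<in> Q" using insert.prems(5) by auto
      \<comment> \<open>If no component depends on \<open>i\<close>, the coordinate is simply
        dropped; the factor \<open>card Q\<close> of the claim then has to be at least 1.\<close>
      then have "card Q \<ge> 1" using assms(5) by (auto simp: Suc_le_eq card_gt_0_iff)
      then have "1 * (real (card Q) ^ card I2 * P) \<le> real (card Q) * (real (card Q) ^ card I2 * P)"
        using P0 by (intro mult_right_mono) auto
      then show ?thesis using IH unfolding goal by simp
    qed
  next
    case True
    then have ne: "J \<noteq> {}" by auto
    define f where "f j = - cmod (D j i)" for j
    define k where "k = arg_min_on f J"
    have k: "k \<in> J" and kmin: "\<not> (\<exists>j\<in>J. f j < f k)"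
      using arg_min_if_finite[OF assms(4) ne, of f] unfolding k_def by auto
    have kmax: "cmod (D j i) \<le> cmod (D k i)" if "j \<in> J" for j
      using kmin that unfolding f_def by force
    then have Dk: "D k i \<noteq> 0" using True by force
    \<comment> \<open>On vectors with the same symbol at \<open>k\<close>, the equation for
      component \<open>k\<close> expresses \<open>y i\<close> by the other coordinates;
      \<open>D'\<close> is the system after substituting it.\<close>
    define D' where "D' j a = D j a - D j i * D k a / D k i" for j a
    have *: "finite {u\<in>S. u k = q} \<and> real (card {u\<in>S. u k = q}) \<le> real (card Q) ^ card I2 * P" for q
      unfolding P_def
    proof (rule insert.IH[of "2 * C" D' "{u\<in>S. u k = q}", OF disj])
      fix j a assume ja: "j \<in> J" "a \<in> I \<union> I2"
      have "cmod (D j i / D k i) \<le> 1" using kmax[OF ja(1)] Dk by (simp add: norm_divide field_simps)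
      then have "cmod (D j i / D k i * D k a) \<le> 1 * C"
        unfolding norm_mult using insert.prems(3)[of k a] ja k by (intro mult_mono) auto
      moreover have "cmod (D j a) \<le> C" using insert.prems(3)[of j a] ja by auto
      ultimately show "cmod (D' j a) \<le> 2 * C"
        unfolding D'_def using norm_triangle_ineq4[of "D j a" "D j i / D k i * D k a"] by simp
    next
      fix u v assume uv: "u \<in> {u\<in>S. u k = q}" "v \<in> {u\<in>S. u k = q}"
      then obtain y where y: "\<forall>a\<in>I. cmod (y a) \<le> \<tau> a"
        and eq: "\<And>j. j \<in> J \<Longrightarrow> u j - v j = D j i * y i + (\<Sum>a\<in>I\<union>I2. D j a * y a)"
        using insert.prems(8)[of u v] unfolding split by auto
      have "0 = D k i * y i + (\<Sum>a\<in>I\<union>I2. D k a * y a)"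
        using eq[OF k] uv by simp
      then have yi: "y i = - (\<Sum>a\<in>I\<union>I2. D k a * y a) / D k i"
        using Dk by (simp add: field_simps eq_neg_iff_add_eq_0 add.commute)
      have "u j - v j = (\<Sum>a\<in>I\<union>I2. D' j a * y a)" if "j \<in> J" for j
        unfolding eq[OF that] yi D'_def
        by (simp add: algebra_simps sum_subtractf sum_divide_distrib sum_distrib_left)
      then show "\<exists>y. (\<forall>a\<in>I. cmod (y a) \<le> \<tau> a) \<and> (\<forall>j\<in>J. u j - v j = (\<Sum>a\<in>I\<union>I2. D' j a * y a))"
        using y by blast
    qed (use insert.prems in auto)
    have S: "S = (\<Union>q\<in>Q. {u\<in>S. u k = q})" using insert.prems(5)[OF _ k] by auto
    have "finite S" by (subst S, rule finite_UN_I[OF assms(5)]) (use * in blast)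
    moreover have "card S \<le> (\<Sum>q\<in>Q. card {u\<in>S. u k = q})"
      by (subst S, rule card_UN_le[OF assms(5)])
    then have "real (card S) \<le> (\<Sum>q\<in>Q. real (card {u\<in>S. u k = q}))"
      by (simp flip: of_nat_sum)
    then have "real (card S) \<le> (\<Sum>q\<in>Q. real (card Q) ^ card I2 * P)"
      using sum_mono[of Q "\<lambda>q. real (card {u\<in>S. u k = q})", OF conjunct2[OF *]] by linarith
    ultimately show ?thesis unfolding goal by simp
  qed
qed

section \<open>QR decompositions\<close>

definition inj_cmat :: "nat \<Rightarrow> nat \<Rightarrow> cmat \<Rightarrow> bool" where
  "inj_cmat m k M \<longleftrightarrow> (\<forall>v. (\<forall>p<m. mvec k M v p = 0) \<longrightarrow> (\<forall>j<k. v j = 0))"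

lemma back_substitution:
  fixes R :: cmat
  assumes "\<And>i j. i < k \<Longrightarrow> j < i \<Longrightarrow> R i j = 0" "K \<le> k" "\<And>i. i < K \<Longrightarrow> R i i \<noteq> 0"
  shows "\<exists>v. (\<forall>j\<ge>K. v j = u j) \<and> (\<forall>i<K. mvec k R v i = b i)"
  using assms(2,3)
proof (induction K arbitrary: u)
  case 0
  then show ?case by auto
next
  case (Suc K)
  define u' where "u' = u(K := (b K - (\<Sum>j=Suc K..<k. R K j * u j)) / R K K)"
  obtain v where v: "\<forall>j\<ge>K. v j = u' j" "\<forall>i<K. mvec k R v i = b i"
    using Suc.IH[of u'] Suc.prems by auto
  have "mvec k R v K = (\<Sum>j=K..<k. R K j * v j)"
    unfolding mvec_def using Suc.prems assms(1)[of K]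
    by (intro sum.mono_neutral_right) (auto simp: not_le)
  also have "\<dots> = R K K * u' K + (\<Sum>j=Suc K..<k. R K j * v j)"
    using Suc.prems v by (subst sum.atLeast_Suc_lessThan) auto
  also have "(\<Sum>j=Suc K..<k. R K j * v j) = (\<Sum>j=Suc K..<k. R K j * u j)"
    using v by (intro sum.cong) (auto simp: u'_def)
  finally have "mvec k R v K = b K" using Suc.prems by (simp add: u'_def)
  then show ?case
    using v by (intro exI[of _ v]) (auto simp: less_Suc_eq u'_def)
qed

lemma mvec_QR:
  assumes "is_thin_QR m k M Q R" "p < m"
  shows "mvec k M v p = (\<Sum>i<k. Q p i * mvec k R v i)"
proof -
  have "mvec k M v p = (\<Sum>j<k. \<Sum>i<k. Q p i * R i j * v j)"
    unfolding mvec_def using assms unfolding is_thin_QR_def by (simp add: sum_distrib_right)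
  also have "\<dots> = (\<Sum>i<k. \<Sum>j<k. Q p i * R i j * v j)" by (rule sum.swap)
  finally show ?thesis unfolding mvec_def by (simp add: sum_distrib_left mult.assoc)
qed

text \<open>Pythagoras: the part of \<open>y\<close> orthogonal to the columns of \<open>Q\<close>
  is untouched by \<open>a\<close>, and inside their span the residual has coordinates
  \<open>r i - a i\<close>.\<close>

lemma orthonormal_residual:
  fixes Q :: cmat and y a :: "nat \<Rightarrow> complex"
  assumes orth: "\<And>i j. i < k \<Longrightarrow> j < k \<Longrightarrow> (\<Sum>p<m. cnj (Q p i) * Q p j) = (if i = j then 1 else 0)"
  defines "r \<equiv> (\<lambda>i. \<Sum>p<m. cnj (Q p i) * y p)"
  shows "(\<Sum>p<m. (cmod (y p - (\<Sum>i<k. Q p i * a i)))\<^sup>2)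
       = (\<Sum>p<m. (cmod (y p))\<^sup>2) - (\<Sum>i<k. (cmod (r i))\<^sup>2) + (\<Sum>i<k. (cmod (r i - a i))\<^sup>2)"
proof -
  have cr: "cnj (r i) = (\<Sum>p<m. Q p i * cnj (y p))" for i
    unfolding r_def by (simp add: mult.commute)
  have "complex_of_real (\<Sum>p<m. (cmod (y p - (\<Sum>i<k. Q p i * a i)))\<^sup>2)
     = (\<Sum>p<m. (y p - (\<Sum>i<k. Q p i * a i)) * cnj (y p - (\<Sum>i<k. Q p i * a i)))"
    by (simp only: of_real_sum complex_norm_square)
  also have "\<dots> = (\<Sum>p<m. y p * cnj (y p)) - (\<Sum>p<m. (\<Sum>i<k. Q p i * a i) * cnj (y p))
      - (\<Sum>p<m. y p * cnj (\<Sum>i<k. Q p i * a i)) + (\<Sum>p<m. (\<Sum>i<k. Q p i * a i) * cnj (\<Sum>i<k. Q p i * a i))"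
    by (simp add: algebra_simps sum_subtractf sum.distrib)
  also have "(\<Sum>p<m. (\<Sum>i<k. Q p i * a i) * cnj (y p)) = (\<Sum>i<k. a i * cnj (r i))"
    unfolding cr by (simp add: sum_distrib_left sum_distrib_right mult_ac) (rule sum.swap)
  also have "(\<Sum>p<m. y p * cnj (\<Sum>i<k. Q p i * a i)) = (\<Sum>i<k. cnj (a i) * r i)"
    unfolding r_def by (simp add: sum_distrib_left sum_distrib_right mult_ac) (rule sum.swap)
  also have "(\<Sum>p<m. (\<Sum>i<k. Q p i * a i) * cnj (\<Sum>i<k. Q p i * a i))
      = (\<Sum>p<m. \<Sum>i<k. \<Sum>j<k. a i * cnj (a j) * (cnj (Q p j) * Q p i))"
    by (simp add: sum_product mult_ac)
  also have "\<dots> = (\<Sum>i<k. \<Sum>p<m. \<Sum>j<k. a i * cnj (a j) * (cnj (Q p j) * Q p i))" by (rule sum.swap)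
  also have "\<dots> = (\<Sum>i<k. \<Sum>j<k. \<Sum>p<m. a i * cnj (a j) * (cnj (Q p j) * Q p i))"
    by (intro sum.cong refl sum.swap)
  also have "\<dots> = (\<Sum>i<k. \<Sum>j<k. a i * cnj (a j) * (if j = i then 1 else 0))"
    by (intro sum.cong refl) (simp only: sum_distrib_left[symmetric], simp add: orth)
  also have "\<dots> = (\<Sum>i<k. a i * cnj (a i))"
    by (simp add: if_distrib sum.delta' cong: if_cong)
  also have "(\<Sum>p<m. y p * cnj (y p)) - (\<Sum>i<k. a i * cnj (r i)) - (\<Sum>i<k. cnj (a i) * r i) + (\<Sum>i<k. a i * cnj (a i))
     = (\<Sum>p<m. y p * cnj (y p)) - (\<Sum>i<k. r i * cnj (r i)) + (\<Sum>i<k. (r i - a i) * cnj (r i - a i))"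
    by (simp add: algebra_simps sum_subtractf sum.distrib)
  also have "\<dots> = complex_of_real ((\<Sum>p<m. (cmod (y p))\<^sup>2) - (\<Sum>i<k. (cmod (r i))\<^sup>2) + (\<Sum>i<k. (cmod (r i - a i))\<^sup>2))"
    by (simp only: of_real_sum of_real_diff of_real_add complex_norm_square)
  finally show ?thesis by (simp only: of_real_eq_iff)
qed

definition qr_coord :: "nat \<Rightarrow> cmat \<Rightarrow> (nat \<Rightarrow> complex) \<Rightarrow> nat \<Rightarrow> complex" where
  "qr_coord m Q y i = (\<Sum>p<m. cnj (Q p i) * y p)"

text \<open>The sphere decoder's metric for tails of length \<open>k - K\<close>: here
  \<open>K\<close> counts the leading symbols that are still undetermined.\<close>

definition qr_cost :: "nat \<Rightarrow> nat \<Rightarrow> cmat \<Rightarrow> cmat \<Rightarrow> (nat \<Rightarrow> complex) \<Rightarrow> nat \<Rightarrow> (nat \<Rightarrow> complex) \<Rightarrow> real" where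
  "qr_cost m k Q R y K t = (\<Sum>i\<in>{K..<k}. (cmod (qr_coord m Q y i - (\<Sum>j\<in>{K..<k}. R i j * t j)))\<^sup>2)"

lemma QR_residual:
  assumes "is_thin_QR m k M Q R"
  shows "(\<Sum>p<m. (cmod (y p - mvec k M v p))\<^sup>2) = (\<Sum>p<m. (cmod (y p))\<^sup>2)
     - (\<Sum>i<k. (cmod (qr_coord m Q y i))\<^sup>2) + (\<Sum>i<k. (cmod (qr_coord m Q y i - mvec k R v i))\<^sup>2)"
  using orthonormal_residual[where k = k and m = m and Q = Q and y = y and a = "mvec k R v"] assms mvec_QR[OF assms]
  unfolding is_thin_QR_def qr_coord_def by simp

lemma QR_norm:
  assumes "is_thin_QR m k M Q R"
  shows "(\<Sum>p<m. (cmod (mvec k M v p))\<^sup>2) = (\<Sum>i<k. (cmod (mvec k R v i))\<^sup>2)"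
  using QR_residual[OF assms, of "\<lambda>_. 0" v] by (simp add: qr_coord_def)

text \<open>At the first zero diagonal entry, back substitution with 1 at position \<open>i\<close>
  and 0 after it would give a nonzero kernel vector of \<open>M\<close>.\<close>

lemma QR_diag_nonzero:
  assumes QR: "is_thin_QR m k M Q R" and inj: "inj_cmat m k M" and "i < k"
  shows "R i i \<noteq> 0"
  using assms(3)
proof (induction i rule: less_induct)
  case (less i)
  show ?case
  proof
    assume Rii: "R i i = 0"
    have tri: "\<And>i j. i < k \<Longrightarrow> j < i \<Longrightarrow> R i j = 0" using QR unfolding is_thin_QR_def by (meson less_trans)
    obtain v where v: "\<forall>j\<ge>i. v j = (if j = i then 1 else 0)" "\<forall>l<i. mvec k R v l = 0"
      using back_substitution[of k R i "\<lambda>j. if j = i then 1 else 0" "\<lambda>_. 0", OF tri] less by auto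
    have "mvec k R v l = 0" if "l < k" for l
    proof (cases "l < i")
      case True then show ?thesis using v by simp
    next
      case False
      have "R l j * v j = 0" if "j < k" for j
        using v tri[OF \<open>l < k\<close>, of j] Rii False by (cases j i rule: linorder_cases; cases "l = i") auto
      then show ?thesis unfolding mvec_def by (intro sum.neutral) auto
    qed
    then have "mvec k M v p = 0" if "p < m" for p
      using mvec_QR[OF QR that] by simp
    then have "v i = 0" using inj less.prems unfolding inj_cmat_def by blast
    then show False using v by simp
  qed
qed

lemma mvec_R_tail:
  assumes QR: "is_thin_QR m k M Q R" and "K \<le> i" "i < k" "\<And>j. K \<le> j \<Longrightarrow> j < k \<Longrightarrow> v j = t j"
  shows "mvec k R v i = (\<Sum>j\<in>{K..<k}. R i j * t j)"
proof -
  have "mvec k R v i = (\<Sum>j\<in>{K..<k}. R i j * v j)"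
    unfolding mvec_def using assms(2,3) QR unfolding is_thin_QR_def
    by (intro sum.mono_neutral_right) (auto simp: not_le)
  then show ?thesis using assms(4) by simp
qed

lemma sum_split_at:
  fixes f :: "nat \<Rightarrow> real"
  assumes "K \<le> k"
  shows "(\<Sum>i<k. f i) = (\<Sum>i<K. f i) + (\<Sum>i\<in>{K..<k}. f i)"
  using assms by (metis atLeast0LessThan sum.atLeastLessThan_concat zero_le)

lemma qr_cost_le:
  assumes QR: "is_thin_QR m k M Q R" and "K \<le> k" "\<And>j. K \<le> j \<Longrightarrow> j < k \<Longrightarrow> v j = t j"
  shows "qr_cost m k Q R y K t \<le> (\<Sum>i<k. (cmod (qr_coord m Q y i - mvec k R v i))\<^sup>2)"
proof -
  have "qr_cost m k Q R y K t = (\<Sum>i\<in>{K..<k}. (cmod (qr_coord m Q y i - mvec k R v i))\<^sup>2)"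
    unfolding qr_cost_def using mvec_R_tail[OF QR _ _ assms(3)] by (intro sum.cong) auto
  then show ?thesis
    unfolding sum_split_at[OF assms(2), of "\<lambda>i. (cmod (qr_coord m Q y i - mvec k R v i))\<^sup>2"]
    by (simp add: sum_nonneg)
qed

text \<open>Back substitution makes the first \<open>K\<close> residuals vanish. Together with
  \<open>qr_cost_le\<close> this identifies the level metric as the minimum of the full metric over
  all complex heads completing the tail, a description in terms of \<open>M\<close> and
  \<open>y\<close> up to a constant.\<close>

lemma qr_cost_attained:
  assumes QR: "is_thin_QR m k M Q R" and inj: "inj_cmat m k M" and "K \<le> k"
  obtains v where "\<And>j. K \<le> j \<Longrightarrow> v j = t j"
    "qr_cost m k Q R y K t = (\<Sum>i<k. (cmod (qr_coord m Q y i - mvec k R v i))\<^sup>2)"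
proof -
  have tri: "\<And>i j. i < k \<Longrightarrow> j < i \<Longrightarrow> R i j = 0" using QR unfolding is_thin_QR_def by (meson less_trans)
  obtain v where v: "\<forall>j\<ge>K. v j = t j" "\<forall>i<K. mvec k R v i = qr_coord m Q y i"
    using back_substitution[of k R K t "qr_coord m Q y", OF tri assms(3)] QR_diag_nonzero[OF QR inj] assms(3)
    by auto
  have "qr_cost m k Q R y K t = (\<Sum>i\<in>{K..<k}. (cmod (qr_coord m Q y i - mvec k R v i))\<^sup>2)"
    unfolding qr_cost_def using mvec_R_tail[OF QR, of K _ v t] v by (intro sum.cong) auto
  then have "qr_cost m k Q R y K t = (\<Sum>i<k. (cmod (qr_coord m Q y i - mvec k R v i))\<^sup>2)"
    unfolding sum_split_at[OF assms(3), of "\<lambda>i. (cmod (qr_coord m Q y i - mvec k R v i))\<^sup>2"]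
    using v by simp
  then show ?thesis using v that by auto
qed

text \<open>The left side is the squared norm of the projection of \<open>y\<close> onto the range
  of \<open>M\<close>: some \<open>v\<close> attains all coordinates, and its residual is then
  compared in both decompositions.\<close>

lemma qr_coord_norm_le:
  assumes "is_thin_QR m k M Q R" "inj_cmat m k M" "is_thin_QR m k M Q' R'"
  shows "(\<Sum>i<k. (cmod (qr_coord m Q y i))\<^sup>2) \<le> (\<Sum>i<k. (cmod (qr_coord m Q' y i))\<^sup>2)"
proof -
  obtain v where "qr_cost m k Q R y k (\<lambda>_. 0) = (\<Sum>i<k. (cmod (qr_coord m Q y i - mvec k R v i))\<^sup>2)"
    using qr_cost_attained[OF assms(1,2) order.refl, of "\<lambda>_. 0" y] by blast
  then have "(\<Sum>i<k. (cmod (qr_coord m Q y i - mvec k R v i))\<^sup>2) = 0" by (simp add: qr_cost_def)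
  then show ?thesis
    using QR_residual[OF assms(1), of y v] QR_residual[OF assms(3), of y v]
    by (smt (verit) sum_nonneg zero_le_power2)
qed

text \<open>Needed because \<open>sd_count\<close> takes its decomposition from the choice operator.
  The minimum over complex heads is the same for every decomposition.\<close>

lemma qr_cost_unique:
  assumes "is_thin_QR m k M Q R" "inj_cmat m k M" "is_thin_QR m k M Q' R'" "K \<le> k"
  shows "qr_cost m k Q R y K t = qr_cost m k Q' R' y K t"
proof -
  have *: "qr_cost m k Q' R' y K t \<le> qr_cost m k Q R y K t"
    if 1: "is_thin_QR m k M Q R" and 2: "is_thin_QR m k M Q' R'" for Q R Q' R'
  proof -
    obtain v where v: "\<And>j. K \<le> j \<Longrightarrow> v j = t j"
      "qr_cost m k Q R y K t = (\<Sum>i<k. (cmod (qr_coord m Q y i - mvec k R v i))\<^sup>2)"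
      using qr_cost_attained[OF 1 assms(2,4)] by blast
    have "qr_cost m k Q' R' y K t \<le> (\<Sum>i<k. (cmod (qr_coord m Q' y i - mvec k R' v i))\<^sup>2)"
      using qr_cost_le[OF 2 assms(4)] v(1) by blast
    then show ?thesis
      using v(2) QR_residual[OF 1, of y v] QR_residual[OF 2, of y v]
        qr_coord_norm_le[OF 1 assms(2) 2, of y] qr_coord_norm_le[OF 2 assms(2) 1, of y] by linarith
  qed
  show ?thesis using *[OF assms(1,3)] *[OF assms(3,1)] by (rule antisym[rotated])
qed

section \<open>Gram-Schmidt as an explicit decomposition\<close>

definition gs_resid :: "nat \<Rightarrow> cmat \<Rightarrow> (nat \<Rightarrow> nat \<Rightarrow> complex) \<Rightarrow> nat \<Rightarrow> nat \<Rightarrow> complex" where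
  "gs_resid m M G i p = M p i - (\<Sum>l<i. (\<Sum>p'<m. cnj (G l p') * M p' i) * G l p)"

definition gs_norm :: "nat \<Rightarrow> cmat \<Rightarrow> (nat \<Rightarrow> nat \<Rightarrow> complex) \<Rightarrow> nat \<Rightarrow> real" where
  "gs_norm m M G i = sqrt (\<Sum>p<m. (cmod (gs_resid m M G i p))\<^sup>2)"

text \<open>An explicit recursion by arithmetic and square roots, so that the factors are measurable
  in \<open>M\<close>, unlike those picked by the choice operator.\<close>

primrec gram_schmidt_cols :: "nat \<Rightarrow> cmat \<Rightarrow> nat \<Rightarrow> nat \<Rightarrow> nat \<Rightarrow> complex" where
  "gram_schmidt_cols m M 0 = (\<lambda>_ _. 0)"
| "gram_schmidt_cols m M (Suc i) = (gram_schmidt_cols m M i)(i := \<lambda>p.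
     gs_resid m M (gram_schmidt_cols m M i) i p / complex_of_real (gs_norm m M (gram_schmidt_cols m M i) i))"

definition gs_R :: "nat \<Rightarrow> cmat \<Rightarrow> nat \<Rightarrow> cmat" where
  "gs_R m M k = (\<lambda>i j. if i \<le> j then \<Sum>p<m. cnj (gram_schmidt_cols m M k i p) * M p j else 0)"

text \<open>The induction also carries that each orthonormal vector lies in the span of the columns
  used so far; this turns a zero residual into a linear relation among columns, which injectivity
  excludes.\<close>

lemma gram_schmidt_thin_QR:
  assumes inj: "inj_cmat m \<kappa> M"
  shows "is_thin_QR m \<kappa> M (\<lambda>p i. gram_schmidt_cols m M \<kappa> i p) (gs_R m M \<kappa>)"
proof -
  have "k \<le> \<kappa> \<Longrightarrow> is_thin_QR m k M (\<lambda>p i. gram_schmidt_cols m M k i p) (gs_R m M k) \<and>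
     (\<forall>i<k. \<exists>c. \<forall>p. gram_schmidt_cols m M k i p = (\<Sum>j<k. c j * M p j))" for k
  proof (induction k)
    case 0
    then show ?case by (simp add: is_thin_QR_def)
  next
    case (Suc k)
    define G where "G = gram_schmidt_cols m M k"
    define v where "v = gs_resid m M G k"
    define N where "N = gs_norm m M G k"
    define G' where "G' = gram_schmidt_cols m M (Suc k)"
    have QR: "is_thin_QR m k M (\<lambda>p i. G i p) (gs_R m M k)"
      and sp: "\<And>i. i < k \<Longrightarrow> \<exists>c. \<forall>p. G i p = (\<Sum>j<k. c j * M p j)"
      using Suc unfolding G_def by auto
    have G': "G' = G(k := \<lambda>p. v p / complex_of_real N)"
      unfolding G'_def G_def v_def N_def by simp
    obtain c where c: "\<And>i p. i < k \<Longrightarrow> G i p = (\<Sum>j<k. c i j * M p j)"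
      using sp by metis
    \<comment> \<open>Coefficients of the residual in the columns of \<open>M\<close>. The
      coefficient of column \<open>k\<close> is 1, so a vanishing residual contradicts
      injectivity.\<close>
    define e where "e j = (if j = k then 1 else - (\<Sum>l<k. (\<Sum>p'<m. cnj (G l p') * M p' k) * c l j))" for j
    have ve: "v p = (\<Sum>j<Suc k. e j * M p j)" for p
    proof -
      have "(\<Sum>l<k. (\<Sum>p'<m. cnj (G l p') * M p' k) * G l p) = (\<Sum>l<k. \<Sum>j<k. (\<Sum>p'<m. cnj (G l p') * M p' k) * c l j * M p j)"
        by (intro sum.cong) (auto simp: c sum_distrib_left mult.assoc)
      also have "\<dots> = (\<Sum>j<k. (\<Sum>l<k. (\<Sum>p'<m. cnj (G l p') * M p' k) * c l j) * M p j)"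
        unfolding sum_distrib_right[of _ _ "M p _"] by (rule sum.swap)
      finally show ?thesis
        unfolding v_def gs_resid_def by (simp add: e_def sum_negf)
    qed
    have "N \<noteq> 0"
    proof
      assume "N = 0"
      then have "(\<Sum>p<m. (cmod (v p))\<^sup>2) = 0"
        unfolding N_def gs_norm_def v_def by simp
      then have v0: "v p = 0" if "p < m" for p
        using that by (simp add: sum_nonneg_eq_0_iff)
      define f where "f j = (if j < Suc k then e j else 0)" for j
      have "mvec \<kappa> M f p = v p" for p
        unfolding mvec_def ve using Suc.prems
        by (intro sum.mono_neutral_cong_right) (auto simp: f_def)
      then have "f k = 0" using inj v0 Suc.prems unfolding inj_cmat_def by auto
      then show False by (simp add: f_def e_def)
    qed
    moreover have "N \<ge> 0" unfolding N_def gs_norm_def by (simp add: sum_nonneg)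
    ultimately have N: "N > 0" by simp
    have orthG: "(\<Sum>p<m. cnj (G i p) * G j p) = (if i = j then 1 else 0)" if "i < k" "j < k" for i j
      using QR that unfolding is_thin_QR_def by auto
    have Gv: "(\<Sum>p<m. cnj (G i p) * v p) = 0" if i: "i < k" for i
    proof -
      have "(\<Sum>p<m. cnj (G i p) * v p) = (\<Sum>p<m. cnj (G i p) * M p k)
          - (\<Sum>p<m. \<Sum>l<k. (\<Sum>p'<m. cnj (G l p') * M p' k) * (cnj (G i p) * G l p))"
        unfolding v_def gs_resid_def
        by (simp add: right_diff_distrib sum_subtractf sum_distrib_left mult_ac)
      also have "(\<Sum>p<m. \<Sum>l<k. (\<Sum>p'<m. cnj (G l p') * M p' k) * (cnj (G i p) * G l p))
         = (\<Sum>l<k. (\<Sum>p'<m. cnj (G l p') * M p' k) * (\<Sum>p<m. cnj (G i p) * G l p))"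
        unfolding sum_distrib_left[of "\<Sum>p'<m. cnj (G _ p') * M p' k"] by (rule sum.swap)
      also have "\<dots> = (\<Sum>p'<m. cnj (G i p') * M p' k)"
        using i by (simp add: orthG if_distrib sum.delta cong: if_cong)
      finally show ?thesis by simp
    qed
    have vv: "(\<Sum>p<m. cnj (v p) * v p) = complex_of_real (N\<^sup>2)"
    proof -
      have "N\<^sup>2 = (\<Sum>p<m. (cmod (v p))\<^sup>2)"
        unfolding N_def gs_norm_def v_def by (simp add: sum_nonneg)
      then show ?thesis by (simp add: complex_norm_square mult.commute del: of_real_power)
    qed
    have vG: "(\<Sum>p<m. cnj (v p) * G i p) = 0" if i: "i < k" for i
    proof -
      have "(\<Sum>p<m. cnj (v p) * G i p) = cnj (\<Sum>p<m. cnj (G i p) * v p)" by (simp add: mult.commute)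
      then show ?thesis using Gv[OF i] by simp
    qed
    have orth: "(\<Sum>p<m. cnj (G' i p) * G' j p) = (if i = j then 1 else 0)" if ij: "i < Suc k" "j < Suc k" for i j
    proof -
      consider "i < k" "j < k" | "i = k" "j < k" | "i < k" "j = k" | "i = k" "j = k"
        using ij by linarith
      then show ?thesis
      proof cases
        case 1 then show ?thesis by (simp add: G' orthG)
      next
        case 2 then show ?thesis using vG[of j] by (simp add: G' sum_divide_distrib[symmetric])
      next
        case 3 then show ?thesis using Gv[of i] by (simp add: G' sum_divide_distrib[symmetric])
      next
        case 4 then show ?thesis using vv N by (simp add: G' sum_divide_distrib[symmetric] power2_eq_square)
      qed
    qed
    have Rold: "gs_R m M (Suc k) i j = gs_R m M k i j" if "i < k" for i j
      using that unfolding gs_R_def G'_def[symmetric] G_def[symmetric] by (simp add: G')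
    have Mk: "M p k = v p + (\<Sum>l<k. (\<Sum>p'<m. cnj (G l p') * M p' k) * G l p)" for p
      unfolding v_def gs_resid_def by simp
    have Rkk: "gs_R m M (Suc k) k k = complex_of_real N"
    proof -
      have "(\<Sum>p<m. cnj (v p) * M p k) = (\<Sum>p<m. cnj (v p) * v p)
         + (\<Sum>p<m. \<Sum>l<k. (\<Sum>p'<m. cnj (G l p') * M p' k) * (cnj (v p) * G l p))"
        by (subst Mk) (simp add: distrib_left sum.distrib sum_distrib_left mult_ac)
      also have "(\<Sum>p<m. \<Sum>l<k. (\<Sum>p'<m. cnj (G l p') * M p' k) * (cnj (v p) * G l p))
         = (\<Sum>l<k. (\<Sum>p'<m. cnj (G l p') * M p' k) * (\<Sum>p<m. cnj (v p) * G l p))"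
        unfolding sum_distrib_left[of "\<Sum>p'<m. cnj (G _ p') * M p' k"] by (rule sum.swap)
      finally have "(\<Sum>p<m. cnj (v p) * M p k) = complex_of_real (N\<^sup>2)" by (simp add: vG vv)
      then show ?thesis
        unfolding gs_R_def G'_def[symmetric] using N
        by (simp add: G' sum_divide_distrib[symmetric] power2_eq_square)
    qed
    have fact: "M p j = (\<Sum>i<Suc k. G' i p * gs_R m M (Suc k) i j)" if p: "p < m" and j: "j < Suc k" for p j
    proof (cases "j = k")
      case True
      have "(\<Sum>i<k. G' i p * gs_R m M (Suc k) i k) = (\<Sum>l<k. (\<Sum>p'<m. cnj (G l p') * M p' k) * G l p)"
        unfolding gs_R_def G'_def[symmetric] by (intro sum.cong) (auto simp: G')
      then show ?thesis using True N by (simp add: Rkk Mk[of p]) (simp add: G')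
    next
      case False
      then have "j < k" using j by simp
      have "M p j = (\<Sum>i<k. G i p * gs_R m M k i j)"
        using QR p \<open>j < k\<close> unfolding is_thin_QR_def by auto
      also have "\<dots> = (\<Sum>i<k. G' i p * gs_R m M (Suc k) i j)"
        by (intro sum.cong) (auto simp: Rold G')
      finally show ?thesis using \<open>j < k\<close> by (simp add: gs_R_def)
    qed
    have span: "\<exists>c. \<forall>p. G' i p = (\<Sum>j<Suc k. c j * M p j)" if "i < Suc k" for i
    proof (cases "i = k")
      case True
      have "G' k p = (\<Sum>j<Suc k. (e j / complex_of_real N) * M p j)" for p
        unfolding G' by (simp add: ve sum_divide_distrib add_divide_distrib)
      then show ?thesis using True by (intro exI[of _ "\<lambda>j. e j / complex_of_real N"]) simp
    next
      case False
      then show ?thesis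
        using that by (intro exI[of _ "\<lambda>j. if j < k then c i j else 0"]) (simp add: G' c)
    qed
    show ?case
      unfolding is_thin_QR_def G'_def[symmetric] using orth fact span by (auto simp: gs_R_def)
  qed
  then show ?thesis by simp
qed

section \<open>Threaded codewords\<close>

lemma sum_mod_div:
  fixes f :: "nat \<Rightarrow> nat \<Rightarrow> 'a::comm_monoid_add"
  assumes "0 < a"
  shows "(\<Sum>p<a * b. f (p mod a) (p div a)) = (\<Sum>c<b. \<Sum>i<a. f i c)"
proof (induction b)
  case (Suc b)
  have "(\<Sum>p=a * b..<a * b + a. f (p mod a) (p div a)) = (\<Sum>i=0..<a. f ((i + a * b) mod a) ((i + a * b) div a))"
    using sum.shift_bounds_nat_ivl[of "\<lambda>p. f (p mod a) (p div a)" 0 "a * b" a] by (simp add: add.commute)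
  also have "\<dots> = (\<Sum>i<a. f i b)"
    unfolding atLeast0LessThan by (intro sum.cong) auto
  finally have "(\<Sum>p=a * b..<a * b + a. f (p mod a) (p div a)) = (\<Sum>i<a. f i b)" .
  moreover have "{..<a * Suc b} = {..<a * b} \<union> {a * b..<a * b + a}" by auto
  ultimately show ?case using Suc by (simp add: sum.union_disjoint ivl_disj_int)
qed simp

text \<open>The column in which thread \<open>l\<close> meets row \<open>j\<close>. Since the thread
  of \<open>(j, c)\<close> is \<open>j - c\<close> modulo \<open>n\<close>, the same formula is its
  own inverse for fixed \<open>j\<close>.\<close>

definition thread_col :: "nat \<Rightarrow> nat \<Rightarrow> nat \<Rightarrow> nat" where
  "thread_col n l j = (j + n - l) mod n"

lemma thread_col_less: "0 < n \<Longrightarrow> thread_col n l j < n"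
  by (simp add: thread_col_def)

lemma thread_of_less: "0 < n \<Longrightarrow> thread_of n j c < n"
  by (simp add: thread_of_def)

lemma mod_reflect:
  assumes "l < n" "(j::nat) < n"
  shows "(j + n - (j + n - l) mod n) mod n = l"
proof (cases "l \<le> j")
  case True
  then have "(j + n - l) mod n = j - l" using assms by (simp add: mod_if)
  then show ?thesis using True assms by (simp add: mod_if)
next
  case False
  then have "(j + n - l) mod n = j + n - l" using assms by (simp add: mod_if)
  then show ?thesis using False assms by (simp add: mod_if)
qed

lemma thread_of_thread_col: "l < n \<Longrightarrow> j < n \<Longrightarrow> thread_of n j (thread_col n l j) = l"
  unfolding thread_of_def thread_col_def by (rule mod_reflect)

lemma thread_col_thread_of: "c < n \<Longrightarrow> j < n \<Longrightarrow> thread_col n (thread_of n j c) j = c"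
  unfolding thread_of_def thread_col_def by (rule mod_reflect)

text \<open>A column meets every thread exactly once; hence giving up \<open>p\<close> threads frees
  exactly \<open>p\<close> entries in each column.\<close>

lemma inj_on_thread_of:
  assumes "c < n"
  shows "inj_on (\<lambda>j. thread_of n j c) {..<n}"
proof (rule inj_onI)
  fix j j' assume "j \<in> {..<n}" "j' \<in> {..<n}" "thread_of n j c = thread_of n j' c"
  then show "j = j'" using assms unfolding thread_of_def
    by (cases "c \<le> j"; cases "c \<le> j'") (auto simp: mod_if split: if_splits)
qed

lemma codeword_scale: "codeword n A ord \<theta> s j c = complex_of_real \<theta> * codeword n A ord 1 s j c"
  unfolding codeword_def by simp

lemma codeword_diff: "codeword n A ord 1 (\<lambda>q. u q - v q) j c = codeword n A ord 1 u j c - codeword n A ord 1 v j c"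
  unfolding codeword_def thread_block_def by (simp add: sum_subtractf right_diff_distrib)

lemma codeword_norm_le:
  assumes "\<And>l j i. l < n \<Longrightarrow> j < n \<Longrightarrow> i < n \<Longrightarrow> cmod (A l j i) \<le> C" "0 \<le> C" "\<And>q. cmod (u q) \<le> \<beta>"
  shows "cmod (codeword n A ord 1 u j c) \<le> n * C * \<beta>"
proof (cases "j < n \<and> c < n")
  case True
  then have t: "thread_of n j c < n" by (auto intro: thread_of_less)
  have "cmod (\<Sum>i<n. A (thread_of n j c) j i * thread_block n ord u (thread_of n j c) i) \<le> (\<Sum>i<n. C * \<beta>)"
    unfolding thread_block_def using True t assms
    by (intro sum_norm_le) (simp only: norm_mult, rule mult_mono, auto)
  then show ?thesis using True by (simp add: codeword_def mult.assoc)
next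
  case False
  have "0 \<le> \<beta>" using assms(3)[of 0] norm_ge_zero order.trans by blast
  then show ?thesis using False assms by (auto simp: codeword_def)
qed

text \<open>Written exactly like the matrix \<open>M\<close> inside \<open>sd_count\<close>, so that
  it can be folded there.\<close>

definition chan_mat :: "nat \<Rightarrow> nat \<Rightarrow> (nat \<Rightarrow> cmat) \<Rightarrow> (nat \<Rightarrow> nat) \<Rightarrow> real \<Rightarrow> cmat \<Rightarrow> cmat" where
  "chan_mat n nr A ord \<theta> H = (\<lambda>p q. complex_of_real \<theta> * mmul (n * n) (kron_id n nr n H) (Gmat n A ord) p q)"

lemma block_index_less: "b < n \<Longrightarrow> i < n \<Longrightarrow> b * n + i < n * (n::nat)"
proof -
  assume "b < n" "i < n"
  then have "b * n + i < (b + 1) * n" by simp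
  also have "\<dots> \<le> n * n" using \<open>b < n\<close> by (intro mult_right_mono) auto
  finally show ?thesis .
qed

context
  fixes n nr :: nat and A :: "nat \<Rightarrow> cmat" and ord :: "nat \<Rightarrow> nat"
  assumes n_pos: "1 \<le> n" and nr_ge: "n \<le> nr"
    and A_inv: "\<forall>l<n. invertible_cmat n (A l)"
    and ord_bij: "bij_betw ord {..<n} {..<n}"
begin

lemma inv_ord: "l < n \<Longrightarrow> inv_into {..<n} ord l < n" "l < n \<Longrightarrow> ord (inv_into {..<n} ord l) = l"
  "b < n \<Longrightarrow> inv_into {..<n} ord (ord b) = b" "b < n \<Longrightarrow> ord b < n"
  using ord_bij
  by (metis bij_betw_imp_surj_on inv_into_into lessThan_iff)
    (metis ord_bij bij_betw_inv_into_right lessThan_iff,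
     metis ord_bij bij_betw_inv_into_left lessThan_iff, metis ord_bij bij_betwE lessThan_iff)

lemma codeword_Gmat:
  assumes "j < n" "c < n"
  shows "codeword n A ord 1 u j c = (\<Sum>q<n * n. Gmat n A ord (c * n + j) q * u q)"
proof -
  define l where "l = thread_of n j c"
  define b where "b = inv_into {..<n} ord l"
  have l: "l < n" unfolding l_def using n_pos by (intro thread_of_less) simp
  have b: "b < n" unfolding b_def using inv_ord(1)[OF l] .
  have md: "(c * n + j) mod n = j" "(c * n + j) div n = c" using assms by auto
  have "(\<Sum>q<n * n. Gmat n A ord (c * n + j) q * u q)
     = (\<Sum>q<n * n. \<Sum>i<n. A l j i * (if b * n + i = q then u q else 0))"
    unfolding Gmat_def vec_of_def md codeword_def thread_block_def l_def[symmetric] b_def[symmetric]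
    using assms by (intro sum.cong) (auto simp: sum_distrib_right intro!: sum.cong)
  also have "\<dots> = (\<Sum>i<n. \<Sum>q<n * n. A l j i * (if b * n + i = q then u q else 0))"
    by (rule sum.swap)
  also have "\<dots> = (\<Sum>i<n. A l j i * u (b * n + i))"
    using block_index_less[OF b] by (intro sum.cong) (auto simp: sum_distrib_left[symmetric])
  finally show ?thesis
    unfolding codeword_def thread_block_def l_def[symmetric] b_def[symmetric] using assms by simp
qed

text \<open>The identity factor of the Kronecker product decouples the codeword columns:
  \<open>H\<close> acts on each of them separately.\<close>

lemma mvec_chan_mat:
  assumes "p < nr * n"
  shows "mvec (n * n) (chan_mat n nr A ord \<theta> H) u p
     = complex_of_real \<theta> * mvec n H (\<lambda>j. codeword n A ord 1 u j (p div nr)) (p mod nr)"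
proof -
  define c where "c = p div nr"
  have c: "c < n" unfolding c_def using assms by (simp add: less_mult_imp_div_less mult.commute)
  have "mmul (n * n) (kron_id n nr n H) (Gmat n A ord) p q = (\<Sum>j<n. H (p mod nr) j * Gmat n A ord (c * n + j) q)" for q
  proof -
    have "mmul (n * n) (kron_id n nr n H) (Gmat n A ord) p q
        = (\<Sum>l<n * n. (\<lambda>j d. if d = c then H (p mod nr) j * Gmat n A ord (d * n + j) q else 0) (l mod n) (l div n))"
      unfolding mmul_def kron_id_def c_def[symmetric] using c by (intro sum.cong) auto
    also have "\<dots> = (\<Sum>d<n. \<Sum>j<n. if d = c then H (p mod nr) j * Gmat n A ord (d * n + j) q else 0)"
      using n_pos by (subst sum_mod_div) auto
    also have "\<dots> = (\<Sum>d<n. if d = c then (\<Sum>j<n. H (p mod nr) j * Gmat n A ord (d * n + j) q) else 0)"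
      by (intro sum.cong) auto
    finally show ?thesis using c by simp
  qed
  then have "mvec (n * n) (chan_mat n nr A ord \<theta> H) u p
     = complex_of_real \<theta> * (\<Sum>q<n * n. \<Sum>j<n. H (p mod nr) j * (Gmat n A ord (c * n + j) q * u q))"
    unfolding mvec_def chan_mat_def by (simp add: sum_distrib_left sum_distrib_right mult_ac)
  also have "(\<Sum>q<n * n. \<Sum>j<n. H (p mod nr) j * (Gmat n A ord (c * n + j) q * u q))
     = (\<Sum>j<n. H (p mod nr) j * (\<Sum>q<n * n. Gmat n A ord (c * n + j) q * u q))"
    by (subst sum.swap) (simp add: sum_distrib_left)
  also have "\<dots> = mvec n H (\<lambda>j. codeword n A ord 1 u j c) (p mod nr)"
    unfolding mvec_def using c by (intro sum.cong) (auto simp: codeword_Gmat)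
  finally show ?thesis unfolding c_def .
qed

lemma received_eq:
  assumes "p < nr * n"
  shows "vec_of nr (received n nr A ord \<theta> H W s) p
     = mvec (n * n) (chan_mat n nr A ord \<theta> H) s p + W (p mod nr) (p div nr)"
  unfolding mvec_chan_mat[OF assms] unfolding vec_of_def received_def mmul_def mvec_def
  by (simp add: sum_distrib_left codeword_scale[of n A ord \<theta>] mult_ac)

lemma chan_mat_norm:
  "(\<Sum>p<nr * n. (cmod (mvec (n * n) (chan_mat n nr A ord \<theta> H) u p))\<^sup>2)
     = \<theta>\<^sup>2 * (\<Sum>c<n. \<Sum>i<nr. (cmod (mvec n H (\<lambda>j. codeword n A ord 1 u j c) i))\<^sup>2)"
proof -
  have "(\<Sum>p<nr * n. (cmod (mvec (n * n) (chan_mat n nr A ord \<theta> H) u p))\<^sup>2)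
    = (\<Sum>p<nr * n. (\<lambda>i c. \<theta>\<^sup>2 * (cmod (mvec n H (\<lambda>j. codeword n A ord 1 u j c) i))\<^sup>2) (p mod nr) (p div nr))"
    by (intro sum.cong) (auto simp: mvec_chan_mat norm_mult power_mult_distrib)
  also have "\<dots> = (\<Sum>c<n. \<Sum>i<nr. \<theta>\<^sup>2 * (cmod (mvec n H (\<lambda>j. codeword n A ord 1 u j c) i))\<^sup>2)"
    using n_pos nr_ge by (subst sum_mod_div) auto
  finally show ?thesis by (simp add: sum_distrib_left)
qed

text \<open>The hypothesis supplies left inverses of the \<open>A l\<close>; for square matrices
  they are right inverses too. The first yields locality, as a symbol block is read off from its own
  thread only; the second makes every complex matrix the codeword of some complex symbol
  vector.\<close>

lemma codeword_left_inverse: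
  obtains B :: "nat \<Rightarrow> cmat" where
    "\<And>u b i. b < n \<Longrightarrow> i < n \<Longrightarrow> u (b * n + i) = (\<Sum>j<n. B b i j * codeword n A ord 1 u j (thread_col n (ord b) j))"
    "\<And>X. \<exists>u. \<forall>j<n. \<forall>c<n. codeword n A ord 1 u j c = X j c"
proof -
  have "\<exists>B. \<forall>i<n. \<forall>j<n. mmul n B (A l) i j = (if i = j then 1 else 0)
     \<and> mmul n (A l) B i j = (if i = j then 1 else 0)" if "l < n" for l
  proof -
    from A_inv[rule_format, OF that, unfolded invertible_cmat_def]
    obtain B where B': "\<forall>i<n. \<forall>j<n. mmul n B (A l) i j = (if i = j then 1 else 0)"
      by (elim exE) rule
    note B = B'[rule_format]
    define MA where "MA = mat n n (\<lambda>(i, j). A l i j)"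
    define MB where "MB = mat n n (\<lambda>(i, j). B i j)"
    have car: "MA \<in> carrier_mat n n" "MB \<in> carrier_mat n n" unfolding MA_def MB_def by auto
    have prd: "(mat n n (\<lambda>(i, j). P i j) * mat n n (\<lambda>(i, j). P' i j)) $$ (i, j) = mmul n P P' i j"
      if "i < n" "j < n" for P P' :: cmat and i j
      using that by (simp add: scalar_prod_def mmul_def atLeast0LessThan)
    have "MB * MA = 1\<^sub>m n"
      by (rule eq_matI) (use B prd in \<open>auto simp: MA_def MB_def\<close>)
    then have "MA * MB = 1\<^sub>m n" using mat_mult_left_right_inverse[OF car(2,1)] by simp
    then have "mmul n (A l) B i j = (if i = j then 1 else 0)" if "i < n" "j < n" for i j
      using prd[OF that, of "A l" B] that unfolding MA_def MB_def by simp
    then show ?thesis using B by (intro exI[of _ B]) simp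
  qed
  then have "\<forall>l\<in>{..<n}. \<exists>B. \<forall>i<n. \<forall>j<n. mmul n B (A l) i j = (if i = j then 1 else 0)
     \<and> mmul n (A l) B i j = (if i = j then 1 else 0)" by simp
  from bchoice[OF this] obtain B where "\<forall>l\<in>{..<n}. \<forall>i<n. \<forall>j<n. mmul n (B l) (A l) i j = (if i = j then 1 else 0)
     \<and> mmul n (A l) (B l) i j = (if i = j then 1 else 0)" by (elim exE) rule
  then have B: "\<And>l i j. l < n \<Longrightarrow> i < n \<Longrightarrow> j < n \<Longrightarrow> mmul n (B l) (A l) i j = (if i = j then 1 else 0)"
    and B': "\<And>l i j. l < n \<Longrightarrow> i < n \<Longrightarrow> j < n \<Longrightarrow> mmul n (A l) (B l) i j = (if i = j then 1 else 0)"
    by simp_all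
  have n0: "0 < n" using n_pos by simp
  show ?thesis
  proof (rule that[of "\<lambda>b. B (ord b)"])
    fix u :: "nat \<Rightarrow> complex" and b i assume b: "b < n" and i: "i < n"
    have "(\<Sum>j<n. B (ord b) i j * codeword n A ord 1 u j (thread_col n (ord b) j))
       = (\<Sum>j<n. \<Sum>k<n. B (ord b) i j * (A (ord b) j k * u (b * n + k)))"
      unfolding codeword_def thread_block_def
      using b by (intro sum.cong) (auto simp: thread_col_less[OF n0] thread_of_thread_col inv_ord sum_distrib_left)
    also have "\<dots> = (\<Sum>k<n. mmul n (B (ord b)) (A (ord b)) i k * u (b * n + k))"
      unfolding mmul_def by (subst sum.swap) (simp add: sum_distrib_right mult.assoc)
    also have "\<dots> = (\<Sum>k<n. if i = k then u (b * n + k) else 0)"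
      using i inv_ord(4)[OF b] by (intro sum.cong) (auto simp: B)
    finally show "u (b * n + i) = (\<Sum>j<n. B (ord b) i j * codeword n A ord 1 u j (thread_col n (ord b) j))"
      using i by simp
  next
    fix X :: cmat
    define u where "u q = (\<Sum>j<n. B (ord (q div n)) (q mod n) j * X j (thread_col n (ord (q div n)) j))" for q
    have "codeword n A ord 1 u j c = X j c" if jc: "j < n" "c < n" for j c
    proof -
      define l where "l = thread_of n j c"
      have l: "l < n" unfolding l_def by (intro thread_of_less n0)
      have "codeword n A ord 1 u j c = (\<Sum>k<n. \<Sum>i<n. A l j k * (B l k i * X i (thread_col n l i)))"
        unfolding codeword_def thread_block_def l_def[symmetric] u_def using jc l
        by (simp add: inv_ord sum_distrib_left)
      also have "\<dots> = (\<Sum>i<n. mmul n (A l) (B l) j i * X i (thread_col n l i))"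
        unfolding mmul_def by (subst sum.swap) (simp add: sum_distrib_right mult.assoc)
      also have "\<dots> = (\<Sum>i<n. if j = i then X i (thread_col n l i) else 0)"
        using jc l by (intro sum.cong) (auto simp: B')
      finally show ?thesis using jc by (simp add: l_def thread_col_thread_of)
    qed
    then show "\<exists>u. \<forall>j<n. \<forall>c<n. codeword n A ord 1 u j c = X j c" by blast
  qed
qed

text \<open>The inverse with the thread structure forgotten, padded by zeros off the thread. What
  matters is that \<open>C\<close> depends on the code alone, not on the power level.\<close>

lemma codeword_coords:
  obtains D :: "nat \<Rightarrow> nat \<times> nat \<Rightarrow> complex" and C :: real where "0 \<le> C"
    "\<And>q e. q < n * n \<Longrightarrow> e \<in> {..<n} \<times> {..<n} \<Longrightarrow> cmod (D q e) \<le> C"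
    "\<And>u q. q < n * n \<Longrightarrow> u q = (\<Sum>e\<in>{..<n} \<times> {..<n}. D q e * codeword n A ord 1 u (fst e) (snd e))"
proof -
  obtain B where B: "\<And>u b i. b < n \<Longrightarrow> i < n \<Longrightarrow> u (b * n + i) = (\<Sum>j<n. B b i j * codeword n A ord 1 u j (thread_col n (ord b) j))"
    using codeword_left_inverse by metis
  have n0: "0 < n" using n_pos by simp
  define D where "D q e = (if snd e = thread_col n (ord (q div n)) (fst e) then B (q div n) (q mod n) (fst e) else 0)" for q e
  define C where "C = (\<Sum>q<n * n. \<Sum>e\<in>{..<n} \<times> {..<n}. cmod (D q e))"
  show ?thesis
  proof (rule that[of C D])
    show "0 \<le> C" unfolding C_def by (intro sum_nonneg) auto
    fix q assume q: "q < n * n"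
    show "cmod (D q e) \<le> C" if "e \<in> {..<n} \<times> {..<n}" for e
    proof -
      have "cmod (D q e) \<le> (\<Sum>e\<in>{..<n} \<times> {..<n}. cmod (D q e))"
        using that by (intro member_le_sum) auto
      also have "\<dots> \<le> C" unfolding C_def using q by (intro member_le_sum) (auto intro!: sum_nonneg)
      finally show ?thesis .
    qed
    fix u
    have qd: "q div n < n" "q mod n < n" using q n0 by (auto simp: less_mult_imp_div_less)
    have "(\<Sum>e\<in>{..<n} \<times> {..<n}. D q e * codeword n A ord 1 u (fst e) (snd e))
       = (\<Sum>j<n. \<Sum>c<n. D q (j, c) * codeword n A ord 1 u j c)"
      by (simp add: sum.cartesian_product case_prod_beta)
    also have "\<dots> = (\<Sum>j<n. \<Sum>c<n. if c = thread_col n (ord (q div n)) j then B (q div n) (q mod n) j * codeword n A ord 1 u j c else 0)"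
      unfolding D_def by (intro sum.cong) auto
    also have "\<dots> = (\<Sum>j<n. B (q div n) (q mod n) j * codeword n A ord 1 u j (thread_col n (ord (q div n)) j))"
      using thread_col_less[OF n0] by (intro sum.cong) auto
    also have "\<dots> = u q" using B[OF qd, of u] by simp
    finally show "u q = (\<Sum>e\<in>{..<n} \<times> {..<n}. D q e * codeword n A ord 1 u (fst e) (snd e))" by simp
  qed
qed

lemma inj_chan_mat:
  assumes "inj_cmat nr n H" "\<theta> \<noteq> 0"
  shows "inj_cmat (nr * n) (n * n) (chan_mat n nr A ord \<theta> H)"
  unfolding inj_cmat_def
proof (intro allI impI)
  fix v q assume v: "\<forall>p<nr * n. mvec (n * n) (chan_mat n nr A ord \<theta> H) v p = 0" and q: "q < n * n"
  then have "\<theta>\<^sup>2 * (\<Sum>c<n. \<Sum>i<nr. (cmod (mvec n H (\<lambda>j. codeword n A ord 1 v j c) i))\<^sup>2) = 0"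
    by (subst chan_mat_norm[symmetric]) simp
  then have "(\<Sum>c<n. \<Sum>i<nr. (cmod (mvec n H (\<lambda>j. codeword n A ord 1 v j c) i))\<^sup>2) = 0"
    using assms by simp
  then have "mvec n H (\<lambda>j. codeword n A ord 1 v j c) i = 0" if "c < n" "i < nr" for c i
    using that by (simp add: sum_nonneg_eq_0_iff sum_nonneg)
  then have "codeword n A ord 1 v j c = 0" if "j < n" "c < n" for j c
    using assms(1) that unfolding inj_cmat_def by blast
  moreover obtain D :: "nat \<Rightarrow> nat \<times> nat \<Rightarrow> complex" where
    "\<And>u q. q < n * n \<Longrightarrow> u q = (\<Sum>e\<in>{..<n} \<times> {..<n}. D q e * codeword n A ord 1 u (fst e) (snd e))"
    using codeword_coords by metis
  ultimately show "v q = 0" using q by (metis (no_types, lifting) SigmaE lessThan_iff mult_zero_right fst_conv snd_conv sum.neutral)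
qed

end

section \<open>Size of the symbol alphabet\<close>

lemma QAM_eq: "QAM eta = (\<lambda>(a, b). Complex (of_int a) (of_int b)) ` ({- \<lfloor>eta\<rfloor>..\<lfloor>eta\<rfloor>} \<times> {- \<lfloor>eta\<rfloor>..\<lfloor>eta\<rfloor>})"
proof -
  have *: "\<bar>real_of_int a\<bar> \<le> eta \<longleftrightarrow> a \<in> {- \<lfloor>eta\<rfloor>..\<lfloor>eta\<rfloor>}" for a
    using le_floor_iff[of a eta] le_floor_iff[of "- a" eta] by (auto simp: abs_le_iff)
  show ?thesis
  proof (intro equalityI subsetI)
    fix s assume "s \<in> QAM eta"
    then obtain a b where "Re s = of_int a" "Im s = of_int b" "\<bar>real_of_int a\<bar> \<le> eta" "\<bar>real_of_int b\<bar> \<le> eta"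
      unfolding QAM_def by (auto elim!: Ints_cases)
    then show "s \<in> (\<lambda>(a, b). Complex (of_int a) (of_int b)) ` ({- \<lfloor>eta\<rfloor>..\<lfloor>eta\<rfloor>} \<times> {- \<lfloor>eta\<rfloor>..\<lfloor>eta\<rfloor>})"
      unfolding * by (intro image_eqI[of _ _ "(a, b)"]) (auto simp: complex_eq_iff)
  next
    fix s assume "s \<in> (\<lambda>(a, b). Complex (of_int a) (of_int b)) ` ({- \<lfloor>eta\<rfloor>..\<lfloor>eta\<rfloor>} \<times> {- \<lfloor>eta\<rfloor>..\<lfloor>eta\<rfloor>})"
    then show "s \<in> QAM eta" unfolding QAM_def using * by auto
  qed
qed

lemma finite_QAM: "finite (QAM eta)"
  unfolding QAM_eq by auto

lemma card_QAM:
  assumes "0 \<le> eta"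
  shows "card (QAM eta) = (nat (2 * \<lfloor>eta\<rfloor> + 1))\<^sup>2"
proof -
  have "inj_on (\<lambda>(a, b). Complex (real_of_int a) (real_of_int b)) X" for X
    by (auto simp: inj_on_def)
  then show ?thesis unfolding QAM_eq by (simp add: card_image power2_eq_square)
qed

text \<open>With \<open>1 \<le> eta\<close> the side length
  \<open>2 * \<lfloor>eta\<rfloor> + 1\<close> lies between \<open>eta\<close> and
  \<open>3 * eta\<close>.\<close>

lemma card_QAM_bounds:
  assumes "1 \<le> eta"
  shows "eta\<^sup>2 \<le> real (card (QAM eta))" "real (card (QAM eta)) \<le> (3 * eta)\<^sup>2"
proof -
  have "\<lfloor>eta\<rfloor> \<ge> 1" using assms by simp
  then have "real (nat (2 * \<lfloor>eta\<rfloor> + 1)) = 2 * of_int \<lfloor>eta\<rfloor> + 1" by simp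
  then have "eta \<le> real (nat (2 * \<lfloor>eta\<rfloor> + 1))" "real (nat (2 * \<lfloor>eta\<rfloor> + 1)) \<le> 3 * eta"
    using assms floor_correct[of eta] by linarith+
  then show "eta\<^sup>2 \<le> real (card (QAM eta))" "real (card (QAM eta)) \<le> (3 * eta)\<^sup>2"
    using assms unfolding card_QAM[OF order.trans[OF zero_le_one assms]] of_nat_power
    by (intro power_mono; simp)+
qed

lemma QAM_gauss_int: "s \<in> QAM eta \<Longrightarrow> gauss_int s"
  by (simp add: QAM_def gauss_int_def)

lemma QAM_norm_le: "s \<in> QAM eta \<Longrightarrow> cmod s \<le> 2 * eta"
  using cmod_le[of s] by (auto simp: QAM_def)

section \<open>Upper bound for the level counts\<close>

definition level_set :: "nat \<Rightarrow> real \<Rightarrow> nat \<Rightarrow> (nat \<Rightarrow> complex) set" where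
  "level_set \<kappa> eta K = {t. (\<forall>j. (K \<le> j \<and> j < \<kappa>) \<longrightarrow> t j \<in> QAM eta) \<and> (\<forall>j. \<not> (K \<le> j \<and> j < \<kappa>) \<longrightarrow> t j = 0)}"

lemma finite_level_set: "finite (level_set \<kappa> eta K)"
proof (rule finite_subset)
  show "level_set \<kappa> eta K \<subseteq> {t. \<forall>j. (j \<in> {K..<\<kappa>} \<longrightarrow> t j \<in> QAM eta) \<and> (j \<notin> {K..<\<kappa>} \<longrightarrow> t j = 0)}"
    unfolding level_set_def by auto
  show "finite \<dots>" by (rule finite_set_of_finite_funs) (auto simp: finite_QAM)
qed

lemma symvecs_level_set: "symvecs \<kappa> eta = level_set \<kappa> eta 0"
  unfolding symvecs_def level_set_def by auto

definition qr_count :: "nat \<Rightarrow> nat \<Rightarrow> cmat \<Rightarrow> cmat \<Rightarrow> (nat \<Rightarrow> complex) \<Rightarrow> real \<Rightarrow> real \<Rightarrow> nat" where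
  "qr_count m \<kappa> Q R y eta xi2 = (\<Sum>k = 1..\<kappa>. card {t \<in> level_set \<kappa> eta (\<kappa> - k). qr_cost m \<kappa> Q R y (\<kappa> - k) t \<le> xi2})"

lemma prod_fst_Times:
  fixes f :: "'a \<Rightarrow> real"
  shows "(\<Prod>a\<in>B \<times> {..<n}. f (fst a)) = (\<Prod>l\<in>B. f l) ^ n"
proof -
  have "(\<Prod>a\<in>B \<times> {..<n}. f (fst a)) = (\<Prod>l\<in>B. \<Prod>c<n. f l)"
    unfolding prod.cartesian_product by (intro prod.cong) auto
  then show ?thesis by (simp add: prod_power_distrib)
qed

lemma norm_diff_sq_le: "(cmod (a - b))\<^sup>2 \<le> 2 * (cmod a)\<^sup>2 + 2 * (cmod b)\<^sup>2"
proof -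
  have "(cmod (a - b))\<^sup>2 \<le> (cmod a + cmod b)\<^sup>2"
    using norm_triangle_ineq4[of a b] by (intro power_mono) auto
  also have "\<dots> \<le> 2 * (cmod a)\<^sup>2 + 2 * (cmod b)\<^sup>2"
    using sum_squares_bound[of "cmod a" "cmod b"] by (simp add: power2_sum)
  finally show ?thesis .
qed

text \<open>Subtracting two admissible tails removes the received signal, so that the upper bound
  needs no information on noise or on the transmitted vector.\<close>

lemma qr_cost_diff_le:
  assumes "qr_cost m k Q R y K t \<le> x" "qr_cost m k Q R y K t' \<le> x"
  shows "qr_cost m k Q R (\<lambda>_. 0) K (\<lambda>j. t j - t' j) \<le> 4 * x"
proof -
  have "qr_cost m k Q R (\<lambda>_. 0) K (\<lambda>j. t j - t' j) \<le> 2 * qr_cost m k Q R y K t' + 2 * qr_cost m k Q R y K t"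
    unfolding qr_cost_def sum_distrib_left sum.distrib[symmetric]
  proof (intro sum_mono)
    fix i
    define r where "r = qr_coord m Q y i"
    define a where "a = (\<Sum>j\<in>{K..<k}. R i j * t j)"
    define b where "b = (\<Sum>j\<in>{K..<k}. R i j * t' j)"
    have "qr_coord m Q (\<lambda>_. 0) i - (\<Sum>j\<in>{K..<k}. R i j * (t j - t' j)) = (r - a) - (r - b)"
      unfolding a_def b_def qr_coord_def by (simp add: right_diff_distrib sum_subtractf)
    then show "(cmod (qr_coord m Q (\<lambda>_. 0) i - (\<Sum>j\<in>{K..<k}. R i j * (t j - t' j))))\<^sup>2
      \<le> 2 * (cmod (qr_coord m Q y i - (\<Sum>j = K..<k. R i j * t' j)))\<^sup>2
         + 2 * (cmod (qr_coord m Q y i - (\<Sum>j = K..<k. R i j * t j)))\<^sup>2"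
      using norm_diff_sq_le[of "r - a" "r - b"] unfolding r_def a_def b_def by simp
  qed
  then show ?thesis using assms by linarith
qed

lemma qr_bessel:
  assumes "is_thin_QR m k M Q R"
  shows "(\<Sum>i<k. (cmod (qr_coord m Q y i))\<^sup>2) \<le> (\<Sum>p<m. (cmod (y p))\<^sup>2)"
proof -
  have "0 \<le> (\<Sum>p<m. (cmod (y p - (\<Sum>i<k. Q p i * qr_coord m Q y i)))\<^sup>2)" by (simp add: sum_nonneg)
  also have "\<dots> = (\<Sum>p<m. (cmod (y p))\<^sup>2) - (\<Sum>i<k. (cmod (qr_coord m Q y i))\<^sup>2)"
    using assms unfolding qr_coord_def is_thin_QR_def
    by (subst orthonormal_residual) auto
  finally show ?thesis by simp
qed

text \<open>The tail is completed by the head of \<open>s + v\<close>, which need not consist of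
  symbols, and the level metric is at most the full one. Noise and \<open>M v\<close> contribute
  half of \<open>x\<close> each after splitting the square.\<close>

lemma qr_cost_le_of_close:
  assumes QR: "is_thin_QR m k M Q R" and K: "K \<le> k"
    and y: "\<And>p. p < m \<Longrightarrow> y p = mvec k M s p + w p"
    and w: "(\<Sum>p<m. (cmod (w p))\<^sup>2) \<le> x / 4"
    and v: "\<And>j. K \<le> j \<Longrightarrow> j < k \<Longrightarrow> v j = t j - s j"
    and Mv: "(\<Sum>p<m. (cmod (mvec k M v p))\<^sup>2) \<le> x / 4"
  shows "qr_cost m k Q R y K t \<le> x"
proof -
  define z where "z j = s j + v j" for j
  have "qr_cost m k Q R y K t \<le> (\<Sum>i<k. (cmod (qr_coord m Q y i - mvec k R z i))\<^sup>2)"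
    using v by (intro qr_cost_le[OF QR K]) (auto simp: z_def)
  also have "\<dots> \<le> (\<Sum>p<m. (cmod (y p - mvec k M z p))\<^sup>2)"
    using QR_residual[OF QR, of y z] qr_bessel[OF QR, of y] by linarith
  also have "\<dots> = (\<Sum>p<m. (cmod (w p - mvec k M v p))\<^sup>2)"
    by (intro sum.cong) (auto simp: y z_def mvec_def distrib_left sum.distrib)
  also have "\<dots> \<le> (\<Sum>p<m. 2 * (cmod (w p))\<^sup>2 + 2 * (cmod (mvec k M v p))\<^sup>2)"
    by (intro sum_mono norm_diff_sq_le)
  also have "\<dots> \<le> x" using w Mv by (simp add: sum.distrib sum_distrib_left[symmetric])
  finally show ?thesis .
qed

context
  fixes n nr :: nat and A :: "nat \<Rightarrow> cmat" and ord :: "nat \<Rightarrow> nat"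
  assumes n_pos: "1 \<le> n" and nr_ge: "n \<le> nr"
    and A_inv: "\<forall>l<n. invertible_cmat n (A l)"
    and ord_bij: "bij_betw ord {..<n} {..<n}"
begin

text \<open>From here on any convenient decomposition may stand for the one chosen in
  \<open>sd_count\<close>.\<close>

lemma sd_count_eq_qr_count:
  assumes inj: "inj_cmat nr n H" and \<theta>: "\<theta> \<noteq> 0"
    and QR: "is_thin_QR (nr * n) (n * n) (chan_mat n nr A ord \<theta> H) Q R"
  shows "sd_count n nr A ord \<theta> eta xi2 H W s
     = qr_count (nr * n) (n * n) Q R (vec_of nr (received n nr A ord \<theta> H W s)) eta xi2"
proof -
  define M where "M = chan_mat n nr A ord \<theta> H"
  define y where "y = vec_of nr (received n nr A ord \<theta> H W s)"
  define QR' where "QR' = (SOME QR. is_thin_QR (nr * n) (n * n) M (fst QR) (snd QR))"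
  have "is_thin_QR (nr * n) (n * n) M (fst (Q, R)) (snd (Q, R))" using QR by (simp add: M_def)
  then have QR'p: "is_thin_QR (nr * n) (n * n) M (fst QR') (snd QR')"
    unfolding QR'_def by (rule someI)
  have injM: "inj_cmat (nr * n) (n * n) M"
    unfolding M_def by (rule inj_chan_mat[OF n_pos nr_ge A_inv ord_bij inj \<theta>])
  have "sd_count n nr A ord \<theta> eta xi2 H W s = qr_count (nr * n) (n * n) (fst QR') (snd QR') y eta xi2"
    unfolding sd_count_def qr_count_def Let_def chan_mat_def[symmetric] M_def[symmetric] QR'_def[symmetric]
      y_def[symmetric] level_set_def qr_cost_def qr_coord_def
    by (intro sum.cong arg_cong[where f = card] Collect_cong) auto
  also have "\<dots> = qr_count (nr * n) (n * n) Q R y eta xi2"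
    unfolding qr_count_def using qr_cost_unique[OF QR'p injM QR[folded M_def]] by simp
  finally show ?thesis unfolding y_def .
qed

text \<open>The difference of two tails in the sphere completes to a complex vector whose codeword
  columns have small images under \<open>H\<close>. Each of the \<open>n\<close> columns has
  \<open>n\<close> pivot coordinates, the \<open>l\<close>-th of size about \<open>sqrt xi2\<close>
  over \<open>\<bar>\<theta>\<bar>\<close> times the pivot, and the lattice count applies. The
  pivots in \<open>L\<close> are treated as unconstrained and cost one full alphabet per
  column.\<close>

lemma sd_count_le_pivots:
  obtains N0 :: real where "1 \<le> N0"
    "\<And>H \<theta> eta xi2 W s \<pi> L. \<theta> \<noteq> 0 \<Longrightarrow> 0 \<le> xi2 \<Longrightarrow> complete_pivots nr n H \<pi> \<Longrightarrow> \<pi> \<in> pivot_orders nr n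
       \<Longrightarrow> pivot H \<pi> (n - 1) \<noteq> 0 \<Longrightarrow> inj_cmat nr n H \<Longrightarrow> L \<subseteq> {..<n} \<Longrightarrow>
       real (sd_count n nr A ord \<theta> eta xi2 H W s) \<le> real (n * n) *
         (\<Prod>l<n. if l \<in> L then real (card (QAM eta)) else (N0 * (1 + sqrt xi2 / (\<bar>\<theta>\<bar> * cmod (pivot H \<pi> l))))\<^sup>2) ^ n"
proof -
  obtain D0 :: "nat \<Rightarrow> nat \<times> nat \<Rightarrow> complex" and C :: real where C: "0 \<le> C"
    and D0: "\<And>q e. q < n * n \<Longrightarrow> e \<in> {..<n} \<times> {..<n} \<Longrightarrow> cmod (D0 q e) \<le> C"
    and D0u: "\<And>u q. q < n * n \<Longrightarrow> u q = (\<Sum>e\<in>{..<n} \<times> {..<n}. D0 q e * codeword n A ord 1 u (fst e) (snd e))"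
    by (rule codeword_coords[OF n_pos nr_ge A_inv ord_bij]) blast
  define C1 where "C1 = real n * (C * real (n + 1) ^ n)"
  \<comment> \<open>\<open>N1\<close> dominates the constant of the lattice count for every
    \<open>L\<close>, as both index sets have at most \<open>n * n\<close> elements. The extra
    factor in \<open>N0\<close> absorbs \<open>2 ^ n\<close> from the elimination and 2 from
    doubling the radius.\<close>
  define N1 where "N1 = 2 * (2 * (2 ^ (n * n) * C1) * real (n * n) + 1)"
  define N0 where "N0 = N1 * (1 + 2 ^ n * 2)"
  have C1: "0 \<le> C1" unfolding C1_def using C by simp
  have N1: "1 \<le> N1" unfolding N1_def using C1 by simp
  have N0: "1 \<le> N0" unfolding N0_def using mult_mono[of 1 N1 1 "1 + 2 ^ n * 2"] N1 by simp
  show ?thesis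
  proof (rule that[OF N0])
    fix H W :: cmat and \<theta> eta xi2 :: real and s \<pi> L
    assume \<theta>: "\<theta> \<noteq> 0" and xi: "0 \<le> xi2" and cp: "complete_pivots nr n H \<pi>" and po: "\<pi> \<in> pivot_orders nr n"
      and pn: "pivot H \<pi> (n - 1) \<noteq> 0" and inj: "inj_cmat nr n H" and L: "L \<subseteq> {..<n}"
    define m where "m = nr * n"
    define \<kappa> where "\<kappa> = n * n"
    define M where "M = chan_mat n nr A ord \<theta> H"
    define y where "y = vec_of nr (received n nr A ord \<theta> H W s)"
    have injM: "inj_cmat m \<kappa> M"
      unfolding M_def m_def \<kappa>_def by (rule inj_chan_mat[OF n_pos nr_ge A_inv ord_bij inj \<theta>])
    obtain Q R where QR: "is_thin_QR m \<kappa> M Q R" using gram_schmidt_thin_QR[OF injM] by blast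
    note nz = pivot_nonzero[OF cp po pn]
    obtain E :: "nat \<Rightarrow> nat \<Rightarrow> complex" where Eb: "\<And>b i. cmod (E b i) \<le> real (n + 1) ^ n"
      and E: "\<And>x b. b < n \<Longrightarrow> x b = (\<Sum>i<n. E b i * pivot_coord n H \<pi> x i)"
      by (rule pivot_coords_determine[OF cp po nz]) (assumption, rule that, assumption+)
    define \<tau>0 where "\<tau>0 = 2 * sqrt xi2 / \<bar>\<theta>\<bar>"
    define \<tau> where "\<tau> l = 2 ^ n * \<tau>0 / cmod (pivot H \<pi> l)" for l
    \<comment> \<open>Symbols are expressed by codeword entries through \<open>D0\<close>, and the
      entries of each column by its pivot coordinates through \<open>E\<close>.\<close>
    define D where "D q e = (\<Sum>j<n. D0 q (j, snd e) * E j (fst e))" for q e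
    define I where "I = ({..<n} - L) \<times> {..<n}"
    define I2 where "I2 = L \<times> {..<n}"
    have fin: "finite I" "finite I2" unfolding I_def I2_def using L finite_subset by auto
    have un: "I \<union> I2 = {..<n} \<times> {..<n}" "I \<inter> I2 = {}" unfolding I_def I2_def using L by auto
    have cI: "card I \<le> n * n" "card I2 \<le> n * n"
      using card_mono[of "{..<n} \<times> {..<n}" I] card_mono[of "{..<n} \<times> {..<n}" I2] un by auto
    have \<tau>0: "0 \<le> \<tau>0" unfolding \<tau>0_def using xi by simp
    have \<tau>_nn: "0 \<le> \<tau> l" for l unfolding \<tau>_def using \<tau>0 by simp
    have Db: "cmod (D q e) \<le> C1" if "q < n * n" "e \<in> I \<union> I2" for q e
    proof -
      have "cmod (D q e) \<le> (\<Sum>j<n. C * real (n + 1) ^ n)"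
        unfolding D_def
      proof (rule sum_norm_le)
        fix j assume j: "j \<in> {..<n}"
        have "cmod (D0 q (j, snd e)) \<le> C"
          using that j unfolding un by (intro D0) auto
        then show "cmod (D0 q (j, snd e) * E j (fst e)) \<le> C * real (n + 1) ^ n"
          unfolding norm_mult by (intro mult_mono Eb C norm_ge_zero)
      qed
      then show ?thesis unfolding C1_def by simp
    qed
    have lev: "real (card {t \<in> level_set \<kappa> eta K. qr_cost m \<kappa> Q R y K t \<le> xi2})
       \<le> (\<Prod>l<n. if l \<in> L then real (card (QAM eta)) else (N0 * (1 + sqrt xi2 / (\<bar>\<theta>\<bar> * cmod (pivot H \<pi> l))))\<^sup>2) ^ n"
      if K: "K < \<kappa>" for K
    proof -
      define S where "S = {t \<in> level_set \<kappa> eta K. qr_cost m \<kappa> Q R y K t \<le> xi2}"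
      have rep: "\<exists>y. (\<forall>a\<in>I. cmod (y a) \<le> (\<tau> \<circ> fst) a) \<and> (\<forall>j\<in>{K..<\<kappa>}. t j - t' j = (\<Sum>a\<in>I \<union> I2. D j a * y a))"
        if tt: "t \<in> S" "t' \<in> S" for t t'
      proof -
        have "qr_cost m \<kappa> Q R (\<lambda>_. 0) K (\<lambda>j. t j - t' j) \<le> 4 * xi2"
          using tt unfolding S_def by (intro qr_cost_diff_le) auto
        \<comment> \<open>The head of \<open>v\<close> is complex and not a lattice vector. It only
          serves to turn the small level metric into a small \<open>M v\<close>; the lattice count
          uses the tail alone.\<close>
        moreover obtain v where v: "\<And>j. K \<le> j \<Longrightarrow> v j = t j - t' j"
          and vc: "qr_cost m \<kappa> Q R (\<lambda>_. 0) K (\<lambda>j. t j - t' j) = (\<Sum>i<\<kappa>. (cmod (qr_coord m Q (\<lambda>_. 0) i - mvec \<kappa> R v i))\<^sup>2)"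
          using qr_cost_attained[OF QR injM less_imp_le[OF K], of "\<lambda>j. t j - t' j" "\<lambda>_. 0"] by blast
        ultimately have "(\<Sum>p<m. (cmod (mvec \<kappa> M v p))\<^sup>2) \<le> 4 * xi2"
          unfolding QR_norm[OF QR] by (simp add: qr_coord_def)
        then have nrm: "\<theta>\<^sup>2 * (\<Sum>c<n. \<Sum>i<nr. (cmod (mvec n H (\<lambda>j. codeword n A ord 1 v j c) i))\<^sup>2) \<le> 4 * xi2"
          unfolding M_def m_def \<kappa>_def chan_mat_norm[OF n_pos nr_ge A_inv ord_bij] .
        have small: "cmod (mvec n H (\<lambda>j. codeword n A ord 1 v j c) i) \<le> \<tau>0" if c: "c < n" and i: "i < nr" for c i
        proof -
          define h where "h = cmod (mvec n H (\<lambda>j. codeword n A ord 1 v j c) i)"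
          have "h\<^sup>2 \<le> (\<Sum>i<nr. (cmod (mvec n H (\<lambda>j. codeword n A ord 1 v j c) i))\<^sup>2)"
            unfolding h_def using i by (intro member_le_sum) auto
          also have "\<dots> \<le> (\<Sum>c<n. \<Sum>i<nr. (cmod (mvec n H (\<lambda>j. codeword n A ord 1 v j c) i))\<^sup>2)"
            using c by (intro member_le_sum) (auto intro!: sum_nonneg)
          finally have "\<theta>\<^sup>2 * h\<^sup>2 \<le> 4 * xi2" using nrm by (smt (verit) mult_left_mono zero_le_power2)
          then have "(\<bar>\<theta>\<bar> * h)\<^sup>2 \<le> (2 * sqrt xi2)\<^sup>2" using xi by (simp add: power_mult_distrib)
          then have "\<bar>\<theta>\<bar> * h \<le> 2 * sqrt xi2" by (rule power2_le_imp_le) (simp add: xi)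
          then have "h \<le> \<tau>0" unfolding \<tau>0_def using \<theta> by (simp add: pos_le_divide_eq mult.commute)
          then show ?thesis unfolding h_def .
        qed
        define z where "z e = pivot_coord n H \<pi> (\<lambda>j. codeword n A ord 1 v j (snd e)) (fst e)" for e
        have "cmod (z e) \<le> (\<tau> \<circ> fst) e" if eI: "e \<in> I" for e
        proof -
          obtain l c where e: "e = (l, c)" "l < n" "c < n" using eI unfolding I_def by auto
          have fl: "fst (\<pi> l) < nr" using po e unfolding pivot_orders_def by auto
          have "cmod (mvec n (gauss_elim H \<pi> l) (\<lambda>j. codeword n A ord 1 v j c) (fst (\<pi> l))) \<le> 2 ^ l * \<tau>0"
            by (rule mvec_gauss_elim_bound[OF cp po small[OF e(3)]]) (use e fl in simp_all)
          also have "\<dots> \<le> 2 ^ n * \<tau>0" using \<tau>0 e by (intro mult_right_mono power_increasing) auto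
          finally show ?thesis
            unfolding z_def pivot_coord_def \<tau>_def e by (simp add: norm_divide divide_right_mono)
        qed
        moreover have "t q - t' q = (\<Sum>a\<in>I \<union> I2. D q a * z a)" if q: "q \<in> {K..<\<kappa>}" for q
        proof -
          have qk: "q < n * n" using q unfolding \<kappa>_def by simp
          have "t q - t' q = v q" using v q by simp
          also have "\<dots> = (\<Sum>e\<in>{..<n} \<times> {..<n}. D0 q e * codeword n A ord 1 v (fst e) (snd e))"
            by (rule D0u[OF qk])
          also have "\<dots> = (\<Sum>j<n. \<Sum>c<n. D0 q (j, c) * codeword n A ord 1 v j c)"
            by (simp add: sum.cartesian_product case_prod_beta)
          also have "\<dots> = (\<Sum>j<n. \<Sum>c<n. \<Sum>l<n. D0 q (j, c) * E j l * z (l, c))"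
          proof (intro sum.cong refl)
            fix j c assume "j \<in> {..<n}" "c \<in> {..<n}"
            then have "codeword n A ord 1 v j c = (\<Sum>l<n. E j l * z (l, c))"
              using E[of j "\<lambda>j. codeword n A ord 1 v j c"] by (simp add: z_def)
            then show "D0 q (j, c) * codeword n A ord 1 v j c = (\<Sum>l<n. D0 q (j, c) * E j l * z (l, c))"
              by (simp add: sum_distrib_left mult.assoc)
          qed
          also have "\<dots> = (\<Sum>j<n. \<Sum>l<n. \<Sum>c<n. D0 q (j, c) * E j l * z (l, c))"
            by (intro sum.cong refl sum.swap)
          also have "\<dots> = (\<Sum>l<n. \<Sum>j<n. \<Sum>c<n. D0 q (j, c) * E j l * z (l, c))"
            by (rule sum.swap)
          also have "\<dots> = (\<Sum>l<n. \<Sum>c<n. \<Sum>j<n. D0 q (j, c) * E j l * z (l, c))"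
            by (intro sum.cong refl sum.swap)
          also have "\<dots> = (\<Sum>l<n. \<Sum>c<n. D q (l, c) * z (l, c))"
            unfolding D_def by (simp add: sum_distrib_right)
          finally show ?thesis unfolding un by (simp add: sum.cartesian_product case_prod_beta)
        qed
        ultimately show ?thesis by (intro exI[of _ z]) blast
      qed
      have "finite S \<and> real (card S) \<le> real (card (QAM eta)) ^ card I2 *
         (\<Prod>a\<in>I. (2 * (2 * (2 ^ card I2 * C1) * card I + 1) * (1 + (\<tau> \<circ> fst) a))\<^sup>2)"
      proof (rule card_lattice_image_clipped_le[OF fin un(2), of "{K..<\<kappa>}" "QAM eta" C1 D S])
        show "u j \<in> QAM eta" if "u \<in> S" "j \<in> {K..<\<kappa>}" for u j
          using that unfolding S_def level_set_def by auto
        show "u j = 0" if "u \<in> S" "j \<notin> {K..<\<kappa>}" for u j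
          using that unfolding S_def level_set_def by auto
        show "gauss_int (u j)" if "u \<in> S" for u j
        proof (cases "j \<in> {K..<\<kappa>}")
          case True
          then show ?thesis using that unfolding S_def level_set_def by (auto intro: QAM_gauss_int)
        next
          case False
          then have "u j = 0" using that unfolding S_def level_set_def by auto
          then show ?thesis by (simp add: gauss_int_def)
        qed
        show "cmod (D j a) \<le> C1" if "j \<in> {K..<\<kappa>}" "a \<in> I \<union> I2" for j a
          using Db[of j a] that unfolding \<kappa>_def by simp
        show "0 \<le> (\<tau> \<circ> fst) a" for a using \<tau>_nn by simp
      qed (use K C1 finite_QAM rep in auto)
      then have "real (card S) \<le> real (card (QAM eta)) ^ card I2 *
         (\<Prod>a\<in>I. (2 * (2 * (2 ^ card I2 * C1) * card I + 1) * (1 + (\<tau> \<circ> fst) a))\<^sup>2)" by simp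
      also have "\<dots> \<le> real (card (QAM eta)) ^ card I2 *
         (\<Prod>a\<in>I. (N0 * (1 + sqrt xi2 / (\<bar>\<theta>\<bar> * cmod (pivot H \<pi> (fst a)))))\<^sup>2)"
      proof (intro mult_left_mono prod_mono conjI power_mono zero_le_power2)
        fix a
        define x where "x = sqrt xi2 / (\<bar>\<theta>\<bar> * cmod (pivot H \<pi> (fst a)))"
        have x: "0 \<le> x" unfolding x_def using xi by simp
        have "2 * (2 * (2 ^ card I2 * C1) * card I + 1) \<le> N1"
          unfolding N1_def using C1 cI of_nat_mono[OF cI(1), where 'a = real]
          by (intro mult_left_mono add_mono mult_mono power_increasing) auto
        moreover have "1 + (\<tau> \<circ> fst) a \<le> (1 + 2 ^ n * 2) * (1 + x)"
        proof -
          have "(\<tau> \<circ> fst) a = (2 ^ n * 2) * x" unfolding \<tau>_def \<tau>0_def x_def by simp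
          then show ?thesis using x by (simp only: distrib_left distrib_right) simp
        qed
        ultimately have "2 * (2 * (2 ^ card I2 * C1) * card I + 1) * (1 + (\<tau> \<circ> fst) a) \<le> N1 * ((1 + 2 ^ n * 2) * (1 + x))"
          using N1 \<tau>_nn by (intro mult_mono) auto
        then show "2 * (2 * (2 ^ card I2 * C1) * card I + 1) * (1 + (\<tau> \<circ> fst) a)
           \<le> N0 * (1 + sqrt xi2 / (\<bar>\<theta>\<bar> * cmod (pivot H \<pi> (fst a))))"
          unfolding N0_def x_def by (simp add: mult.assoc)
        show "0 \<le> 2 * (2 * (2 ^ card I2 * C1) * card I + 1) * (1 + (\<tau> \<circ> fst) a)"
          using C1 \<tau>_nn by (intro mult_nonneg_nonneg add_nonneg_nonneg) auto
      qed auto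
      also have "(\<Prod>a\<in>I. (N0 * (1 + sqrt xi2 / (\<bar>\<theta>\<bar> * cmod (pivot H \<pi> (fst a)))))\<^sup>2)
         = (\<Prod>l\<in>{..<n} - L. (N0 * (1 + sqrt xi2 / (\<bar>\<theta>\<bar> * cmod (pivot H \<pi> l))))\<^sup>2) ^ n"
        unfolding I_def by (rule prod_fst_Times)
      also have "real (card (QAM eta)) ^ card I2 = (\<Prod>l\<in>L. real (card (QAM eta))) ^ n"
        unfolding I2_def by (simp add: card_cartesian_product power_mult)
      also have "(\<Prod>l\<in>L. real (card (QAM eta))) ^ n * (\<Prod>l\<in>{..<n} - L. (N0 * (1 + sqrt xi2 / (\<bar>\<theta>\<bar> * cmod (pivot H \<pi> l))))\<^sup>2) ^ n
        = (\<Prod>l<n. if l \<in> L then real (card (QAM eta)) else (N0 * (1 + sqrt xi2 / (\<bar>\<theta>\<bar> * cmod (pivot H \<pi> l))))\<^sup>2) ^ n"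
      proof -
        have "{..<n} \<inter> {l. l \<in> L} = L" "{..<n} \<inter> - {l. l \<in> L} = {..<n} - L" using L by auto
        then show ?thesis by (simp add: prod.If_cases power_mult_distrib)
      qed
      finally show ?thesis unfolding S_def .
    qed
    have "real (sd_count n nr A ord \<theta> eta xi2 H W s) = real (qr_count m \<kappa> Q R y eta xi2)"
      unfolding m_def \<kappa>_def y_def
      by (subst sd_count_eq_qr_count[OF inj \<theta> QR[unfolded m_def \<kappa>_def M_def]]) simp
    also have "\<dots> \<le> (\<Sum>k = 1..\<kappa>. (\<Prod>l<n. if l \<in> L then real (card (QAM eta)) else (N0 * (1 + sqrt xi2 / (\<bar>\<theta>\<bar> * cmod (pivot H \<pi> l))))\<^sup>2) ^ n)"
      unfolding qr_count_def of_nat_sum by (intro sum_mono lev) auto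
    finally show "real (sd_count n nr A ord \<theta> eta xi2 H W s) \<le> real (n * n) *
         (\<Prod>l<n. if l \<in> L then real (card (QAM eta)) else (N0 * (1 + sqrt xi2 / (\<bar>\<theta>\<bar> * cmod (pivot H \<pi> l))))\<^sup>2) ^ n"
      unfolding \<kappa>_def by simp
  qed
qed

end

section \<open>Gaussian matrices under elimination\<close>

lemma sets_cgauss [measurable_cong, simp]: "sets cgauss = sets borel"
  and space_cgauss [simp]: "space cgauss = UNIV"
  unfolding cgauss_def by auto

lemma measurable_Complex: "(\<lambda>(a, b). Complex a b) \<in> borel_measurable (borel \<Otimes>\<^sub>M borel)"
proof -
  have "(\<lambda>(a, b). Complex a b) = (\<lambda>p. complex_of_real (fst p) + \<i> * complex_of_real (snd p))"
    by (auto simp: complex_eq_iff)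
  then show ?thesis by simp
qed

abbreviation half_normal :: "real measure" where
  "half_normal \<equiv> density lborel (normal_density 0 (sqrt (1/2)))"

lemma prob_space_half_normal: "prob_space half_normal"
  by (rule prob_space_normal_density) simp

lemma emeasure_cgauss:
  assumes "X \<in> sets borel"
  shows "emeasure cgauss X = emeasure (half_normal \<Otimes>\<^sub>M half_normal) {p. Complex (fst p) (snd p) \<in> X}"
proof -
  have "(\<lambda>(a, b). Complex a b) \<in> measurable (half_normal \<Otimes>\<^sub>M half_normal) borel"
    using measurable_Complex by (simp cong: measurable_cong_sets)
  then show ?thesis
    unfolding cgauss_def using assms
    by (subst emeasure_distr) (auto simp: space_pair_measure vimage_def case_prod_beta)
qed

lemma prob_space_cgauss: "prob_space cgauss"
proof -
  interpret H: prob_space half_normal by (rule prob_space_half_normal)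
  interpret P: pair_prob_space half_normal half_normal ..
  show ?thesis
    unfolding cgauss_def
    by (rule P.prob_space_distr) (use measurable_Complex in \<open>simp cong: measurable_cong_sets\<close>)
qed

lemma half_normal_density: "normal_density 0 (sqrt (1/2)) x = exp (- x\<^sup>2) / sqrt pi"
  by (simp add: normal_density_def)

text \<open>Real and imaginary parts have variance 1/2, so their density is at most
  \<open>1 / sqrt pi < 1\<close>.\<close>

lemma half_normal_interval_le:
  assumes "0 \<le> \<delta>"
  shows "emeasure half_normal {c - \<delta>..c + \<delta>} \<le> ennreal (2 * \<delta>)"
proof -
  have "normal_density 0 (sqrt (1/2)) x \<le> 1" for x
  proof -
    have "exp (- x\<^sup>2) \<le> 1" by simp
    moreover have "1 \<le> sqrt pi" using pi_gt3 by simp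
    ultimately have "exp (- x\<^sup>2) \<le> sqrt pi" by (rule order.trans)
    then show ?thesis unfolding half_normal_density by (simp add: divide_le_eq pi_gt_zero)
  qed
  then have "emeasure half_normal {c - \<delta>..c + \<delta>} \<le> (\<integral>\<^sup>+x. 1 * indicator {c - \<delta>..c + \<delta>} x \<partial>lborel)"
  proof (subst emeasure_density)
    show "(\<integral>\<^sup>+x. ennreal (normal_density 0 (sqrt (1/2)) x) * indicator {c - \<delta>..c + \<delta>} x \<partial>lborel)
       \<le> (\<integral>\<^sup>+x. 1 * indicator {c - \<delta>..c + \<delta>} x \<partial>lborel)"
      using ennreal_leI[OF \<open>\<And>x. normal_density 0 (sqrt (1/2)) x \<le> 1\<close>]
      by (intro nn_integral_mono mult_right_mono) auto
  qed auto
  also have "\<dots> = ennreal (2 * \<delta>)" using assms by simp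
  finally show ?thesis .
qed

lemma half_normal_interval_ge:
  assumes "0 \<le> \<delta>" "\<delta> \<le> 1" "\<bar>c\<bar> \<le> G"
  shows "ennreal (exp (- (G + 1)\<^sup>2) / sqrt pi * (2 * \<delta>)) \<le> emeasure half_normal {c - \<delta>..c + \<delta>}"
proof -
  have *: "exp (- (G + 1)\<^sup>2) / sqrt pi \<le> normal_density 0 (sqrt (1/2)) x" if "x \<in> {c - \<delta>..c + \<delta>}" for x
  proof -
    have "\<bar>x\<bar> \<le> G + 1" using that assms by auto
    then have "x\<^sup>2 \<le> (G + 1)\<^sup>2" by (metis abs_ge_zero order.trans power2_abs power_mono)
    then show ?thesis unfolding half_normal_density by (auto intro!: divide_right_mono)
  qed
  have "ennreal (exp (- (G + 1)\<^sup>2) / sqrt pi * (2 * \<delta>))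
     = (\<integral>\<^sup>+x. ennreal (exp (- (G + 1)\<^sup>2) / sqrt pi) * indicator {c - \<delta>..c + \<delta>} x \<partial>lborel)"
    using assms by (subst nn_integral_cmult_indicator) (auto simp: ennreal_mult[symmetric])
  also have "\<dots> \<le> emeasure half_normal {c - \<delta>..c + \<delta>}"
  proof (subst emeasure_density)
    show "(\<integral>\<^sup>+x. ennreal (exp (- (G + 1)\<^sup>2) / sqrt pi) * indicator {c - \<delta>..c + \<delta>} x \<partial>lborel)
       \<le> (\<integral>\<^sup>+x. ennreal (normal_density 0 (sqrt (1/2)) x) * indicator {c - \<delta>..c + \<delta>} x \<partial>lborel)"
    proof (rule nn_integral_mono)
      fix x
      show "ennreal (exp (- (G + 1)\<^sup>2) / sqrt pi) * indicator {c - \<delta>..c + \<delta>} x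
        \<le> ennreal (normal_density 0 (sqrt (1/2)) x) * indicator {c - \<delta>..c + \<delta>} x"
        using ennreal_leI[OF *, of x] by (cases "x \<in> {c - \<delta>..c + \<delta>}") auto
    qed
  qed auto
  finally show ?thesis .
qed

text \<open>The disc lies in a square of side \<open>2 * \<delta>\<close>; the bound is uniform in
  the centre, so translations are harmless.\<close>

lemma cgauss_cball_le:
  assumes "0 \<le> \<delta>"
  shows "emeasure cgauss (cball c \<delta>) \<le> ennreal (4 * \<delta>\<^sup>2)"
proof -
  interpret H: prob_space half_normal by (rule prob_space_half_normal)
  have "{p. Complex (fst p) (snd p) \<in> cball c \<delta>} \<subseteq> {Re c - \<delta>..Re c + \<delta>} \<times> {Im c - \<delta>..Im c + \<delta>}"
  proof
    fix p assume "p \<in> {p. Complex (fst p) (snd p) \<in> cball c \<delta>}"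
    then have "cmod (c - Complex (fst p) (snd p)) \<le> \<delta>" by (simp add: dist_norm)
    then have "\<bar>Re c - fst p\<bar> \<le> \<delta>" "\<bar>Im c - snd p\<bar> \<le> \<delta>"
      using abs_Re_le_cmod[of "c - Complex (fst p) (snd p)"] abs_Im_le_cmod[of "c - Complex (fst p) (snd p)"] by auto
    then show "p \<in> {Re c - \<delta>..Re c + \<delta>} \<times> {Im c - \<delta>..Im c + \<delta>}" by (cases p) auto
  qed
  then have "emeasure cgauss (cball c \<delta>) \<le> emeasure (half_normal \<Otimes>\<^sub>M half_normal) ({Re c - \<delta>..Re c + \<delta>} \<times> {Im c - \<delta>..Im c + \<delta>})"
    by (subst emeasure_cgauss) (auto intro!: emeasure_mono)
  also have "\<dots> = emeasure half_normal {Re c - \<delta>..Re c + \<delta>} * emeasure half_normal {Im c - \<delta>..Im c + \<delta>}"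
    by (intro H.emeasure_pair_measure_Times) auto
  also have "\<dots> \<le> ennreal (2 * \<delta>) * ennreal (2 * \<delta>)"
    by (intro mult_mono half_normal_interval_le assms) auto
  also have "\<dots> = ennreal (4 * \<delta>\<^sup>2)"
    using assms by (simp add: ennreal_mult[symmetric] power2_eq_square)
  finally show ?thesis .
qed

text \<open>Square of the minimum of the one-dimensional density on the interval of radius
  \<open>G + 1\<close>.\<close>

definition gauss_lb :: "real \<Rightarrow> real" where
  "gauss_lb G = (exp (- (G + 1)\<^sup>2) / sqrt pi)\<^sup>2"

lemma gauss_lb_pos: "0 < gauss_lb G"
  unfolding gauss_lb_def by (simp add: pi_gt_zero)

text \<open>The disc contains the concentric square of side \<open>\<delta>\<close>, and
  \<open>\<delta> \<le> 1\<close> keeps its coordinates below \<open>G + 1\<close>. Unlike the upper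
  bound, this one requires control of the centre.\<close>

lemma cgauss_cball_ge:
  assumes "0 \<le> \<delta>" "\<delta> \<le> 1" "cmod c \<le> G"
  shows "ennreal (gauss_lb G * \<delta>\<^sup>2) \<le> emeasure cgauss (cball c \<delta>)"
proof -
  interpret H: prob_space half_normal by (rule prob_space_half_normal)
  define g where "g = exp (- (G + 1)\<^sup>2) / sqrt pi"
  have sub: "{Re c - \<delta>/2..Re c + \<delta>/2} \<times> {Im c - \<delta>/2..Im c + \<delta>/2} \<subseteq> {p. Complex (fst p) (snd p) \<in> cball c \<delta>}"
  proof
    fix p assume "p \<in> {Re c - \<delta>/2..Re c + \<delta>/2} \<times> {Im c - \<delta>/2..Im c + \<delta>/2}"
    then have "Re c - \<delta>/2 \<le> fst p" "fst p \<le> Re c + \<delta>/2" "Im c - \<delta>/2 \<le> snd p" "snd p \<le> Im c + \<delta>/2"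
      by (simp_all add: mem_Times_iff)
    then have "\<bar>Re c - fst p\<bar> \<le> \<delta>/2" "\<bar>Im c - snd p\<bar> \<le> \<delta>/2" by linarith+
    then show "p \<in> {p. Complex (fst p) (snd p) \<in> cball c \<delta>}"
      using cmod_le[of "c - Complex (fst p) (snd p)"] by (simp add: dist_norm)
  qed
  have m: "(\<lambda>(a, b). Complex a b) \<in> measurable (half_normal \<Otimes>\<^sub>M half_normal) borel"
    using measurable_Complex by (simp cong: measurable_cong_sets)
  have "ennreal (gauss_lb G * \<delta>\<^sup>2) = ennreal (g * (2 * (\<delta>/2))) * ennreal (g * (2 * (\<delta>/2)))"
    unfolding gauss_lb_def g_def using assms by (simp add: ennreal_mult[symmetric] power2_eq_square)
  also have "\<dots> \<le> emeasure half_normal {Re c - \<delta>/2..Re c + \<delta>/2} * emeasure half_normal {Im c - \<delta>/2..Im c + \<delta>/2}"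
    unfolding g_def using assms abs_Re_le_cmod[of c] abs_Im_le_cmod[of c]
    by (intro mult_mono half_normal_interval_ge) auto
  also have "\<dots> = emeasure (half_normal \<Otimes>\<^sub>M half_normal) ({Re c - \<delta>/2..Re c + \<delta>/2} \<times> {Im c - \<delta>/2..Im c + \<delta>/2})"
    by (intro H.emeasure_pair_measure_Times[symmetric]) auto
  also have "\<dots> \<le> emeasure (half_normal \<Otimes>\<^sub>M half_normal) {p. Complex (fst p) (snd p) \<in> cball c \<delta>}"
  proof (rule emeasure_mono[OF sub])
    have "(\<lambda>(a, b). Complex a b) -` cball c \<delta> \<inter> space (half_normal \<Otimes>\<^sub>M half_normal) \<in> sets (half_normal \<Otimes>\<^sub>M half_normal)"
      by (rule measurable_sets[OF m]) simp
    then show "{p. Complex (fst p) (snd p) \<in> cball c \<delta>} \<in> sets (half_normal \<Otimes>\<^sub>M half_normal)"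
      by (simp add: space_pair_measure vimage_def case_prod_beta)
  qed
  finally show ?thesis by (subst emeasure_cgauss) auto
qed

section \<open>One elimination stage conditioned on the earlier ones\<close>

abbreviation gaussP :: "'i set \<Rightarrow> ('i \<Rightarrow> complex) measure" where
  "gaussP I \<equiv> PiM I (\<lambda>_. cgauss)"

lemma prob_space_gaussP: "prob_space (gaussP I)"
  by (rule prob_space_PiM) (rule prob_space_cgauss)

lemma prod_mono_ennreal:
  fixes f g :: "'a \<Rightarrow> ennreal"
  assumes "\<And>x. x \<in> A \<Longrightarrow> f x \<le> g x"
  shows "prod f A \<le> prod g A"
  using assms by (induction A rule: infinite_finite_induct) (auto intro!: mult_mono)

definition stage_event :: "'i set \<Rightarrow> 'i set \<Rightarrow> ('i \<Rightarrow> complex) set \<Rightarrow> ('i \<Rightarrow> ('i \<Rightarrow> complex) \<Rightarrow> complex) \<Rightarrow> ('i \<Rightarrow> complex) \<Rightarrow> ('i \<Rightarrow> real) \<Rightarrow> ('i \<Rightarrow> complex) set" where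
  "stage_event I J E k ctr \<delta> = {h \<in> space (gaussP (I \<union> J)). restrict h I \<in> E \<and>
      (\<forall>j\<in>J. cmod (h j + k j (restrict h I) - ctr j) \<le> \<delta> j)}"

text \<open>Fubini: given the coordinates in \<open>I\<close>, those in \<open>J\<close> are
  independent, and the condition at \<open>j\<close> is membership in a disc shifted by
  \<open>k j x\<close>.\<close>

lemma stage_event:
  fixes I J :: "'i set"
  assumes fin: "finite I" "finite J" and disj: "I \<inter> J = {}" and E: "E \<in> sets (gaussP I)"
    and k: "\<And>j. j \<in> J \<Longrightarrow> k j \<in> borel_measurable (gaussP I)"
  shows "stage_event I J E k ctr \<delta> \<in> sets (gaussP (I \<union> J))"
    and "emeasure (gaussP (I \<union> J)) (stage_event I J E k ctr \<delta>) =
      (\<integral>\<^sup>+x. indicator E x * (\<Prod>j\<in>J. emeasure cgauss (cball (ctr j - k j x) (\<delta> j))) \<partial>gaussP I)"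
proof -
  interpret C: prob_space cgauss by (rule prob_space_cgauss)
  interpret product_sigma_finite "\<lambda>_::'i. cgauss" by standard
  have restr: "(\<lambda>h. restrict h I) \<in> measurable (gaussP (I \<union> J)) (gaussP I)"
    by (rule measurable_restrict_subset) auto
  show B: "stage_event I J E k ctr \<delta> \<in> sets (gaussP (I \<union> J))"
  proof -
    have "(\<lambda>h. cmod (h j + k j (restrict h I) - ctr j)) \<in> borel_measurable (gaussP (I \<union> J))" if j: "j \<in> J" for j
    proof -
      have "(\<lambda>h. h j) \<in> borel_measurable (gaussP (I \<union> J))"
        using j measurable_component_singleton[of j "I \<union> J" "\<lambda>_. cgauss"] by (simp cong: measurable_cong_sets)
      moreover have "(\<lambda>h. k j (restrict h I)) \<in> borel_measurable (gaussP (I \<union> J))"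
        by (rule measurable_compose[OF restr k[OF j]])
      ultimately show ?thesis by measurable
    qed
    then have "{h \<in> space (gaussP (I \<union> J)). \<forall>j\<in>J. cmod (h j + k j (restrict h I) - ctr j) \<le> \<delta> j} \<in> sets (gaussP (I \<union> J))"
      using fin(2) by (intro sets.sets_Collect_finite_All borel_measurable_le) auto
    moreover have "{h \<in> space (gaussP (I \<union> J)). restrict h I \<in> E} \<in> sets (gaussP (I \<union> J))"
      using measurable_sets[OF restr E] by (simp add: vimage_def Int_def conj_commute)
    ultimately have "{h \<in> space (gaussP (I \<union> J)). restrict h I \<in> E} \<inter> {h \<in> space (gaussP (I \<union> J)). \<forall>j\<in>J. cmod (h j + k j (restrict h I) - ctr j) \<le> \<delta> j} \<in> sets (gaussP (I \<union> J))"
      by (rule sets.Int[rotated])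
    moreover have "stage_event I J E k ctr \<delta> = {h \<in> space (gaussP (I \<union> J)). restrict h I \<in> E} \<inter> {h \<in> space (gaussP (I \<union> J)). \<forall>j\<in>J. cmod (h j + k j (restrict h I) - ctr j) \<le> \<delta> j}"
      unfolding stage_event_def by auto
    ultimately show ?thesis by simp
  qed
  have "emeasure (gaussP (I \<union> J)) (stage_event I J E k ctr \<delta>) = (\<integral>\<^sup>+h. indicator (stage_event I J E k ctr \<delta>) h \<partial>gaussP (I \<union> J))"
    using B by simp
  also have "\<dots> = (\<integral>\<^sup>+x. (\<integral>\<^sup>+y. indicator (stage_event I J E k ctr \<delta>) (merge I J (x, y)) \<partial>gaussP J) \<partial>gaussP I)"
    using B by (intro product_nn_integral_fold[OF disj fin]) simp
  also have "\<dots> = (\<integral>\<^sup>+x. indicator E x * (\<Prod>j\<in>J. emeasure cgauss (cball (ctr j - k j x) (\<delta> j))) \<partial>gaussP I)"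
  proof (rule nn_integral_cong)
    fix x assume x: "x \<in> space (gaussP I)"
    define P where "P = Pi\<^sub>E J (\<lambda>j. cball (ctr j - k j x) (\<delta> j))"
    have "(\<integral>\<^sup>+y. indicator (stage_event I J E k ctr \<delta>) (merge I J (x, y)) \<partial>gaussP J)
        = (\<integral>\<^sup>+y. indicator E x * indicator P y \<partial>gaussP J)"
    proof (rule nn_integral_cong)
      fix y assume y: "y \<in> space (gaussP J)"
      have ext: "x \<in> extensional I" "y \<in> extensional J"
        using x y by (auto simp: space_PiM PiE_def)
      have r: "restrict (merge I J (x, y)) I = x"
        using ext(1) by (auto simp: restrict_def merge_def extensional_def fun_eq_iff)
      have mj: "merge I J (x, y) j = y j" if "j \<in> J" for j
        using that disj by (auto simp: merge_def)
      have sp: "merge I J (x, y) \<in> space (gaussP (I \<union> J))"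
        by (auto simp: space_PiM PiE_def extensional_def merge_def)
      have "cmod (y j + k j x - ctr j) \<le> \<delta> j \<longleftrightarrow> y j \<in> cball (ctr j - k j x) (\<delta> j)" for j
        by (simp add: dist_norm norm_minus_commute[of "y j + k j x" "ctr j"] algebra_simps)
      then have "merge I J (x, y) \<in> stage_event I J E k ctr \<delta> \<longleftrightarrow> x \<in> E \<and> y \<in> P"
        unfolding stage_event_def P_def using sp mj ext(2) by (auto simp: PiE_def r)
      then show "indicator (stage_event I J E k ctr \<delta>) (merge I J (x, y)) = indicator E x * (indicator P y :: ennreal)"
        by (auto simp: indicator_def)
    qed
    also have "\<dots> = indicator E x * emeasure (gaussP J) P"
      unfolding P_def using fin(2) by (subst nn_integral_cmult) (auto intro!: sets_PiM_I_finite)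
    also have "emeasure (gaussP J) P = (\<Prod>j\<in>J. emeasure cgauss (cball (ctr j - k j x) (\<delta> j)))"
      unfolding P_def using fin(2) by (intro emeasure_PiM) auto
    finally show "(\<integral>\<^sup>+y. indicator (stage_event I J E k ctr \<delta>) (merge I J (x, y)) \<partial>gaussP J)
       = indicator E x * (\<Prod>j\<in>J. emeasure cgauss (cball (ctr j - k j x) (\<delta> j)))" .
  qed
  finally show "emeasure (gaussP (I \<union> J)) (stage_event I J E k ctr \<delta>) =
      (\<integral>\<^sup>+x. indicator E x * (\<Prod>j\<in>J. emeasure cgauss (cball (ctr j - k j x) (\<delta> j))) \<partial>gaussP I)" .
qed

text \<open>The disc bound does not see the shift, so each new coordinate contributes a factor
  \<open>4 * (\<delta> j)\<^sup>2\<close> whatever happened before.\<close>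

lemma stage_event_le:
  fixes I J :: "'i set"
  assumes "finite I" "finite J" "I \<inter> J = {}" "E \<in> sets (gaussP I)"
    and "\<And>j. j \<in> J \<Longrightarrow> k j \<in> borel_measurable (gaussP I)" and \<delta>: "\<And>j. j \<in> J \<Longrightarrow> 0 \<le> \<delta> j"
  shows "emeasure (gaussP (I \<union> J)) (stage_event I J E k ctr \<delta>) \<le> emeasure (gaussP I) E * ennreal (\<Prod>j\<in>J. 4 * (\<delta> j)\<^sup>2)"
proof -
  have "(\<integral>\<^sup>+x. indicator E x * (\<Prod>j\<in>J. emeasure cgauss (cball (ctr j - k j x) (\<delta> j))) \<partial>gaussP I)
     \<le> (\<integral>\<^sup>+x. indicator E x * ennreal (\<Prod>j\<in>J. 4 * (\<delta> j)\<^sup>2) \<partial>gaussP I)"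
  proof (intro nn_integral_mono mult_left_mono)
    fix x
    have "(\<Prod>j\<in>J. emeasure cgauss (cball (ctr j - k j x) (\<delta> j))) \<le> (\<Prod>j\<in>J. ennreal (4 * (\<delta> j)\<^sup>2))"
      by (intro prod_mono_ennreal cgauss_cball_le \<delta>)
    also have "\<dots> = ennreal (\<Prod>j\<in>J. 4 * (\<delta> j)\<^sup>2)" by (rule prod_ennreal) simp
    finally show "(\<Prod>j\<in>J. emeasure cgauss (cball (ctr j - k j x) (\<delta> j))) \<le> ennreal (\<Prod>j\<in>J. 4 * (\<delta> j)\<^sup>2)" .
  qed auto
  also have "\<dots> = emeasure (gaussP I) E * ennreal (\<Prod>j\<in>J. 4 * (\<delta> j)\<^sup>2)"
    using assms(4) by (subst nn_integral_multc) auto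
  finally show ?thesis using stage_event(2)[OF assms(1-5)] by simp
qed

text \<open>For a lower bound the shifted centres must stay in a fixed disc, but only on the event
  \<open>E\<close> already secured.\<close>

lemma stage_event_ge:
  fixes I J :: "'i set"
  assumes "finite I" "finite J" "I \<inter> J = {}" "E \<in> sets (gaussP I)"
    and "\<And>j. j \<in> J \<Longrightarrow> k j \<in> borel_measurable (gaussP I)" and \<delta>: "\<And>j. j \<in> J \<Longrightarrow> 0 \<le> \<delta> j" "\<And>j. j \<in> J \<Longrightarrow> \<delta> j \<le> 1"
    and G: "\<And>j x. j \<in> J \<Longrightarrow> x \<in> E \<Longrightarrow> cmod (ctr j - k j x) \<le> G"
  shows "emeasure (gaussP I) E * ennreal (\<Prod>j\<in>J. gauss_lb G * (\<delta> j)\<^sup>2) \<le> emeasure (gaussP (I \<union> J)) (stage_event I J E k ctr \<delta>)"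
proof -
  have "emeasure (gaussP I) E * ennreal (\<Prod>j\<in>J. gauss_lb G * (\<delta> j)\<^sup>2) = (\<integral>\<^sup>+x. indicator E x * ennreal (\<Prod>j\<in>J. gauss_lb G * (\<delta> j)\<^sup>2) \<partial>gaussP I)"
    using assms(4) by (subst nn_integral_multc) auto
  also have "\<dots> \<le> (\<integral>\<^sup>+x. indicator E x * (\<Prod>j\<in>J. emeasure cgauss (cball (ctr j - k j x) (\<delta> j))) \<partial>gaussP I)"
  proof (intro nn_integral_mono)
    fix x
    show "indicator E x * ennreal (\<Prod>j\<in>J. gauss_lb G * (\<delta> j)\<^sup>2) \<le> indicator E x * (\<Prod>j\<in>J. emeasure cgauss (cball (ctr j - k j x) (\<delta> j)))"
    proof (cases "x \<in> E")
      case True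
      have "ennreal (\<Prod>j\<in>J. gauss_lb G * (\<delta> j)\<^sup>2) = (\<Prod>j\<in>J. ennreal (gauss_lb G * (\<delta> j)\<^sup>2))"
        using gauss_lb_pos[of G] by (intro prod_ennreal[symmetric]) simp
      also have "\<dots> \<le> (\<Prod>j\<in>J. emeasure cgauss (cball (ctr j - k j x) (\<delta> j)))"
        using True by (intro prod_mono_ennreal cgauss_cball_ge \<delta> G)
      finally show ?thesis by (intro mult_left_mono) auto
    qed simp
  qed
  finally show ?thesis using stage_event(2)[OF assms(1-5)] by simp
qed

lemma restrict_event_emeasure:
  fixes I J :: "'i set"
  assumes "finite I" "finite J" "I \<inter> J = {}" "E \<in> sets (gaussP I)"
  shows "{h \<in> space (gaussP (I \<union> J)). restrict h I \<in> E} \<in> sets (gaussP (I \<union> J))"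
    "emeasure (gaussP (I \<union> J)) {h \<in> space (gaussP (I \<union> J)). restrict h I \<in> E} = emeasure (gaussP I) E"
proof -
  interpret C: prob_space cgauss by (rule prob_space_cgauss)
  interpret product_prob_space "\<lambda>_::'i. cgauss" by standard
  have restr: "(\<lambda>h. restrict h I) \<in> measurable (gaussP (I \<union> J)) (gaussP I)"
    by (rule measurable_restrict_subset) auto
  have eq: "{h \<in> space (gaussP (I \<union> J)). restrict h I \<in> E} = (\<lambda>h. restrict h I) -` E \<inter> space (gaussP (I \<union> J))" by auto
  show "{h \<in> space (gaussP (I \<union> J)). restrict h I \<in> E} \<in> sets (gaussP (I \<union> J))"
    unfolding eq by (rule measurable_sets[OF restr assms(4)])
  have "gaussP I = distr (gaussP (I \<union> J)) (gaussP I) (\<lambda>h. restrict h I)"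
    by (rule distr_restrict) (use assms in auto)
  then have "emeasure (gaussP I) E = emeasure (distr (gaussP (I \<union> J)) (gaussP I) (\<lambda>h. restrict h I)) E" by simp
  also have "\<dots> = emeasure (gaussP (I \<union> J)) {h \<in> space (gaussP (I \<union> J)). restrict h I \<in> E}"
    unfolding eq by (rule emeasure_distr[OF restr assms(4)])
  finally show "emeasure (gaussP (I \<union> J)) {h \<in> space (gaussP (I \<union> J)). restrict h I \<in> E} = emeasure (gaussP I) E" by simp
qed

section \<open>Elimination of a Gaussian matrix, stage by stage\<close>

definition ibox :: "nat \<Rightarrow> nat \<Rightarrow> (nat \<Rightarrow> nat \<times> nat) \<Rightarrow> nat \<Rightarrow> (nat \<times> nat) set" where
  "ibox nr n \<pi> l = ({..<nr} \<times> {..<n}) \<inter> cross \<pi> l"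

text \<open>Turns the entries seen so far into a total matrix. By locality of elimination, an unseen
  entry enters its own eliminated value only additively, so padding it by 0 isolates the
  translation.\<close>

definition ext0 :: "(nat \<times> nat) set \<Rightarrow> (nat \<times> nat \<Rightarrow> complex) \<Rightarrow> cmat" where
  "ext0 I h = (\<lambda>a b. if (a, b) \<in> I then h (a, b) else 0)"

lemma ibox_mono: "l \<le> l' \<Longrightarrow> ibox nr n \<pi> l \<subseteq> ibox nr n \<pi> l'"
  unfolding ibox_def cross_def using order.strict_trans2 by blast

lemma finite_ibox: "finite (ibox nr n \<pi> l)"
  unfolding ibox_def by auto

lemma gauss_elim_measurable:
  assumes "\<And>a b. (\<lambda>w. H w a b) \<in> borel_measurable M"
  shows "(\<lambda>w. gauss_elim (H w) \<pi> l a b) \<in> borel_measurable M"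
proof (induction l arbitrary: a b)
  case 0
  then show ?case using assms by simp
next
  case (Suc l)
  then show ?case unfolding gauss_elim.simps schur_def by (intro borel_measurable_diff borel_measurable_divide borel_measurable_times)
qed

lemma ext0_measurable: "(\<lambda>h. ext0 I h a b) \<in> borel_measurable (gaussP I)"
proof (cases "(a, b) \<in> I")
  case True
  then show ?thesis
    using measurable_component_singleton[of "(a, b)" I "\<lambda>_. cgauss"]
    by (simp add: ext0_def cong: measurable_cong_sets)
qed (simp add: ext0_def)

lemma gauss_elim_ext0:
  assumes "ibox nr n \<pi> l \<subseteq> I" "ibox nr n \<pi> l \<subseteq> I'" "\<And>e. e \<in> ibox nr n \<pi> l \<Longrightarrow> h e = h' e"
    and "\<And>l'. l' < l \<Longrightarrow> fst (\<pi> l') < nr \<and> snd (\<pi> l') < n" "a < nr" "b < n"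
  shows "gauss_elim (ext0 I h) \<pi> l a b - ext0 I h a b = gauss_elim (ext0 I' h') \<pi> l a b - ext0 I' h' a b"
proof (rule gauss_elim_local[where R = "{..<nr}" and C = "{..<n}"])
  fix a b assume "a \<in> {..<nr}" "b \<in> {..<n}" "(a, b) \<in> cross \<pi> l"
  then have "(a, b) \<in> ibox nr n \<pi> l" by (simp add: ibox_def)
  then show "ext0 I h a b = ext0 I' h' a b" using assms(1-3) by (auto simp: ext0_def)
qed (use assms in auto)

text \<open>\<open>act\<close> selects the stages with a constraint. The upper estimate takes
  centres 0; the lower estimate prescribes the centres \<open>lb_ctr\<close>.\<close>

definition elim_event :: "nat \<Rightarrow> nat \<Rightarrow> (nat \<Rightarrow> nat \<times> nat) \<Rightarrow> (nat \<Rightarrow> bool) \<Rightarrow> (nat \<Rightarrow> nat \<times> nat \<Rightarrow> complex) \<Rightarrow> (nat \<Rightarrow> real) \<Rightarrow> nat \<Rightarrow> (nat \<times> nat \<Rightarrow> complex) set" where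
  "elim_event nr n \<pi> act ctr \<delta> L = {h \<in> space (gaussP (ibox nr n \<pi> L)). \<forall>l<L. act l \<longrightarrow>
     (\<forall>e\<in>ibox nr n \<pi> (Suc l) - ibox nr n \<pi> l. cmod (gauss_elim (ext0 (ibox nr n \<pi> L) h) \<pi> l (fst e) (snd e) - ctr l e) \<le> \<delta> l)}"

text \<open>Brings the event into the form to which the one-stage estimates apply: the constraints
  of earlier stages see only old entries, and the new ones see their own entry plus a function of
  the old ones.\<close>

lemma elim_event_Suc:
  assumes po: "\<pi> \<in> pivot_orders nr n" and L: "L < n"
  defines "I \<equiv> ibox nr n \<pi> L" and "J \<equiv> ibox nr n \<pi> (Suc L) - ibox nr n \<pi> L"
  shows "elim_event nr n \<pi> act ctr \<delta> (Suc L) = (if act L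
      then stage_event I J (elim_event nr n \<pi> act ctr \<delta> L) (\<lambda>e x. gauss_elim (ext0 I x) \<pi> L (fst e) (snd e)) (ctr L) (\<lambda>_. \<delta> L)
      else {h \<in> space (gaussP (I \<union> J)). restrict h I \<in> elim_event nr n \<pi> act ctr \<delta> L})"
proof -
  have IJ: "I \<union> J = ibox nr n \<pi> (Suc L)"
    unfolding I_def J_def using ibox_mono[of L "Suc L" nr n \<pi>] by auto
  have inb: "\<And>l'. l' < n \<Longrightarrow> fst (\<pi> l') < nr \<and> snd (\<pi> l') < n" using po unfolding pivot_orders_def by auto
  have "h \<in> elim_event nr n \<pi> act ctr \<delta> (Suc L) \<longleftrightarrow> restrict h I \<in> elim_event nr n \<pi> act ctr \<delta> L \<and>
     (act L \<longrightarrow> (\<forall>e\<in>J. cmod (h e + gauss_elim (ext0 I (restrict h I)) \<pi> L (fst e) (snd e) - ctr L e) \<le> \<delta> L))"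
    if h: "h \<in> space (gaussP (I \<union> J))" for h
  proof -
    have sp: "restrict h I \<in> space (gaussP I)" by (auto simp: space_PiM)
    have old: "gauss_elim (ext0 (ibox nr n \<pi> (Suc L)) h) \<pi> l (fst e) (snd e)
        = gauss_elim (ext0 I (restrict h I)) \<pi> l (fst e) (snd e)"
      if l: "l < L" and e: "e \<in> ibox nr n \<pi> (Suc l) - ibox nr n \<pi> l" for l e
    proof -
      have eI: "e \<in> I" "e \<in> ibox nr n \<pi> (Suc L)"
        using e ibox_mono[of "Suc l" L nr n \<pi>] ibox_mono[of "Suc l" "Suc L" nr n \<pi>] l unfolding I_def by auto
      have "gauss_elim (ext0 (ibox nr n \<pi> (Suc L)) h) \<pi> l (fst e) (snd e) - ext0 (ibox nr n \<pi> (Suc L)) h (fst e) (snd e)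
         = gauss_elim (ext0 I (restrict h I)) \<pi> l (fst e) (snd e) - ext0 I (restrict h I) (fst e) (snd e)"
      proof (rule gauss_elim_ext0)
        show "ibox nr n \<pi> l \<subseteq> ibox nr n \<pi> (Suc L)" "ibox nr n \<pi> l \<subseteq> I"
          unfolding I_def using l by (auto intro!: ibox_mono)
        then show "\<And>e. e \<in> ibox nr n \<pi> l \<Longrightarrow> h e = restrict h I e" by auto
        show "\<And>l'. l' < l \<Longrightarrow> fst (\<pi> l') < nr \<and> snd (\<pi> l') < n" using inb l L by auto
        show "fst e < nr" "snd e < n" using e unfolding ibox_def by auto
      qed
      then show ?thesis using eI by (simp add: ext0_def)
    qed
    \<comment> \<open>A fresh entry is padded by 0 in the old matrix, so its eliminated value there
      is exactly the translation.\<close>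
    have new: "gauss_elim (ext0 (ibox nr n \<pi> (Suc L)) h) \<pi> L (fst e) (snd e)
        = h e + gauss_elim (ext0 I (restrict h I)) \<pi> L (fst e) (snd e)" if e: "e \<in> J" for e
    proof -
      have "gauss_elim (ext0 (ibox nr n \<pi> (Suc L)) h) \<pi> L (fst e) (snd e) - ext0 (ibox nr n \<pi> (Suc L)) h (fst e) (snd e)
         = gauss_elim (ext0 I (restrict h I)) \<pi> L (fst e) (snd e) - ext0 I (restrict h I) (fst e) (snd e)"
      proof (rule gauss_elim_ext0)
        show "ibox nr n \<pi> L \<subseteq> ibox nr n \<pi> (Suc L)" "ibox nr n \<pi> L \<subseteq> I"
          unfolding I_def by (auto intro!: ibox_mono)
        then show "\<And>e. e \<in> ibox nr n \<pi> L \<Longrightarrow> h e = restrict h I e" by auto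
        show "\<And>l'. l' < L \<Longrightarrow> fst (\<pi> l') < nr \<and> snd (\<pi> l') < n" using inb L by auto
        show "fst e < nr" "snd e < n" using e unfolding J_def ibox_def by auto
      qed
      moreover have "e \<in> ibox nr n \<pi> (Suc L)" "e \<notin> I" using e unfolding J_def I_def by auto
      ultimately show ?thesis by (simp add: ext0_def diff_eq_eq add.commute)
    qed
    have sp': "h \<in> space (gaussP (ibox nr n \<pi> (Suc L)))" using h IJ by simp
    have JI: "J = ibox nr n \<pi> (Suc L) - I" unfolding J_def I_def ..
    show ?thesis
      unfolding elim_event_def mem_Collect_eq I_def[symmetric] All_less_Suc
      using sp sp' old new unfolding JI by auto
  qed
  moreover have "elim_event nr n \<pi> act ctr \<delta> (Suc L) \<subseteq> space (gaussP (I \<union> J))"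
    unfolding IJ elim_event_def by auto
  ultimately show ?thesis
    unfolding stage_event_def by (cases "act L") (auto simp only: if_True if_False mem_Collect_eq subset_eq)
qed

lemma card_ibox:
  assumes po: "\<pi> \<in> pivot_orders nr n" and "L \<le> n" "n \<le> nr"
  shows "card (ibox nr n \<pi> L) + (nr - L) * (n - L) = nr * n"
proof -
  define X where "X = ({..<nr} - (\<lambda>l. fst (\<pi> l)) ` {..<L}) \<times> ({..<n} - (\<lambda>l. snd (\<pi> l)) ` {..<L})"
  have sub: "(\<lambda>l. fst (\<pi> l)) ` {..<L} \<subseteq> {..<nr}" "(\<lambda>l. snd (\<pi> l)) ` {..<L} \<subseteq> {..<n}"
    using po assms(2) unfolding pivot_orders_def by auto
  have inj: "inj_on (\<lambda>l. fst (\<pi> l)) {..<L}" "inj_on (\<lambda>l. snd (\<pi> l)) {..<L}"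
    using po assms(2) unfolding pivot_orders_def by (auto elim!: inj_on_subset)
  have "card X = (nr - L) * (n - L)"
    unfolding X_def card_cartesian_product
    using card_Diff_subset[OF _ sub(1)] card_Diff_subset[OF _ sub(2)] inj by (simp add: card_image)
  moreover have "ibox nr n \<pi> L \<inter> X = {}" "ibox nr n \<pi> L \<union> X = {..<nr} \<times> {..<n}"
    unfolding ibox_def X_def cross_def by auto
  moreover have "finite X" unfolding X_def by auto
  ultimately show ?thesis
    using card_Un_disjoint[of "ibox nr n \<pi> L" X] finite_ibox[of nr n \<pi> L] by (simp add: card_cartesian_product)
qed

text \<open>It equals \<open>(nr - L) * (n - L) - (nr - L - 1) * (n - L - 1)\<close>, and becomes
  the weight of pivot \<open>L\<close> in every exponent. Writing \<open>nr\<close> and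
  \<open>n\<close> as successors avoids truncated subtraction.\<close>

lemma card_stage:
  assumes po: "\<pi> \<in> pivot_orders nr n" and "L < n" "n \<le> nr"
  shows "card (ibox nr n \<pi> (Suc L) - ibox nr n \<pi> L) = nr + n - 2 * L - 1"
proof -
  obtain x where x: "nr = Suc (L + x)" using assms less_imp_Suc_add[of L nr] by auto
  obtain y where y: "n = Suc (L + y)" using assms less_imp_Suc_add[of L n] by auto
  have "card (ibox nr n \<pi> (Suc L)) + x * y = nr * n" "card (ibox nr n \<pi> L) + Suc x * Suc y = nr * n"
    using card_ibox[OF po, of "Suc L"] card_ibox[OF po, of L] assms x y by auto
  then have "card (ibox nr n \<pi> (Suc L)) = card (ibox nr n \<pi> L) + x + y + 1" by simp
  moreover have "card (ibox nr n \<pi> (Suc L) - ibox nr n \<pi> L) = card (ibox nr n \<pi> (Suc L)) - card (ibox nr n \<pi> L)"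
    by (intro card_Diff_subset finite_ibox ibox_mono) simp
  ultimately show ?thesis using x y by simp
qed

lemma ibox_full:
  assumes po: "\<pi> \<in> pivot_orders nr n"
  shows "ibox nr n \<pi> n = {..<nr} \<times> {..<n}"
proof -
  have inj: "inj_on (\<lambda>l. snd (\<pi> l)) {..<n}" using po unfolding pivot_orders_def by auto
  have "(\<lambda>l. snd (\<pi> l)) ` {..<n} = {..<n}"
    using po inj unfolding pivot_orders_def by (intro card_subset_eq) (auto simp: card_image)
  then have "\<exists>l<n. b = snd (\<pi> l)" if "b < n" for b
    using that by (metis imageE lessThan_iff)
  then show ?thesis unfolding ibox_def cross_def by auto
qed

lemma elim_event_sets:
  assumes po: "\<pi> \<in> pivot_orders nr n" and "L \<le> n"
  shows "elim_event nr n \<pi> act ctr \<delta> L \<in> sets (gaussP (ibox nr n \<pi> L))"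
  using assms(2)
proof (induction L)
  case 0
  have "elim_event nr n \<pi> act ctr \<delta> 0 = space (gaussP (ibox nr n \<pi> 0))" unfolding elim_event_def by auto
  then show ?case by simp
next
  case (Suc L)
  have U: "ibox nr n \<pi> L \<union> (ibox nr n \<pi> (Suc L) - ibox nr n \<pi> L) = ibox nr n \<pi> (Suc L)"
    using ibox_mono[of L "Suc L" nr n \<pi>] by auto
  have m: "(\<lambda>x. gauss_elim (ext0 (ibox nr n \<pi> L) x) \<pi> L (fst j) (snd j)) \<in> borel_measurable (gaussP (ibox nr n \<pi> L))" for j
    by (intro gauss_elim_measurable ext0_measurable)
  have fin: "finite (ibox nr n \<pi> L)" "finite (ibox nr n \<pi> (Suc L) - ibox nr n \<pi> L)"
      "ibox nr n \<pi> L \<inter> (ibox nr n \<pi> (Suc L) - ibox nr n \<pi> L) = {}"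
    using finite_ibox by auto
  have E: "elim_event nr n \<pi> act ctr \<delta> L \<in> sets (gaussP (ibox nr n \<pi> L))" using Suc by simp
  show ?case
    using stage_event(1)[OF fin E m] restrict_event_emeasure(1)[OF fin E]
    unfolding elim_event_Suc[OF po Suc_le_lessD[OF Suc.prems]] U by (cases "act L") (simp_all only: if_True if_False)
qed

text \<open>Unconstrained stages are integrated out with factor 1; the others multiply by their disc
  bounds, one factor per fresh entry.\<close>

lemma elim_event_le:
  assumes po: "\<pi> \<in> pivot_orders nr n" and "L \<le> n" "n \<le> nr" and \<delta>: "\<And>l. 0 \<le> \<delta> l"
  shows "emeasure (gaussP (ibox nr n \<pi> L)) (elim_event nr n \<pi> act ctr \<delta> L)
     \<le> ennreal (\<Prod>l<L. if act l then (4 * (\<delta> l)\<^sup>2) ^ (nr + n - 2 * l - 1) else 1)"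
  using assms(2)
proof (induction L)
  case 0
  interpret P: prob_space "gaussP (ibox nr n \<pi> 0)" by (rule prob_space_gaussP)
  show ?case using P.emeasure_le_1 by simp
next
  case (Suc L)
  define I where "I = ibox nr n \<pi> L"
  define J where "J = ibox nr n \<pi> (Suc L) - ibox nr n \<pi> L"
  define E where "E = elim_event nr n \<pi> act ctr \<delta> L"
  define P where "P = (\<Prod>l<L. if act l then (4 * (\<delta> l)\<^sup>2) ^ (nr + n - 2 * l - 1) else 1)"
  have P0: "0 \<le> P" unfolding P_def by (intro prod_nonneg) auto
  have U: "ibox nr n \<pi> (Suc L) = I \<union> J" unfolding I_def J_def
    using ibox_mono[of L "Suc L" nr n \<pi>] by auto
  have m: "(\<lambda>x. gauss_elim (ext0 I x) \<pi> L (fst j) (snd j)) \<in> borel_measurable (gaussP I)" for j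
    by (intro gauss_elim_measurable ext0_measurable)
  have fin: "finite I" "finite J" "I \<inter> J = {}"
    using finite_ibox unfolding I_def J_def by auto
  have E: "E \<in> sets (gaussP I)" unfolding E_def I_def using Suc.prems by (intro elim_event_sets[OF po]) simp
  have cJ: "card J = nr + n - 2 * L - 1" unfolding J_def using Suc.prems assms by (intro card_stage) auto
  have IH: "emeasure (gaussP I) E \<le> ennreal P" using Suc unfolding E_def P_def I_def by simp
  show ?case
  proof (cases "act L")
    case True
    have "emeasure (gaussP (I \<union> J)) (stage_event I J E (\<lambda>e x. gauss_elim (ext0 I x) \<pi> L (fst e) (snd e)) (ctr L) (\<lambda>_. \<delta> L))
       \<le> emeasure (gaussP I) E * ennreal (\<Prod>j\<in>J. 4 * (\<delta> L)\<^sup>2)"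
      by (rule stage_event_le[OF fin E m \<delta>])
    also have "\<dots> \<le> ennreal P * ennreal ((4 * (\<delta> L)\<^sup>2) ^ (nr + n - 2 * L - 1))"
      unfolding prod_constant cJ by (intro mult_right_mono IH) simp
    also have "\<dots> = ennreal (P * (4 * (\<delta> L)\<^sup>2) ^ (nr + n - 2 * L - 1))"
      using P0 by (simp add: ennreal_mult)
    finally show ?thesis
      unfolding U elim_event_Suc[OF po Suc_le_lessD[OF Suc.prems], folded I_def J_def E_def]
      using True by (simp only: if_True prod.lessThan_Suc P_def E_def)
  next
    case False
    then show ?thesis
      unfolding U elim_event_Suc[OF po Suc_le_lessD[OF Suc.prems], folded I_def J_def E_def]
      using IH restrict_event_emeasure(2)[OF fin E] by (simp only: if_False prod.lessThan_Suc P_def mult_1_right E_def)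
  qed
qed

text \<open>All entries are bounded, not just the pivot. For the order found by complete pivoting
  this is the same condition, and the probability estimate then needs no conditioning on which order
  was found.\<close>

definition small_pivot_event :: "nat \<Rightarrow> nat \<Rightarrow> (nat \<Rightarrow> nat \<times> nat) \<Rightarrow> (nat \<Rightarrow> bool) \<Rightarrow> (nat \<Rightarrow> real) \<Rightarrow> (nat \<times> nat \<Rightarrow> complex) set" where
  "small_pivot_event nr n \<pi> act \<delta> = {h \<in> space (gauss_mat nr n). \<forall>l<n. act l \<longrightarrow>
     (\<forall>a<nr. \<forall>b<n. cmod (gauss_elim (to_mat h) \<pi> l a b) \<le> \<delta> l)}"

lemma gauss_elim_to_mat:
  assumes po: "\<pi> \<in> pivot_orders nr n" and "l \<le> n" "a < nr" "b < n"
  shows "gauss_elim (to_mat h) \<pi> l a b = gauss_elim (ext0 ({..<nr} \<times> {..<n}) h) \<pi> l a b"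
proof -
  have "gauss_elim (to_mat h) \<pi> l a b - to_mat h a b
     = gauss_elim (ext0 ({..<nr} \<times> {..<n}) h) \<pi> l a b - ext0 ({..<nr} \<times> {..<n}) h a b"
    by (rule gauss_elim_local[where R = "{..<nr}" and C = "{..<n}"])
      (use assms in \<open>auto simp: ext0_def to_mat_def pivot_orders_def\<close>)
  then show ?thesis using assms by (simp add: ext0_def to_mat_def)
qed

text \<open>Restricting the bound at stage \<open>l\<close> to the entries fresh at that stage gives
  an elimination event with centres 0.\<close>

lemma small_pivot_event:
  assumes po: "\<pi> \<in> pivot_orders nr n" and "n \<le> nr" and \<delta>: "\<And>l. 0 \<le> \<delta> l"
  shows "small_pivot_event nr n \<pi> act \<delta> \<in> sets (gauss_mat nr n)"
    and "emeasure (gauss_mat nr n) (small_pivot_event nr n \<pi> act \<delta>)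
     \<le> ennreal (\<Prod>l<n. if act l then (4 * (\<delta> l)\<^sup>2) ^ (nr + n - 2 * l - 1) else 1)"
proof -
  have m: "(\<lambda>h. gauss_elim (ext0 ({..<nr} \<times> {..<n}) h) \<pi> l a b) \<in> borel_measurable (gaussP ({..<nr} \<times> {..<n}))" for l a b
    by (intro gauss_elim_measurable ext0_measurable)
  have eq: "small_pivot_event nr n \<pi> act \<delta> = {h \<in> space (gaussP ({..<nr} \<times> {..<n})). \<forall>l\<in>{..<n}. act l \<longrightarrow>
     (\<forall>a\<in>{..<nr}. \<forall>b\<in>{..<n}. cmod (gauss_elim (ext0 ({..<nr} \<times> {..<n}) h) \<pi> l a b) \<le> \<delta> l)}"
    unfolding small_pivot_event_def gauss_mat_def using gauss_elim_to_mat[OF po] by auto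
  show "small_pivot_event nr n \<pi> act \<delta> \<in> sets (gauss_mat nr n)"
    unfolding eq gauss_mat_def using m
    by (intro sets.sets_Collect_finite_All sets.sets_Collect_imp sets.sets_Collect_const borel_measurable_le borel_measurable_norm) auto
  have "small_pivot_event nr n \<pi> act \<delta> \<subseteq> elim_event nr n \<pi> act (\<lambda>_ _. 0) \<delta> n"
    unfolding eq elim_event_def ibox_full[OF po] by (auto simp: ibox_def)
  then have "emeasure (gauss_mat nr n) (small_pivot_event nr n \<pi> act \<delta>)
     \<le> emeasure (gaussP (ibox nr n \<pi> n)) (elim_event nr n \<pi> act (\<lambda>_ _. 0) \<delta> n)"
    unfolding gauss_mat_def ibox_full[OF po]
    using elim_event_sets[OF po order.refl, of act "\<lambda>_ _. 0" \<delta>] unfolding ibox_full[OF po]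
    by (intro emeasure_mono) auto
  also have "\<dots> \<le> ennreal (\<Prod>l<n. if act l then (4 * (\<delta> l)\<^sup>2) ^ (nr + n - 2 * l - 1) else 1)"
    by (rule elim_event_le[OF po order.refl assms(2) \<delta>])
  finally show "emeasure (gauss_mat nr n) (small_pivot_event nr n \<pi> act \<delta>)
     \<le> ennreal (\<Prod>l<n. if act l then (4 * (\<delta> l)\<^sup>2) ^ (nr + n - 2 * l - 1) else 1)" .
qed

section \<open>Singular channels form a null set\<close>

definition singular_event :: "nat \<Rightarrow> nat \<Rightarrow> (nat \<times> nat \<Rightarrow> complex) set" where
  "singular_event nr n = (\<Union>\<pi>\<in>pivot_orders nr n. small_pivot_event nr n \<pi> (\<lambda>l. l = n - 1) (\<lambda>_. 0))"

text \<open>For every order the last stage has \<open>nr - n + 1 \<ge> 1\<close> fresh entries, so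
  radius 0 makes its factor vanish.\<close>

lemma singular_event_null:
  assumes "1 \<le> n" "n \<le> nr"
  shows "singular_event nr n \<in> null_sets (gauss_mat nr n)"
  unfolding singular_event_def
proof (intro null_sets_UN' countable_finite finite_pivot_orders)
  fix \<pi> assume po: "\<pi> \<in> pivot_orders nr n"
  have z: "(0::real) ^ (nr + n - 2 * (n - 1) - 1) = 0" using assms by simp
  have "(\<Prod>l<n. if l = n - 1 then (4 * (0::real)\<^sup>2) ^ (nr + n - 2 * l - 1) else 1) = 0"
    using assms z by (intro prod_zero) (auto intro!: bexI[of _ "n - 1"])
  then show "small_pivot_event nr n \<pi> (\<lambda>l. l = n - 1) (\<lambda>_. 0) \<in> null_sets (gauss_mat nr n)"
    using small_pivot_event[OF po assms(2), of "\<lambda>_. 0" "\<lambda>l. l = n - 1"] by (intro null_setsI) auto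
qed

lemma nonsingular:
  assumes "1 \<le> n" "n \<le> nr" "h \<in> space (gauss_mat nr n)" "h \<notin> singular_event nr n"
    and po: "\<pi> \<in> pivot_orders nr n" and cp: "complete_pivots nr n (to_mat h) \<pi>"
  shows "pivot (to_mat h) \<pi> (n - 1) \<noteq> 0"
proof
  assume "pivot (to_mat h) \<pi> (n - 1) = 0"
  moreover have "\<forall>a<nr. \<forall>b<n. cmod (gauss_elim (to_mat h) \<pi> (n - 1) a b) \<le> cmod (pivot (to_mat h) \<pi> (n - 1))"
    using assms(1) cp unfolding complete_pivots_def by simp
  ultimately have "h \<in> small_pivot_event nr n \<pi> (\<lambda>l. l = n - 1) (\<lambda>_. 0)"
    using assms(3) unfolding small_pivot_event_def by simp
  then show False using assms(4) po unfolding singular_event_def by auto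
qed

text \<open>A vector with zero image has all its pivot coordinates bounded by 0, and these determine
  it.\<close>

lemma nonsingular_inj:
  assumes "1 \<le> n" "n \<le> nr" "h \<in> space (gauss_mat nr n)" "h \<notin> singular_event nr n"
  shows "inj_cmat nr n (to_mat h)"
proof -
  obtain \<pi> where po: "\<pi> \<in> pivot_orders nr n" and cp: "complete_pivots nr n (to_mat h) \<pi>"
    by (rule complete_pivoting[OF assms(2)])
  note nz = pivot_nonzero[OF cp po nonsingular[OF assms po cp]]
  obtain E :: "nat \<Rightarrow> nat \<Rightarrow> complex" where
    E: "\<And>x b. b < n \<Longrightarrow> x b = (\<Sum>i<n. E b i * pivot_coord n (to_mat h) \<pi> x i)"
    by (rule pivot_coords_determine[OF cp po nz]) (assumption, rule that, assumption+)
  show ?thesis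
    unfolding inj_cmat_def
  proof (intro allI impI)
    fix v j assume v: "\<forall>p<nr. mvec n (to_mat h) v p = 0" and j: "j < n"
    have "pivot_coord n (to_mat h) \<pi> v i = 0" if i: "i < n" for i
    proof -
      have fi: "fst (\<pi> i) < nr" using po i unfolding pivot_orders_def by auto
      have "cmod (mvec n (gauss_elim (to_mat h) \<pi> i) v (fst (\<pi> i))) \<le> 2 ^ i * 0"
        by (rule mvec_gauss_elim_bound[OF cp po]) (use v i fi in auto)
      then show ?thesis by (simp add: pivot_coord_def)
    qed
    then show "v j = 0" using E[OF j, of v] by simp
  qed
qed

section \<open>Channels with few large pivots\<close>

text \<open>Eliminating the last unknown at most doubles both the distance from the identity and the
  right side. The power \<open>4 ^ N\<close> pays for these doublings and for the size of the
  eliminated unknown.\<close>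

lemma near_identity_solve:
  fixes M :: cmat
  assumes "\<And>i j. i < N \<Longrightarrow> j < N \<Longrightarrow> cmod (M i j - (if i = j then 1 else 0)) \<le> \<epsilon>" "0 \<le> \<epsilon>" "\<epsilon> * 4 ^ N \<le> 1 / 4"
    and "\<And>i. i < N \<Longrightarrow> cmod (b i) \<le> \<beta>" "0 \<le> \<beta>"
  shows "\<exists>x. (\<forall>i<N. (\<Sum>j<N. M i j * x j) = b i) \<and> (\<forall>i<N. cmod (x i) \<le> 4 ^ N * \<beta>)"
  using assms
proof (induction N arbitrary: M \<epsilon> b \<beta>)
  case 0
  then show ?case by auto
next
  case (Suc N)
  have e4: "\<epsilon> * 4 ^ N * 4 \<le> 1 / 4" using Suc.prems(3) by (simp add: mult_ac)
  have "\<epsilon> * 1 \<le> \<epsilon> * 4 ^ N" using Suc.prems(2) by (intro mult_left_mono) auto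
  then have e16: "\<epsilon> \<le> 1 / 16" using e4 by simp
  define p where "p = M N N"
  have p: "cmod (p - 1) \<le> \<epsilon>" using Suc.prems(1)[of N N] by (simp add: p_def)
  have p2: "1 / 2 \<le> cmod p"
    using norm_triangle_ineq2[of 1 "1 - p"] p e16 by (simp add: norm_minus_commute)
  then have p0: "p \<noteq> 0" by auto
  have MN: "cmod (M i N) \<le> \<epsilon>" "cmod (M N i) \<le> \<epsilon>" if "i < N" for i
    using Suc.prems(1)[of i N] Suc.prems(1)[of N i] that by auto
  have ratio: "cmod (M i N / p) \<le> 2 * \<epsilon>" if "i < N" for i
  proof -
    have "cmod (M i N) / cmod p \<le> \<epsilon> / (1 / 2)"
      using MN(1)[OF that] p2 Suc.prems(2) by (intro frac_le) auto
    then show ?thesis by (simp add: norm_divide)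
  qed
  define M' where "M' i j = M i j - M i N / p * M N j" for i j
  define b' where "b' i = b i - M i N / p * b N" for i
  have M': "cmod (M' i j - (if i = j then 1 else 0)) \<le> 2 * \<epsilon>" if ij: "i < N" "j < N" for i j
  proof -
    have "cmod (M i N / p * M N j) \<le> 2 * \<epsilon> * (1 / 2)"
      unfolding norm_mult using ratio[OF ij(1)] MN(2)[OF ij(2)] e16 Suc.prems(2) by (intro mult_mono) auto
    moreover have "cmod (M i j - (if i = j then 1 else 0)) \<le> \<epsilon>" using Suc.prems(1)[of i j] ij by auto
    ultimately show ?thesis
      using norm_triangle_ineq4[of "M i j - (if i = j then 1 else 0)" "M i N / p * M N j"]
      unfolding M'_def by (simp add: algebra_simps)
  qed
  have b': "cmod (b' i) \<le> 2 * \<beta>" if i: "i < N" for i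
  proof -
    have "cmod (M i N / p * b N) \<le> 1 * \<beta>"
      unfolding norm_mult using ratio[OF i] e16 Suc.prems(4)[of N] by (intro mult_mono) auto
    then show ?thesis
      using norm_triangle_ineq4[of "b i" "M i N / p * b N"] Suc.prems(4)[of i] i unfolding b'_def by auto
  qed
  have "2 * \<epsilon> * 4 ^ N \<le> 1 / 4" using e4 Suc.prems(2) by simp
  from Suc.IH[of M' "2 * \<epsilon>" b' "2 * \<beta>", OF M' _ this b'] Suc.prems(2,5)
  obtain x where x: "\<And>i. i < N \<Longrightarrow> (\<Sum>j<N. M' i j * x j) = b' i" "\<And>i. i < N \<Longrightarrow> cmod (x i) \<le> 4 ^ N * (2 * \<beta>)"
    by auto
  define y where "y = x(N := (b N - (\<Sum>j<N. M N j * x j)) / p)"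
  have yN: "p * y N = b N - (\<Sum>j<N. M N j * x j)" unfolding y_def using p0 by simp
  have sumy: "(\<Sum>j<Suc N. M i j * y j) = (\<Sum>j<N. M i j * x j) + M i N * y N" for i
    unfolding y_def by simp
  have "(\<Sum>j<Suc N. M i j * y j) = b i" if i: "i < Suc N" for i
  proof (cases "i = N")
    case True
    then show ?thesis unfolding sumy using yN by (simp add: p_def)
  next
    case False
    then have i': "i < N" using i by simp
    have "(\<Sum>j<N. M i j * x j) = (\<Sum>j<N. M' i j * x j) + M i N / p * (\<Sum>j<N. M N j * x j)"
      unfolding M'_def by (simp add: left_diff_distrib sum_subtractf sum_distrib_left mult.assoc)
    also have "\<dots> = b i - M i N / p * (p * y N)"
      unfolding x(1)[OF i'] yN b'_def by (simp add: algebra_simps)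
    finally show ?thesis unfolding sumy using p0 by simp
  qed
  moreover have "cmod (y i) \<le> 4 ^ Suc N * \<beta>" if i: "i < Suc N" for i
  proof (cases "i = N")
    case True
    have "cmod (\<Sum>j<N. M N j * x j) \<le> (\<Sum>j<N. \<epsilon> * (4 ^ N * (2 * \<beta>)))"
      using MN(2) x(2) Suc.prems(2) by (intro sum_norm_le) (simp only: norm_mult, rule mult_mono, auto)
    also have "\<dots> = real N * \<beta> * (2 * (\<epsilon> * 4 ^ N))" by simp
    also have "\<dots> \<le> real N * \<beta> * 1" using e4 Suc.prems(5) by (intro mult_left_mono) auto
    finally have "cmod (b N - (\<Sum>j<N. M N j * x j)) \<le> \<beta> + real N * \<beta>"
      using norm_triangle_ineq4[of "b N" "\<Sum>j<N. M N j * x j"] Suc.prems(4)[of N] by simp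
    then have "cmod (b N - (\<Sum>j<N. M N j * x j)) / cmod p \<le> (\<beta> + real N * \<beta>) / (1 / 2)"
      using p2 Suc.prems(5) by (intro frac_le) auto
    then have "cmod (y N) \<le> (\<beta> + real N * \<beta>) / (1 / 2)"
      unfolding y_def by (simp add: norm_divide)
    also have "\<dots> = (2 * (1 + real N)) * \<beta>" by (simp add: algebra_simps)
    also have "\<dots> \<le> 4 ^ Suc N * \<beta>"
    proof (intro mult_right_mono Suc.prems(5))
      have "1 + real N \<le> 2 ^ N" by (induction N) auto
      also have "(2::real) ^ N \<le> 4 ^ N" by (intro power_mono) auto
      finally show "2 * (1 + real N) \<le> 4 ^ Suc N" by simp
    qed
    finally show ?thesis using True by simp
  next
    case False
    then have "cmod (y i) \<le> 4 ^ N * (2 * \<beta>)" using x(2)[of i] i unfolding y_def by simp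
    also have "\<dots> \<le> 4 ^ Suc N * \<beta>" using Suc.prems(5) by simp
    finally show ?thesis .
  qed
  ultimately show ?case by (intro exI[of _ y]) blast
qed

text \<open>As a function of \<open>b\<close>, \<open>b choose l\<close> is a polynomial of degree
  \<open>l\<close>. The combination has degree below \<open>p\<close> and \<open>p\<close> distinct
  zeros, hence vanishes identically.\<close>

lemma binomial_kernel_trivial:
  fixes v :: "nat \<Rightarrow> complex"
  assumes B: "finite B" "card B = p" and v: "\<And>b. b \<in> B \<Longrightarrow> (\<Sum>l<p. v l * of_nat (b choose l)) = 0" and "l < p"
  shows "v l = 0"
proof -
  define P where "P = (\<Sum>l<p. Polynomial.smult (v l / fact l) (\<Prod>i<l. [:- of_nat i, 1:]))"
  have ev: "poly P (of_nat b) = (\<Sum>l<p. v l * of_nat (b choose l))" for b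
    unfolding P_def poly_sum poly_smult poly_prod
    by (intro sum.cong) (auto simp: binomial_gbinomial gbinomial_prod_rev atLeast0LessThan)
  have "degree (Polynomial.smult (v l / fact l) (\<Prod>i<l. [:- of_nat i, 1:])) \<le> p - 1" if "l < p" for l
  proof -
    have "degree (\<Prod>i<l. [:- of_nat i, 1:] :: complex poly) \<le> (\<Sum>i<l. 1)"
      by (rule order.trans[OF degree_prod_sum_le]) (auto intro!: sum_mono)
    then show ?thesis using that by (intro order.trans[OF degree_smult_le]) simp
  qed
  then have deg: "degree P \<le> p - 1" unfolding P_def by (intro degree_sum_le) auto
  have "P = 0"
  proof (rule ccontr)
    assume "P \<noteq> 0"
    have "of_nat ` B \<subseteq> {x. poly P x = 0}" using ev v by auto
    then have "card (of_nat ` B :: complex set) \<le> card {x. poly P x = 0}"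
      using \<open>P \<noteq> 0\<close> by (intro card_mono poly_roots_finite)
    also have "\<dots> \<le> degree P" using \<open>P \<noteq> 0\<close> by (rule card_poly_roots_bound)
    finally have "p \<le> p - 1" using deg B(2) by (simp add: card_image inj_on_def)
    then show False using \<open>l < p\<close> by simp
  qed
  \<comment> \<open>Evaluating at 0, 1, 2, ... is now triangular, since
    \<open>l choose i = 0\<close> for \<open>i > l\<close>; so the coefficients vanish one after
    another.\<close>
  then have z: "(\<Sum>i<p. v i * of_nat (b choose i)) = 0" for b using ev[of b] by simp
  show ?thesis
    using \<open>l < p\<close>
  proof (induction l rule: less_induct)
    case (less l)
    have "(\<Sum>i<p. v i * of_nat (l choose i)) = (\<Sum>i\<in>{l}. v i * of_nat (l choose i))"
    proof (rule sum.mono_neutral_right)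
      show "\<forall>i\<in>{..<p} - {l}. v i * of_nat (l choose i) = 0"
      proof
        fix i assume "i \<in> {..<p} - {l}"
        then show "v i * of_nat (l choose i) = 0"
          using less.IH[of i] by (cases "i < l") (auto simp: binomial_eq_0)
      qed
    qed (use less.prems in auto)
    then show ?case using z[of l] by simp
  qed
qed

text \<open>Any \<open>p\<close> columns of the first \<open>p\<close> rows of the binomial matrix
  are independent; a kernel vector of the transpose would contradict
  \<open>binomial_kernel_trivial\<close>.\<close>

lemma binomial_right_inverse:
  assumes e: "bij_betw e {..<p} B"
  shows "\<exists>C::cmat. \<forall>l<p. \<forall>l'<p. (\<Sum>i<p. of_nat (e i choose l) * C i l') = (if l = l' then 1 else 0)"
proof -
  define M where "M = mat p p (\<lambda>(l, i). of_nat (e i choose l) :: complex)"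
  have M: "M \<in> carrier_mat p p" unfolding M_def by auto
  have B: "finite B" "card B = p" using e bij_betw_finite bij_betw_same_card by fastforce+
  have "det (transpose_mat M) \<noteq> 0"
  proof
    assume "det (transpose_mat M) = 0"
    then obtain v where v: "v \<in> carrier_vec p" "v \<noteq> 0\<^sub>v p" "transpose_mat M *\<^sub>v v = 0\<^sub>v p"
      using det_0_iff_vec_prod_zero_field[of "transpose_mat M" p] M by auto
    have "(\<Sum>l<p. vec_index v l * of_nat (b choose l)) = 0" if b: "b \<in> B" for b
    proof -
      obtain i where i: "i < p" "b = e i" using b e by (auto simp: bij_betw_def)
      have "vec_index (transpose_mat M *\<^sub>v v) i = 0" using v(3) i by simp
      then show ?thesis
        using i v(1) unfolding M_def by (simp add: scalar_prod_def atLeast0LessThan mult.commute)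
    qed
    then have "vec_index v l = 0" if "l < p" for l
      using binomial_kernel_trivial[OF B, of "vec_index v"] that by blast
    then have "v = 0\<^sub>v p" using v(1) by (intro eq_vecI) auto
    then show False using v(2) by simp
  qed
  then have "det M \<noteq> 0" using det_transpose[OF M] by simp
  from det_non_zero_imp_unit[OF M this, of "()"]
  obtain N where N: "N \<in> carrier_mat p p" "M * N = 1\<^sub>m p"
    unfolding Units_def ring_mat_def by auto
  show ?thesis
  proof (intro exI[of _ "\<lambda>i l'. N $$ (i, l')"] allI impI)
    fix l l' assume l: "l < p" "l' < p"
    have "(M * N) $$ (l, l') = (if l = l' then 1 else 0)" unfolding N(2) using l by simp
    then show "(\<Sum>i<p. of_nat (e i choose l) * N $$ (i, l')) = (if l = l' then 1 else 0)"
      using l N(1) unfolding M_def by (simp add: scalar_prod_def atLeast0LessThan)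
  qed
qed

definition solvable_near :: "nat \<Rightarrow> nat set \<Rightarrow> real \<Rightarrow> real \<Rightarrow> bool" where
  "solvable_near p B \<epsilon> K \<longleftrightarrow> (\<forall>(U::cmat) y. (\<forall>l<p. \<forall>b\<in>B. cmod (U l b - of_nat (b choose l)) \<le> \<epsilon>) \<longrightarrow> (\<forall>\<beta>\<ge>0. (\<forall>l<p. cmod (y l) \<le> \<beta>) \<longrightarrow>
     (\<exists>x. (\<forall>l<p. (\<Sum>b\<in>B. U l b * x b) = y l) \<and> (\<forall>b\<in>B. cmod (x b) \<le> K * \<beta>))))"

text \<open>Multiplying the perturbed columns by the right inverse of the unperturbed ones gives a
  matrix near the identity; solve there and map the solution back.\<close>

lemma solvable_near_ex:
  assumes "finite B" "card B = p"
  shows "\<exists>\<epsilon>>0. \<exists>K\<ge>0. solvable_near p B \<epsilon> K"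
proof -
  obtain e where e: "bij_betw e {..<p} B"
    using assms ex_bij_betw_nat_finite[of B] by (auto simp: atLeast0LessThan)
  obtain C :: cmat where C: "\<And>l l'. l < p \<Longrightarrow> l' < p \<Longrightarrow> (\<Sum>i<p. of_nat (e i choose l) * C i l') = (if l = l' then 1 else 0)"
    using binomial_right_inverse[OF e] by auto
  define c where "c = (\<Sum>i<p. \<Sum>l<p. cmod (C i l))"
  have c0: "0 \<le> c" unfolding c_def by (intro sum_nonneg) auto
  have cl: "(\<Sum>i<p. cmod (C i l)) \<le> c" if "l < p" for l
    unfolding c_def using that by (intro sum_mono member_le_sum) auto
  have ci: "(\<Sum>l<p. cmod (C i l)) \<le> c" if "i < p" for i
    unfolding c_def using that by (intro member_le_sum) (auto intro!: sum_nonneg)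
  \<comment> \<open>Chosen so that \<open>\<epsilon> * c\<close>, the distance of the product from
    the identity, meets the requirement of \<open>near_identity_solve\<close>. The summand 1 guards
    against \<open>c = 0\<close>.\<close>
  define \<epsilon> where "\<epsilon> = 1 / (4 ^ Suc p * (1 + c))"
  have e0: "0 < \<epsilon>" unfolding \<epsilon>_def using c0 by simp
  have "\<epsilon> * c * 4 ^ p \<le> \<epsilon> * (1 + c) * 4 ^ p" using e0 by simp
  also have "\<dots> = (4 ^ Suc p * (1 + c)) / (4 ^ Suc p * (1 + c)) / 4" unfolding \<epsilon>_def by simp
  also have "\<dots> = 1 / 4" using c0 by simp
  finally have ec: "\<epsilon> * c * 4 ^ p \<le> 1 / 4" .
  have "solvable_near p B \<epsilon> (c * 4 ^ p)"
    unfolding solvable_near_def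
  proof (intro allI impI)
    fix U :: cmat and y \<beta>
    assume U: "\<forall>l<p. \<forall>b\<in>B. cmod (U l b - of_nat (b choose l)) \<le> \<epsilon>" and \<beta>: "0 \<le> \<beta>" and y: "\<forall>l<p. cmod (y l) \<le> \<beta>"
    define D where "D l l' = (\<Sum>i<p. U l (e i) * C i l')" for l l'
    have eB: "e i \<in> B" if "i < p" for i using e that by (auto simp: bij_betw_def)
    have D: "cmod (D l l' - (if l = l' then 1 else 0)) \<le> \<epsilon> * c" if l: "l < p" "l' < p" for l l'
    proof -
      have "D l l' - (if l = l' then 1 else 0) = (\<Sum>i<p. (U l (e i) - of_nat (e i choose l)) * C i l')"
        unfolding D_def C[OF l, symmetric] by (simp add: left_diff_distrib sum_subtractf)
      also have "cmod \<dots> \<le> (\<Sum>i<p. \<epsilon> * cmod (C i l'))"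
        using U l eB by (intro sum_norm_le) (auto simp: norm_mult intro!: mult_right_mono)
      also have "\<dots> \<le> \<epsilon> * c"
        unfolding sum_distrib_left[symmetric] using cl[OF l(2)] e0 by (intro mult_left_mono) auto
      finally show ?thesis .
    qed
    have "0 \<le> \<epsilon> * c" using e0 c0 by simp
    from near_identity_solve[of p D "\<epsilon> * c" y \<beta>, OF D this ec _ \<beta>] y
    obtain x where x: "\<And>l. l < p \<Longrightarrow> (\<Sum>j<p. D l j * x j) = y l" "\<And>l. l < p \<Longrightarrow> cmod (x l) \<le> 4 ^ p * \<beta>"
      by auto
    define z where "z b = (\<Sum>l<p. C (inv_into {..<p} e b) l * x l)" for b
    have ze: "z (e i) = (\<Sum>l<p. C i l * x l)" if "i < p" for i
      unfolding z_def using e that by (simp add: bij_betw_inv_into_left)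
    have "(\<Sum>b\<in>B. U l b * z b) = y l" if l: "l < p" for l
    proof -
      have "(\<Sum>b\<in>B. U l b * z b) = (\<Sum>i<p. U l (e i) * z (e i))"
        by (rule sum.reindex_bij_betw[OF e, symmetric])
      also have "\<dots> = (\<Sum>i<p. \<Sum>l'<p. U l (e i) * C i l' * x l')"
        by (intro sum.cong) (auto simp: ze sum_distrib_left mult.assoc)
      also have "\<dots> = (\<Sum>l'<p. D l l' * x l')"
        unfolding D_def by (subst sum.swap) (simp add: sum_distrib_right)
      finally show ?thesis using x(1)[OF l] by simp
    qed
    moreover have "cmod (z b) \<le> c * 4 ^ p * \<beta>" if b: "b \<in> B" for b
    proof -
      obtain i where i: "i < p" "b = e i" using b e by (auto simp: bij_betw_def)
      have "cmod (z b) \<le> (\<Sum>l<p. cmod (C i l) * (4 ^ p * \<beta>))"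
        unfolding i(2) ze[OF i(1)] using x(2) by (intro sum_norm_le) (auto simp: norm_mult intro!: mult_left_mono)
      also have "\<dots> \<le> c * (4 ^ p * \<beta>)"
        unfolding sum_distrib_right[symmetric] using ci[OF i(1)] \<beta> by (intro mult_right_mono) auto
      finally show ?thesis by (simp add: mult.assoc)
    qed
    ultimately show "\<exists>x. (\<forall>l<p. (\<Sum>b\<in>B. U l b * x b) = y l) \<and> (\<forall>b\<in>B. cmod (x b) \<le> c * 4 ^ p * \<beta>)"
      by blast
  qed
  moreover have "0 \<le> c * 4 ^ p" using c0 by simp
  ultimately show ?thesis using e0 by blast
qed

lemma solvable_near_mono:
  assumes "solvable_near p B \<epsilon> K" "\<epsilon>' \<le> \<epsilon>" "K \<le> K'"
  shows "solvable_near p B \<epsilon>' K'"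
  unfolding solvable_near_def
proof (intro allI impI)
  fix U :: cmat and y \<beta>
  assume U: "\<forall>l<p. \<forall>b\<in>B. cmod (U l b - of_nat (b choose l)) \<le> \<epsilon>'" and \<beta>: "0 \<le> \<beta>" and y: "\<forall>l<p. cmod (y l) \<le> \<beta>"
  have "\<forall>l<p. \<forall>b\<in>B. cmod (U l b - of_nat (b choose l)) \<le> \<epsilon>" using U assms(2) by force
  then obtain x where x: "\<forall>l<p. (\<Sum>b\<in>B. U l b * x b) = y l" "\<forall>b\<in>B. cmod (x b) \<le> K * \<beta>"
    using assms(1) \<beta> y unfolding solvable_near_def by blast
  moreover have "K * \<beta> \<le> K' * \<beta>" using assms(3) \<beta> by (rule mult_right_mono)
  ultimately show "\<exists>x. (\<forall>l<p. (\<Sum>b\<in>B. U l b * x b) = y l) \<and> (\<forall>b\<in>B. cmod (x b) \<le> K' * \<beta>)"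
    by (intro exI[of _ x]) force
qed

text \<open>One tolerance and one constant must serve all codeword columns at once, since different
  columns free different sets of rows.\<close>

lemma solvable_near_uniform:
  assumes "finite F" "\<And>B. B \<in> F \<Longrightarrow> finite B \<and> card B = p"
  shows "\<exists>\<epsilon>>0. \<epsilon> \<le> 1/2 \<and> (\<exists>K\<ge>0. \<forall>B\<in>F. solvable_near p B \<epsilon> K)"
  using assms
proof (induction F rule: finite_induct)
  case empty
  then show ?case by (intro exI[of _ "1/2"]) auto
next
  case (insert B F)
  then obtain \<epsilon> K where 1: "0 < \<epsilon>" "\<epsilon> \<le> 1/2" "0 \<le> K" "\<And>B. B \<in> F \<Longrightarrow> solvable_near p B \<epsilon> K" by auto
  obtain \<epsilon>' K' where 2: "0 < \<epsilon>'" "0 \<le> K'" "solvable_near p B \<epsilon>' K'"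
    using solvable_near_ex[of B p] insert.prems by auto
  have "\<forall>B\<in>insert B F. solvable_near p B (min \<epsilon> \<epsilon>') (max K K')"
    using solvable_near_mono[OF 1(4), of _ "min \<epsilon> \<epsilon>'" "max K K'"] solvable_near_mono[OF 2(3), of "min \<epsilon> \<epsilon>'" "max K K'"] by auto
  then show ?case
    using 1 2 by (intro exI[of _ "min \<epsilon> \<epsilon>'"] conjI exI[of _ "max K K'"]) auto
qed

section \<open>The channel event of the lower bound\<close>

definition diag_order :: "nat \<Rightarrow> nat \<Rightarrow> nat \<times> nat" where
  "diag_order n l = (if l < n then (l, l) else (0, 0))"

lemma diag_order_pivot: "n \<le> nr \<Longrightarrow> diag_order n \<in> pivot_orders nr n"
  unfolding pivot_orders_def mem_Collect_eq
  by (intro conjI allI impI inj_onI) (simp_all add: diag_order_def)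

lemma cross_diag:
  assumes "L \<le> n"
  shows "(a, b) \<in> cross (diag_order n) L \<longleftrightarrow> a < L \<or> b < L"
proof -
  have "diag_order n l = (l, l)" if "l < L" for l using that assms by (simp add: diag_order_def)
  then have "(a, b) \<in> cross (diag_order n) L \<longleftrightarrow> (\<exists>l<L. a = l \<or> b = l)"
    unfolding cross_def by (simp cong: conj_cong)
  then show ?thesis by blast
qed

lemma stage_diag:
  assumes "l < n"
  shows "(a, b) \<in> ibox nr n (diag_order n) (Suc l) - ibox nr n (diag_order n) l \<longleftrightarrow>
    a < nr \<and> b < n \<and> l \<le> a \<and> l \<le> b \<and> (a = l \<or> b = l)"
proof -
  have "(a, b) \<in> cross (diag_order n) (Suc l) \<longleftrightarrow> a < Suc l \<or> b < Suc l"
    "(a, b) \<in> cross (diag_order n) l \<longleftrightarrow> a < l \<or> b < l"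
    using assms by (intro cross_diag; simp)+
  then show ?thesis unfolding ibox_def Diff_iff Int_iff mem_Times_iff fst_conv snd_conv lessThan_iff by linarith
qed

lemma gauss_elim_diag_Suc:
  "l < n \<Longrightarrow> gauss_elim H (diag_order n) (Suc l) a b =
    gauss_elim H (diag_order n) l a b - gauss_elim H (diag_order n) l a l * gauss_elim H (diag_order n) l l b / gauss_elim H (diag_order n) l l l"
  by (simp add: schur_def diag_order_def)

text \<open>Binomials fit the shape of a triangular factor in diagonal order:
  \<open>b choose l\<close> is 0 for \<open>b < l\<close>, and the pivot \<open>l choose l\<close>
  is 1. At stage \<open>p\<close> only the pivot has a nonzero centre.\<close>

definition lb_ctr :: "nat \<Rightarrow> real \<Rightarrow> nat \<Rightarrow> nat \<times> nat \<Rightarrow> complex" where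
  "lb_ctr p \<sigma> l e = (if l < p then (if fst e = l then of_nat (snd e choose l) else 0)
     else (if e = (p, p) then complex_of_real (3 / 4 * \<sigma>) else 0))"

text \<open>Radius \<open>\<sigma> / 4\<close> around \<open>3 / 4 * \<sigma>\<close> keeps pivot
  \<open>p\<close> between \<open>\<sigma> / 2\<close> and \<open>\<sigma>\<close>, while the other
  entries of its row and column stay below \<open>\<sigma> / 4\<close>.\<close>

definition lb_rad :: "nat \<Rightarrow> real \<Rightarrow> real \<Rightarrow> nat \<Rightarrow> real" where
  "lb_rad p \<epsilon> \<sigma> l = (if l < p then \<epsilon> else \<sigma> / 4)"

lemma lb_ctr_le:
  assumes "snd e < n" "0 < \<sigma>" "\<sigma> \<le> 1"
  shows "cmod (lb_ctr p \<sigma> l e) \<le> 2 ^ n"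
proof -
  have one: "(1::real) \<le> 2 ^ n" by simp
  have "real (snd e choose l) \<le> real (2 ^ snd e)" using binomial_le_pow2[of "snd e" l] by (simp only: of_nat_le_iff)
  also have "\<dots> \<le> 2 ^ n" using assms by simp
  finally have bin: "cmod (of_nat (snd e choose l)) \<le> 2 ^ n" by (simp only: norm_of_nat)
  have "cmod (complex_of_real (3 / 4 * \<sigma>)) = 3 / 4 * \<sigma>"
    unfolding norm_of_real using assms by simp
  then have "cmod (complex_of_real (3 / 4 * \<sigma>)) \<le> 2 ^ n" using assms one by linarith
  then show ?thesis unfolding lb_ctr_def using bin by simp
qed

lemma lb_ctr_le_scale:
  assumes "0 < \<sigma>" "\<not> l < p"
  shows "cmod (lb_ctr p \<sigma> l e) \<le> 3 / 4 * \<sigma>"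
proof -
  have "cmod (complex_of_real (3 / 4 * \<sigma>)) = 3 / 4 * \<sigma>"
    unfolding norm_of_real using assms by simp
  then show ?thesis unfolding lb_ctr_def using assms by simp
qed

text \<open>The first \<open>p\<close> rows of the triangular factor are close to the binomial matrix, all of whose
  maximal minors are nonzero; the next Schur complement has size \<open>\<sigma>\<close> and is of rank one up to
  an error \<open>\<tau>\<close>.\<close>

definition good_channel :: "nat \<Rightarrow> nat \<Rightarrow> nat \<Rightarrow> real \<Rightarrow> real \<Rightarrow> real \<Rightarrow> cmat \<Rightarrow> bool" where
  "good_channel nr n p \<epsilon> \<sigma> \<tau> H \<longleftrightarrow>
    (\<forall>l\<le>p. \<forall>a<nr. \<forall>b<n. l \<le> a \<longrightarrow> l \<le> b \<longrightarrow> (a = l \<or> b = l) \<longrightarrow>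
       cmod (gauss_elim H (diag_order n) l a b - lb_ctr p \<sigma> l (a, b)) \<le> lb_rad p \<epsilon> \<sigma> l) \<and>
    (\<forall>a<nr. \<forall>b<n. p < a \<longrightarrow> p < b \<longrightarrow> cmod (gauss_elim H (diag_order n) (Suc p) a b) \<le> \<tau>)"

text \<open>The windows keep each pivot at least as large as the entries below it, so the prescribed
  diagonal order has multipliers of modulus at most 1, as complete pivoting would give.\<close>

lemma stage_bounds:
  assumes \<epsilon>: "0 < \<epsilon>" "\<epsilon> \<le> 1/2" and \<sigma>: "0 < \<sigma>" "\<sigma> \<le> 1" and ln: "l < n" "n \<le> nr" "l \<le> p"
    and st: "\<And>a b. a < nr \<Longrightarrow> b < n \<Longrightarrow> l \<le> a \<Longrightarrow> l \<le> b \<Longrightarrow> a = l \<or> b = l \<Longrightarrow>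
       cmod (S a b - lb_ctr p \<sigma> l (a, b)) \<le> lb_rad p \<epsilon> \<sigma> l"
  shows "S l l \<noteq> 0" "\<And>a. l < a \<Longrightarrow> a < nr \<Longrightarrow> cmod (S a l / S l l) \<le> 1"
    "\<And>b. l \<le> b \<Longrightarrow> b < n \<Longrightarrow> cmod (S l b) \<le> 2 ^ n + 1" "l = p \<Longrightarrow> l \<le> b \<Longrightarrow> b < n \<Longrightarrow> cmod (S l b) \<le> \<sigma>"
proof -
  define x where "x = (if l < p then 1/2 else \<sigma> / 2)"
  have x0: "0 < x" using \<sigma> by (simp add: x_def)
  have piv: "x \<le> cmod (S l l)"
  proof -
    define c where "c = lb_ctr p \<sigma> l (l, l)"
    have "cmod (S l l - c) \<le> lb_rad p \<epsilon> \<sigma> l" using st[of l l] ln unfolding c_def by simp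
    moreover have "cmod c \<le> cmod (S l l - c) + cmod (S l l)"
      using norm_triangle_ineq4[of "S l l" "S l l - c"] by simp
    moreover have "x + lb_rad p \<epsilon> \<sigma> l \<le> cmod c"
    proof (cases "l < p")
      case True
      then show ?thesis using \<epsilon> unfolding x_def c_def lb_ctr_def lb_rad_def by simp
    next
      case False
      then have "c = complex_of_real (3 / 4 * \<sigma>)" using ln unfolding c_def lb_ctr_def by simp
      then have "cmod c = 3 / 4 * \<sigma>" using \<sigma> by (simp only: norm_of_real)
      then show ?thesis using False unfolding x_def lb_rad_def by simp
    qed
    ultimately show ?thesis by linarith
  qed
  then show "S l l \<noteq> 0" using x0 by auto
  have xrad: "lb_rad p \<epsilon> \<sigma> l \<le> x" using \<epsilon> \<sigma> unfolding lb_rad_def x_def by auto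
  show "cmod (S a l / S l l) \<le> 1" if "l < a" "a < nr" for a
  proof -
    have "cmod (S a l) \<le> lb_rad p \<epsilon> \<sigma> l" 
    proof -
      have "lb_ctr p \<sigma> l (a, l) = 0" using that by (auto simp: lb_ctr_def)
      then show ?thesis using st[of a l] that ln by simp
    qed
    then have "cmod (S a l) \<le> cmod (S l l)" using piv xrad by linarith
    then show ?thesis using piv x0 by (simp add: norm_divide divide_le_eq)
  qed
  show "cmod (S l b) \<le> 2 ^ n + 1" if "l \<le> b" "b < n" for b
  proof -
    have "cmod (S l b - lb_ctr p \<sigma> l (l, b)) \<le> lb_rad p \<epsilon> \<sigma> l" using st[of l b] that ln by simp
    moreover have "lb_rad p \<epsilon> \<sigma> l \<le> 1" using \<epsilon> \<sigma> by (simp add: lb_rad_def)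
    moreover have "cmod (lb_ctr p \<sigma> l (l, b)) \<le> 2 ^ n"
      using that \<sigma> by (intro lb_ctr_le) auto
    ultimately show ?thesis
      using norm_triangle_ineq[of "S l b - lb_ctr p \<sigma> l (l, b)" "lb_ctr p \<sigma> l (l, b)"] by simp
  qed
  show "cmod (S l b) \<le> \<sigma>" if "l = p" "l \<le> b" "b < n"
  proof -
    have "cmod (S l b - lb_ctr p \<sigma> l (l, b)) \<le> \<sigma> / 4" using st[of l b] that ln by (simp add: lb_rad_def)
    moreover have "cmod (lb_ctr p \<sigma> l (l, b)) \<le> 3 / 4 * \<sigma>"
      using that \<sigma> by (intro lb_ctr_le_scale) auto
    ultimately show ?thesis
      using norm_triangle_ineq[of "S l b - lb_ctr p \<sigma> l (l, b)" "lb_ctr p \<sigma> l (l, b)"] by simp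
  qed
qed

text \<open>An unseen entry starts at its padding value 0, and each step moves it by a multiplier of
  modulus at most 1 times a row entry of at most \<open>2 ^ n + 1\<close>. This controls the centres
  in \<open>stage_event_ge\<close>.\<close>

lemma elim_event_center_bound:
  assumes \<epsilon>: "0 < \<epsilon>" "\<epsilon> \<le> 1/2" and \<sigma>: "0 < \<sigma>" "\<sigma> \<le> 1" and n: "n \<le> nr" "p < n" "L \<le> Suc p"
    and x: "x \<in> elim_event nr n (diag_order n) (\<lambda>_. True) (lb_ctr p \<sigma>) (lb_rad p \<epsilon> \<sigma>) L"
    and ab: "L \<le> a" "a < nr" "L \<le> b" "b < n"
  shows "cmod (gauss_elim (ext0 (ibox nr n (diag_order n) L) x) (diag_order n) L a b) \<le> real n * (2 ^ n + 1)"
proof -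
  define S where "S = gauss_elim (ext0 (ibox nr n (diag_order n) L) x) (diag_order n)"
  have "l \<le> L \<Longrightarrow> cmod (S l a b) \<le> real l * (2 ^ n + 1)" for l
  proof (induction l)
    case 0
    have "(a, b) \<notin> ibox nr n (diag_order n) L" using ab n by (simp add: ibox_def cross_diag)
    then show ?case by (simp add: S_def ext0_def)
  next
    case (Suc l)
    have ln: "l < n" "l \<le> p" using Suc.prems n by auto
    have st: "cmod (S l a b - lb_ctr p \<sigma> l (a, b)) \<le> lb_rad p \<epsilon> \<sigma> l"
      if "a < nr" "b < n" "l \<le> a" "l \<le> b" "a = l \<or> b = l" for a b
    proof -
      have "(a, b) \<in> ibox nr n (diag_order n) (Suc l) - ibox nr n (diag_order n) l"
        unfolding stage_diag[OF ln(1)] using that by simp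
      then show ?thesis
        using x Suc_le_lessD[OF Suc.prems] unfolding elim_event_def S_def mem_Collect_eq by (metis fst_conv snd_conv)
    qed
    note sb = stage_bounds[of \<epsilon> \<sigma> l n nr p "S l", OF \<epsilon> \<sigma> ln(1) n(1) ln(2) st]
    have "cmod (S l a l / S l l l) \<le> 1" "cmod (S l l b) \<le> 2 ^ n + 1"
      using sb(2)[of a] sb(3)[of b] ab Suc.prems by auto
    then have "cmod (S l a l / S l l l * S l l b) \<le> 1 * (2 ^ n + 1)"
      unfolding norm_mult by (intro mult_mono) auto
    moreover have "S (Suc l) a b = S l a b - S l a l / S l l l * S l l b"
      unfolding S_def using gauss_elim_diag_Suc[OF ln(1)] by simp
    moreover have "cmod (S l a b) \<le> real l * (2 ^ n + 1)" using Suc by simp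
    ultimately have "cmod (S (Suc l) a b) \<le> real l * (2 ^ n + 1) + 1 * (2 ^ n + 1)"
      by (simp only:) (rule order.trans[OF norm_triangle_ineq4 add_mono])
    then show ?case by (simp add: algebra_simps)
  qed
  from this[of L] have "cmod (S L a b) \<le> real L * (2 ^ n + 1)" by simp
  also have "\<dots> \<le> real n * (2 ^ n + 1)" using n by (intro mult_right_mono) auto
  finally show ?thesis unfolding S_def .
qed

text \<open>The first \<open>p\<close> stages have windows of fixed size and cost only a constant.
  Stage \<open>p\<close> costs \<open>\<sigma>\<^sup>2\<close> for each of its entries, and every
  entry of the remaining block costs \<open>\<tau>\<^sup>2\<close>.\<close>

lemma good_channel_prob:
  assumes \<epsilon>: "0 < \<epsilon>" "\<epsilon> \<le> 1/2" and n: "n \<le> nr" "p < n"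
  shows "\<exists>c>0. \<forall>\<sigma> \<tau>. 0 < \<sigma> \<longrightarrow> \<sigma> \<le> 1 \<longrightarrow> 0 \<le> \<tau> \<longrightarrow> \<tau> \<le> 1 \<longrightarrow>
    (\<exists>E\<in>sets (gauss_mat nr n). (\<forall>h\<in>E. good_channel nr n p \<epsilon> \<sigma> \<tau> (to_mat h)) \<and>
       ennreal (c * ((\<sigma>\<^sup>2) ^ (nr + n - 2 * p - 1) * (\<tau>\<^sup>2) ^ ((nr - p - 1) * (n - p - 1)))) \<le> emeasure (gauss_mat nr n) E)"
proof -
  define \<pi> where "\<pi> = diag_order n"
  have po: "\<pi> \<in> pivot_orders nr n" unfolding \<pi>_def by (rule diag_order_pivot[OF n(1)])
  \<comment> \<open>Bound on the translations plus bound on the window centres.\<close>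
  define G where "G = real n * (2 ^ n + 1) + 2 ^ n"
  define g where "g = gauss_lb G"
  have g: "0 < g" unfolding g_def by (rule gauss_lb_pos)
  define N1 where "N1 = nr + n - 2 * p - 1"
  define N2 where "N2 = (nr - p - 1) * (n - p - 1)"
  \<comment> \<open>The 16 comes from the radius \<open>\<sigma> / 4\<close> of stage
    \<open>p\<close>.\<close>
  define c where "c = (\<Prod>l<p. (g * \<epsilon>\<^sup>2) ^ (nr + n - 2 * l - 1)) * (g / 16) ^ N1 * g ^ N2"
  have c: "0 < c" unfolding c_def using g \<epsilon> by (intro mult_pos_pos prod_pos zero_less_power) auto
  have "\<exists>E\<in>sets (gauss_mat nr n). (\<forall>h\<in>E. good_channel nr n p \<epsilon> \<sigma> \<tau> (to_mat h)) \<and>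
       ennreal (c * ((\<sigma>\<^sup>2) ^ N1 * (\<tau>\<^sup>2) ^ N2)) \<le> emeasure (gauss_mat nr n) E"
    if \<sigma>: "0 < \<sigma>" "\<sigma> \<le> 1" and \<tau>: "0 \<le> \<tau>" "\<tau> \<le> 1" for \<sigma> \<tau>
  proof -
    define Ev where "Ev = elim_event nr n \<pi> (\<lambda>_. True) (lb_ctr p \<sigma>) (lb_rad p \<epsilon> \<sigma>)"
    define I where "I = ibox nr n \<pi>"
    have ctr: "cmod (lb_ctr p \<sigma> l e) \<le> 2 ^ n" if "snd e < n" for l e
      using that \<sigma> by (intro lb_ctr_le) auto
    have cen: "cmod (gauss_elim (ext0 (I L) x) \<pi> L (fst e) (snd e)) \<le> real n * (2 ^ n + 1)"
      if "L \<le> Suc p" "x \<in> Ev L" "e \<in> {..<nr} \<times> {..<n} - I L" for L x e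
    proof -
      have "L \<le> fst e" "L \<le> snd e" "fst e < nr" "snd e < n"
        using that(1,3) n unfolding I_def ibox_def \<pi>_def by (auto simp: cross_diag)
      then show ?thesis
        using that elim_event_center_bound[OF \<epsilon> \<sigma> n(1,2), of L x "fst e" "snd e"]
        unfolding I_def Ev_def \<pi>_def by auto
    qed
    have meas: "(\<lambda>x. gauss_elim (ext0 (I L) x) \<pi> L (fst j) (snd j)) \<in> borel_measurable (gaussP (I L))" for L j
      by (intro gauss_elim_measurable ext0_measurable)
    have Evs: "Ev L \<in> sets (gaussP (I L))" if "L \<le> n" for L
      unfolding Ev_def I_def by (rule elim_event_sets[OF po that])
    have rad: "0 \<le> lb_rad p \<epsilon> \<sigma> l" "lb_rad p \<epsilon> \<sigma> l \<le> 1" for l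
      using \<epsilon> \<sigma> by (auto simp: lb_rad_def)
    have lower: "L \<le> Suc p \<Longrightarrow> ennreal (\<Prod>l<L. (g * (lb_rad p \<epsilon> \<sigma> l)\<^sup>2) ^ (nr + n - 2 * l - 1)) \<le> emeasure (gaussP (I L)) (Ev L)" for L
    proof (induction L)
      case 0
      interpret P: prob_space "gaussP (I 0)" by (rule prob_space_gaussP)
      have "Ev 0 = space (gaussP (I 0))" unfolding Ev_def I_def elim_event_def by auto
      then show ?case using P.emeasure_space_1 by simp
    next
      case (Suc L)
      define J where "J = I (Suc L) - I L"
      have Ln: "L < n" "L \<le> n" using Suc.prems n by auto
      have U: "I (Suc L) = I L \<union> J" unfolding J_def I_def using ibox_mono[of L "Suc L" nr n \<pi>] by auto
      have fin: "finite (I L)" "finite J" "I L \<inter> J = {}"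
        using finite_ibox unfolding I_def J_def by auto
      have eq: "Ev (Suc L) = stage_event (I L) J (Ev L) (\<lambda>e x. gauss_elim (ext0 (I L) x) \<pi> L (fst e) (snd e)) (lb_ctr p \<sigma> L) (\<lambda>_. lb_rad p \<epsilon> \<sigma> L)"
        unfolding Ev_def elim_event_Suc[OF po Ln(1)] J_def I_def by (simp only: if_True)
      have cJ: "card J = nr + n - 2 * L - 1" unfolding J_def I_def by (rule card_stage[OF po Ln(1) n(1)])
      have "emeasure (gaussP (I L)) (Ev L) * ennreal (\<Prod>j\<in>J. gauss_lb G * (lb_rad p \<epsilon> \<sigma> L)\<^sup>2) \<le>
          emeasure (gaussP (I L \<union> J)) (stage_event (I L) J (Ev L) (\<lambda>e x. gauss_elim (ext0 (I L) x) \<pi> L (fst e) (snd e)) (lb_ctr p \<sigma> L) (\<lambda>_. lb_rad p \<epsilon> \<sigma> L))"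
      proof (rule stage_event_ge[OF fin Evs[OF Ln(2)] meas rad])
        fix j x assume j: "j \<in> J" and x: "x \<in> Ev L"
        have jb: "j \<in> {..<nr} \<times> {..<n} - I L" using j unfolding J_def I_def ibox_def by auto
        have "cmod (lb_ctr p \<sigma> L j) \<le> 2 ^ n" using jb by (intro ctr) auto
        moreover have "cmod (gauss_elim (ext0 (I L) x) \<pi> L (fst j) (snd j)) \<le> real n * (2 ^ n + 1)"
          using Suc.prems x jb by (intro cen) auto
        ultimately show "cmod (lb_ctr p \<sigma> L j - gauss_elim (ext0 (I L) x) \<pi> L (fst j) (snd j)) \<le> G"
          unfolding G_def using norm_triangle_ineq4[of "lb_ctr p \<sigma> L j" "gauss_elim (ext0 (I L) x) \<pi> L (fst j) (snd j)"] by linarith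
      qed
      moreover have "ennreal (\<Prod>l<Suc L. (g * (lb_rad p \<epsilon> \<sigma> l)\<^sup>2) ^ (nr + n - 2 * l - 1))
         = ennreal (\<Prod>l<L. (g * (lb_rad p \<epsilon> \<sigma> l)\<^sup>2) ^ (nr + n - 2 * l - 1)) * ennreal (\<Prod>j\<in>J. gauss_lb G * (lb_rad p \<epsilon> \<sigma> L)\<^sup>2)"
        unfolding prod_constant cJ g_def[symmetric] prod.lessThan_Suc using g
        by (intro ennreal_mult prod_nonneg) auto
      moreover have "\<dots> \<le> emeasure (gaussP (I L)) (Ev L) * ennreal (\<Prod>j\<in>J. gauss_lb G * (lb_rad p \<epsilon> \<sigma> L)\<^sup>2)"
        using Suc by (intro mult_right_mono) auto
      ultimately show ?case unfolding U eq by (simp only:)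
    qed
    define J where "J = {..<nr} \<times> {..<n} - I (Suc p)"
    have Jiff: "(a, b) \<in> J \<longleftrightarrow> p < a \<and> a < nr \<and> p < b \<and> b < n" for a b
    proof -
      have "(a, b) \<in> cross \<pi> (Suc p) \<longleftrightarrow> a < Suc p \<or> b < Suc p"
        unfolding \<pi>_def using n by (intro cross_diag) simp
      then show ?thesis unfolding J_def I_def ibox_def by auto
    qed
    have fin: "finite (I (Suc p))" "finite J" "I (Suc p) \<inter> J = {}"
      using finite_ibox unfolding I_def J_def by auto
    have U: "I (Suc p) \<union> J = {..<nr} \<times> {..<n}" unfolding J_def I_def ibox_def by auto
    \<comment> \<open>All entries outside the first \<open>p + 1\<close> crosses are treated
      together as one final stage with centre 0 and radius \<open>\<tau>\<close>.\<close>
    define E where "E = stage_event (I (Suc p)) J (Ev (Suc p)) (\<lambda>e x. gauss_elim (ext0 (I (Suc p)) x) \<pi> (Suc p) (fst e) (snd e)) (\<lambda>_. 0) (\<lambda>_. \<tau>)"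
    have pn: "Suc p \<le> n" using n by simp
    have "emeasure (gaussP (I (Suc p))) (Ev (Suc p)) * ennreal (\<Prod>j\<in>J. gauss_lb G * \<tau>\<^sup>2) \<le> emeasure (gaussP (I (Suc p) \<union> J)) E"
      unfolding E_def
    proof (rule stage_event_ge[OF fin Evs[OF pn] meas \<tau>])
      fix j x assume j: "j \<in> J" and x: "x \<in> Ev (Suc p)"
      have "cmod (gauss_elim (ext0 (I (Suc p)) x) \<pi> (Suc p) (fst j) (snd j)) \<le> real n * (2 ^ n + 1)"
        using x j unfolding J_def by (intro cen) auto
      then have "cmod (gauss_elim (ext0 (I (Suc p)) x) \<pi> (Suc p) (fst j) (snd j)) \<le> G"
        unfolding G_def by (rule order.trans) simp
      then show "cmod (0 - gauss_elim (ext0 (I (Suc p)) x) \<pi> (Suc p) (fst j) (snd j)) \<le> G"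
        by (simp only: diff_0 norm_minus_cancel)
    qed
    moreover have "card J = N2"
    proof -
      have "J = {Suc p..<nr} \<times> {Suc p..<n}"
        by (auto simp: Jiff)
      then show ?thesis unfolding N2_def by (simp add: card_cartesian_product)
    qed
    ultimately have e1: "emeasure (gaussP (I (Suc p))) (Ev (Suc p)) * ennreal ((g * \<tau>\<^sup>2) ^ N2) \<le> emeasure (gauss_mat nr n) E"
      unfolding U gauss_mat_def g_def prod_constant by simp
    have "c * ((\<sigma>\<^sup>2) ^ N1 * (\<tau>\<^sup>2) ^ N2) = (\<Prod>l<Suc p. (g * (lb_rad p \<epsilon> \<sigma> l)\<^sup>2) ^ (nr + n - 2 * l - 1)) * (g * \<tau>\<^sup>2) ^ N2"
    proof -
      have e1: "(\<Prod>l<p. (g * (lb_rad p \<epsilon> \<sigma> l)\<^sup>2) ^ (nr + n - 2 * l - 1)) = (\<Prod>l<p. (g * \<epsilon>\<^sup>2) ^ (nr + n - 2 * l - 1))"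
        by (intro prod.cong) (auto simp: lb_rad_def)
      have e2: "g * (lb_rad p \<epsilon> \<sigma> p)\<^sup>2 = g / 16 * \<sigma>\<^sup>2" by (simp add: lb_rad_def power_divide)
      show ?thesis
        unfolding c_def prod.lessThan_Suc N1_def[symmetric] e1 e2 power_mult_distrib[of "g / 16"] power_mult_distrib[of g "\<tau>\<^sup>2"]
        by (simp only: mult_ac)
    qed
    moreover have "0 \<le> (\<Prod>l<Suc p. (g * (lb_rad p \<epsilon> \<sigma> l)\<^sup>2) ^ (nr + n - 2 * l - 1))" "0 \<le> (g * \<tau>\<^sup>2) ^ N2"
      using g by (intro prod_nonneg zero_le_power ballI mult_nonneg_nonneg zero_le_power2; simp)+
    ultimately have "ennreal (c * ((\<sigma>\<^sup>2) ^ N1 * (\<tau>\<^sup>2) ^ N2)) = ennreal (\<Prod>l<Suc p. (g * (lb_rad p \<epsilon> \<sigma> l)\<^sup>2) ^ (nr + n - 2 * l - 1)) * ennreal ((g * \<tau>\<^sup>2) ^ N2)"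
      by (simp only: ennreal_mult)
    also have "\<dots> \<le> emeasure (gaussP (I (Suc p))) (Ev (Suc p)) * ennreal ((g * \<tau>\<^sup>2) ^ N2)"
      by (intro mult_right_mono lower) auto
    also note e1
    finally have prob: "ennreal (c * ((\<sigma>\<^sup>2) ^ N1 * (\<tau>\<^sup>2) ^ N2)) \<le> emeasure (gauss_mat nr n) E" .
    have Es: "E \<in> sets (gauss_mat nr n)"
      unfolding gauss_mat_def U[symmetric] E_def by (rule stage_event(1)[OF fin Evs[OF pn] meas])
    have good: "good_channel nr n p \<epsilon> \<sigma> \<tau> (to_mat h)" if hE: "h \<in> E" for h
    proof -
      have hEv: "restrict h (I (Suc p)) \<in> Ev (Suc p)"
        and hJ: "\<And>e. e \<in> J \<Longrightarrow> cmod (h e + gauss_elim (ext0 (I (Suc p)) (restrict h (I (Suc p)))) \<pi> (Suc p) (fst e) (snd e)) \<le> \<tau>"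
        using hE unfolding E_def stage_event_def by auto
      have loc: "gauss_elim (to_mat h) \<pi> l a b - h (a, b) = gauss_elim (ext0 (I (Suc p)) (restrict h (I (Suc p)))) \<pi> l a b - ext0 (I (Suc p)) (restrict h (I (Suc p))) a b"
        if "l \<le> Suc p" "a < nr" "b < n" for l a b
      proof -
        have "gauss_elim (to_mat h) \<pi> l a b = gauss_elim (ext0 ({..<nr} \<times> {..<n}) h) \<pi> l a b"
          using that n by (intro gauss_elim_to_mat[OF po]) auto
        moreover have "gauss_elim (ext0 ({..<nr} \<times> {..<n}) h) \<pi> l a b - ext0 ({..<nr} \<times> {..<n}) h a b =
           gauss_elim (ext0 (I (Suc p)) (restrict h (I (Suc p)))) \<pi> l a b - ext0 (I (Suc p)) (restrict h (I (Suc p))) a b"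
        proof (rule gauss_elim_ext0)
          show "ibox nr n \<pi> l \<subseteq> {..<nr} \<times> {..<n}" unfolding ibox_def by auto
          show "ibox nr n \<pi> l \<subseteq> I (Suc p)" unfolding I_def using that by (intro ibox_mono) auto
          then show "\<And>e. e \<in> ibox nr n \<pi> l \<Longrightarrow> h e = restrict h (I (Suc p)) e" by auto
          show "\<And>l'. l' < l \<Longrightarrow> fst (\<pi> l') < nr \<and> snd (\<pi> l') < n"
            using that n po unfolding pivot_orders_def by auto
        qed (use that in auto)
        ultimately show ?thesis using that by (simp add: ext0_def)
      qed
      show ?thesis
        unfolding good_channel_def \<pi>_def[symmetric]
      proof (intro conjI allI impI)
        fix l a b assume l: "l \<le> p" and ab: "a < nr" "b < n" "l \<le> a" "l \<le> b" "a = l \<or> b = l"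
        have ln: "l < n" using l n by simp
        have e: "(a, b) \<in> ibox nr n \<pi> (Suc l) - ibox nr n \<pi> l"
          unfolding \<pi>_def stage_diag[OF ln] using ab by simp
        then have eI: "(a, b) \<in> I (Suc p)" unfolding I_def using ibox_mono[of "Suc l" "Suc p" nr n \<pi>] l by auto
        have "l < Suc p" using l by simp
        then have "cmod (gauss_elim (ext0 (I (Suc p)) (restrict h (I (Suc p)))) \<pi> l (fst (a, b)) (snd (a, b)) - lb_ctr p \<sigma> l (a, b)) \<le> lb_rad p \<epsilon> \<sigma> l"
          using hEv e unfolding Ev_def elim_event_def I_def[symmetric] by blast
        then show "cmod (gauss_elim (to_mat h) \<pi> l a b - lb_ctr p \<sigma> l (a, b)) \<le> lb_rad p \<epsilon> \<sigma> l"
          using loc[of l a b] l ab eI by (simp add: ext0_def)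
      next
        fix a b assume ab: "a < nr" "b < n" "p < a" "p < b"
        then have e: "(a, b) \<in> J" by (simp add: Jiff)
        then have "(a, b) \<notin> I (Suc p)" unfolding J_def by simp
        then have "gauss_elim (to_mat h) \<pi> (Suc p) a b = h (a, b) + gauss_elim (ext0 (I (Suc p)) (restrict h (I (Suc p)))) \<pi> (Suc p) a b"
          using loc[of "Suc p" a b] ab by (simp add: ext0_def diff_eq_eq add.commute del: gauss_elim.simps)
        then show "cmod (gauss_elim (to_mat h) \<pi> (Suc p) a b) \<le> \<tau>" using hJ[OF e] by simp
      qed
    qed
    show ?thesis using Es good prob by blast
  qed
  then show ?thesis using c unfolding N1_def N2_def by blast
qed

text \<open>The counterpart, for an arbitrary order with nonzero pivots, of the zeros that complete
  pivoting yields.\<close>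

lemma gauss_elim_cross_zero:
  assumes "\<And>l'. l' < l \<Longrightarrow> pivot H \<pi> l' \<noteq> 0" "(a, b) \<in> cross \<pi> l"
  shows "gauss_elim H \<pi> l a b = 0"
  using assms
proof (induction l arbitrary: a b)
  case 0
  then show ?case by (simp add: cross_def)
next
  case (Suc l)
  define S where "S = gauss_elim H \<pi> l"
  define i j where "i = fst (\<pi> l)" and "j = snd (\<pi> l)"
  have piv: "S i j \<noteq> 0" using Suc.prems(1)[of l] unfolding pivot_def S_def i_def j_def by simp
  have IH: "S a b = 0" if "(a, b) \<in> cross \<pi> l" for a b
    unfolding S_def using Suc.IH Suc.prems(1) that by simp
  have "S a b - S a j * S i b / S i j = 0"
  proof (cases "(a, b) \<in> cross \<pi> l")
    case True
    then obtain l' where "l' < l" "a = fst (\<pi> l') \<or> b = snd (\<pi> l')" unfolding cross_def by auto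
    then have "(a, j) \<in> cross \<pi> l \<or> (i, b) \<in> cross \<pi> l" unfolding cross_def by auto
    then show ?thesis using IH[OF True] IH[of a j] IH[of i b] by auto
  next
    case False
    then have "a = i \<or> b = j" using Suc.prems(2) by (simp add: cross_Suc i_def j_def)
    then show ?thesis using piv by auto
  qed
  then show ?case by (simp add: schur_def S_def i_def j_def)
qed

lemma mvec_sum:
  "mvec n S (\<lambda>b. \<Sum>j\<in>J. X j b * z j) a = (\<Sum>j\<in>J. mvec n S (X j) a * z j)"
  unfolding mvec_def sum_distrib_left sum_distrib_right
  by (subst sum.swap) (simp add: mult.assoc)

lemma norm_mvec_le:
  assumes "\<And>b. b < n \<Longrightarrow> cmod (S a b) \<le> s" "\<And>b. b < n \<Longrightarrow> cmod (x b) \<le> t" "0 \<le> s"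
  shows "cmod (mvec n S x a) \<le> real n * (s * t)"
proof -
  have "cmod (mvec n S x a) \<le> (\<Sum>b<n. s * t)"
    unfolding mvec_def using assms by (intro sum_norm_le) (simp only: norm_mult, rule mult_mono, auto)
  then show ?thesis by simp
qed

text \<open>With the entries outside \<open>B\<close> prescribed, those in \<open>B\<close> are
  solved for so that the first \<open>p\<close> triangular rows annihilate the column. What remains
  of \<open>H x\<close> is one linear functional of the prescribed entries, of size
  \<open>\<sigma>\<close>, up to an error of order \<open>\<tau>\<close>.\<close>

lemma kernel_extension:
  assumes n: "n \<le> nr" "p < n"
  obtains \<epsilon> K :: real where "0 < \<epsilon>" "\<epsilon> \<le> 1/2" "0 \<le> K"
    "\<And>H \<sigma> \<tau> B. good_channel nr n p \<epsilon> \<sigma> \<tau> H \<Longrightarrow> 0 < \<sigma> \<Longrightarrow> \<sigma> \<le> 1 \<Longrightarrow> 0 \<le> \<tau> \<Longrightarrow> B \<subseteq> {..<n} \<Longrightarrow> card B = p \<Longrightarrow>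
      \<exists>lam. (\<forall>j. cmod (lam j) \<le> K * \<sigma>) \<and> (\<forall>z \<beta>. 0 \<le> \<beta> \<longrightarrow> (\<forall>j<n. cmod (z j) \<le> \<beta>) \<longrightarrow>
        (\<exists>x. (\<forall>j<n. j \<notin> B \<longrightarrow> x j = z j) \<and> (\<forall>a<nr. cmod (mvec n H x a) \<le> cmod (\<Sum>j\<in>{..<n} - B. lam j * z j) + K * \<tau> * \<beta>)))"
proof -
  define F where "F = {B. B \<subseteq> {..<n} \<and> card B = p}"
  have "finite F" unfolding F_def by (rule finite_subset[of _ "Pow {..<n}"]) auto
  moreover have "finite B \<and> card B = p" if "B \<in> F" for B using that finite_subset[of B "{..<n}"] unfolding F_def by auto
  ultimately obtain \<epsilon> K0 where \<epsilon>: "0 < \<epsilon>" "\<epsilon> \<le> 1/2" and K0: "0 \<le> K0" and sol: "\<And>B. B \<in> F \<Longrightarrow> solvable_near p B \<epsilon> K0"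
    using solvable_near_uniform[of F p] by blast
  define K1 where "K1 = K0 * (2 ^ n + 1) + 1"
  have K1: "1 \<le> K1" unfolding K1_def using K0 by simp
  define K where "K = real n * (real n * K1)"
  have n1: "1 \<le> real n" using n by simp
  have K: "0 \<le> K" unfolding K_def using K1 by simp
  have KK: "real n * K1 \<le> K" unfolding K_def using mult_right_mono[of 1 "real n" "real n * K1"] n1 K1 by simp
  show ?thesis
  proof (rule that[OF \<epsilon> K])
    fix H \<sigma> \<tau> B
    assume good: "good_channel nr n p \<epsilon> \<sigma> \<tau> H" and \<sigma>: "0 < \<sigma>" "\<sigma> \<le> 1" and \<tau>: "0 \<le> \<tau>" and B: "B \<subseteq> {..<n}" "card B = p"
    define S where "S = gauss_elim H (diag_order n)"
    define J where "J = {..<n} - B"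
    have finB: "finite B" "finite J" using B finite_subset unfolding J_def by auto
    have Bn: "b < n" if "b \<in> B" for b using B that by auto
    have st: "cmod (S l a b - lb_ctr p \<sigma> l (a, b)) \<le> lb_rad p \<epsilon> \<sigma> l"
      if "l \<le> p" "a < nr" "b < n" "l \<le> a" "l \<le> b" "a = l \<or> b = l" for l a b
      using good that unfolding good_channel_def S_def by blast
    have piv: "S l l l \<noteq> 0" and ratio: "\<And>a. l < a \<Longrightarrow> a < nr \<Longrightarrow> cmod (S l a l / S l l l) \<le> 1"
      and row: "\<And>b. l \<le> b \<Longrightarrow> b < n \<Longrightarrow> cmod (S l l b) \<le> 2 ^ n + 1"
      and rowp: "\<And>b. l = p \<Longrightarrow> l \<le> b \<Longrightarrow> b < n \<Longrightarrow> cmod (S l l b) \<le> \<sigma>" if l: "l \<le> p" for l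
    proof -
      have ln: "l < n" using l n by simp
      note s = stage_bounds[of \<epsilon> \<sigma> l n nr p "S l", OF \<epsilon> \<sigma> ln n(1) l st[OF l]]
      show "S l l l \<noteq> 0" by (rule s(1))
      show "cmod (S l a l / S l l l) \<le> 1" if "l < a" "a < nr" for a by (rule s(2)[OF _ _ _ _ _ that])
      show "cmod (S l l b) \<le> 2 ^ n + 1" if "l \<le> b" "b < n" for b by (rule s(3)[OF _ _ _ _ _ that])
      show "cmod (S l l b) \<le> \<sigma>" if "l = p" "l \<le> b" "b < n" for b by (rule s(4)[OF _ _ _ _ _ that])
    qed
    have pivot: "pivot H (diag_order n) l \<noteq> 0" if "l < Suc p" for l
    proof -
      have "diag_order n l = (l, l)" using that n by (simp add: diag_order_def)
      then show ?thesis using piv[of l] that unfolding pivot_def S_def by simp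
    qed
    have zero: "S l a b = 0" if "l \<le> Suc p" "a < l \<or> b < l" for l a b
      unfolding S_def
    proof (rule gauss_elim_cross_zero)
      show "(a, b) \<in> cross (diag_order n) l" using that n by (subst cross_diag) auto
    qed (use pivot that in auto)
    have Ub: "cmod (S l l b) \<le> 2 ^ n + 1" if "l \<le> p" "b < n" for l b
      using row[of l b] zero[of l l b] that n by (cases "l \<le> b") auto
    have Unear: "cmod (S l l b - of_nat (b choose l)) \<le> \<epsilon>" if "l < p" "b < n" for l b
    proof (cases "l \<le> b")
      case True
      then have "cmod (S l l b - lb_ctr p \<sigma> l (l, b)) \<le> lb_rad p \<epsilon> \<sigma> l" using that n by (intro st) auto
      then show ?thesis using that by (simp add: lb_ctr_def lb_rad_def)
    next
      case False
      then have "S l l b = 0" using that by (intro zero) auto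
      then show ?thesis using False \<epsilon> by (simp add: binomial_eq_0)
    qed
    have "\<exists>x. (\<forall>l<p. (\<Sum>b\<in>B. S l l b * x b) = - S l l j) \<and> (\<forall>b\<in>B. cmod (x b) \<le> K0 * (2 ^ n + 1))" if j: "j \<in> J" for j
    proof -
      have "B \<in> F" using B by (simp add: F_def)
      then have "solvable_near p B \<epsilon> K0" by (rule sol)
      moreover have "\<forall>l<p. \<forall>b\<in>B. cmod (S l l b - of_nat (b choose l)) \<le> \<epsilon>" using Unear Bn by simp
      moreover have "\<forall>l<p. cmod (- S l l j) \<le> 2 ^ n + 1" using Ub j unfolding J_def by simp
      moreover have "(0::real) \<le> 2 ^ n + 1" by simp
      ultimately show ?thesis
        unfolding solvable_near_def by (elim allE[of _ "\<lambda>l b. S l l b"] allE[of _ "\<lambda>l. - S l l j"]) blast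
    qed
    then have "\<forall>j\<in>J. \<exists>x. (\<forall>l<p. (\<Sum>b\<in>B. S l l b * x b) = - S l l j) \<and> (\<forall>b\<in>B. cmod (x b) \<le> K0 * (2 ^ n + 1))" by simp
    from bchoice[OF this] obtain y where y: "\<And>j l. j \<in> J \<Longrightarrow> l < p \<Longrightarrow> (\<Sum>b\<in>B. S l l b * y j b) = - S l l j"
      and yb: "\<And>j b. j \<in> J \<Longrightarrow> b \<in> B \<Longrightarrow> cmod (y j b) \<le> K0 * (2 ^ n + 1)" by auto
    \<comment> \<open>The unit vector at \<open>j\<close> outside \<open>B\<close>, corrected on
      \<open>B\<close> so that the first \<open>p\<close> triangular rows send it to 0.\<close>
    define X where "X j b = (if b \<in> B then y j b else if b = j then 1 else 0)" for j b
    have Xb: "cmod (X j b) \<le> K1" if "j \<in> J" for j b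
      using yb[OF that, of b] K0 unfolding X_def K1_def by auto
    have ker: "mvec n (S l) (X j) l = 0" if "j \<in> J" "l < p" for j l
    proof -
      have "mvec n (S l) (X j) l = (\<Sum>b\<in>insert j B. S l l b * X j b)"
        unfolding mvec_def using that B finB by (intro sum.mono_neutral_right) (auto simp: X_def J_def)
      also have "\<dots> = S l l j + (\<Sum>b\<in>B. S l l b * y j b)"
        using that finB unfolding J_def by (subst sum.insert) (auto simp: X_def)
      finally show ?thesis using y[OF that] by simp
    qed
    define lam where "lam j = (if j \<in> J then mvec n (S p) (X j) p else 0)" for j
    have Sp: "cmod (S p p b) \<le> \<sigma>" if "b < n" for b
      using rowp[of p b] zero[of p p b] that n \<sigma> by (cases "p \<le> b") auto
    have lamb: "cmod (lam j) \<le> K * \<sigma>" for j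
    proof (cases "j \<in> J")
      case True
      then have "cmod (lam j) \<le> real n * (\<sigma> * K1)"
        unfolding lam_def using norm_mvec_le[of n "S p" p \<sigma> "X j" K1] Sp Xb \<sigma> by simp
      also have "\<dots> = real n * K1 * \<sigma>" by simp
      also have "\<dots> \<le> K * \<sigma>" using KK \<sigma> by (intro mult_right_mono) auto
      finally show ?thesis .
    next
      case False
      then show ?thesis using K \<sigma> by (simp add: lam_def)
    qed
    have ext: "\<exists>x. (\<forall>j<n. j \<notin> B \<longrightarrow> x j = z j) \<and> (\<forall>a<nr. cmod (mvec n H x a) \<le> cmod (\<Sum>j\<in>{..<n} - B. lam j * z j) + K * \<tau> * \<beta>)"
      if \<beta>: "0 \<le> \<beta>" and z: "\<forall>j<n. cmod (z j) \<le> \<beta>" for z \<beta>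
    proof -
      define x where "x = (\<lambda>b. \<Sum>j\<in>J. X j b * z j)"
      define \<phi> where "\<phi> = (\<Sum>j\<in>{..<n} - B. lam j * z j)"
      have xJ: "x j = z j" if "j < n" "j \<notin> B" for j
      proof -
        have "x j = (\<Sum>i\<in>J. if j = i then z i else 0)"
          unfolding x_def X_def using that by (intro sum.cong) auto
        then show ?thesis using that finB by (simp add: J_def)
      qed
      have xb: "cmod (x b) \<le> real n * (K1 * \<beta>)" for b
      proof -
        have "cmod (x b) \<le> (\<Sum>j\<in>J. K1 * \<beta>)"
          unfolding x_def using Xb z K1 by (intro sum_norm_le) (simp only: norm_mult, rule mult_mono, auto simp: J_def)
        also have "\<dots> = real (card J) * (K1 * \<beta>)" by simp
        also have "\<dots> \<le> real n * (K1 * \<beta>)"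
          using card_mono[of "{..<n}" J] K1 \<beta> unfolding J_def by (intro mult_right_mono) auto
        finally show ?thesis .
      qed
      have kerx: "mvec n (S l) x l = 0" if "l < p" for l
        unfolding x_def mvec_sum using ker that by simp
      \<comment> \<open>Row \<open>l\<close> at stage \<open>l\<close> annihilates \<open>x\<close>,
        so the elimination step subtracts nothing from the image.\<close>
      have Hx: "l \<le> p \<Longrightarrow> mvec n (S l) x a = mvec n H x a" for l a
      proof (induction l)
        case 0
        then show ?case by (simp add: S_def)
      next
        case (Suc l)
        then have "diag_order n l = (l, l)" using n by (simp add: diag_order_def)
        then show ?case using Suc kerx[of l] by (simp add: S_def mvec_schur)
      qed
      have \<phi>: "mvec n (S p) x p = \<phi>"
        unfolding x_def mvec_sum \<phi>_def J_def[symmetric] by (intro sum.cong) (auto simp: lam_def)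
      have "cmod (mvec n H x a) \<le> cmod \<phi> + K * \<tau> * \<beta>" if a: "a < nr" for a
      proof -
        have R: "0 \<le> K * \<tau> * \<beta>" using K \<tau> \<beta> by simp
        consider "a < p" | "a = p" | "p < a" by linarith
        then show ?thesis
        proof cases
          case 1
          have "mvec n (S p) x a = 0" unfolding mvec_def using zero[of p a] 1 by (intro sum.neutral) auto
          then show ?thesis using Hx[of p a] R by simp
        next
          case 2
          then show ?thesis using Hx[of p p] \<phi> R by simp
        next
          case 3
          have dp: "diag_order n p = (p, p)" using n by (simp add: diag_order_def)
          \<comment> \<open>Below row \<open>p\<close> the image is a multiple of
            \<open>\<phi>\<close> with factor of modulus at most 1, plus the image under the next
            Schur complement, whose entries are at most \<open>\<tau>\<close>.\<close>
          have eq: "mvec n (S p) x a = mvec n (S (Suc p)) x a + S p a p / S p p p * \<phi>"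
            unfolding \<phi>[symmetric] by (simp add: S_def mvec_schur dp)
          have "cmod (S (Suc p) a b) \<le> \<tau>" if "b < n" for b
          proof (cases "p < b")
            case True
            then show ?thesis using good a 3 that unfolding good_channel_def S_def by blast
          next
            case False
            then have "S (Suc p) a b = 0" by (intro zero) auto
            then show ?thesis using \<tau> by simp
          qed
          then have "cmod (mvec n (S (Suc p)) x a) \<le> real n * (\<tau> * (real n * (K1 * \<beta>)))"
            using xb \<tau> by (intro norm_mvec_le) auto
          also have "\<dots> = K * \<tau> * \<beta>" unfolding K_def by simp
          finally have "cmod (mvec n (S (Suc p)) x a) \<le> K * \<tau> * \<beta>" .
          moreover have "cmod (S p a p / S p p p * \<phi>) \<le> 1 * cmod \<phi>"
            unfolding norm_mult using ratio[of p a] 3 a n by (intro mult_right_mono) auto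
          ultimately have "cmod (mvec n (S p) x a) \<le> cmod \<phi> + K * \<tau> * \<beta>"
            unfolding eq using norm_triangle_ineq[of "mvec n (S (Suc p)) x a" "S p a p / S p p p * \<phi>"] by linarith
          then show ?thesis using Hx[of p a] by simp
        qed
      qed
      then show ?thesis unfolding \<phi>_def using xJ by blast
    qed
    show "\<exists>lam. (\<forall>j. cmod (lam j) \<le> K * \<sigma>) \<and> (\<forall>z \<beta>. 0 \<le> \<beta> \<longrightarrow> (\<forall>j<n. cmod (z j) \<le> \<beta>) \<longrightarrow>
        (\<exists>x. (\<forall>j<n. j \<notin> B \<longrightarrow> x j = z j) \<and> (\<forall>a<nr. cmod (mvec n H x a) \<le> cmod (\<Sum>j\<in>{..<n} - B. lam j * z j) + K * \<tau> * \<beta>)))"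
      using lamb ext by (intro exI[of _ lam]) blast
  qed
qed

section \<open>Lower bound for the level counts\<close>

text \<open>Elements whose fibre has less than half the average size fill at most half of
  \<open>T\<close>, because there are at most \<open>card L\<close> such fibres.\<close>

lemma pigeonhole_half:
  assumes "finite T" "finite L" "\<And>t. t \<in> T \<Longrightarrow> key t \<in> L"
  shows "card T \<le> 2 * card {t'\<in>T. card T \<le> 2 * card L * card {t\<in>T. key t = key t'}}"
proof (cases "L = {}")
  case True
  then have "T = {}" using assms(3) by auto
  then show ?thesis by simp
next
  case False
  define bad where "bad = {t'\<in>T. 2 * card L * card {t\<in>T. key t = key t'} < card T}"
  define good where "good = {t'\<in>T. card T \<le> 2 * card L * card {t\<in>T. key t = key t'}}"
  have fb: "finite bad" "finite good" unfolding bad_def good_def using assms(1) by auto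
  have T: "card T = card good + card bad"
    using fb by (subst card_Un_disjoint[symmetric]) (auto simp: good_def bad_def intro!: arg_cong[where f = card])
  have *: "2 * card L * card {t'\<in>bad. key t' = k} \<le> card T" for k
  proof (cases "{t'\<in>bad. key t' = k} = {}")
    case True
    show ?thesis unfolding True by simp
  next
    case ne: False
    then obtain t' where t': "t' \<in> bad" "key t' = k" by auto
    have "card {t'\<in>bad. key t' = k} \<le> card {t\<in>T. key t = k}"
      using assms(1) by (intro card_mono) (auto simp: bad_def)
    then have "2 * card L * card {t'\<in>bad. key t' = k} \<le> 2 * card L * card {t\<in>T. key t = k}" by simp
    also have "\<dots> < card T" using t' unfolding bad_def by auto
    finally show ?thesis by simp
  qed
  have "bad = (\<Union>k\<in>L. {t'\<in>bad. key t' = k})" using assms(3) unfolding bad_def by auto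
  then have "card bad \<le> (\<Sum>k\<in>L. card {t'\<in>bad. key t' = k})" using card_UN_le[OF assms(2)] by metis
  then have "2 * card L * card bad \<le> (\<Sum>k\<in>L. 2 * card L * card {t'\<in>bad. key t' = k})"
    by (simp add: sum_distrib_left[symmetric])
  also have "\<dots> \<le> (\<Sum>k\<in>L. card T)" by (intro sum_mono *)
  finally have "card L * (2 * card bad) \<le> card L * card T" by (simp add: mult_ac)
  moreover have "0 < card L" using False assms(2) by (simp add: card_gt_0_iff)
  ultimately have "2 * card bad \<le> card T" by simp
  then show ?thesis using T unfolding good_def by simp
qed

definition cut :: "nat \<Rightarrow> (nat \<Rightarrow> complex) \<Rightarrow> nat \<Rightarrow> complex" where
  "cut K s = (\<lambda>q. if K \<le> q then s q else 0)"

lemma card_level_set: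
  assumes "K \<le> \<kappa>"
  shows "card (level_set \<kappa> eta K) = card (QAM eta) ^ (\<kappa> - K)"
proof -
  have "bij_betw (\<lambda>t. restrict t {K..<\<kappa>}) (level_set \<kappa> eta K) (Pi\<^sub>E {K..<\<kappa>} (\<lambda>_. QAM eta))"
  proof (rule bij_betw_byWitness[where f' = "\<lambda>f j. if j \<in> {K..<\<kappa>} then f j else 0"])
    show "\<forall>t\<in>level_set \<kappa> eta K. (\<lambda>j. if j \<in> {K..<\<kappa>} then restrict t {K..<\<kappa>} j else 0) = t"
      unfolding level_set_def by (auto simp: fun_eq_iff)
    show "\<forall>f\<in>Pi\<^sub>E {K..<\<kappa>} (\<lambda>_. QAM eta). restrict (\<lambda>j. if j \<in> {K..<\<kappa>} then f j else 0) {K..<\<kappa>} = f"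
      by (auto simp: fun_eq_iff PiE_def extensional_def)
    show "(\<lambda>t. restrict t {K..<\<kappa>}) ` level_set \<kappa> eta K \<subseteq> Pi\<^sub>E {K..<\<kappa>} (\<lambda>_. QAM eta)"
      unfolding level_set_def by auto
    show "(\<lambda>f j. if j \<in> {K..<\<kappa>} then f j else 0) ` Pi\<^sub>E {K..<\<kappa>} (\<lambda>_. QAM eta) \<subseteq> level_set \<kappa> eta K"
      unfolding level_set_def by auto
  qed
  then have "card (level_set \<kappa> eta K) = card (Pi\<^sub>E {K..<\<kappa>} (\<lambda>_. QAM eta))" by (rule bij_betw_same_card)
  then show ?thesis using assms by (simp add: card_PiE)
qed

lemma cut_symvecs: "s \<in> symvecs \<kappa> eta \<Longrightarrow> cut K s \<in> level_set \<kappa> eta K"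
  unfolding symvecs_def level_set_def cut_def by auto

text \<open>The head symbols are free, so a proportion of tails is the same proportion of
  transmitted vectors.\<close>

lemma card_cut_vimage:
  assumes K: "K \<le> \<kappa>" and G: "G \<subseteq> level_set \<kappa> eta K"
  shows "card {s \<in> symvecs \<kappa> eta. cut K s \<in> G} = card G * card (symvecs K eta)"
proof -
  have "bij_betw (\<lambda>(t, f). \<lambda>q. if K \<le> q then t q else f q) (G \<times> symvecs K eta) {s \<in> symvecs \<kappa> eta. cut K s \<in> G}"
  proof (rule bij_betw_byWitness[where f' = "\<lambda>s. (cut K s, \<lambda>q. if q < K then s q else 0)"])
    show "\<forall>a\<in>G \<times> symvecs K eta. (cut K ((\<lambda>(t, f). \<lambda>q. if K \<le> q then t q else f q) a), \<lambda>q. if q < K then (\<lambda>(t, f). \<lambda>q. if K \<le> q then t q else f q) a q else 0) = a"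
    proof
      fix a assume a: "a \<in> G \<times> symvecs K eta"
      obtain t f where tf: "a = (t, f)" "t \<in> level_set \<kappa> eta K" "f \<in> symvecs K eta" using a G by (cases a) auto
      have "t q = 0" if "q < K" for q using tf(2) that unfolding level_set_def by auto
      moreover have "f q = 0" if "\<not> q < K" for q using tf(3) that unfolding symvecs_def by auto
      ultimately show "(cut K ((\<lambda>(t, f). \<lambda>q. if K \<le> q then t q else f q) a), \<lambda>q. if q < K then (\<lambda>(t, f). \<lambda>q. if K \<le> q then t q else f q) a q else 0) = a"
        unfolding tf(1) cut_def by (auto simp: fun_eq_iff)
    qed
    show "\<forall>s\<in>{s \<in> symvecs \<kappa> eta. cut K s \<in> G}. (\<lambda>(t, f). \<lambda>q. if K \<le> q then t q else f q) (cut K s, \<lambda>q. if q < K then s q else 0) = s"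
      unfolding cut_def by (auto simp: fun_eq_iff)
    show "(\<lambda>(t, f). \<lambda>q. if K \<le> q then t q else f q) ` (G \<times> symvecs K eta) \<subseteq> {s \<in> symvecs \<kappa> eta. cut K s \<in> G}"
    proof
      fix s assume "s \<in> (\<lambda>(t, f). \<lambda>q. if K \<le> q then t q else f q) ` (G \<times> symvecs K eta)"
      then obtain t f where s: "s = (\<lambda>q. if K \<le> q then t q else f q)" and t: "t \<in> G" and f: "f \<in> symvecs K eta" by auto
      have tl: "t \<in> level_set \<kappa> eta K" using t G by auto
      have "cut K s = t" using tl unfolding s cut_def level_set_def by (auto simp: fun_eq_iff)
      moreover have "s \<in> symvecs \<kappa> eta"
        using tl f K unfolding s symvecs_def level_set_def by auto
      ultimately show "s \<in> {s \<in> symvecs \<kappa> eta. cut K s \<in> G}" using t by simp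
    qed
    show "(\<lambda>s. (cut K s, \<lambda>q. if q < K then s q else 0)) ` {s \<in> symvecs \<kappa> eta. cut K s \<in> G} \<subseteq> G \<times> symvecs K eta"
      using K unfolding symvecs_def by auto
  qed
  then have "card (G \<times> symvecs K eta) = card {s \<in> symvecs \<kappa> eta. cut K s \<in> G}" by (rule bij_betw_same_card)
  then show ?thesis by (simp add: card_cartesian_product)
qed

context
  fixes n nr :: nat and A :: "nat \<Rightarrow> cmat" and ord :: "nat \<Rightarrow> nat"
  assumes n_pos: "1 \<le> n" and nr_ge: "n \<le> nr"
    and A_inv: "\<forall>l<n. invertible_cmat n (A l)"
    and ord_bij: "bij_betw ord {..<n} {..<n}"
begin

text \<open>The rows of column \<open>c\<close> whose threads lie in the first \<open>p\<close>
  blocks, that is, the entries left open by the symbols from index \<open>n * p\<close> on.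
  Thread-wise ordering makes their number equal to \<open>p\<close> in every column.\<close>

definition head_rows :: "nat \<Rightarrow> nat \<Rightarrow> nat set" where
  "head_rows p c = {j. j < n \<and> inv_into {..<n} ord (thread_of n j c) < p}"

lemma card_head_rows:
  assumes "c < n" "p \<le> n"
  shows "card (head_rows p c) = p"
proof -
  have n0: "0 < n" using n_pos by simp
  note inv_ord = inv_ord[OF n_pos nr_ge A_inv ord_bij]
  define f where "f j = inv_into {..<n} ord (thread_of n j c)" for j
  have "inj_on f {..<n}"
  proof (rule inj_onI)
    fix j j' assume j: "j \<in> {..<n}" "j' \<in> {..<n}" "f j = f j'"
    then have "ord (f j) = ord (f j')" by simp
    then have "thread_of n j c = thread_of n j' c"
      unfolding f_def using inv_ord(2)[OF thread_of_less[OF n0]] by simp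
    then show "j = j'" using inj_onD[OF inj_on_thread_of[OF assms(1)]] j by auto
  qed
  moreover have "f ` {..<n} \<subseteq> {..<n}"
    unfolding f_def using inv_ord(1)[OF thread_of_less[OF n0]] by auto
  ultimately have bij: "bij_betw f {..<n} {..<n}"
    by (simp add: bij_betw_def endo_inj_surj)
  have "f ` head_rows p c = {..<p}"
  proof
    show "f ` head_rows p c \<subseteq> {..<p}" unfolding head_rows_def f_def by auto
    show "{..<p} \<subseteq> f ` head_rows p c"
    proof
      fix b assume b: "b \<in> {..<p}"
      then have "b \<in> f ` {..<n}" using bij assms(2) unfolding bij_betw_def by auto
      then show "b \<in> f ` head_rows p c" using b unfolding head_rows_def f_def by auto
    qed
  qed
  moreover have "inj_on f (head_rows p c)"
    using bij unfolding bij_betw_def head_rows_def by (auto elim: inj_on_subset)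
  ultimately show ?thesis by (metis card_image card_lessThan)
qed

text \<open>Entries in the head rows may be replaced by arbitrary complex numbers: the new matrix is
  still the codeword of a complex vector, and its tail is unchanged. So a small image of the
  modified matrix certifies that the tail lies in the sphere.\<close>

lemma sd_count_ge_fiber:
  assumes inj: "inj_cmat nr n H" and \<theta>: "\<theta> \<noteq> 0" and p: "p < n"
    and W: "(\<Sum>c<n. \<Sum>i<nr. (cmod (W i c))\<^sup>2) \<le> xi2 / 4"
    and F: "F \<subseteq> level_set (n * n) eta (n * p)"
    and close: "\<And>t. t \<in> F \<Longrightarrow> \<exists>X. (\<forall>c<n. \<forall>j<n. j \<notin> head_rows p c \<longrightarrow> X j c = codeword n A ord 1 (\<lambda>q. t q - cut (n * p) s q) j c)
        \<and> \<theta>\<^sup>2 * (\<Sum>c<n. \<Sum>i<nr. (cmod (mvec n H (\<lambda>j. X j c) i))\<^sup>2) \<le> xi2 / 4"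
  shows "card F \<le> sd_count n nr A ord \<theta> eta xi2 H W s"
proof -
  define m where "m = nr * n"
  define \<kappa> where "\<kappa> = n * n"
  define M where "M = chan_mat n nr A ord \<theta> H"
  define y where "y = vec_of nr (received n nr A ord \<theta> H W s)"
  have injM: "inj_cmat m \<kappa> M"
    unfolding M_def m_def \<kappa>_def by (rule inj_chan_mat[OF n_pos nr_ge A_inv ord_bij inj \<theta>])
  obtain Q R where QR: "is_thin_QR m \<kappa> M Q R" using gram_schmidt_thin_QR[OF injM] by blast
  note inv_ord = inv_ord[OF n_pos nr_ge A_inv ord_bij]
  have n0: "0 < n" using n_pos by simp
  have Kk: "n * p \<le> \<kappa>" unfolding \<kappa>_def using p by simp
  have "F \<subseteq> {t \<in> level_set \<kappa> eta (n * p). qr_cost m \<kappa> Q R y (n * p) t \<le> xi2}"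
  proof
    fix t assume t: "t \<in> F"
    define u where "u = (\<lambda>q. t q - cut (n * p) s q)"
    obtain X where X: "\<And>c j. c < n \<Longrightarrow> j < n \<Longrightarrow> j \<notin> head_rows p c \<Longrightarrow> X j c = codeword n A ord 1 u j c"
      and Xs: "\<theta>\<^sup>2 * (\<Sum>c<n. \<Sum>i<nr. (cmod (mvec n H (\<lambda>j. X j c) i))\<^sup>2) \<le> xi2 / 4"
      using close[OF t] unfolding u_def[symmetric] by auto
    obtain B :: "nat \<Rightarrow> cmat" where
      B: "\<And>u b i. b < n \<Longrightarrow> i < n \<Longrightarrow> u (b * n + i) = (\<Sum>j<n. B b i j * codeword n A ord 1 u j (thread_col n (ord b) j))"
      and surj: "\<And>X. \<exists>u. \<forall>j<n. \<forall>c<n. codeword n A ord 1 u j c = X j c"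
      by (rule codeword_left_inverse[OF n_pos nr_ge A_inv ord_bij]) (rule that, assumption+)
    obtain v where v: "\<And>j c. j < n \<Longrightarrow> c < n \<Longrightarrow> codeword n A ord 1 v j c = X j c" using surj[of X] by auto
    \<comment> \<open>A block from \<open>p\<close> on is recovered from its own thread, and none of
      that thread's entries lies in the head rows.\<close>
    have vu: "v q = u q" if q: "n * p \<le> q" "q < \<kappa>" for q
    proof -
      define b where "b = q div n"
      define i where "i = q mod n"
      have bi: "b < n" "i < n" "q = b * n + i" "p \<le> b"
        using q n0 unfolding b_def i_def \<kappa>_def
        by (auto simp: less_mult_imp_div_less less_eq_div_iff_mult_less_eq mult.commute)
      have "B b i j * codeword n A ord 1 v j (thread_col n (ord b) j) = B b i j * codeword n A ord 1 u j (thread_col n (ord b) j)" if j: "j < n" for j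
      proof -
        define c where "c = thread_col n (ord b) j"
        have c: "c < n" unfolding c_def by (rule thread_col_less[OF n0])
        have "thread_of n j c = ord b" unfolding c_def using bi j inv_ord(4) by (intro thread_of_thread_col) auto
        then have "j \<notin> head_rows p c" unfolding head_rows_def using inv_ord(3)[OF bi(1)] bi(4) by simp
        then show ?thesis unfolding c_def[symmetric] using v[OF j c] X[OF c j] by simp
      qed
      then have "(\<Sum>j<n. B b i j * codeword n A ord 1 v j (thread_col n (ord b) j)) = (\<Sum>j<n. B b i j * codeword n A ord 1 u j (thread_col n (ord b) j))"
        by (intro sum.cong) auto
      then show ?thesis unfolding bi(3) using B[OF bi(1,2), of v] B[OF bi(1,2), of u] by simp
    qed
    have "qr_cost m \<kappa> Q R y (n * p) t \<le> xi2"
    proof (rule qr_cost_le_of_close[OF QR Kk, where s = s and w = "\<lambda>p. W (p mod nr) (p div nr)" and v = v])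
      show "y q = mvec \<kappa> M s q + W (q mod nr) (q div nr)" if "q < m" for q
        unfolding y_def M_def \<kappa>_def using that unfolding m_def by (rule received_eq[OF n_pos nr_ge A_inv ord_bij])
      have "(\<Sum>q<m. (cmod (W (q mod nr) (q div nr)))\<^sup>2) = (\<Sum>c<n. \<Sum>i<nr. (cmod (W i c))\<^sup>2)"
        unfolding m_def using n_pos nr_ge sum_mod_div[of nr "\<lambda>i c. (cmod (W i c))\<^sup>2" n] by simp
      then show "(\<Sum>q<m. (cmod (W (q mod nr) (q div nr)))\<^sup>2) \<le> xi2 / 4" using W by simp
      show "v j = t j - s j" if "n * p \<le> j" "j < \<kappa>" for j
        using vu[OF that] that(1) unfolding u_def cut_def by simp
      have "(\<Sum>q<m. (cmod (mvec \<kappa> M v q))\<^sup>2) = \<theta>\<^sup>2 * (\<Sum>c<n. \<Sum>i<nr. (cmod (mvec n H (\<lambda>j. codeword n A ord 1 v j c) i))\<^sup>2)"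
        unfolding m_def \<kappa>_def M_def by (rule chan_mat_norm[OF n_pos nr_ge A_inv ord_bij])
      also have "(\<Sum>c<n. \<Sum>i<nr. (cmod (mvec n H (\<lambda>j. codeword n A ord 1 v j c) i))\<^sup>2) = (\<Sum>c<n. \<Sum>i<nr. (cmod (mvec n H (\<lambda>j. X j c) i))\<^sup>2)"
        unfolding mvec_def using v by (intro sum.cong arg_cong[where f = "\<lambda>z. (cmod z)\<^sup>2"] refl) auto
      finally show "(\<Sum>q<m. (cmod (mvec \<kappa> M v q))\<^sup>2) \<le> xi2 / 4" using Xs by simp
    qed
    then show "t \<in> {t \<in> level_set \<kappa> eta (n * p). qr_cost m \<kappa> Q R y (n * p) t \<le> xi2}"
      using t F unfolding \<kappa>_def by auto
  qed
  then have "card F \<le> card {t \<in> level_set \<kappa> eta (n * p). qr_cost m \<kappa> Q R y (n * p) t \<le> xi2}"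
    using finite_level_set by (intro card_mono) auto
  \<comment> \<open>Levels are indexed by tail length, so a cut at \<open>n * p\<close> is the
    summand with index \<open>\<kappa> - n * p\<close>.\<close>
  also have "\<dots> = card {t \<in> level_set \<kappa> eta (\<kappa> - (\<kappa> - n * p)). qr_cost m \<kappa> Q R y (\<kappa> - (\<kappa> - n * p)) t \<le> xi2}"
    using Kk by simp
  also have "\<dots> \<le> qr_count m \<kappa> Q R y eta xi2"
  proof -
    have "\<kappa> - n * p \<in> {1..\<kappa>}" using p n0 unfolding \<kappa>_def by (auto simp: Suc_le_eq)
    then show ?thesis
      unfolding qr_count_def
      using member_le_sum[of "\<kappa> - n * p" "{1..\<kappa>}" "\<lambda>k. card {t \<in> level_set \<kappa> eta (\<kappa> - k). qr_cost m \<kappa> Q R y (\<kappa> - k) t \<le> xi2}"] by simp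
  qed
  also have "\<dots> = sd_count n nr A ord \<theta> eta xi2 H W s"
    unfolding m_def \<kappa>_def y_def
    using sd_count_eq_qr_count[OF n_pos nr_ge A_inv ord_bij inj \<theta> QR[unfolded m_def \<kappa>_def M_def]] by simp
  finally show ?thesis .
qed

end

context
  fixes n nr :: nat and A :: "nat \<Rightarrow> cmat" and ord :: "nat \<Rightarrow> nat"
  assumes n_pos: "1 \<le> n" and nr_ge: "n \<le> nr"
    and A_inv: "\<forall>l<n. invertible_cmat n (A l)"
    and ord_bij: "bij_betw ord {..<n} {..<n}"
begin

text \<open>Tails are sorted by the unit cell that contains their \<open>n\<close> functionals. Two
  tails in the same cell have a difference whose kernel extension has a small image, so all tails in
  the cell of the transmitted one are counted. By pigeonhole such a cell is typically well
  filled.\<close>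

lemma sd_count_lower:
  assumes p: "p < n"
  obtains \<epsilon> C0 :: real where "0 < \<epsilon>" "\<epsilon> \<le> 1/2" "1 \<le> C0"
    "\<And>H \<theta> eta xi2 \<sigma> \<tau> W. good_channel nr n p \<epsilon> \<sigma> \<tau> H \<Longrightarrow> 0 < \<sigma> \<Longrightarrow> \<sigma> \<le> 1 \<Longrightarrow> 0 \<le> \<tau> \<Longrightarrow> inj_cmat nr n H \<Longrightarrow>
      \<theta> \<noteq> 0 \<Longrightarrow> 1 \<le> eta \<Longrightarrow> (\<Sum>c<n. \<Sum>i<nr. (cmod (W i c))\<^sup>2) \<le> xi2 / 4 \<Longrightarrow> C0 * (1 + \<bar>\<theta>\<bar> * \<tau> * eta)\<^sup>2 \<le> xi2 \<Longrightarrow>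
      card (symvecs (n * n) eta) \<le> 2 * card {s \<in> symvecs (n * n) eta.
        (eta\<^sup>2) ^ (n * (n - p)) / (2 * ((C0 * (1 + \<bar>\<theta>\<bar> * \<sigma> * eta))\<^sup>2) ^ n) \<le> real (sd_count n nr A ord \<theta> eta xi2 H W s)}"
proof -
  obtain \<epsilon> K :: real where \<epsilon>: "0 < \<epsilon>" "\<epsilon> \<le> 1/2" and K: "0 \<le> K"
    and ker: "\<And>H \<sigma> \<tau> B. good_channel nr n p \<epsilon> \<sigma> \<tau> H \<Longrightarrow> 0 < \<sigma> \<Longrightarrow> \<sigma> \<le> 1 \<Longrightarrow> 0 \<le> \<tau> \<Longrightarrow> B \<subseteq> {..<n} \<Longrightarrow> card B = p \<Longrightarrow>
      \<exists>lam. (\<forall>j. cmod (lam j) \<le> K * \<sigma>) \<and> (\<forall>z \<beta>. 0 \<le> \<beta> \<longrightarrow> (\<forall>j<n. cmod (z j) \<le> \<beta>) \<longrightarrow>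
        (\<exists>x. (\<forall>j<n. j \<notin> B \<longrightarrow> x j = z j) \<and> (\<forall>a<nr. cmod (mvec n H x a) \<le> cmod (\<Sum>j\<in>{..<n} - B. lam j * z j) + K * \<tau> * \<beta>)))"
    by (rule kernel_extension[OF nr_ge p]) (rule that, assumption+)
  define CA where "CA = (\<Sum>l<n. \<Sum>j<n. \<Sum>i<n. cmod (A l j i))"
  have CA0: "0 \<le> CA" unfolding CA_def by (intro sum_nonneg) auto
  have CA: "cmod (A l j i) \<le> CA" if "l < n" "j < n" "i < n" for l j i
  proof -
    have "cmod (A l j i) \<le> (\<Sum>i<n. cmod (A l j i))" using that by (intro member_le_sum) auto
    also have "\<dots> \<le> (\<Sum>j<n. \<Sum>i<n. cmod (A l j i))" using that by (intro member_le_sum) (auto intro!: sum_nonneg)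
    also have "\<dots> \<le> CA" unfolding CA_def using that by (intro member_le_sum) (auto intro!: sum_nonneg)
    finally show ?thesis .
  qed
  \<comment> \<open>\<open>c1\<close> bounds the functionals, with symbols of modulus at most
    \<open>2 * eta\<close>; \<open>c2\<close> bounds the error term, with symbol differences of
    modulus at most \<open>4 * eta\<close>.\<close>
  define c1 where "c1 = real n * (K * (real n * CA * 2))"
  define c2 where "c2 = K * (real n * CA * 4)"
  have c12: "0 \<le> c1" "0 \<le> c2" unfolding c1_def c2_def using K CA0 by auto
  \<comment> \<open>The part \<open>2 + 2 * c1\<close> dominates the number of integers in
    \<open>[-\<Gamma>, \<Gamma>]\<close>. The last summand makes the total image of a column system
    at most a quarter of the squared radius.\<close>
  define C0 where "C0 = 2 + 2 * c1 + 4 * (real n * real nr) * (2 + c2)\<^sup>2"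
  have C0: "1 \<le> C0" "2 + 2 * c1 \<le> C0" "4 * (real n * real nr) * (2 + c2)\<^sup>2 \<le> C0"
    unfolding C0_def using c12 by (auto intro!: add_nonneg_nonneg add_increasing2)
  show ?thesis
  proof (rule that[OF \<epsilon> C0(1)])
    fix H W :: cmat and \<theta> eta xi2 \<sigma> \<tau> :: real
    assume good: "good_channel nr n p \<epsilon> \<sigma> \<tau> H" and \<sigma>: "0 < \<sigma>" "\<sigma> \<le> 1" and \<tau>: "0 \<le> \<tau>" and inj: "inj_cmat nr n H"
      and \<theta>: "\<theta> \<noteq> 0" and eta: "1 \<le> eta" and W: "(\<Sum>c<n. \<Sum>i<nr. (cmod (W i c))\<^sup>2) \<le> xi2 / 4"
      and xi: "C0 * (1 + \<bar>\<theta>\<bar> * \<tau> * eta)\<^sup>2 \<le> xi2"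
    define B where "B c = head_rows n ord p c" for c
    have Bc: "B c \<subseteq> {..<n}" "card (B c) = p" if "c < n" for c
      using card_head_rows[OF n_pos nr_ge A_inv ord_bij that, of p] p unfolding B_def
      by (auto simp: head_rows_def[OF n_pos nr_ge A_inv ord_bij])
    have "\<forall>c\<in>{..<n}. \<exists>lam. (\<forall>j. cmod (lam j) \<le> K * \<sigma>) \<and> (\<forall>z \<beta>. 0 \<le> \<beta> \<longrightarrow> (\<forall>j<n. cmod (z j) \<le> \<beta>) \<longrightarrow>
        (\<exists>x. (\<forall>j<n. j \<notin> B c \<longrightarrow> x j = z j) \<and> (\<forall>a<nr. cmod (mvec n H x a) \<le> cmod (\<Sum>j\<in>{..<n} - B c. lam j * z j) + K * \<tau> * \<beta>)))"
      using ker[OF good \<sigma> \<tau> Bc] by simp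
    from bchoice[OF this] obtain lam where lamext: "\<forall>c\<in>{..<n}. (\<forall>j. cmod (lam c j) \<le> K * \<sigma>) \<and> (\<forall>z \<beta>. 0 \<le> \<beta> \<longrightarrow> (\<forall>j<n. cmod (z j) \<le> \<beta>) \<longrightarrow>
        (\<exists>x. (\<forall>j<n. j \<notin> B c \<longrightarrow> x j = z j) \<and> (\<forall>a<nr. cmod (mvec n H x a) \<le> cmod (\<Sum>j\<in>{..<n} - B c. lam c j * z j) + K * \<tau> * \<beta>)))"
      by (elim exE) rule
    have lam: "cmod (lam c j) \<le> K * \<sigma>" if "c < n" for c j using lamext that by simp
    have ext: "\<exists>x. (\<forall>j<n. j \<notin> B c \<longrightarrow> x j = z j) \<and> (\<forall>a<nr. cmod (mvec n H x a) \<le> cmod (\<Sum>j\<in>{..<n} - B c. lam c j * z j) + K * \<tau> * \<beta>)"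
      if c: "c < n" and \<beta>: "0 \<le> \<beta>" and z: "\<forall>j<n. cmod (z j) \<le> \<beta>" for c z \<beta>
    proof -
      have "c \<in> {..<n}" using c by simp
      from conjunct2[OF bspec[OF lamext this]] \<beta> z show ?thesis by (elim allE[of _ z] allE[of _ \<beta>]) (elim impE, assumption+)
    qed
    define \<kappa> where "\<kappa> = n * n"
    define T where "T = level_set \<kappa> eta (n * p)"
    \<comment> \<open>The one component of column \<open>c\<close>, scaled by
      \<open>\<theta>\<close>, that is not negligible after kernel extension.\<close>
    define v where "v t c = complex_of_real \<theta> * (\<Sum>j\<in>{..<n} - B c. lam c j * codeword n A ord 1 t j c)" for t c
    define \<Gamma> where "\<Gamma> = c1 * (\<bar>\<theta>\<bar> * \<sigma> * eta)"
    have \<Gamma>0: "0 \<le> \<Gamma>" unfolding \<Gamma>_def using c12 \<sigma> eta by simp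
    have tq: "cmod (t q) \<le> 2 * eta" if "t \<in> T" for t q
    proof (cases "n * p \<le> q \<and> q < \<kappa>")
      case True
      then have "t q \<in> QAM eta" using that unfolding T_def level_set_def by auto
      then show ?thesis by (rule QAM_norm_le)
    next
      case False
      then have "t q = 0" using that unfolding T_def level_set_def by auto
      then show ?thesis using eta by simp
    qed
    have vb: "cmod (v t c) \<le> \<Gamma>" if t: "t \<in> T" and c: "c < n" for t c
    proof -
      have cw: "cmod (codeword n A ord 1 t j c) \<le> real n * CA * (2 * eta)" for j
        by (rule codeword_norm_le[OF CA CA0 tq[OF t]])
      have "cmod (\<Sum>j\<in>{..<n} - B c. lam c j * codeword n A ord 1 t j c) \<le> (\<Sum>j\<in>{..<n} - B c. K * \<sigma> * (real n * CA * (2 * eta)))"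
        using lam[OF c] cw K \<sigma> by (intro sum_norm_le) (simp only: norm_mult, rule mult_mono, auto)
      also have "\<dots> \<le> real n * (K * \<sigma> * (real n * CA * (2 * eta)))"
      proof -
        have "card ({..<n} - B c) \<le> n" using card_mono[of "{..<n}" "{..<n} - B c"] by simp
        then show ?thesis using K \<sigma> CA0 eta unfolding sum_constant by (intro mult_right_mono) auto
      qed
      finally have "\<bar>\<theta>\<bar> * cmod (\<Sum>j\<in>{..<n} - B c. lam c j * codeword n A ord 1 t j c) \<le> \<bar>\<theta>\<bar> * (real n * (K * \<sigma> * (real n * CA * (2 * eta))))"
        by (intro mult_left_mono) auto
      also have "\<dots> = \<Gamma>" unfolding \<Gamma>_def c1_def by (simp add: mult_ac)
      finally show ?thesis unfolding v_def norm_mult by simp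
    qed
    define key where "key t = (\<lambda>c\<in>{..<n}. (\<lfloor>Re (v t c)\<rfloor>, \<lfloor>Im (v t c)\<rfloor>))" for t
    define L where "L = Pi\<^sub>E {..<n} (\<lambda>_. {\<lfloor>- \<Gamma>\<rfloor>..\<lfloor>\<Gamma>\<rfloor>} \<times> {\<lfloor>- \<Gamma>\<rfloor>..\<lfloor>\<Gamma>\<rfloor>})"
    have finL: "finite L" unfolding L_def by (intro finite_PiE) auto
    have finT: "finite T" unfolding T_def by (rule finite_level_set)
    have fl: "\<lfloor>x\<rfloor> \<in> {\<lfloor>- \<Gamma>\<rfloor>..\<lfloor>\<Gamma>\<rfloor>}" if "\<bar>x\<bar> \<le> \<Gamma>" for x
      using that by (auto intro!: floor_mono)
    have keyL: "key t \<in> L" if "t \<in> T" for t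
      unfolding key_def L_def
      by (intro restrict_PiE_iff[THEN iffD2] ballI SigmaI fl
        order.trans[OF abs_Re_le_cmod] order.trans[OF abs_Im_le_cmod] vb that) auto
    have cL: "real (card L) \<le> ((C0 * (1 + \<bar>\<theta>\<bar> * \<sigma> * eta))\<^sup>2) ^ n"
    proof -
      have "2 * \<Gamma> + 2 \<le> C0 * (1 + \<bar>\<theta>\<bar> * \<sigma> * eta)"
      proof -
        have "2 * \<Gamma> + 2 \<le> (2 + 2 * c1) * (1 + \<bar>\<theta>\<bar> * \<sigma> * eta)"
          unfolding \<Gamma>_def using c12 \<sigma> eta by (simp add: algebra_simps)
        also have "\<dots> \<le> C0 * (1 + \<bar>\<theta>\<bar> * \<sigma> * eta)"
          using C0 \<sigma> eta by (intro mult_right_mono) auto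
        finally show ?thesis .
      qed
      then have ci: "real (card {\<lfloor>- \<Gamma>\<rfloor>..\<lfloor>\<Gamma>\<rfloor>}) \<le> C0 * (1 + \<bar>\<theta>\<bar> * \<sigma> * eta)"
        using card_int_interval_le[OF \<Gamma>0] by linarith
      have "real (card L) = ((real (card {\<lfloor>- \<Gamma>\<rfloor>..\<lfloor>\<Gamma>\<rfloor>}))\<^sup>2) ^ n"
        unfolding L_def by (simp only: card_PiE finite_lessThan card_cartesian_product prod_constant card_lessThan of_nat_power of_nat_mult power2_eq_square)
      also have "\<dots> \<le> ((C0 * (1 + \<bar>\<theta>\<bar> * \<sigma> * eta))\<^sup>2) ^ n"
        using ci by (intro power_mono) auto
      finally show ?thesis .
    qed
    \<comment> \<open>Tails whose cell holds at least half of the average number of tails.\<close>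
    define good where "good = {t'\<in>T. card T \<le> 2 * card L * card {t\<in>T. key t = key t'}}"
    have half: "card T \<le> 2 * card good" unfolding good_def by (rule pigeonhole_half[OF finT finL keyL])
    have cT: "real (card T) \<ge> (eta\<^sup>2) ^ (n * (n - p))"
    proof -
      have "n * p \<le> \<kappa>" unfolding \<kappa>_def using p by simp
      moreover have "\<kappa> - n * p = n * (n - p)" unfolding \<kappa>_def by (simp add: diff_mult_distrib2)
      ultimately have "card T = card (QAM eta) ^ (n * (n - p))" unfolding T_def by (simp add: card_level_set)
      then show ?thesis using card_QAM_bounds(1)[OF eta] by (simp add: power_mono)
    qed
    have count: "(eta\<^sup>2) ^ (n * (n - p)) / (2 * ((C0 * (1 + \<bar>\<theta>\<bar> * \<sigma> * eta))\<^sup>2) ^ n) \<le> real (sd_count n nr A ord \<theta> eta xi2 H W s)"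
      if s: "s \<in> symvecs \<kappa> eta" "cut (n * p) s \<in> good" for s
    proof -
      define t' where "t' = cut (n * p) s"
      define F where "F = {t\<in>T. key t = key t'}"
      have t': "t' \<in> T" using s unfolding t'_def good_def by simp
      have "card F \<le> sd_count n nr A ord \<theta> eta xi2 H W s"
      proof (rule sd_count_ge_fiber[OF n_pos nr_ge A_inv ord_bij inj \<theta> p W])
        show "F \<subseteq> level_set (n * n) eta (n * p)" unfolding F_def T_def \<kappa>_def by auto
        fix t assume "t \<in> F"
        then have t: "t \<in> T" and kt: "key t = key t'" unfolding F_def by auto
        define z where "z c j = codeword n A ord 1 (\<lambda>q. t q - t' q) j c" for c j
        define \<beta> where "\<beta> = real n * CA * (4 * eta)"
        have \<beta>0: "0 \<le> \<beta>" unfolding \<beta>_def using CA0 eta by simp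
        have uq: "cmod (t q - t' q) \<le> 4 * eta" for q
          using norm_triangle_ineq4[of "t q" "t' q"] tq[OF t, of q] tq[OF t', of q] by linarith
        have zb: "cmod (z c j) \<le> \<beta>" for c j
          unfolding z_def \<beta>_def by (rule codeword_norm_le[OF CA CA0 uq])
        have "\<forall>c\<in>{..<n}. \<exists>x. (\<forall>j<n. j \<notin> B c \<longrightarrow> x j = z c j) \<and> (\<forall>a<nr. cmod (mvec n H x a) \<le> cmod (\<Sum>j\<in>{..<n} - B c. lam c j * z c j) + K * \<tau> * \<beta>)"
          using ext[OF _ \<beta>0] zb by simp
        from bchoice[OF this] obtain x where x: "\<And>c j. c < n \<Longrightarrow> j < n \<Longrightarrow> j \<notin> B c \<Longrightarrow> x c j = z c j"
          and xa: "\<And>c a. c < n \<Longrightarrow> a < nr \<Longrightarrow> cmod (mvec n H (x c) a) \<le> cmod (\<Sum>j\<in>{..<n} - B c. lam c j * z c j) + K * \<tau> * \<beta>"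
          by auto
        define \<omega> where "\<omega> = 2 + c2 * (\<bar>\<theta>\<bar> * \<tau> * eta)"
        have small: "\<bar>\<theta>\<bar> * cmod (mvec n H (x c) a) \<le> \<omega>" if c: "c < n" and a: "a < nr" for c a
        proof -
          have "key t c = key t' c" using kt by simp
          then have "\<lfloor>Re (v t c)\<rfloor> = \<lfloor>Re (v t' c)\<rfloor>" "\<lfloor>Im (v t c)\<rfloor> = \<lfloor>Im (v t' c)\<rfloor>"
            unfolding key_def using c by auto
          then have "\<bar>Re (v t c) - Re (v t' c)\<bar> \<le> 1" "\<bar>Im (v t c) - Im (v t' c)\<bar> \<le> 1" by linarith+
          then have "cmod (v t c - v t' c) \<le> 2" using cmod_le[of "v t c - v t' c"] by simp
          moreover have "v t c - v t' c = complex_of_real \<theta> * (\<Sum>j\<in>{..<n} - B c. lam c j * z c j)"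
            unfolding v_def z_def codeword_diff by (simp add: right_diff_distrib sum_subtractf)
          ultimately have "\<bar>\<theta>\<bar> * cmod (\<Sum>j\<in>{..<n} - B c. lam c j * z c j) \<le> 2" by (simp add: norm_mult)
          moreover have "\<bar>\<theta>\<bar> * cmod (mvec n H (x c) a) \<le> \<bar>\<theta>\<bar> * (cmod (\<Sum>j\<in>{..<n} - B c. lam c j * z c j) + K * \<tau> * \<beta>)"
            by (intro mult_left_mono xa c a) auto
          moreover have "\<bar>\<theta>\<bar> * (K * \<tau> * \<beta>) = c2 * (\<bar>\<theta>\<bar> * \<tau> * eta)"
            unfolding c2_def \<beta>_def by (simp add: mult_ac)
          ultimately show ?thesis unfolding \<omega>_def by (simp add: distrib_left)
        qed
        have "\<theta>\<^sup>2 * (\<Sum>c<n. \<Sum>i<nr. (cmod (mvec n H (\<lambda>j. x c j) i))\<^sup>2) = (\<Sum>c<n. \<Sum>i<nr. (\<bar>\<theta>\<bar> * cmod (mvec n H (x c) i))\<^sup>2)"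
          by (simp add: sum_distrib_left power_mult_distrib)
        also have "\<dots> \<le> (\<Sum>c<n. \<Sum>i<nr. \<omega>\<^sup>2)"
          using small by (intro sum_mono power_mono) auto
        also have "\<dots> = (real n * real nr) * \<omega>\<^sup>2" by simp
        also have "\<dots> \<le> (real n * real nr) * ((2 + c2) * (1 + \<bar>\<theta>\<bar> * \<tau> * eta))\<^sup>2"
        proof (intro mult_left_mono power_mono)
          show "\<omega> \<le> (2 + c2) * (1 + \<bar>\<theta>\<bar> * \<tau> * eta)"
            unfolding \<omega>_def using c12 \<tau> eta by (simp add: algebra_simps)
          show "0 \<le> \<omega>" unfolding \<omega>_def using c12 \<tau> eta by (intro add_nonneg_nonneg mult_nonneg_nonneg) auto
        qed auto
        also have "\<dots> = (4 * (real n * real nr) * (2 + c2)\<^sup>2) * (1 + \<bar>\<theta>\<bar> * \<tau> * eta)\<^sup>2 / 4"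
          by (simp add: power_mult_distrib)
        also have "\<dots> \<le> C0 * (1 + \<bar>\<theta>\<bar> * \<tau> * eta)\<^sup>2 / 4"
          using C0(3) by (intro divide_right_mono mult_right_mono) auto
        also have "\<dots> \<le> xi2 / 4" using xi by simp
        finally have "\<theta>\<^sup>2 * (\<Sum>c<n. \<Sum>i<nr. (cmod (mvec n H (\<lambda>j. x c j) i))\<^sup>2) \<le> xi2 / 4" .
        then show "\<exists>X. (\<forall>c<n. \<forall>j<n. j \<notin> head_rows n ord p c \<longrightarrow> X j c = codeword n A ord 1 (\<lambda>q. t q - cut (n * p) s q) j c)
          \<and> \<theta>\<^sup>2 * (\<Sum>c<n. \<Sum>i<nr. (cmod (mvec n H (\<lambda>j. X j c) i))\<^sup>2) \<le> xi2 / 4"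
          using x unfolding B_def z_def t'_def by (intro exI[of _ "\<lambda>j c. x c j"]) auto
      qed
      moreover have "card T \<le> 2 * card L * card F" using s(2) unfolding good_def F_def t'_def by simp
      then have "real (card T) \<le> 2 * real (card L) * real (card F)"
        by (metis of_nat_mono of_nat_mult of_nat_numeral)
      then have "(eta\<^sup>2) ^ (n * (n - p)) \<le> 2 * ((C0 * (1 + \<bar>\<theta>\<bar> * \<sigma> * eta))\<^sup>2) ^ n * real (card F)"
        using cT mult_right_mono[of "2 * real (card L)" "2 * ((C0 * (1 + \<bar>\<theta>\<bar> * \<sigma> * eta))\<^sup>2) ^ n" "real (card F)"] cL by linarith
      moreover have "0 < 2 * ((C0 * (1 + \<bar>\<theta>\<bar> * \<sigma> * eta))\<^sup>2) ^ n"
      proof -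
        have "0 < 1 + \<bar>\<theta>\<bar> * \<sigma> * eta" using \<sigma> eta by (intro add_pos_nonneg mult_nonneg_nonneg) auto
        then have "0 < C0 * (1 + \<bar>\<theta>\<bar> * \<sigma> * eta)" using C0(1) by simp
        then have "0 < ((C0 * (1 + \<bar>\<theta>\<bar> * \<sigma> * eta))\<^sup>2) ^ n" by (rule zero_less_power[OF zero_less_power])
        then show ?thesis by (rule mult_pos_pos[OF zero_less_numeral])
      qed
      ultimately have "(eta\<^sup>2) ^ (n * (n - p)) / (2 * ((C0 * (1 + \<bar>\<theta>\<bar> * \<sigma> * eta))\<^sup>2) ^ n) \<le> real (card F)"
        by (simp add: pos_divide_le_eq mult.commute)
      then show ?thesis using \<open>card F \<le> sd_count n nr A ord \<theta> eta xi2 H W s\<close> by linarith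
    qed
    have Kk: "n * p \<le> \<kappa>" unfolding \<kappa>_def using p by simp
    have gT: "good \<subseteq> level_set \<kappa> eta (n * p)" unfolding good_def T_def by auto
    have "symvecs \<kappa> eta = {s \<in> symvecs \<kappa> eta. cut (n * p) s \<in> T}"
      using cut_symvecs unfolding T_def by auto
    then have "card (symvecs \<kappa> eta) = card T * card (symvecs (n * p) eta)"
      using card_cut_vimage[OF Kk, of T eta] unfolding T_def by simp
    also have "\<dots> \<le> 2 * card good * card (symvecs (n * p) eta)" using half by simp
    also have "\<dots> = 2 * card {s \<in> symvecs \<kappa> eta. cut (n * p) s \<in> good}"
      using card_cut_vimage[OF Kk gT] by simp
    also have "\<dots> \<le> 2 * card {s \<in> symvecs \<kappa> eta. (eta\<^sup>2) ^ (n * (n - p)) / (2 * ((C0 * (1 + \<bar>\<theta>\<bar> * \<sigma> * eta))\<^sup>2) ^ n) \<le> real (sd_count n nr A ord \<theta> eta xi2 H W s)}"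
      using count finite_level_set[of \<kappa> eta 0] unfolding symvecs_level_set[symmetric]
      by (intro mult_left_mono card_mono) auto
    finally show "card (symvecs (n * n) eta) \<le> 2 * card {s \<in> symvecs (n * n) eta.
        (eta\<^sup>2) ^ (n * (n - p)) / (2 * ((C0 * (1 + \<bar>\<theta>\<bar> * \<sigma> * eta))\<^sup>2) ^ n) \<le> real (sd_count n nr A ord \<theta> eta xi2 H W s)}"
      unfolding \<kappa>_def .
  qed
qed

end

section \<open>The sample space\<close>

definition base_space :: "nat \<Rightarrow> nat \<Rightarrow> real \<Rightarrow>
    ((nat \<times> nat \<Rightarrow> complex) \<times> (nat \<times> nat \<Rightarrow> complex) \<times> (nat \<Rightarrow> complex)) measure" where
  "base_space n nr eta = gauss_mat nr n \<Otimes>\<^sub>M gauss_mat nr n \<Otimes>\<^sub>M uniform_count_measure (symvecs (n * n) eta)"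

lemma sample_eq: "sample n nr eta = completion (base_space n nr eta)"
  unfolding sample_def base_space_def ..

lemma finite_symvecs: "finite (symvecs \<kappa> eta)"
  unfolding symvecs_level_set by (rule finite_level_set)

lemma symvecs_nonempty:
  assumes "0 \<le> eta"
  shows "symvecs \<kappa> eta \<noteq> {}"
proof -
  have "(\<lambda>_. 0) \<in> symvecs \<kappa> eta" using assms unfolding symvecs_def QAM_def by auto
  then show ?thesis by auto
qed

lemma prob_space_gauss_mat: "prob_space (gauss_mat nr n)"
  unfolding gauss_mat_def by (rule prob_space_gaussP)

lemma prob_space_symvecs:
  assumes "0 \<le> eta"
  shows "prob_space (uniform_count_measure (symvecs \<kappa> eta))"
  by (rule prob_space_uniform_count_measure[OF finite_symvecs symvecs_nonempty[OF assms]])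

lemma borel_measurable_cnj_fun: "f \<in> borel_measurable N \<Longrightarrow> (\<lambda>w. cnj (f w)) \<in> borel_measurable N"
proof -
  have "cnj \<in> borel_measurable borel" by (intro borel_measurable_continuous_onI continuous_intros)
  then show "f \<in> borel_measurable N \<Longrightarrow> ?thesis" by (rule measurable_compose[rotated])
qed

lemma borel_measurable_cmod_fun: "f \<in> borel_measurable N \<Longrightarrow> (\<lambda>w. cmod (f w)) \<in> borel_measurable N"
  by (rule measurable_compose[OF _ borel_measurable_norm])

lemma borel_measurable_sqrt_fun: "f \<in> borel_measurable N \<Longrightarrow> (\<lambda>w. sqrt (f w)) \<in> borel_measurable N"
proof -
  have "sqrt \<in> borel_measurable borel" by (intro borel_measurable_continuous_onI continuous_intros)
  then show "f \<in> borel_measurable N \<Longrightarrow> ?thesis" by (rule measurable_compose[rotated])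
qed

lemma gram_schmidt_cols_measurable:
  assumes M: "\<And>p q. (\<lambda>w. M w p q) \<in> borel_measurable N"
  shows "(\<lambda>w. gram_schmidt_cols m (M w) k i p) \<in> borel_measurable N"
proof (induction k arbitrary: i p)
  case 0
  then show ?case by simp
next
  case (Suc k)
  have r: "(\<lambda>w. gs_resid m (M w) (gram_schmidt_cols m (M w) k) k p) \<in> borel_measurable N" for p
    unfolding gs_resid_def
    by (intro borel_measurable_diff borel_measurable_sum borel_measurable_times borel_measurable_cnj_fun M Suc)
  have nm: "(\<lambda>w. gs_norm m (M w) (gram_schmidt_cols m (M w) k) k) \<in> borel_measurable N"
    unfolding gs_norm_def
    by (intro borel_measurable_sqrt_fun borel_measurable_sum borel_measurable_power borel_measurable_cmod_fun r)
  show ?case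
  proof (cases "i = k")
    case True
    then show ?thesis using borel_measurable_divide[OF r measurable_compose[OF nm borel_measurable_of_real]] by simp
  next
    case False
    then show ?thesis using Suc by simp
  qed
qed

text \<open>For fixed \<open>eta\<close> the candidate tails form a finite set independent of the
  channel, so the count is a finite sum of indicators of measurable conditions.\<close>

lemma qr_count_measurable:
  assumes M: "\<And>p q. (\<lambda>w. M w p q) \<in> borel_measurable N"
    and y: "\<And>p. p < m \<Longrightarrow> (\<lambda>w. y w p) \<in> borel_measurable N"
  shows "(\<lambda>w. real (qr_count m \<kappa> (\<lambda>p i. gram_schmidt_cols m (M w) \<kappa> i p) (gs_R m (M w) \<kappa>) (y w) eta xi2)) \<in> borel_measurable N"
proof -
  note G = gram_schmidt_cols_measurable[OF M]
  have R: "(\<lambda>w. gs_R m (M w) \<kappa> i j) \<in> borel_measurable N" for i j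
  proof (cases "i \<le> j")
    case True
    then show ?thesis unfolding gs_R_def
      by (simp only: if_True) (intro borel_measurable_sum borel_measurable_times borel_measurable_cnj_fun M G)
  next
    case False
    then show ?thesis unfolding gs_R_def by simp
  qed
  have cost: "(\<lambda>w. qr_cost m \<kappa> (\<lambda>p i. gram_schmidt_cols m (M w) \<kappa> i p) (gs_R m (M w) \<kappa>) (y w) K t) \<in> borel_measurable N" for K t
    unfolding qr_cost_def qr_coord_def
    by (intro borel_measurable_sum borel_measurable_power borel_measurable_cmod_fun borel_measurable_diff borel_measurable_times R borel_measurable_cnj_fun G y borel_measurable_const) auto
  have cnt: "real (card {t \<in> T. P t}) = (\<Sum>t\<in>T. if P t then 1 else 0)" if "finite T" for T and P :: "(nat \<Rightarrow> complex) \<Rightarrow> bool"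
    using that by (simp add: sum.If_cases Int_def)
  have "(\<lambda>w. real (card {t \<in> level_set \<kappa> eta K. qr_cost m \<kappa> (\<lambda>p i. gram_schmidt_cols m (M w) \<kappa> i p) (gs_R m (M w) \<kappa>) (y w) K t \<le> xi2})) \<in> borel_measurable N" for K
    unfolding cnt[OF finite_level_set]
    by (intro borel_measurable_sum measurable_If borel_measurable_const borel_measurable_le cost)
  then show ?thesis unfolding qr_count_def of_nat_sum by (intro borel_measurable_sum)
qed

context
  fixes n nr :: nat and A :: "nat \<Rightarrow> cmat" and ord :: "nat \<Rightarrow> nat"
  assumes n_pos: "1 \<le> n" and nr_ge: "n \<le> nr"
    and A_inv: "\<forall>l<n. invertible_cmat n (A l)"
    and ord_bij: "bij_betw ord {..<n} {..<n}"
begin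

lemma gauss_entry_measurable:
  "a < nr \<Longrightarrow> b < n \<Longrightarrow> (\<lambda>h. to_mat h a b) \<in> borel_measurable (gauss_mat nr n)"
  unfolding gauss_mat_def to_mat_def measurable_cong_sets[OF refl sets_cgauss[symmetric]]
  by (rule measurable_component_singleton) simp

lemma base_measurable:
  shows "a < nr \<Longrightarrow> b < n \<Longrightarrow> (\<lambda>\<omega>. to_mat (fst \<omega>) a b) \<in> borel_measurable (base_space n nr eta)"
    "a < nr \<Longrightarrow> b < n \<Longrightarrow> (\<lambda>\<omega>. to_mat (fst (snd \<omega>)) a b) \<in> borel_measurable (base_space n nr eta)"
    "(\<lambda>\<omega>. f (snd (snd \<omega>)) :: complex) \<in> borel_measurable (base_space n nr eta)"
proof -
  have 1: "fst \<in> measurable (base_space n nr eta) (gauss_mat nr n)"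
    unfolding base_space_def by (rule measurable_fst)
  have 2: "(\<lambda>\<omega>. fst (snd \<omega>)) \<in> measurable (base_space n nr eta) (gauss_mat nr n)"
    unfolding base_space_def by (rule measurable_compose[OF measurable_snd measurable_fst])
  have 3: "(\<lambda>\<omega>. snd (snd \<omega>)) \<in> measurable (base_space n nr eta) (uniform_count_measure (symvecs (n * n) eta))"
    unfolding base_space_def by (rule measurable_compose[OF measurable_snd measurable_snd])
  show "(\<lambda>\<omega>. to_mat (fst \<omega>) a b) \<in> borel_measurable (base_space n nr eta)" if "a < nr" "b < n"
    by (rule measurable_compose[OF 1 gauss_entry_measurable[OF that]])
  show "(\<lambda>\<omega>. to_mat (fst (snd \<omega>)) a b) \<in> borel_measurable (base_space n nr eta)" if "a < nr" "b < n"
    by (rule measurable_compose[OF 2 gauss_entry_measurable[OF that]])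
  have "f \<in> borel_measurable (uniform_count_measure (symvecs (n * n) eta))"
    by (auto simp: measurable_def sets_uniform_count_measure space_uniform_count_measure)
  then show "(\<lambda>\<omega>. f (snd (snd \<omega>)) :: complex) \<in> borel_measurable (base_space n nr eta)"
    by (rule measurable_compose[OF 3])
qed

definition tail_set :: "real \<Rightarrow> real \<Rightarrow> real \<Rightarrow> real \<Rightarrow> ((nat \<times> nat \<Rightarrow> complex) \<times> (nat \<times> nat \<Rightarrow> complex) \<times> (nat \<Rightarrow> complex)) set" where
  "tail_set \<theta> eta xi2 x = {\<omega> \<in> space (base_space n nr eta).
      x \<le> real (sd_count n nr A ord \<theta> eta xi2 (to_mat (fst \<omega>)) (to_mat (fst (snd \<omega>))) (snd (snd \<omega>)))}"

text \<open>The choice operator gives no measurability of \<open>sd_count\<close>. Off the singular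
  channels it agrees with the Gram-Schmidt count, and \<open>E\<close> is the event defined by the
  latter.\<close>

lemma tail_set_version:
  assumes \<theta>: "\<theta> \<noteq> 0"
  obtains E where "E \<in> sets (base_space n nr eta)"
    "\<And>\<omega>. \<omega> \<in> space (base_space n nr eta) \<Longrightarrow> fst \<omega> \<notin> singular_event nr n \<Longrightarrow> \<omega> \<in> E \<longleftrightarrow> \<omega> \<in> tail_set \<theta> eta xi2 x"
proof -
  define N where "N = base_space n nr eta"
  define M where "M \<omega> = chan_mat n nr A ord \<theta> (to_mat (fst \<omega>))" for \<omega> :: "(nat \<times> nat \<Rightarrow> complex) \<times> (nat \<times> nat \<Rightarrow> complex) \<times> (nat \<Rightarrow> complex)"
  define y where "y \<omega> = vec_of nr (received n nr A ord \<theta> (to_mat (fst \<omega>)) (to_mat (fst (snd \<omega>))) (snd (snd \<omega>)))" for \<omega> :: "(nat \<times> nat \<Rightarrow> complex) \<times> (nat \<times> nat \<Rightarrow> complex) \<times> (nat \<Rightarrow> complex)"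
  have pos: "0 < n" "0 < nr" using n_pos nr_ge by auto
  have M: "(\<lambda>\<omega>. M \<omega> p q) \<in> borel_measurable N" for p q
  proof -
    have "(\<lambda>\<omega>. kron_id n nr n (to_mat (fst \<omega>)) p l) \<in> borel_measurable N" for l
    proof (cases "p div nr = l div n \<and> p div nr < n")
      case True
      then show ?thesis
        unfolding kron_id_def N_def using pos by (simp add: base_measurable(1))
    next
      case False
      then show ?thesis unfolding kron_id_def by (simp only: if_False) simp
    qed
    then show ?thesis
      unfolding M_def chan_mat_def mmul_def by (intro borel_measurable_times borel_measurable_const borel_measurable_sum)
  qed
  have y: "(\<lambda>\<omega>. y \<omega> p) \<in> borel_measurable N" if p: "p < nr * n" for p
  proof -
    have pd: "p mod nr < nr" "p div nr < n" using p pos by (auto simp: less_mult_imp_div_less mult.commute)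
    show ?thesis
      unfolding y_def vec_of_def received_def mmul_def N_def
      by (intro borel_measurable_add borel_measurable_sum borel_measurable_times base_measurable pd) auto
  qed
  define E where "E = {\<omega> \<in> space N. x \<le> real (qr_count (nr * n) (n * n) (\<lambda>p i. gram_schmidt_cols (nr * n) (M \<omega>) (n * n) i p) (gs_R (nr * n) (M \<omega>) (n * n)) (y \<omega>) eta xi2)}"
  show ?thesis
  proof (rule that[of E])
    show "E \<in> sets (base_space n nr eta)"
      unfolding E_def N_def[symmetric] by (intro borel_measurable_le borel_measurable_const qr_count_measurable M y)
    fix \<omega> assume \<omega>: "\<omega> \<in> space (base_space n nr eta)" "fst \<omega> \<notin> singular_event nr n"
    have "fst \<omega> \<in> space (gauss_mat nr n)" using \<omega>(1) unfolding base_space_def space_pair_measure by auto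
    then have inj: "inj_cmat nr n (to_mat (fst \<omega>))" using nonsingular_inj[OF n_pos nr_ge] \<omega>(2) by simp
    have "is_thin_QR (nr * n) (n * n) (M \<omega>) (\<lambda>p i. gram_schmidt_cols (nr * n) (M \<omega>) (n * n) i p) (gs_R (nr * n) (M \<omega>) (n * n))"
      unfolding M_def by (intro gram_schmidt_thin_QR inj_chan_mat[OF n_pos nr_ge A_inv ord_bij inj \<theta>])
    from sd_count_eq_qr_count[OF n_pos nr_ge A_inv ord_bij inj \<theta> this[unfolded M_def]]
    show "\<omega> \<in> E \<longleftrightarrow> \<omega> \<in> tail_set \<theta> eta xi2 x"
      unfolding E_def tail_set_def N_def y_def M_def by simp
  qed
qed

lemma sd_tail_prob_eq:
  "sd_tail_prob n nr A ord \<theta> eta xi2 x \<rho> = measure (completion (base_space n nr eta)) (tail_set \<theta> eta xi2 (\<rho> powr x))"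
  unfolding sd_tail_prob_def sample_eq tail_set_def by (simp only: space_completion)

lemma base_prob_space:
  assumes "0 \<le> eta"
  shows "prob_space (base_space n nr eta)"
proof -
  interpret U: prob_space "uniform_count_measure (symvecs (n * n) eta)" by (rule prob_space_symvecs[OF assms])
  interpret G: prob_space "gauss_mat nr n" by (rule prob_space_gauss_mat)
  interpret P: pair_prob_space "gauss_mat nr n" "uniform_count_measure (symvecs (n * n) eta)" ..
  interpret P2: pair_prob_space "gauss_mat nr n" "gauss_mat nr n \<Otimes>\<^sub>M uniform_count_measure (symvecs (n * n) eta)" ..
  show ?thesis unfolding base_space_def by (rule P2.prob_space_axioms)
qed

lemma channel_cylinder:
  assumes "0 \<le> eta" and B: "B \<in> sets (gauss_mat nr n)"
  shows "{\<omega> \<in> space (base_space n nr eta). fst \<omega> \<in> B} \<in> sets (base_space n nr eta)"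
    "emeasure (base_space n nr eta) {\<omega> \<in> space (base_space n nr eta). fst \<omega> \<in> B} = emeasure (gauss_mat nr n) B"
proof -
  define R where "R = gauss_mat nr n \<Otimes>\<^sub>M uniform_count_measure (symvecs (n * n) eta)"
  interpret U: prob_space "uniform_count_measure (symvecs (n * n) eta)" by (rule prob_space_symvecs[OF assms(1)])
  interpret G: prob_space "gauss_mat nr n" by (rule prob_space_gauss_mat)
  interpret P: pair_prob_space "gauss_mat nr n" "uniform_count_measure (symvecs (n * n) eta)" ..
  interpret R: prob_space R unfolding R_def by (rule P.prob_space_axioms)
  have eq: "{\<omega> \<in> space (base_space n nr eta). fst \<omega> \<in> B} = B \<times> space R"
    unfolding base_space_def R_def[symmetric] space_pair_measure using sets.sets_into_space[OF B] by auto
  show "{\<omega> \<in> space (base_space n nr eta). fst \<omega> \<in> B} \<in> sets (base_space n nr eta)"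
    unfolding eq unfolding base_space_def R_def[symmetric] using B by simp
  show "emeasure (base_space n nr eta) {\<omega> \<in> space (base_space n nr eta). fst \<omega> \<in> B} = emeasure (gauss_mat nr n) B"
    unfolding eq unfolding base_space_def R_def[symmetric]
    using R.emeasure_pair_measure_Times[OF B sets.top] R.emeasure_space_1 by simp
qed

text \<open>Adding the null set of singular channels to \<open>B\<close> makes the inclusion
  unconditional, and the resulting cylinder is measurable.\<close>

lemma tail_prob_le:
  assumes eta: "0 \<le> eta" and B: "B \<in> sets (gauss_mat nr n)"
    and sub: "\<And>\<omega>. \<omega> \<in> tail_set \<theta> eta xi2 x \<Longrightarrow> fst \<omega> \<notin> singular_event nr n \<Longrightarrow> fst \<omega> \<in> B"
  shows "measure (completion (base_space n nr eta)) (tail_set \<theta> eta xi2 x) \<le> measure (gauss_mat nr n) B"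
proof -
  interpret G: prob_space "gauss_mat nr n" by (rule prob_space_gauss_mat)
  interpret S: prob_space "base_space n nr eta" by (rule base_prob_space[OF eta])
  interpret C: prob_space "completion (base_space n nr eta)" by (rule S.prob_space_completion)
  have sg: "singular_event nr n \<in> null_sets (gauss_mat nr n)" by (rule singular_event_null[OF n_pos nr_ge])
  define B' where "B' = B \<union> singular_event nr n"
  have B': "B' \<in> sets (gauss_mat nr n)" unfolding B'_def using B sg by auto
  have "tail_set \<theta> eta xi2 x \<subseteq> {\<omega> \<in> space (base_space n nr eta). fst \<omega> \<in> B'}"
    using sub unfolding B'_def tail_set_def by blast
  then have "measure (completion (base_space n nr eta)) (tail_set \<theta> eta xi2 x)
     \<le> measure (completion (base_space n nr eta)) {\<omega> \<in> space (base_space n nr eta). fst \<omega> \<in> B'}"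
    using channel_cylinder(1)[OF eta B'] by (intro C.finite_measure_mono) auto
  also have "\<dots> = measure (gauss_mat nr n) B'"
    using channel_cylinder[OF eta B'] by (simp add: measure_def)
  also have "\<dots> = measure (gauss_mat nr n) B"
    unfolding B'_def using sg B by (simp add: measure_def emeasure_Un_null_set)
  finally show ?thesis .
qed

text \<open>The channel and the noise are fixed first; at least half of the symbol vectors then lie
  in the section, whence the factor 1/2 after integrating over both.\<close>

lemma tail_prob_ge:
  assumes eta: "0 \<le> eta" and \<theta>: "\<theta> \<noteq> 0" and B: "B \<in> sets (gauss_mat nr n)" and D: "D \<in> sets (gauss_mat nr n)"
    and half: "\<And>h w. h \<in> B \<Longrightarrow> h \<notin> singular_event nr n \<Longrightarrow> w \<in> D \<Longrightarrow> card (symvecs (n * n) eta)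
      \<le> 2 * card {s \<in> symvecs (n * n) eta. x \<le> real (sd_count n nr A ord \<theta> eta xi2 (to_mat h) (to_mat w) s)}"
  shows "measure (gauss_mat nr n) B * measure (gauss_mat nr n) D / 2 \<le> measure (completion (base_space n nr eta)) (tail_set \<theta> eta xi2 x)"
proof -
  interpret G: prob_space "gauss_mat nr n" by (rule prob_space_gauss_mat)
  interpret S: prob_space "base_space n nr eta" by (rule base_prob_space[OF eta])
  interpret C: prob_space "completion (base_space n nr eta)" by (rule S.prob_space_completion)
  define U where "U = uniform_count_measure (symvecs (n * n) eta)"
  interpret U: prob_space U unfolding U_def by (rule prob_space_symvecs[OF eta])
  interpret P: pair_prob_space "gauss_mat nr n" U ..
  have sf: "sigma_finite_measure (gauss_mat nr n \<Otimes>\<^sub>M U)"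
    by (rule prob_space_imp_sigma_finite[OF P.prob_space_axioms])
  have sg: "singular_event nr n \<in> null_sets (gauss_mat nr n)" by (rule singular_event_null[OF n_pos nr_ge])
  define Z where "Z = {\<omega> \<in> space (base_space n nr eta). fst \<omega> \<in> singular_event nr n}"
  have Z: "Z \<in> null_sets (base_space n nr eta)"
    unfolding Z_def using channel_cylinder[OF eta, of "singular_event nr n"] sg by (auto simp: null_sets_def)
  obtain E where E: "E \<in> sets (base_space n nr eta)"
    and Eiff: "\<And>\<omega>. \<omega> \<in> space (base_space n nr eta) \<Longrightarrow> fst \<omega> \<notin> singular_event nr n \<Longrightarrow> \<omega> \<in> E \<longleftrightarrow> \<omega> \<in> tail_set \<theta> eta xi2 x"
    by (rule tail_set_version[OF \<theta>]) (rule that, assumption+)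
  define T where "T = tail_set \<theta> eta xi2 x"
  have Tsp: "T \<subseteq> space (base_space n nr eta)" unfolding T_def tail_set_def by auto
  have Esp: "E \<subseteq> space (base_space n nr eta)" using sets.sets_into_space[OF E] .
  have eq: "T - Z = E - Z" using Eiff Tsp Esp unfolding T_def[symmetric] Z_def by blast
  \<comment> \<open>The second part is a subset of a null set, which the completion makes
    measurable.\<close>
  have Tdec: "T = (E - Z) \<union> (T \<inter> Z)" using eq by blast
  have EZ: "E - Z \<in> sets (base_space n nr eta)" using E Z by auto
  have "T \<inter> Z \<in> sets (completion (base_space n nr eta))"
    by (rule sets_completionI_sub[OF Z]) auto
  then have T: "T \<in> sets (completion (base_space n nr eta))"
    using sets.Un[OF sets_completionI_sets[OF EZ]] Tdec by metis
  have "measure (base_space n nr eta) (E - Z) \<le> measure (completion (base_space n nr eta)) T"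
    using C.finite_measure_mono[OF _ T, of "E - Z"] eq EZ by (auto simp: measure_completion)
  moreover have "ennreal (measure (gauss_mat nr n) B * measure (gauss_mat nr n) D / 2) \<le> emeasure (base_space n nr eta) (E - Z)"
  proof -
    define B0 where "B0 = B - singular_event nr n"
    have B0: "B0 \<in> sets (gauss_mat nr n)" unfolding B0_def using B sg by auto
    have mB0: "emeasure (gauss_mat nr n) B0 = emeasure (gauss_mat nr n) B"
      unfolding B0_def using emeasure_Diff_null_set[OF sg B] .
    have inner: "ennreal (1/2) * emeasure (gauss_mat nr n) D \<le> emeasure (gauss_mat nr n \<Otimes>\<^sub>M U) (Pair h -` (E - Z))"
      if h: "h \<in> B0" for h
    proof -
      have hs: "h \<in> space (gauss_mat nr n)" "h \<notin> singular_event nr n" "h \<in> B"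
        using h sets.sets_into_space[OF B0] unfolding B0_def by auto
      have sec: "Pair h -` (E - Z) \<in> sets (gauss_mat nr n \<Otimes>\<^sub>M U)"
        using EZ unfolding base_space_def U_def by (rule sets_Pair1)
      have sec2: "ennreal (1/2) \<le> emeasure U (Pair w -` (Pair h -` (E - Z)))" if w: "w \<in> D" for w
      proof -
        have ws: "w \<in> space (gauss_mat nr n)" using w sets.sets_into_space[OF D] by auto
        define X where "X = {s \<in> symvecs (n * n) eta. x \<le> real (sd_count n nr A ord \<theta> eta xi2 (to_mat h) (to_mat w) s)}"
        have sp: "(h, w, s) \<in> space (base_space n nr eta)" if "s \<in> symvecs (n * n) eta" for s
          unfolding base_space_def space_pair_measure using hs ws that by (simp add: space_uniform_count_measure)
        have "X \<subseteq> Pair w -` (Pair h -` (E - Z))"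
        proof
          fix s assume s: "s \<in> X"
          then have ss: "s \<in> symvecs (n * n) eta" unfolding X_def by simp
          have "(h, w, s) \<in> T" using s sp[OF ss] unfolding T_def tail_set_def X_def by simp
          then have "(h, w, s) \<in> E" using Eiff[OF sp[OF ss]] hs unfolding T_def by simp
          moreover have "(h, w, s) \<notin> Z" unfolding Z_def using hs by simp
          ultimately show "s \<in> Pair w -` (Pair h -` (E - Z))" by simp
        qed
        moreover have "Pair w -` (Pair h -` (E - Z)) \<in> sets U" using sec by (rule sets_Pair1)
        ultimately have m1: "emeasure U X \<le> emeasure U (Pair w -` (Pair h -` (E - Z)))" by (rule emeasure_mono)
        have m2: "emeasure U X = ennreal (real (card X) / real (card (symvecs (n * n) eta)))"
          unfolding U_def X_def by (intro emeasure_uniform_count_measure finite_symvecs) auto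
        have m3: "1/2 \<le> real (card X) / real (card (symvecs (n * n) eta))"
        proof -
          have "0 < card (symvecs (n * n) eta)"
            using finite_symvecs symvecs_nonempty[OF eta] by (simp add: card_gt_0_iff)
          moreover have "card (symvecs (n * n) eta) \<le> 2 * card X" unfolding X_def by (rule half[OF hs(3,2) w])
          ultimately show ?thesis by (simp add: field_simps)
        qed
        have "ennreal (1/2) \<le> emeasure U X" unfolding m2 by (rule ennreal_leI[OF m3])
        then show ?thesis using m1 by (rule order.trans)
      qed
      have "ennreal (1/2) * emeasure (gauss_mat nr n) D = (\<integral>\<^sup>+w. ennreal (1/2) * indicator D w \<partial>gauss_mat nr n)"
        by (rule nn_integral_cmult_indicator[OF D, symmetric])
      also have "\<dots> \<le> (\<integral>\<^sup>+w. emeasure U (Pair w -` (Pair h -` (E - Z))) \<partial>gauss_mat nr n)"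
      proof (rule nn_integral_mono)
        fix w
        show "ennreal (1/2) * indicator D w \<le> emeasure U (Pair w -` (Pair h -` (E - Z)))"
          using sec2[of w] by (cases "w \<in> D") auto
      qed
      also have "\<dots> = emeasure (gauss_mat nr n \<Otimes>\<^sub>M U) (Pair h -` (E - Z))"
        by (rule U.emeasure_pair_measure_alt[OF sec, symmetric])
      finally show ?thesis .
    qed
    have "ennreal (measure (gauss_mat nr n) B * measure (gauss_mat nr n) D / 2)
      = (ennreal (1/2) * emeasure (gauss_mat nr n) D) * emeasure (gauss_mat nr n) B0"
    proof -
      have h0: "(0::real) \<le> 1/2" by simp
      have "ennreal (measure (gauss_mat nr n) B * measure (gauss_mat nr n) D / 2)
        = ennreal ((1/2) * measure (gauss_mat nr n) D * measure (gauss_mat nr n) B)"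
        by (rule arg_cong[where f = ennreal]) simp
      also have "\<dots> = ennreal (1/2) * ennreal (measure (gauss_mat nr n) D) * ennreal (measure (gauss_mat nr n) B)"
        by (simp only: ennreal_mult mult_nonneg_nonneg measure_nonneg h0)
      finally show ?thesis unfolding mB0 unfolding G.emeasure_eq_measure .
    qed
    also have "\<dots> = (\<integral>\<^sup>+h. (ennreal (1/2) * emeasure (gauss_mat nr n) D) * indicator B0 h \<partial>gauss_mat nr n)"
      by (rule nn_integral_cmult_indicator[OF B0, symmetric])
    also have "\<dots> \<le> (\<integral>\<^sup>+h. emeasure (gauss_mat nr n \<Otimes>\<^sub>M U) (Pair h -` (E - Z)) \<partial>gauss_mat nr n)"
    proof (rule nn_integral_mono)
      fix h
      show "(ennreal (1/2) * emeasure (gauss_mat nr n) D) * indicator B0 h \<le> emeasure (gauss_mat nr n \<Otimes>\<^sub>M U) (Pair h -` (E - Z))"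
        using inner[of h] by (cases "h \<in> B0") auto
    qed
    also have "\<dots> = emeasure (base_space n nr eta) (E - Z)"
      unfolding base_space_def U_def[symmetric]
      by (rule sigma_finite_measure.emeasure_pair_measure_alt[OF sf, symmetric]) (use EZ in \<open>simp add: base_space_def U_def\<close>)
    finally show ?thesis .
  qed
  then have "measure (gauss_mat nr n) B * measure (gauss_mat nr n) D / 2 \<le> measure (base_space n nr eta) (E - Z)"
    unfolding S.emeasure_eq_measure by (subst (asm) ennreal_le_iff) (rule measure_nonneg)
  ultimately show ?thesis unfolding T_def by linarith
qed

end

section \<open>Exponents\<close>

lemma exp_equal_bounds:
  assumes f: "exp_equal f e" and pos: "eventually (\<lambda>\<rho>. 0 < f \<rho>) at_top" and \<epsilon>: "0 < \<epsilon>"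
  shows "eventually (\<lambda>\<rho>. \<rho> powr (e - \<epsilon>) \<le> f \<rho> \<and> f \<rho> \<le> \<rho> powr (e + \<epsilon>)) at_top"
proof -
  have lim: "((\<lambda>\<rho>. log 2 (f \<rho>) / log 2 \<rho>) \<longlongrightarrow> e) at_top" using f unfolding exp_equal_def .
  have "eventually (\<lambda>\<rho>. e - \<epsilon> < log 2 (f \<rho>) / log 2 \<rho>) at_top"
    "eventually (\<lambda>\<rho>. log 2 (f \<rho>) / log 2 \<rho> < e + \<epsilon>) at_top"
    using order_tendstoD[OF lim] \<epsilon> by auto
  then show ?thesis
    using pos eventually_gt_at_top[of "1::real"]
  proof eventually_elim
    case (elim \<rho>)
    have l: "0 < log 2 \<rho>" using elim by simp
    have "(e - \<epsilon>) * log 2 \<rho> \<le> log 2 (f \<rho>)" "log 2 (f \<rho>) \<le> (e + \<epsilon>) * log 2 \<rho>"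
      using elim l by (simp_all add: field_simps)
    then have "log 2 (\<rho> powr (e - \<epsilon>)) \<le> log 2 (f \<rho>)" "log 2 (f \<rho>) \<le> log 2 (\<rho> powr (e + \<epsilon>))"
      using elim by (simp_all add: log_powr)
    then show ?case using elim by simp
  qed
qed

text \<open>A zero probability counts as exponent \<open>\<infinity>\<close>, which a finite limit
  excludes eventually.\<close>

lemma neg_exponent_eventually_nonzero:
  assumes "neg_exponent P (ereal L)"
  shows "eventually (\<lambda>\<rho>. P \<rho> \<noteq> 0) at_top"
proof -
  have "eventually (\<lambda>\<rho>. (if P \<rho> = 0 then \<infinity> else ereal (- log 2 (P \<rho>) / log 2 \<rho>)) < ereal (L + 1)) at_top"
    using order_tendstoD(2)[OF assms[unfolded neg_exponent_def], of "ereal (L + 1)"] by simp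
  then show ?thesis by eventually_elim (auto split: if_splits)
qed

lemma neg_exponent_ge:
  assumes P: "neg_exponent P L" and le: "eventually (\<lambda>\<rho>. 0 \<le> P \<rho> \<and> P \<rho> \<le> \<rho> powr (- e)) at_top"
  shows "ereal e \<le> L"
proof (rule tendsto_lowerbound[OF P[unfolded neg_exponent_def]])
  show "eventually (\<lambda>\<rho>. ereal e \<le> (if P \<rho> = 0 then \<infinity> else ereal (- log 2 (P \<rho>) / log 2 \<rho>))) at_top"
    using le eventually_gt_at_top[of "1::real"]
  proof eventually_elim
    case (elim \<rho>)
    have l: "0 < log 2 \<rho>" using elim by simp
    show ?case
    proof (cases "P \<rho> = 0")
      case False
      then have "log 2 (P \<rho>) \<le> log 2 (\<rho> powr (- e))" using elim by simp
      also have "\<dots> = - e * log 2 \<rho>" using elim by (simp add: log_powr)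
      finally have "e \<le> - log 2 (P \<rho>) / log 2 \<rho>" using l by (simp add: field_simps)
      then show ?thesis using False by simp
    qed simp
  qed
qed simp

lemma neg_exponent_le:
  assumes P: "neg_exponent P L" and ge: "eventually (\<lambda>\<rho>. \<rho> powr (- e) \<le> P \<rho>) at_top"
  shows "L \<le> ereal e"
proof (rule tendsto_upperbound[OF P[unfolded neg_exponent_def]])
  show "eventually (\<lambda>\<rho>. (if P \<rho> = 0 then \<infinity> else ereal (- log 2 (P \<rho>) / log 2 \<rho>)) \<le> ereal e) at_top"
    using ge eventually_gt_at_top[of "1::real"]
  proof eventually_elim
    case (elim \<rho>)
    have l: "0 < log 2 \<rho>" using elim by simp
    have p0: "0 < \<rho> powr (- e)" using elim by simp
    then have "P \<rho> \<noteq> 0" using elim by linarith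
    have "- e * log 2 \<rho> = log 2 (\<rho> powr (- e))" using elim by (simp add: log_powr)
    also have "\<dots> \<le> log 2 (P \<rho>)" 
    proof -
      have P0: "0 < P \<rho>" using p0 elim by linarith
      show ?thesis by (rule iffD2[OF log_le_cancel_iff]) (use elim p0 P0 in simp_all)
    qed
    finally have "- log 2 (P \<rho>) / log 2 \<rho> \<le> e" using l by (simp add: field_simps)
    then show ?case using \<open>P \<rho> \<noteq> 0\<close> by simp
  qed
qed simp

lemma eventually_const_le_powr:
  fixes c e :: real
  assumes "0 < e"
  shows "eventually (\<lambda>\<rho>. c \<le> \<rho> powr e) at_top"
  using assms by real_asymp

lemma eventually_log_le_powr:
  fixes z e :: real
  assumes "0 < e" "0 < z"
  shows "eventually (\<lambda>\<rho>. z * log 2 \<rho> \<le> \<rho> powr e) at_top"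
  using assms by real_asymp

lemma eventually_const_le_log:
  fixes z c :: real
  assumes "0 < z"
  shows "eventually (\<lambda>\<rho>. c \<le> z * log 2 \<rho>) at_top"
  using assms by real_asymp

text \<open>The exponent conditions tolerate degenerate choices, such as \<open>\<eta> = 1/2\<close>
  for \<open>r = 0\<close>. A decoding error needs two distinct codewords, which excludes
  them.\<close>

lemma err_prob_nonzero:
  assumes n: "1 \<le> n" and nz: "err_prob n nr A ord \<theta> eta \<noteq> 0"
  shows "\<theta> \<noteq> 0" "1 \<le> eta"
proof -
  define \<kappa> where "\<kappa> = n * n"
  have "\<exists>\<omega>\<in>space (sample n nr eta). ml_error n nr A ord \<theta> eta (to_mat (fst \<omega>)) (to_mat (fst (snd \<omega>))) (snd (snd \<omega>))"
  proof (rule ccontr)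
    assume "\<not> ?thesis"
    then have E: "{\<omega> \<in> space (sample n nr eta). ml_error n nr A ord \<theta> eta (to_mat (fst \<omega>)) (to_mat (fst (snd \<omega>))) (snd (snd \<omega>))} = {}" by blast
    show False using nz unfolding err_prob_def E by simp
  qed
  then obtain \<omega> where \<omega>: "\<omega> \<in> space (sample n nr eta)"
    and err: "ml_error n nr A ord \<theta> eta (to_mat (fst \<omega>)) (to_mat (fst (snd \<omega>))) (snd (snd \<omega>))" by (elim bexE) (rule that)
  define s where "s = snd (snd \<omega>)"
  have s: "s \<in> symvecs \<kappa> eta"
    using \<omega> unfolding sample_eq space_completion base_space_def space_pair_measure s_def \<kappa>_def
    by (auto simp: space_uniform_count_measure)
  define dist where "dist s' = fro_dist2 nr n (received n nr A ord \<theta> (to_mat (fst \<omega>)) (to_mat (fst (snd \<omega>))) s) (mmul n (to_mat (fst \<omega>)) (codeword n A ord \<theta> s'))" for s'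
  define shat where "shat = (SOME s'. s' \<in> symvecs \<kappa> eta \<and> (\<forall>s''\<in>symvecs \<kappa> eta. dist s' \<le> dist s''))"
  have "\<exists>s'. s' \<in> symvecs \<kappa> eta \<and> (\<forall>s''\<in>symvecs \<kappa> eta. dist s' \<le> dist s'')"
  proof -
    have ne: "symvecs \<kappa> eta \<noteq> {}" using s by auto
    have "arg_min_on dist (symvecs \<kappa> eta) \<in> symvecs \<kappa> eta"
      "\<not> (\<exists>x\<in>symvecs \<kappa> eta. dist x < dist (arg_min_on dist (symvecs \<kappa> eta)))"
      using arg_min_if_finite[OF finite_symvecs ne, of dist] by auto
    then show ?thesis by (intro exI[of _ "arg_min_on dist (symvecs \<kappa> eta)"]) (auto simp: not_less)
  qed
  then have shat: "shat \<in> symvecs \<kappa> eta" unfolding shat_def by (rule someI2_ex) simp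
  have ne: "\<exists>j<n. \<exists>c<n. codeword n A ord \<theta> shat j c \<noteq> codeword n A ord \<theta> s j c"
    using err unfolding ml_error_def Let_def s_def[symmetric] \<kappa>_def[symmetric] dist_def[symmetric] shat_def[symmetric] .
  show "\<theta> \<noteq> 0"
  proof
    assume "\<theta> = 0"
    then show False using ne by (auto simp: codeword_def)
  qed
  show "1 \<le> eta"
  proof (rule ccontr)
    assume "\<not> 1 \<le> eta"
    then have eta: "eta < 1" by simp
    have z0: "z = 0" if z: "z \<in> QAM eta" for z
    proof -
      have "Re z \<in> \<int>" "Im z \<in> \<int>" "\<bar>Re z\<bar> < 1" "\<bar>Im z\<bar> < 1" using z eta unfolding QAM_def by auto
      then have "Re z = 0" "Im z = 0" using Ints_nonzero_abs_ge1[of "Re z"] Ints_nonzero_abs_ge1[of "Im z"] by auto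
      then show ?thesis by (simp add: complex_eq_iff)
    qed
    have t0: "t q = 0" if "t \<in> symvecs \<kappa> eta" for t q
      using that z0[of "t q"] unfolding symvecs_def by (cases "q < \<kappa>") auto
    have "shat = s" by (intro ext) (simp add: t0[OF shat] t0[OF s])
    then show False using ne by simp
  qed
qed

text \<open>One form serves all \<open>r\<close>: the segment \<open>k\<close> and the position
  \<open>f\<close> on it express the tradeoff and the claimed exponent together.\<close>

lemma dstar_eq:
  assumes "1 \<le> n" "r \<in> {0..real n}"
  obtains k f where "k < n" "0 \<le> f" "f \<le> 1" "r = real k + f"
    "dstar n nr r = (real n - real k) * (real nr - real k) - f * (real nr + real n - 2 * real k - 1)"
    "r * (real n - \<lfloor>r\<rfloor> - 1) + max (real n * \<lfloor>r\<rfloor> - r * (real n - 1)) 0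
       = r * (real n - 1 - real k) + max (r - real n * f) 0"
proof -
  define k where "k = min (nat \<lfloor>r\<rfloor>) (n - 1)"
  define f where "f = r - real k"
  have kn: "k < n" unfolding k_def using assms by auto
  have d: "dstar n nr r = (real n - real k) * (real nr - real k) - f * (real nr + real n - 2 * real k - 1)"
    unfolding dstar_def Let_def k_def[symmetric] f_def by (simp add: algebra_simps)
  show ?thesis
  proof (cases "r < real n")
    case True
    have fl: "0 \<le> \<lfloor>r\<rfloor>" "\<lfloor>r\<rfloor> < int n" using assms True by (auto simp: floor_less_iff)
    then have k: "real k = of_int \<lfloor>r\<rfloor>" unfolding k_def by (auto simp: min_def)
    have "0 \<le> f" "f \<le> 1" unfolding f_def k using floor_correct[of r] by linarith+
    moreover have "real n * \<lfloor>r\<rfloor> - r * (real n - 1) = r - real n * f"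
      unfolding f_def k by (simp add: algebra_simps)
    moreover have "real n - real_of_int \<lfloor>r\<rfloor> - 1 = real n - 1 - real k" unfolding k by simp
    moreover have "r = real k + f" by (simp add: f_def)
    ultimately show ?thesis using that[of k f, OF kn _ _ _ d] by metis
  next
    \<comment> \<open>At \<open>r = n\<close> the floor is \<open>n\<close>, while the segment index
      is capped at \<open>n - 1\<close> and \<open>f = 1\<close>; both expressions for the exponent
      are 0.\<close>
    case False
    then have r: "r = real n" using assms by simp
    then have k: "k = n - 1" unfolding k_def by simp
    have f: "f = 1" unfolding f_def r k using assms by (simp add: of_nat_diff)
    have "r * (real n - \<lfloor>r\<rfloor> - 1) + max (real n * \<lfloor>r\<rfloor> - r * (real n - 1)) 0 = 0"
      unfolding r by (simp add: algebra_simps)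
    moreover have "r * (real n - 1 - real k) + max (r - real n * f) 0 = 0"
      unfolding r f k using assms by (simp add: of_nat_diff)
    moreover have "r = real k + f" by (simp add: f_def)
    moreover have "0 \<le> f" "f \<le> 1" using f by auto
    ultimately show ?thesis using that[of k f, OF kn _ _ _ d] by metis
  qed
qed

section \<open>The knapsack problem\<close>

text \<open>Telescopes, because each weight is the difference of the products at \<open>k\<close>
  and \<open>k + 1\<close>.\<close>

lemma sum_weights_from:
  assumes "k \<le> n"
  shows "(\<Sum>l\<in>{k..<n}. real nr + real n - 2 * real l - 1) = (real n - real k) * (real nr - real k)"
  using assms
proof (induction "n - k" arbitrary: k)
  case 0
  then show ?case by simp
next
  case (Suc d)
  then have "k < n" by simp
  then have "(\<Sum>l\<in>{k..<n}. real nr + real n - 2 * real l - 1)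
     = (real nr + real n - 2 * real k - 1) + (\<Sum>l\<in>{Suc k..<n}. real nr + real n - 2 * real l - 1)"
    by (simp add: sum.atLeast_Suc_lessThan)
  also have "(\<Sum>l\<in>{Suc k..<n}. real nr + real n - 2 * real l - 1) = (real n - real (Suc k)) * (real nr - real (Suc k))"
    using Suc \<open>k < n\<close> by simp
  finally show ?case by (simp add: algebra_simps)
qed

text \<open>Exchange argument: weights decrease in \<open>l\<close>, so saturating the coordinates
  from \<open>k\<close> on is cheapest, and any deviation of the total mass is charged at a rate of
  at least \<open>w k\<close>, also when mass moves across \<open>k\<close>.\<close>

lemma weighted_cost_ge:
  fixes \<alpha> :: "nat \<Rightarrow> real" and nr :: nat
  assumes k: "k < n" and \<alpha>: "\<And>l. l < n \<Longrightarrow> 0 \<le> \<alpha> l" "\<And>l. l < n \<Longrightarrow> \<alpha> l \<le> 1"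
  defines "w \<equiv> \<lambda>l::nat. real nr + real n - 2 * real l - 1"
  shows "(real n - real k) * (real nr - real k) + w k * ((\<Sum>l<n. \<alpha> l) - (real n - real k)) \<le> (\<Sum>l<n. w l * \<alpha> l)"
proof -
  have split: "(\<Sum>l<n. g l) = (\<Sum>l<k. g l) + (\<Sum>l\<in>{k..<n}. g l)" for g :: "nat \<Rightarrow> real"
    using sum_split_at[of k n g] k by simp
  have "(\<Sum>l<k. w k * \<alpha> l) \<le> (\<Sum>l<k. w l * \<alpha> l)"
    using \<alpha> k by (intro sum_mono mult_right_mono) (auto simp: w_def)
  moreover have "(\<Sum>l\<in>{k..<n}. w l - w k * (1 - \<alpha> l)) \<le> (\<Sum>l\<in>{k..<n}. w l * \<alpha> l)"
  proof (rule sum_mono)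
    fix l assume l: "l \<in> {k..<n}"
    have "w l * (1 - \<alpha> l) \<le> w k * (1 - \<alpha> l)" using l \<alpha>(2)[of l] by (intro mult_right_mono) (auto simp: w_def)
    then show "w l - w k * (1 - \<alpha> l) \<le> w l * \<alpha> l" by (simp add: algebra_simps)
  qed
  moreover have "(\<Sum>l\<in>{k..<n}. w l - w k * (1 - \<alpha> l)) = (real n - real k) * (real nr - real k) - w k * (real n - real k) + (\<Sum>l\<in>{k..<n}. w k * \<alpha> l)"
  proof -
    have "(\<Sum>l\<in>{k..<n}. w l - w k * (1 - \<alpha> l)) = (\<Sum>l\<in>{k..<n}. w l) - (\<Sum>l\<in>{k..<n}. w k) + (\<Sum>l\<in>{k..<n}. w k * \<alpha> l)"
      by (simp only: right_diff_distrib mult_1_right sum_subtractf)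
    then show ?thesis using sum_weights_from[of k n nr] k unfolding w_def by (simp add: of_nat_diff)
  qed
  moreover have "w k * (\<Sum>l<n. \<alpha> l) = (\<Sum>l<k. w k * \<alpha> l) + (\<Sum>l\<in>{k..<n}. w k * \<alpha> l)"
    unfolding split[of \<alpha>] by (simp add: distrib_left sum_distrib_left)
  ultimately show ?thesis unfolding split[of "\<lambda>l. w l * \<alpha> l"] by (simp add: right_diff_distrib)
qed

text \<open>A sum of hinge functions is convex, so its maximum over vectors in \<open>[0, 1]\<close> of total mass
  \<open>q + t\<close> is attained by saturating \<open>q\<close> coordinates and giving the remainder to one more.\<close>

lemma hinge_sum_le:
  fixes \<alpha> :: "nat \<Rightarrow> real" and q :: nat
  assumes \<alpha>: "\<And>l. l < n \<Longrightarrow> 0 \<le> \<alpha> l" "\<And>l. l < n \<Longrightarrow> \<alpha> l \<le> 1" and a: "0 \<le> a" "a \<le> 1"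
    and t: "(\<Sum>l<n. \<alpha> l) \<le> real q + t"
  shows "(\<Sum>l<n. max (\<alpha> l - a) 0) \<le> real q * (1 - a) + max (t - a) 0"
proof -
  define P where "P = {l. l < n \<and> a < \<alpha> l}"
  have P: "P \<subseteq> {..<n}" "finite P" unfolding P_def by auto
  have "(\<Sum>l<n. max (\<alpha> l - a) 0) = (\<Sum>l\<in>P. max (\<alpha> l - a) 0)"
    using P by (intro sum.mono_neutral_right) (auto simp: P_def)
  also have "\<dots> = (\<Sum>l\<in>P. \<alpha> l - a)" by (intro sum.cong) (auto simp: P_def)
  finally have eq: "(\<Sum>l<n. max (\<alpha> l - a) 0) = (\<Sum>l\<in>P. \<alpha> l - a)" .
  show ?thesis
  proof (cases "card P \<le> q")
    case True
    have "(\<Sum>l\<in>P. \<alpha> l - a) \<le> (\<Sum>l\<in>P. 1 - a)" using \<alpha>(2) by (intro sum_mono) (auto simp: P_def)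
    also have "\<dots> \<le> real q * (1 - a)" using True a by (simp add: mult_right_mono)
    finally show ?thesis unfolding eq by linarith
  next
    case False
    have "(\<Sum>l\<in>P. \<alpha> l - a) = (\<Sum>l\<in>P. \<alpha> l) - real (card P) * a" by (simp add: sum_subtractf)
    also have "\<dots> \<le> (real q + t) - (real q + 1) * a"
    proof -
      have "(\<Sum>l\<in>P. \<alpha> l) \<le> (\<Sum>l<n. \<alpha> l)" using P \<alpha>(1) by (intro sum_mono2) auto
      moreover have "(real q + 1) * a \<le> real (card P) * a" using False a by (intro mult_right_mono) auto
      ultimately show ?thesis using t by linarith
    qed
    also have "\<dots> = real q * (1 - a) + (t - a)" by (simp add: algebra_simps)
    finally show ?thesis unfolding eq by linarith
  qed
qed

text \<open>A value beyond the optimum forces the total mass beyond \<open>n - r\<close> by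
  \<open>\<delta> / n\<close>, and \<open>weighted_cost_ge\<close> converts excess mass into excess
  cost at rate \<open>w k \<ge> 1\<close>.\<close>

lemma cost_exceeds:
  fixes \<alpha> :: "nat \<Rightarrow> real" and n nr k :: nat
  assumes k: "k < n" "n \<le> nr" and f: "r = real k + f" "0 \<le> f" "f \<le> 1" and r: "0 \<le> r" "r \<le> real n"
    and \<alpha>: "\<And>l. l < n \<Longrightarrow> 0 \<le> \<alpha> l" "\<And>l. l < n \<Longrightarrow> \<alpha> l \<le> 1"
    and val: "r * (real n - 1 - real k) + max (r - real n * f) 0 + \<delta> \<le> real n * (\<Sum>l<n. max (\<alpha> l - (1 - r / real n)) 0)"
    and \<delta>: "0 < \<delta>"
  shows "(real n - real k) * (real nr - real k) - f * (real nr + real n - 2 * real k - 1) + \<delta> / real n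
     \<le> (\<Sum>l<n. (real nr + real n - 2 * real l - 1) * \<alpha> l)"
proof -
  define a where "a = 1 - r / real n"
  \<comment> \<open>At the optimum the last \<open>q\<close> exponents are 1 and exponent
    \<open>k\<close> is \<open>1 - f\<close>; \<open>t\<close> is the mass left over once
    \<open>q\<close> is taken off.\<close>
  define q where "q = n - 1 - k"
  define t where "t = (\<Sum>l<n. \<alpha> l) - real q"
  have n0: "0 < real n" using k by simp
  have q: "real q = real n - 1 - real k" unfolding q_def using k by (simp add: of_nat_diff)
  have a: "0 \<le> a" "a \<le> 1" "real n * (1 - a) = r" unfolding a_def using r n0 by (auto simp: field_simps)
  have "(\<Sum>l<n. max (\<alpha> l - a) 0) \<le> real q * (1 - a) + max (t - a) 0"
    by (rule hinge_sum_le[OF \<alpha> a(1,2)]) (simp_all add: t_def)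
  then have "real n * (\<Sum>l<n. max (\<alpha> l - a) 0) \<le> real n * (real q * (1 - a) + max (t - a) 0)"
    using n0 by (intro mult_left_mono) auto
  also have "\<dots> = real q * (real n * (1 - a)) + real n * max (t - a) 0" by (simp add: algebra_simps)
  also have "\<dots> = r * (real n - 1 - real k) + real n * max (t - a) 0" unfolding a(3) q by simp
  finally have up: "max (r - real n * f) 0 + \<delta> \<le> real n * max (t - a) 0" using val unfolding a_def by linarith
  \<comment> \<open>The hinge has slope at most 1, so mass beyond \<open>1 - f\<close> raises the
    value by at most that mass.\<close>
  have "max (t - a) 0 \<le> max (1 - f - a) 0 + max (t - (1 - f)) 0" by (simp add: max_def)
  then have "real n * max (t - a) 0 \<le> real n * max (1 - f - a) 0 + real n * max (t - (1 - f)) 0"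
    using mult_left_mono[of "max (t - a) 0" "max (1 - f - a) 0 + max (t - (1 - f)) 0" "real n"] n0 by (simp add: distrib_left)
  moreover have "real n * max (1 - f - a) 0 = max (r - real n * f) 0"
  proof -
    have "real n * (1 - f - a) = r - real n * f" using a(3) by (simp add: algebra_simps)
    then show ?thesis using n0 by (simp add: max_mult_distrib_left)
  qed
  ultimately have "\<delta> \<le> real n * max (t - (1 - f)) 0" using up by linarith
  then have "\<delta> / real n \<le> max (t - (1 - f)) 0" using n0 by (simp add: field_simps)
  moreover have "0 < \<delta> / real n" using \<delta> n0 by simp
  ultimately have t: "\<delta> / real n \<le> t - (1 - f)" by (simp add: max_def split: if_splits)
  define w where "w = real nr + real n - 2 * real k - 1"
  have w: "1 \<le> w"
  proof -
    have "real k + 1 \<le> real n" "real n \<le> real nr" using k by auto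
    then show ?thesis unfolding w_def by linarith
  qed
  have "(real n - real k) * (real nr - real k) + w * ((\<Sum>l<n. \<alpha> l) - (real n - real k)) \<le> (\<Sum>l<n. (real nr + real n - 2 * real l - 1) * \<alpha> l)"
    unfolding w_def by (rule weighted_cost_ge[OF k(1) \<alpha>])
  moreover have "(\<Sum>l<n. \<alpha> l) - (real n - real k) = (t - (1 - f)) - f" unfolding t_def q by simp
  moreover have "\<delta> / real n \<le> w * (t - (1 - f))"
  proof -
    have "1 * (\<delta> / real n) \<le> w * (t - (1 - f))" using w t \<open>0 < \<delta> / real n\<close> by (intro mult_mono) auto
    then show ?thesis by simp
  qed
  ultimately show ?thesis unfolding w_def[symmetric] by (simp add: right_diff_distrib mult.commute)
qed

lemma power_eq_powr: "0 < \<rho> \<Longrightarrow> (\<rho> powr e) ^ k = \<rho> powr (e * real k)"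
  by (induction k) (simp_all add: powr_add[symmetric] distrib_left)

lemma prod_powr:
  fixes e :: "'a \<Rightarrow> real"
  assumes "0 < \<rho>"
  shows "(\<Prod>l\<in>A. \<rho> powr e l) = \<rho> powr (\<Sum>l\<in>A. e l)"
  using assms by (induction A rule: infinite_finite_induct) (auto simp: powr_add)

context
  fixes n nr :: nat and A :: "nat \<Rightarrow> cmat" and ord :: "nat \<Rightarrow> nat"
  assumes n_pos: "1 \<le> n" and nr_ge: "n \<le> nr"
    and A_inv: "\<forall>l<n. invertible_cmat n (A l)"
    and ord_bij: "bij_betw ord {..<n} {..<n}"
begin

text \<open>Exponents are rounded to multiples of \<open>\<epsilon> = 1 / G\<close>, and
  \<open>a\<close> plays the role of \<open>1 - r / n\<close>. Each factor loses at most
  \<open>8 * \<epsilon>\<close> in the exponent; over \<open>n * n\<close> factors and with the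
  number of levels this stays below \<open>9 * (real n)\<^sup>2 * \<epsilon>\<close>.\<close>

lemma sd_count_le_grid:
  obtains N0 :: real where "1 \<le> N0"
    "\<And>H W s \<theta> eta xi2 \<rho> \<epsilon> a \<pi> g G. 1 < \<rho> \<Longrightarrow> 0 < \<epsilon> \<Longrightarrow> 1 \<le> eta \<Longrightarrow> \<theta> \<noteq> 0 \<Longrightarrow> 0 \<le> xi2 \<Longrightarrow>
       complete_pivots nr n H \<pi> \<Longrightarrow> \<pi> \<in> pivot_orders nr n \<Longrightarrow> pivot H \<pi> (n - 1) \<noteq> 0 \<Longrightarrow> inj_cmat nr n H \<Longrightarrow>
       0 \<le> a \<Longrightarrow> a \<le> 1 \<Longrightarrow> real G * \<epsilon> = 1 \<Longrightarrow> (\<forall>l<n. g l \<le> G) \<Longrightarrow>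
       (\<forall>l<n. g l < G \<longrightarrow> \<rho> powr (- (real (g l) + 1) * \<epsilon> / 2) \<le> cmod (pivot H \<pi> l)) \<Longrightarrow>
       eta \<le> \<rho> powr ((1 - a) / 2 + \<epsilon>) \<Longrightarrow> \<rho> powr (a - 2 * \<epsilon>) \<le> \<theta>\<^sup>2 \<Longrightarrow> xi2 \<le> \<rho> powr (2 * \<epsilon>) \<Longrightarrow>
       2 * N0 \<le> \<rho> powr \<epsilon> \<Longrightarrow> 3 \<le> \<rho> powr \<epsilon> \<Longrightarrow> real (n * n) \<le> \<rho> powr \<epsilon> \<Longrightarrow>
       real (sd_count n nr A ord \<theta> eta xi2 H W s) \<le> \<rho> powr (real n * (\<Sum>l<n. max (real (g l) * \<epsilon> - a) 0) + 9 * (real n)\<^sup>2 * \<epsilon>)"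
proof -
  obtain N0 :: real where N0: "1 \<le> N0"
    and bound: "\<And>H \<theta> eta xi2 W s \<pi> L. \<theta> \<noteq> 0 \<Longrightarrow> 0 \<le> xi2 \<Longrightarrow> complete_pivots nr n H \<pi> \<Longrightarrow> \<pi> \<in> pivot_orders nr n
       \<Longrightarrow> pivot H \<pi> (n - 1) \<noteq> 0 \<Longrightarrow> inj_cmat nr n H \<Longrightarrow> L \<subseteq> {..<n} \<Longrightarrow>
       real (sd_count n nr A ord \<theta> eta xi2 H W s) \<le> real (n * n) *
         (\<Prod>l<n. if l \<in> L then real (card (QAM eta)) else (N0 * (1 + sqrt xi2 / (\<bar>\<theta>\<bar> * cmod (pivot H \<pi> l))))\<^sup>2) ^ n"
    by (rule sd_count_le_pivots[OF n_pos nr_ge A_inv ord_bij]) (rule that, assumption+)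
  show ?thesis
  proof (rule that[OF N0])
    fix H W :: cmat and s \<pi> and \<theta> eta xi2 \<rho> \<epsilon> a :: real and g :: "nat \<Rightarrow> nat" and G :: nat
    assume \<rho>: "1 < \<rho>" and \<epsilon>: "0 < \<epsilon>" and eta: "1 \<le> eta" and \<theta>: "\<theta> \<noteq> 0" and xi: "0 \<le> xi2"
      and cp: "complete_pivots nr n H \<pi>" and po: "\<pi> \<in> pivot_orders nr n" and pn: "pivot H \<pi> (n - 1) \<noteq> 0" and inj: "inj_cmat nr n H"
      and a: "0 \<le> a" "a \<le> 1" and G: "real G * \<epsilon> = 1" and gG': "\<forall>l<n. g l \<le> G"
      and gp': "\<forall>l<n. g l < G \<longrightarrow> \<rho> powr (- (real (g l) + 1) * \<epsilon> / 2) \<le> cmod (pivot H \<pi> l)"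
      and etaB: "eta \<le> \<rho> powr ((1 - a) / 2 + \<epsilon>)" and \<theta>B: "\<rho> powr (a - 2 * \<epsilon>) \<le> \<theta>\<^sup>2" and xiB: "xi2 \<le> \<rho> powr (2 * \<epsilon>)"
      and c1: "2 * N0 \<le> \<rho> powr \<epsilon>" and c2: "3 \<le> \<rho> powr \<epsilon>" and c3: "real (n * n) \<le> \<rho> powr \<epsilon>"
    note gG = gG'[rule_format] and gp = gp'[rule_format]
    \<comment> \<open>No lower bound on the pivot is available at the top grid value, so these
      factors are capped by the alphabet size, of exponent \<open>1 - a\<close>. This is exactly the
      hinge at exponent 1.\<close>
    define L where "L = {l. l < n \<and> g l = G}"
    define F where "F l = (if l \<in> L then real (card (QAM eta)) else (N0 * (1 + sqrt xi2 / (\<bar>\<theta>\<bar> * cmod (pivot H \<pi> l))))\<^sup>2)" for l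
    define \<psi> where "\<psi> l = max (real (g l) * \<epsilon> - a) 0" for l
    have \<rho>0: "0 < \<rho>" using \<rho> by simp
    have FB: "F l \<le> \<rho> powr (\<psi> l + 8 * \<epsilon>)" if l: "l < n" for l
    proof (cases "l \<in> L")
      case True
      have "3 * eta \<le> \<rho> powr \<epsilon> * \<rho> powr ((1 - a) / 2 + \<epsilon>)"
        using c2 etaB eta by (intro mult_mono) auto
      also have "\<dots> = \<rho> powr ((1 - a) / 2 + 2 * \<epsilon>)"
        unfolding powr_add[symmetric] by (rule arg_cong[where f = "\<lambda>x. \<rho> powr x"]) (simp add: field_simps)
      finally have "(3 * eta)\<^sup>2 \<le> (\<rho> powr ((1 - a) / 2 + 2 * \<epsilon>))\<^sup>2" using eta by (intro power_mono) auto
      also have "\<dots> = \<rho> powr ((1 - a) + 4 * \<epsilon>)" unfolding power_eq_powr[OF \<rho>0] by (rule arg_cong[where f = "\<lambda>x. \<rho> powr x"]) (simp add: field_simps)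
      also have "\<dots> \<le> \<rho> powr (\<psi> l + 8 * \<epsilon>)"
      proof -
        have "\<psi> l = 1 - a" using True G a unfolding \<psi>_def L_def by simp
        then show ?thesis using \<rho> \<epsilon> by (intro powr_mono) auto
      qed
      finally show ?thesis using True card_QAM_bounds(2)[OF eta] unfolding F_def by simp
    next
      case False
      then have gl: "g l < G" using gG[OF l] l unfolding L_def by auto
      define d where "d = cmod (pivot H \<pi> l)"
      have d: "\<rho> powr (- (real (g l) + 1) * \<epsilon> / 2) \<le> d" using gp[OF l gl] unfolding d_def .
      have th: "\<rho> powr (a / 2 - \<epsilon>) \<le> \<bar>\<theta>\<bar>"
      proof -
        have "(\<rho> powr (a / 2 - \<epsilon>))\<^sup>2 = \<rho> powr (a - 2 * \<epsilon>)" unfolding power_eq_powr[OF \<rho>0] by (rule arg_cong[where f = "\<lambda>x. \<rho> powr x"]) (simp add: field_simps)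
        then have "(\<rho> powr (a / 2 - \<epsilon>))\<^sup>2 \<le> \<bar>\<theta>\<bar>\<^sup>2" using \<theta>B by simp
        then show ?thesis by (rule power2_le_imp_le) simp
      qed
      have sx: "sqrt xi2 \<le> \<rho> powr \<epsilon>"
      proof -
        have "(\<rho> powr \<epsilon>)\<^sup>2 = \<rho> powr (2 * \<epsilon>)" unfolding power_eq_powr[OF \<rho>0] by (rule arg_cong[where f = "\<lambda>x. \<rho> powr x"]) (simp add: field_simps)
        then have "xi2 \<le> (\<rho> powr \<epsilon>)\<^sup>2" using xiB by simp
        then show ?thesis by (rule real_le_lsqrt[rotated]) simp
      qed
      have "\<rho> powr (a / 2 - \<epsilon>) * \<rho> powr (- (real (g l) + 1) * \<epsilon> / 2) \<le> \<bar>\<theta>\<bar> * d"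
        using th d by (intro mult_mono) auto
      then have "sqrt xi2 / (\<bar>\<theta>\<bar> * d) \<le> \<rho> powr \<epsilon> / (\<rho> powr (a / 2 - \<epsilon>) * \<rho> powr (- (real (g l) + 1) * \<epsilon> / 2))"
        using sx xi \<rho>0 by (intro frac_le) auto
      also have "\<dots> = \<rho> powr (\<epsilon> - ((a / 2 - \<epsilon>) + (- (real (g l) + 1) * \<epsilon> / 2)))"
        by (simp only: powr_add[symmetric] powr_diff[symmetric])
      also have "\<dots> \<le> \<rho> powr (\<psi> l / 2 + 3 * \<epsilon>)"
      proof (rule powr_mono)
        have "real (g l) * \<epsilon> - a \<le> \<psi> l" unfolding \<psi>_def by simp
        then show "\<epsilon> - ((a / 2 - \<epsilon>) + (- (real (g l) + 1) * \<epsilon> / 2)) \<le> \<psi> l / 2 + 3 * \<epsilon>"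
          using \<epsilon> by (simp add: field_simps)
      qed (use \<rho> in simp)
      finally have x: "sqrt xi2 / (\<bar>\<theta>\<bar> * d) \<le> \<rho> powr (\<psi> l / 2 + 3 * \<epsilon>)" .
      have "1 \<le> \<rho> powr (\<psi> l / 2 + 3 * \<epsilon>)"
        using \<rho> \<epsilon> unfolding \<psi>_def by (intro ge_one_powr_ge_zero add_nonneg_nonneg) auto
      then have "1 + sqrt xi2 / (\<bar>\<theta>\<bar> * d) \<le> 2 * \<rho> powr (\<psi> l / 2 + 3 * \<epsilon>)" using x by linarith
      then have "N0 * (1 + sqrt xi2 / (\<bar>\<theta>\<bar> * d)) \<le> N0 * (2 * \<rho> powr (\<psi> l / 2 + 3 * \<epsilon>))"
        using N0 by (intro mult_left_mono) auto
      also have "\<dots> = (2 * N0) * \<rho> powr (\<psi> l / 2 + 3 * \<epsilon>)" by simp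
      also have "\<dots> \<le> \<rho> powr \<epsilon> * \<rho> powr (\<psi> l / 2 + 3 * \<epsilon>)" using c1 by (intro mult_right_mono) auto
      also have "\<dots> = \<rho> powr (\<psi> l / 2 + 4 * \<epsilon>)" unfolding powr_add[symmetric] by (rule arg_cong[where f = "\<lambda>x. \<rho> powr x"]) (simp add: field_simps)
      finally have "(N0 * (1 + sqrt xi2 / (\<bar>\<theta>\<bar> * d)))\<^sup>2 \<le> (\<rho> powr (\<psi> l / 2 + 4 * \<epsilon>))\<^sup>2"
        using N0 xi by (intro power_mono) (auto intro!: mult_nonneg_nonneg add_nonneg_nonneg divide_nonneg_nonneg simp: d_def)
      also have "\<dots> = \<rho> powr (\<psi> l + 8 * \<epsilon>)" unfolding power_eq_powr[OF \<rho>0] by (rule arg_cong[where f = "\<lambda>x. \<rho> powr x"]) (simp add: field_simps)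
      finally show ?thesis using False unfolding F_def d_def by simp
    qed
    have F0: "0 \<le> F l" for l unfolding F_def by simp
    have "real (sd_count n nr A ord \<theta> eta xi2 H W s) \<le> real (n * n) * (\<Prod>l<n. F l) ^ n"
      unfolding F_def by (rule bound[OF \<theta> xi cp po pn inj]) (auto simp: L_def)
    also have "\<dots> \<le> \<rho> powr \<epsilon> * (\<Prod>l<n. \<rho> powr (\<psi> l + 8 * \<epsilon>)) ^ n"
      using c3 F0 FB by (intro mult_mono power_mono prod_mono prod_nonneg zero_le_power) auto
    also have "(\<Prod>l<n. \<rho> powr (\<psi> l + 8 * \<epsilon>)) ^ n = \<rho> powr ((\<Sum>l<n. \<psi> l + 8 * \<epsilon>) * real n)"
      unfolding prod_powr[OF \<rho>0] power_eq_powr[OF \<rho>0] ..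
    also have "\<rho> powr \<epsilon> * \<rho> powr ((\<Sum>l<n. \<psi> l + 8 * \<epsilon>) * real n) = \<rho> powr (\<epsilon> + (\<Sum>l<n. \<psi> l + 8 * \<epsilon>) * real n)"
      by (simp only: powr_add)
    also have "\<dots> \<le> \<rho> powr (real n * (\<Sum>l<n. \<psi> l) + 9 * (real n)\<^sup>2 * \<epsilon>)"
    proof (rule powr_mono)
      have "1 \<le> (real n)\<^sup>2" using n_pos by simp
      then have "1 * \<epsilon> \<le> (real n)\<^sup>2 * \<epsilon>" using \<epsilon> by (intro mult_right_mono) auto
      moreover have "(\<Sum>l<n. \<psi> l + 8 * \<epsilon>) * real n = real n * (\<Sum>l<n. \<psi> l) + 8 * (real n)\<^sup>2 * \<epsilon>"
        by (simp add: sum.distrib algebra_simps power2_eq_square)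
      ultimately show "\<epsilon> + (\<Sum>l<n. \<psi> l + 8 * \<epsilon>) * real n \<le> real n * (\<Sum>l<n. \<psi> l) + 9 * (real n)\<^sup>2 * \<epsilon>" by linarith
    qed (use \<rho> in simp)
    finally show "real (sd_count n nr A ord \<theta> eta xi2 H W s) \<le> \<rho> powr (real n * (\<Sum>l<n. max (real (g l) * \<epsilon> - a) 0) + 9 * (real n)\<^sup>2 * \<epsilon>)"
      unfolding \<psi>_def .
  qed
qed

end

section \<open>The complexity exponent\<close>

text \<open>The largest admissible grid index is taken. Index 0 imposes no upper bound and index
  \<open>G\<close> no lower bound, so every pivot size is covered.\<close>

lemma powr_ex_grid:
  fixes d \<rho> \<epsilon> :: real and G :: nat
  obtains g where "g \<le> G" "g = 0 \<or> d \<le> \<rho> powr (- real g * \<epsilon> / 2)" "g < G \<Longrightarrow> \<rho> powr (- (real g + 1) * \<epsilon> / 2) \<le> d"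
proof -
  define S where "S = {g. g \<le> G \<and> (g = 0 \<or> d \<le> \<rho> powr (- real g * \<epsilon> / 2))}"
  have S: "finite S" "S \<noteq> {}" unfolding S_def by auto
  define g where "g = Max S"
  have gS: "g \<in> S" unfolding g_def by (rule Max_in[OF S])
  have "\<rho> powr (- (real g + 1) * \<epsilon> / 2) \<le> d" if "g < G"
  proof (rule ccontr)
    assume neg: "\<not> \<rho> powr (- (real g + 1) * \<epsilon> / 2) \<le> d"
    have eq: "real (Suc g) = real g + 1" by simp
    have "d \<le> \<rho> powr (- real (Suc g) * \<epsilon> / 2)" using neg unfolding eq by linarith
    then have "Suc g \<in> S" unfolding S_def using that by (simp only: mem_Collect_eq) simp
    then have "Suc g \<le> g" unfolding g_def using Max_ge[OF S(1)] by simp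
    then show False by simp
  qed
  then show ?thesis using that[of g] gS unfolding S_def by blast
qed

context
  fixes n nr :: nat and A :: "nat \<Rightarrow> cmat" and ord :: "nat \<Rightarrow> nat"
  assumes n_pos: "1 \<le> n" and nr_ge: "n \<le> nr"
    and A_inv: "\<forall>l<n. invertible_cmat n (A l)"
    and ord_bij: "bij_betw ord {..<n} {..<n}"
begin

lemma small_pivot_measure_le:
  assumes po: "\<pi> \<in> pivot_orders nr n" and \<rho>: "1 < \<rho>"
  shows "measure (gauss_mat nr n) (small_pivot_event nr n \<pi> (\<lambda>l. 0 < g l) (\<lambda>l. \<rho> powr (- real (g l) * \<epsilon> / 2)))
     \<le> (\<Prod>l<n. 4 ^ (nr + n - 2 * l - 1)) * \<rho> powr (- (\<Sum>l<n. (real nr + real n - 2 * real l - 1) * (real (g l) * \<epsilon>)))"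
proof -
  interpret G: prob_space "gauss_mat nr n" by (rule prob_space_gauss_mat)
  have \<rho>0: "0 < \<rho>" using \<rho> by simp
  define F where "F l = (if 0 < g l then (4 * (\<rho> powr (- real (g l) * \<epsilon> / 2))\<^sup>2) ^ (nr + n - 2 * l - 1) else 1)" for l
  have F0: "0 \<le> F l" for l unfolding F_def by simp
  have "ennreal (measure (gauss_mat nr n) (small_pivot_event nr n \<pi> (\<lambda>l. 0 < g l) (\<lambda>l. \<rho> powr (- real (g l) * \<epsilon> / 2)))) \<le> ennreal (\<Prod>l<n. F l)"
    unfolding G.emeasure_eq_measure[symmetric] F_def by (rule small_pivot_event(2)[OF po nr_ge]) simp
  then have "measure (gauss_mat nr n) (small_pivot_event nr n \<pi> (\<lambda>l. 0 < g l) (\<lambda>l. \<rho> powr (- real (g l) * \<epsilon> / 2))) \<le> (\<Prod>l<n. F l)"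
    by (subst (asm) ennreal_le_iff) (auto intro!: prod_nonneg F0)
  also have "\<dots> \<le> (\<Prod>l<n. 4 ^ (nr + n - 2 * l - 1) * \<rho> powr (- (real nr + real n - 2 * real l - 1) * (real (g l) * \<epsilon>)))"
  proof (intro prod_mono conjI F0)
    fix l assume l: "l \<in> {..<n}"
    have w: "real (nr + n - 2 * l - 1) = real nr + real n - 2 * real l - 1" using l nr_ge by (simp add: of_nat_diff)
    show "F l \<le> 4 ^ (nr + n - 2 * l - 1) * \<rho> powr (- (real nr + real n - 2 * real l - 1) * (real (g l) * \<epsilon>))"
    proof (cases "0 < g l")
      case True
      have "F l = 4 ^ (nr + n - 2 * l - 1) * (\<rho> powr (- real (g l) * \<epsilon> / 2 * real 2)) ^ (nr + n - 2 * l - 1)"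
        unfolding F_def using True by (simp only: if_True power_mult_distrib power_eq_powr[OF \<rho>0])
      also have "\<dots> = 4 ^ (nr + n - 2 * l - 1) * \<rho> powr (- real (g l) * \<epsilon> / 2 * real 2 * (real nr + real n - 2 * real l - 1))"
        by (simp only: power_eq_powr[OF \<rho>0] w)
      also have "- real (g l) * \<epsilon> / 2 * real 2 * (real nr + real n - 2 * real l - 1) = - (real nr + real n - 2 * real l - 1) * (real (g l) * \<epsilon>)"
        by (simp add: algebra_simps)
      finally show ?thesis by simp
    next
      case False
      have "(1::real) \<le> 4 ^ (nr + n - 2 * l - 1)" by simp
      then show ?thesis using False \<rho>0 unfolding F_def by simp
    qed
  qed
  also have "\<dots> = (\<Prod>l<n. 4 ^ (nr + n - 2 * l - 1)) * \<rho> powr (\<Sum>l<n. - (real nr + real n - 2 * real l - 1) * (real (g l) * \<epsilon>))"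
    unfolding prod.distrib prod_powr[OF \<rho>0] ..
  also have "(\<Sum>l<n. - (real nr + real n - 2 * real l - 1) * (real (g l) * \<epsilon>)) = - (\<Sum>l<n. (real nr + real n - 2 * real l - 1) * (real (g l) * \<epsilon>))"
    by (simp only: sum_negf[symmetric] minus_mult_left)
  finally show ?thesis .
qed

text \<open>A count of at least \<open>\<rho> powr x\<close> puts the channel into one of finitely
  many small-pivot events, indexed by orders and grid vectors with value at least
  \<open>c + \<delta>\<close>. Each of them costs at least \<open>d + \<delta> / n\<close>, and a
  union bound finishes.\<close>

lemma tail_exponent_lower:
  fixes \<theta> \<eta> :: "real \<Rightarrow> real" and k :: nat
  assumes ok: "eventually (\<lambda>\<rho>. \<theta> \<rho> \<noteq> 0 \<and> 1 \<le> \<eta> \<rho>) at_top" and z: "0 < z"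
    and eta: "exp_equal \<eta> (r / (2 * real n))" and th: "exp_equal (\<lambda>\<rho>. (\<theta> \<rho>)\<^sup>2) (1 - r / real n)"
    and k: "k < n" and f: "r = real k + f" "0 \<le> f" "f \<le> 1" and r: "0 \<le> r" "r \<le> real n"
    and x: "r * (real n - 1 - real k) + max (r - real n * f) 0 < x"
  shows "\<exists>e. (real n - real k) * (real nr - real k) - f * (real nr + real n - 2 * real k - 1) < e \<and>
     eventually (\<lambda>\<rho>. sd_tail_prob n nr A ord (\<theta> \<rho>) (\<eta> \<rho>) (z * log 2 \<rho>) x \<rho> \<le> \<rho> powr (- e)) at_top"
proof -
  obtain N0 :: real where N0: "1 \<le> N0"
    and bound: "\<And>H W s \<theta> eta xi2 \<rho> \<epsilon> a \<pi> g G. 1 < \<rho> \<Longrightarrow> 0 < \<epsilon> \<Longrightarrow> 1 \<le> eta \<Longrightarrow> \<theta> \<noteq> 0 \<Longrightarrow> 0 \<le> xi2 \<Longrightarrow>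
       complete_pivots nr n H \<pi> \<Longrightarrow> \<pi> \<in> pivot_orders nr n \<Longrightarrow> pivot H \<pi> (n - 1) \<noteq> 0 \<Longrightarrow> inj_cmat nr n H \<Longrightarrow>
       0 \<le> a \<Longrightarrow> a \<le> 1 \<Longrightarrow> real G * \<epsilon> = 1 \<Longrightarrow> (\<forall>l<n. g l \<le> G) \<Longrightarrow>
       (\<forall>l<n. g l < G \<longrightarrow> \<rho> powr (- (real (g l) + 1) * \<epsilon> / 2) \<le> cmod (pivot H \<pi> l)) \<Longrightarrow>
       eta \<le> \<rho> powr ((1 - a) / 2 + \<epsilon>) \<Longrightarrow> \<rho> powr (a - 2 * \<epsilon>) \<le> \<theta>\<^sup>2 \<Longrightarrow> xi2 \<le> \<rho> powr (2 * \<epsilon>) \<Longrightarrow>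
       2 * N0 \<le> \<rho> powr \<epsilon> \<Longrightarrow> 3 \<le> \<rho> powr \<epsilon> \<Longrightarrow> real (n * n) \<le> \<rho> powr \<epsilon> \<Longrightarrow>
       real (sd_count n nr A ord \<theta> eta xi2 H W s) \<le> \<rho> powr (real n * (\<Sum>l<n. max (real (g l) * \<epsilon> - a) 0) + 9 * (real n)\<^sup>2 * \<epsilon>)"
    by (rule sd_count_le_grid[OF n_pos nr_ge A_inv ord_bij]) (rule that, assumption+)
  define c where "c = r * (real n - 1 - real k) + max (r - real n * f) 0"
  \<comment> \<open>Half of the slack absorbs the grid error, the other half is the excess value fed
    to \<open>cost_exceeds\<close>.\<close>
  define \<delta> where "\<delta> = (x - c) / 2"
  have "c < x" unfolding c_def by (rule x)
  then have \<delta>: "0 < \<delta>" "x = c + 2 * \<delta>" unfolding \<delta>_def by (simp_all add: field_simps)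
  define d where "d = (real n - real k) * (real nr - real k) - f * (real nr + real n - 2 * real k - 1)"
  define a where "a = 1 - r / real n"
  have n0: "0 < real n" using n_pos by simp
  have a: "0 \<le> a" "a \<le> 1" "(1 - a) / 2 = r / (2 * real n)" unfolding a_def using r n0 by (auto simp: field_simps)
  obtain G :: nat where G: "9 * (real n)\<^sup>2 / \<delta> \<le> real G" "1 \<le> G"
  proof -
    obtain G' :: nat where "9 * (real n)\<^sup>2 / \<delta> \<le> real G'" using real_arch_simple by blast
    then show ?thesis using that[of "Suc G'"] by simp
  qed
  define \<epsilon> where "\<epsilon> = 1 / real G"
  have \<epsilon>: "0 < \<epsilon>" "real G * \<epsilon> = 1" "9 * (real n)\<^sup>2 * \<epsilon> \<le> \<delta>"
    unfolding \<epsilon>_def using G \<delta>(1) by (auto simp: field_simps)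
  define Gr where "Gr = {g \<in> Pi\<^sub>E {..<n} (\<lambda>_. {..G}). c + \<delta> \<le> real n * (\<Sum>l<n. max (real (g l) * \<epsilon> - a) 0)}"
  have finGr: "finite Gr" unfolding Gr_def by (rule finite_subset[of _ "Pi\<^sub>E {..<n} (\<lambda>_. {..G})"]) (auto intro!: finite_PiE)
  define C where "C = real (card (pivot_orders nr n \<times> Gr)) * (\<Prod>l<n. 4 ^ (nr + n - 2 * l - 1))"
  \<comment> \<open>Half of the excess cost is spent on the constant \<open>C\<close>.\<close>
  define e where "e = d + \<delta> / (2 * real n)"
  have de: "d < e" unfolding e_def using \<delta> n0 by simp
  have th_pos: "eventually (\<lambda>\<rho>. 0 < (\<theta> \<rho>)\<^sup>2) at_top" using ok by eventually_elim simp
  have eta_pos: "eventually (\<lambda>\<rho>. 0 < \<eta> \<rho>) at_top" using ok by eventually_elim simp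
  have "0 < 2 * \<epsilon>" "0 < \<delta> / (2 * real n)" using \<epsilon> \<delta> n0 by auto
  note ev = exp_equal_bounds[OF eta eta_pos \<epsilon>(1)] exp_equal_bounds[OF th th_pos \<open>0 < 2 * \<epsilon>\<close>]
    eventually_log_le_powr[OF \<open>0 < 2 * \<epsilon>\<close> z] eventually_const_le_powr[OF \<epsilon>(1), of "2 * N0"]
    eventually_const_le_powr[OF \<epsilon>(1), of 3] eventually_const_le_powr[OF \<epsilon>(1), of "real (n * n)"]
    eventually_const_le_powr[OF \<open>0 < \<delta> / (2 * real n)\<close>, of C] eventually_gt_at_top[of "1::real"] ok
  have "eventually (\<lambda>\<rho>. sd_tail_prob n nr A ord (\<theta> \<rho>) (\<eta> \<rho>) (z * log 2 \<rho>) x \<rho> \<le> \<rho> powr (- e)) at_top"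
    using ev
  proof eventually_elim
    case (elim \<rho>)
    interpret P: prob_space "gauss_mat nr n" by (rule prob_space_gauss_mat)
    have \<rho>: "1 < \<rho>" "0 < \<rho>" using elim by auto
    have xi: "0 \<le> z * log 2 \<rho>" using z \<rho> by simp
    define S where "S \<pi> g = small_pivot_event nr n \<pi> (\<lambda>l. 0 < g l) (\<lambda>l. \<rho> powr (- real (g l) * \<epsilon> / 2))" for \<pi> g
    define B where "B = (\<Union>p\<in>pivot_orders nr n \<times> Gr. S (fst p) (snd p))"
    have Ss: "S \<pi> g \<in> sets (gauss_mat nr n)" if "\<pi> \<in> pivot_orders nr n" for \<pi> g
      unfolding S_def by (rule small_pivot_event(1)[OF that nr_ge]) simp
    have Bs: "B \<in> sets (gauss_mat nr n)"
      unfolding B_def using Ss finite_pivot_orders finGr by (intro sets.finite_UN) auto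
    have "sd_tail_prob n nr A ord (\<theta> \<rho>) (\<eta> \<rho>) (z * log 2 \<rho>) x \<rho> \<le> measure (gauss_mat nr n) B"
      unfolding sd_tail_prob_eq[OF n_pos nr_ge A_inv ord_bij]
    proof (rule tail_prob_le[OF n_pos nr_ge A_inv ord_bij _ Bs])
      show "0 \<le> \<eta> \<rho>" using elim by simp
      fix \<omega> assume \<omega>: "\<omega> \<in> tail_set n nr A ord (\<theta> \<rho>) (\<eta> \<rho>) (z * log 2 \<rho>) (\<rho> powr x)" and ns: "fst \<omega> \<notin> singular_event nr n"
      define H where "H = to_mat (fst \<omega>)"
      have sp: "\<omega> \<in> space (base_space n nr (\<eta> \<rho>))"
        and big: "\<rho> powr x \<le> real (sd_count n nr A ord (\<theta> \<rho>) (\<eta> \<rho>) (z * log 2 \<rho>) H (to_mat (fst (snd \<omega>))) (snd (snd \<omega>)))"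
        using \<omega> unfolding tail_set_def[OF n_pos nr_ge A_inv ord_bij] H_def by auto
      have hs: "fst \<omega> \<in> space (gauss_mat nr n)" using sp unfolding base_space_def space_pair_measure by auto
      obtain \<pi> where po: "\<pi> \<in> pivot_orders nr n" and cp: "complete_pivots nr n H \<pi>"
        by (rule complete_pivoting[OF nr_ge])
      have pn: "pivot H \<pi> (n - 1) \<noteq> 0" unfolding H_def by (rule nonsingular[OF n_pos nr_ge hs ns po cp[unfolded H_def]])
      have inj: "inj_cmat nr n H" unfolding H_def by (rule nonsingular_inj[OF n_pos nr_ge hs ns])
      have "\<forall>l. \<exists>g. g \<le> G \<and> (g = 0 \<or> cmod (pivot H \<pi> l) \<le> \<rho> powr (- real g * \<epsilon> / 2)) \<and> (g < G \<longrightarrow> \<rho> powr (- (real g + 1) * \<epsilon> / 2) \<le> cmod (pivot H \<pi> l))"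
      proof
        fix l
        show "\<exists>g. g \<le> G \<and> (g = 0 \<or> cmod (pivot H \<pi> l) \<le> \<rho> powr (- real g * \<epsilon> / 2)) \<and> (g < G \<longrightarrow> \<rho> powr (- (real g + 1) * \<epsilon> / 2) \<le> cmod (pivot H \<pi> l))"
          by (rule powr_ex_grid[of G "cmod (pivot H \<pi> l)" \<rho> \<epsilon>]) blast
      qed
      from choice[OF this] obtain g' where g': "\<And>l. g' l \<le> G" "\<And>l. g' l = 0 \<or> cmod (pivot H \<pi> l) \<le> \<rho> powr (- real (g' l) * \<epsilon> / 2)"
        "\<And>l. g' l < G \<Longrightarrow> \<rho> powr (- (real (g' l) + 1) * \<epsilon> / 2) \<le> cmod (pivot H \<pi> l)" by blast
      define g where "g = restrict g' {..<n}"
      have g: "\<And>l. l < n \<Longrightarrow> g l = g' l" unfolding g_def by simp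
      have "real (sd_count n nr A ord (\<theta> \<rho>) (\<eta> \<rho>) (z * log 2 \<rho>) H (to_mat (fst (snd \<omega>))) (snd (snd \<omega>)))
         \<le> \<rho> powr (real n * (\<Sum>l<n. max (real (g l) * \<epsilon> - a) 0) + 9 * (real n)\<^sup>2 * \<epsilon>)"
      proof (rule bound[OF \<rho>(1) \<epsilon>(1) _ _ xi cp po pn inj a(1,2) \<epsilon>(2)])
        show "1 \<le> \<eta> \<rho>" "\<theta> \<rho> \<noteq> 0" using elim by auto
        show "\<forall>l<n. g l \<le> G" using g g'(1) by simp
        show "\<forall>l<n. g l < G \<longrightarrow> \<rho> powr (- (real (g l) + 1) * \<epsilon> / 2) \<le> cmod (pivot H \<pi> l)" using g g'(3) by simp
        show "\<eta> \<rho> \<le> \<rho> powr ((1 - a) / 2 + \<epsilon>)" unfolding a(3) using elim by simp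
        show "\<rho> powr (a - 2 * \<epsilon>) \<le> (\<theta> \<rho>)\<^sup>2" unfolding a_def using elim by simp
        show "z * log 2 \<rho> \<le> \<rho> powr (2 * \<epsilon>)" "2 * N0 \<le> \<rho> powr \<epsilon>" "3 \<le> \<rho> powr \<epsilon>" "real (n * n) \<le> \<rho> powr \<epsilon>" using elim by blast+
      qed
      then have "\<rho> powr x \<le> \<rho> powr (real n * (\<Sum>l<n. max (real (g l) * \<epsilon> - a) 0) + 9 * (real n)\<^sup>2 * \<epsilon>)" using big by linarith
      then have "x \<le> real n * (\<Sum>l<n. max (real (g l) * \<epsilon> - a) 0) + 9 * (real n)\<^sup>2 * \<epsilon>"
        using \<rho>(1) by (simp only: powr_le_cancel_iff)
      then have "c + \<delta> \<le> real n * (\<Sum>l<n. max (real (g l) * \<epsilon> - a) 0)" using \<epsilon>(3) \<delta>(2) by linarith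
      then have gGr: "g \<in> Gr" unfolding Gr_def g_def using g'(1) by auto
      have "fst \<omega> \<in> S \<pi> g"
        unfolding S_def small_pivot_event_def
      proof (intro CollectI conjI hs allI impI)
        fix l a' b assume l: "l < n" "0 < g l" and ab: "a' < nr" "b < n"
        have "cmod (gauss_elim H \<pi> l a' b) \<le> cmod (pivot H \<pi> l)" using cp l ab unfolding complete_pivots_def by blast
        also have "\<dots> \<le> \<rho> powr (- real (g l) * \<epsilon> / 2)" using g'(2)[of l] l g[of l] by auto
        finally show "cmod (gauss_elim (to_mat (fst \<omega>)) \<pi> l a' b) \<le> \<rho> powr (- real (g l) * \<epsilon> / 2)" unfolding H_def .
      qed
      then show "fst \<omega> \<in> B" unfolding B_def using po gGr by (intro UN_I[of "(\<pi>, g)"]) auto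
    qed
    also have "\<dots> \<le> (\<Sum>p\<in>pivot_orders nr n \<times> Gr. measure (gauss_mat nr n) (S (fst p) (snd p)))"
      unfolding B_def using Ss finite_pivot_orders finGr
      by (intro P.finite_measure_subadditive_finite) auto
    also have "\<dots> \<le> (\<Sum>p\<in>pivot_orders nr n \<times> Gr. (\<Prod>l<n. 4 ^ (nr + n - 2 * l - 1)) * \<rho> powr (- (d + \<delta> / real n)))"
    proof (rule sum_mono)
      fix p assume p: "p \<in> pivot_orders nr n \<times> Gr"
      define g where "g = snd p"
      have gGr: "g \<in> Gr" and po: "fst p \<in> pivot_orders nr n" using p unfolding g_def by auto
      have gl: "g l \<le> G" if "l < n" for l using gGr that unfolding Gr_def by auto
      have "d + \<delta> / real n \<le> (\<Sum>l<n. (real nr + real n - 2 * real l - 1) * (real (g l) * \<epsilon>))"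
        unfolding d_def
      proof (rule cost_exceeds[OF k nr_ge f r _ _ _ \<delta>(1)])
        show "\<And>l. l < n \<Longrightarrow> 0 \<le> real (g l) * \<epsilon>" using \<epsilon>(1) by simp
        show "real (g l) * \<epsilon> \<le> 1" if "l < n" for l
        proof -
          have "real (g l) * \<epsilon> \<le> real G * \<epsilon>" using gl[OF that] \<epsilon>(1) by (intro mult_right_mono) auto
          then show ?thesis using \<epsilon>(2) by simp
        qed
        show "r * (real n - 1 - real k) + max (r - real n * f) 0 + \<delta> \<le> real n * (\<Sum>l<n. max (real (g l) * \<epsilon> - (1 - r / real n)) 0)"
          using gGr unfolding Gr_def c_def a_def by simp
      qed
      then have "\<rho> powr (- (\<Sum>l<n. (real nr + real n - 2 * real l - 1) * (real (g l) * \<epsilon>))) \<le> \<rho> powr (- (d + \<delta> / real n))"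
        using \<rho> by (intro powr_mono) auto
      then have "(\<Prod>l<n. 4 ^ (nr + n - 2 * l - 1)) * \<rho> powr (- (\<Sum>l<n. (real nr + real n - 2 * real l - 1) * (real (g l) * \<epsilon>)))
         \<le> (\<Prod>l<n. 4 ^ (nr + n - 2 * l - 1)) * \<rho> powr (- (d + \<delta> / real n))"
        by (intro mult_left_mono prod_nonneg) auto
      then show "measure (gauss_mat nr n) (S (fst p) (snd p)) \<le> (\<Prod>l<n. 4 ^ (nr + n - 2 * l - 1)) * \<rho> powr (- (d + \<delta> / real n))"
        unfolding S_def g_def[symmetric] using small_pivot_measure_le[OF po \<rho>(1), of g \<epsilon>] by linarith
    qed
    also have "\<dots> = C * \<rho> powr (- (d + \<delta> / real n))" unfolding C_def by (simp only: sum_constant mult.assoc)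
    also have "\<dots> \<le> \<rho> powr (\<delta> / (2 * real n)) * \<rho> powr (- (d + \<delta> / real n))"
      using elim by (intro mult_right_mono) auto
    also have "\<dots> = \<rho> powr (- e)"
      unfolding powr_add[symmetric] e_def by (rule arg_cong[where f = "\<lambda>x. \<rho> powr x"]) (simp add: field_simps)
    finally show ?case .
  qed
  then show ?thesis using de unfolding d_def by blast
qed

end

section \<open>Noise event and lower bounds for the tail probability\<close>

definition unit_noise :: "nat \<Rightarrow> nat \<Rightarrow> (nat \<times> nat \<Rightarrow> complex) set" where
  "unit_noise nr n = Pi\<^sub>E ({..<nr} \<times> {..<n}) (\<lambda>_. cball 0 1)"

lemma unit_noise_sets: "unit_noise nr n \<in> sets (gauss_mat nr n)"
  unfolding unit_noise_def gauss_mat_def by (intro sets_PiM_I_finite) auto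

lemma unit_noise_measure: "0 < measure (gauss_mat nr n) (unit_noise nr n)"
proof -
  interpret C: prob_space cgauss by (rule prob_space_cgauss)
  interpret G: prob_space "gauss_mat nr n" by (rule prob_space_gauss_mat)
  interpret product_sigma_finite "\<lambda>_::nat \<times> nat. cgauss" by standard
  have "ennreal (gauss_lb 0 * 1\<^sup>2) \<le> emeasure cgauss (cball 0 1)"
    by (rule cgauss_cball_ge) auto
  then have "emeasure cgauss (cball 0 1) \<noteq> 0" using gauss_lb_pos[of 0] by (auto simp: ennreal_eq_0_iff)
  moreover have "emeasure (gauss_mat nr n) (unit_noise nr n) = (\<Prod>e\<in>{..<nr} \<times> {..<n}. emeasure cgauss (cball 0 1))"
    unfolding gauss_mat_def unit_noise_def by (rule emeasure_PiM) auto
  ultimately have "emeasure (gauss_mat nr n) (unit_noise nr n) \<noteq> 0" by simp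
  then show ?thesis unfolding G.emeasure_eq_measure by (simp add: zero_less_measure_iff)
qed

lemma unit_noise_norm:
  assumes "w \<in> unit_noise nr n"
  shows "(\<Sum>c<n. \<Sum>i<nr. (cmod (to_mat w i c))\<^sup>2) \<le> real (n * nr)"
proof -
  have "(\<Sum>c<n. \<Sum>i<nr. (cmod (to_mat w i c))\<^sup>2) \<le> (\<Sum>c<n. \<Sum>i<nr. 1)"
  proof (intro sum_mono)
    fix c i assume "c \<in> {..<n}" "i \<in> {..<nr}"
    then have "w (i, c) \<in> cball 0 1" using assms unfolding unit_noise_def by auto
    then have "cmod (w (i, c)) \<le> 1" by simp
    then show "(cmod (to_mat w i c))\<^sup>2 \<le> 1" unfolding to_mat_def by (simp add: power_le_one)
  qed
  then show ?thesis by simp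
qed

context
  fixes n nr :: nat and A :: "nat \<Rightarrow> cmat" and ord :: "nat \<Rightarrow> nat"
  assumes n_pos: "1 \<le> n" and nr_ge: "n \<le> nr"
    and A_inv: "\<forall>l<n. invertible_cmat n (A l)"
    and ord_bij: "bij_betw ord {..<n} {..<n}"
begin

text \<open>Under unit noise the transmitted vector lies in the sphere, so the count is at least 1
  on every nonsingular channel, with probability bounded away from 0. This covers the case in which
  the claimed exponent is 0 and no channel event is needed.\<close>

lemma tail_negative_threshold:
  fixes \<theta> \<eta> :: "real \<Rightarrow> real"
  assumes ok: "eventually (\<lambda>\<rho>. \<theta> \<rho> \<noteq> 0 \<and> 1 \<le> \<eta> \<rho>) at_top" and z: "0 < z" and x: "x < 0" and e: "0 < e"
  shows "eventually (\<lambda>\<rho>. \<rho> powr (- e) \<le> sd_tail_prob n nr A ord (\<theta> \<rho>) (\<eta> \<rho>) (z * log 2 \<rho>) x \<rho>) at_top"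
proof -
  define m where "m = measure (gauss_mat nr n) (unit_noise nr n)"
  have m: "0 < m" unfolding m_def by (rule unit_noise_measure)
  show ?thesis
    using ok eventually_gt_at_top[of "1::real"] eventually_const_le_log[OF z, of "4 * real (n * nr)"]
      eventually_const_le_powr[OF e, of "2 / m"]
  proof eventually_elim
    case (elim \<rho>)
    interpret G: prob_space "gauss_mat nr n" by (rule prob_space_gauss_mat)
    have xp: "\<rho> powr x \<le> 1" using elim x powr_mono[of x 0 \<rho>] by simp
    have "measure (gauss_mat nr n) (space (gauss_mat nr n)) * m / 2 \<le> sd_tail_prob n nr A ord (\<theta> \<rho>) (\<eta> \<rho>) (z * log 2 \<rho>) x \<rho>"
      unfolding sd_tail_prob_eq[OF n_pos nr_ge A_inv ord_bij] m_def
    proof (rule tail_prob_ge[OF n_pos nr_ge A_inv ord_bij _ _ sets.top unit_noise_sets])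
      show "0 \<le> \<eta> \<rho>" "\<theta> \<rho> \<noteq> 0" using elim by auto
      fix h w assume h: "h \<in> space (gauss_mat nr n)" "h \<notin> singular_event nr n" and w: "w \<in> unit_noise nr n"
      have inj: "inj_cmat nr n (to_mat h)" by (rule nonsingular_inj[OF n_pos nr_ge h])
      have one: "1 \<le> sd_count n nr A ord (\<theta> \<rho>) (\<eta> \<rho>) (z * log 2 \<rho>) (to_mat h) (to_mat w) s"
        if s: "s \<in> symvecs (n * n) (\<eta> \<rho>)" for s
      proof -
        have "card {cut (n * 0) s} \<le> sd_count n nr A ord (\<theta> \<rho>) (\<eta> \<rho>) (z * log 2 \<rho>) (to_mat h) (to_mat w) s"
        proof (rule sd_count_ge_fiber[OF n_pos nr_ge A_inv ord_bij inj])
          show "\<theta> \<rho> \<noteq> 0" "0 < n" using elim n_pos by auto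
          show "(\<Sum>c<n. \<Sum>i<nr. (cmod (to_mat w i c))\<^sup>2) \<le> z * log 2 \<rho> / 4" using unit_noise_norm[OF w] elim by linarith
          show "{cut (n * 0) s} \<subseteq> level_set (n * n) (\<eta> \<rho>) (n * 0)" using cut_symvecs[OF s] by blast
          fix t assume "t \<in> {cut (n * 0) s}"
          then have t: "t = cut (n * 0) s" by simp
          have "codeword n A ord 1 (\<lambda>q. t q - cut (n * 0) s q) j c = 0" for j c
            unfolding t codeword_def thread_block_def by simp
          moreover have "0 \<le> z * log 2 \<rho> / 4" using z elim by simp
          ultimately show "\<exists>X. (\<forall>c<n. \<forall>j<n. j \<notin> head_rows n ord 0 c \<longrightarrow> X j c = codeword n A ord 1 (\<lambda>q. t q - cut (n * 0) s q) j c)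
             \<and> (\<theta> \<rho>)\<^sup>2 * (\<Sum>c<n. \<Sum>i<nr. (cmod (mvec n (to_mat h) (\<lambda>j. X j c) i))\<^sup>2) \<le> z * log 2 \<rho> / 4"
            by (intro exI[of _ "\<lambda>_ _. 0"]) (simp add: mvec_def)
        qed
        then show ?thesis by simp
      qed
      have "{s \<in> symvecs (n * n) (\<eta> \<rho>). \<rho> powr x \<le> real (sd_count n nr A ord (\<theta> \<rho>) (\<eta> \<rho>) (z * log 2 \<rho>) (to_mat h) (to_mat w) s)} = symvecs (n * n) (\<eta> \<rho>)"
      proof (intro equalityI subsetI)
        fix s assume s: "s \<in> symvecs (n * n) (\<eta> \<rho>)"
        have "1 \<le> real (sd_count n nr A ord (\<theta> \<rho>) (\<eta> \<rho>) (z * log 2 \<rho>) (to_mat h) (to_mat w) s)" using one[OF s] by simp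
        then show "s \<in> {s \<in> symvecs (n * n) (\<eta> \<rho>). \<rho> powr x \<le> real (sd_count n nr A ord (\<theta> \<rho>) (\<eta> \<rho>) (z * log 2 \<rho>) (to_mat h) (to_mat w) s)}"
          using s xp by simp
      qed simp
      then show "card (symvecs (n * n) (\<eta> \<rho>)) \<le> 2 * card {s \<in> symvecs (n * n) (\<eta> \<rho>). \<rho> powr x \<le> real (sd_count n nr A ord (\<theta> \<rho>) (\<eta> \<rho>) (z * log 2 \<rho>) (to_mat h) (to_mat w) s)}"
        by simp
    qed
    then have "m / 2 \<le> sd_tail_prob n nr A ord (\<theta> \<rho>) (\<eta> \<rho>) (z * log 2 \<rho>) x \<rho>" by (simp add: G.prob_space)
    moreover have "\<rho> powr (- e) \<le> m / 2"
    proof -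
      have "0 < \<rho> powr e" using elim by simp
      moreover have "2 \<le> m * \<rho> powr e" using elim m by (simp add: field_simps)
      ultimately show ?thesis by (simp add: powr_minus field_simps)
    qed
    ultimately show ?case by linarith
  qed
qed

text \<open>Pivot \<open>p\<close> gets an exponent slightly below \<open>T\<close> and the later
  block one slightly above 1. There are about \<open>\<rho> powr (r * (n - p))\<close> tails and
  \<open>\<rho> powr (n * (1 - T))\<close> cells, and \<open>cost\<close> is the exponent of the
  channel event.\<close>

lemma tail_exponent_upper:
  fixes \<theta> \<eta> :: "real \<Rightarrow> real" and p :: nat
  assumes ok: "eventually (\<lambda>\<rho>. \<theta> \<rho> \<noteq> 0 \<and> 1 \<le> \<eta> \<rho>) at_top" and z: "0 < z"
    and eta: "exp_equal \<eta> (r / (2 * real n))" and th: "exp_equal (\<lambda>\<rho>. (\<theta> \<rho>)\<^sup>2) (1 - r / real n)"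
    and r: "0 \<le> r" "r \<le> real n" and p: "p < n" and T: "0 < T" "T \<le> 1"
    and cost: "T * (real nr + real n - 2 * real p - 1) + (real nr - real p - 1) * (real n - real p - 1) \<le> d"
    and x: "x < r * (real n - real p) - real n * (1 - T)"
  shows "eventually (\<lambda>\<rho>. \<rho> powr (- d) \<le> sd_tail_prob n nr A ord (\<theta> \<rho>) (\<eta> \<rho>) (z * log 2 \<rho>) x \<rho>) at_top"
proof -
  obtain \<epsilon>0 C0 :: real where \<epsilon>0: "0 < \<epsilon>0" "\<epsilon>0 \<le> 1/2" and C0: "1 \<le> C0"
    and count: "\<And>H \<theta> eta xi2 \<sigma> \<tau> W. good_channel nr n p \<epsilon>0 \<sigma> \<tau> H \<Longrightarrow> 0 < \<sigma> \<Longrightarrow> \<sigma> \<le> 1 \<Longrightarrow> 0 \<le> \<tau> \<Longrightarrow> inj_cmat nr n H \<Longrightarrow>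
      \<theta> \<noteq> 0 \<Longrightarrow> 1 \<le> eta \<Longrightarrow> (\<Sum>c<n. \<Sum>i<nr. (cmod (W i c))\<^sup>2) \<le> xi2 / 4 \<Longrightarrow> C0 * (1 + \<bar>\<theta>\<bar> * \<tau> * eta)\<^sup>2 \<le> xi2 \<Longrightarrow>
      card (symvecs (n * n) eta) \<le> 2 * card {s \<in> symvecs (n * n) eta.
        (eta\<^sup>2) ^ (n * (n - p)) / (2 * ((C0 * (1 + \<bar>\<theta>\<bar> * \<sigma> * eta))\<^sup>2) ^ n) \<le> real (sd_count n nr A ord \<theta> eta xi2 H W s)}"
    by (rule sd_count_lower[OF n_pos nr_ge A_inv ord_bij p]) (rule that, assumption+)
  define w1 where "w1 = nr + n - 2 * p - 1"
  define w2 where "w2 = (nr - p - 1) * (n - p - 1)"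
  have w1: "real w1 = real nr + real n - 2 * real p - 1" unfolding w1_def using p nr_ge by (simp add: of_nat_diff)
  have w2: "real w2 = (real nr - real p - 1) * (real n - real p - 1)" 
  proof -
    have "real (nr - p - 1) = real nr - real p - 1" "real (n - p - 1) = real n - real p - 1" using p nr_ge by linarith+
    then show ?thesis unfolding w2_def of_nat_mult by simp
  qed
  have w1_ge: "1 \<le> real w1" unfolding w1_def using p nr_ge by simp
  from good_channel_prob[OF \<epsilon>0 nr_ge p]
  obtain c where c: "0 < c" and prob: "\<And>\<sigma> \<tau>. 0 < \<sigma> \<Longrightarrow> \<sigma> \<le> 1 \<Longrightarrow> 0 \<le> \<tau> \<Longrightarrow> \<tau> \<le> 1 \<Longrightarrow>
    \<exists>E\<in>sets (gauss_mat nr n). (\<forall>h\<in>E. good_channel nr n p \<epsilon>0 \<sigma> \<tau> (to_mat h)) \<and>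
       ennreal (c * ((\<sigma>\<^sup>2) ^ w1 * (\<tau>\<^sup>2) ^ w2)) \<le> emeasure (gauss_mat nr n) E"
    unfolding w1_def w2_def by blast
  define m where "m = measure (gauss_mat nr n) (unit_noise nr n)"
  have m: "0 < m" unfolding m_def by (rule unit_noise_measure)
  have n0: "1 \<le> real n" using n_pos by simp
  define \<Delta> where "\<Delta> = r * (real n - real p) - real n * (1 - T) - x"
  have \<Delta>: "0 < \<Delta>" unfolding \<Delta>_def using x by simp
  \<comment> \<open>Lowering \<open>T\<close> by \<open>g\<close> costs at most
    \<open>\<Delta> / 2\<close> in the count and saves at least \<open>g\<close> in the channel
    cost: half pays for \<open>\<beta> > 1\<close>, half for the constants \<open>c\<close> and
    \<open>m\<close>.\<close>
  define g where "g = min (\<Delta> / (2 * real n)) (T / 2)"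
  have g: "0 < g" "g \<le> T / 2" "real n * g \<le> \<Delta> / 2"
  proof -
    show "0 < g" "g \<le> T / 2" unfolding g_def using \<Delta> T n0 by auto
    have "g \<le> \<Delta> / (2 * real n)" unfolding g_def by (rule min.cobounded1)
    then show "real n * g \<le> \<Delta> / 2" using n0 by (simp add: field_simps)
  qed
  define t where "t = T - g"
  have t: "0 < t" "t \<le> 1" unfolding t_def using g T by linarith+
  \<comment> \<open>\<open>\<beta> > 1\<close> makes \<open>\<theta> * \<tau> * \<eta>\<close>
    bounded despite the \<open>\<epsilon>\<close> losses. The denominator keeps the extra cost of
    the block below \<open>g / 2\<close>, also when \<open>w2 = 0\<close>.\<close>
  define \<beta> where "\<beta> = 1 + g / (2 * (1 + real w2))"
  have \<beta>: "1 < \<beta>" unfolding \<beta>_def using g by simp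
  have cost': "t * real w1 + \<beta> * real w2 \<le> d - g / 2"
  proof -
    have "\<beta> * real w2 = real w2 + g / 2 * (real w2 / (1 + real w2))" unfolding \<beta>_def by (simp add: field_simps)
    moreover have "g / 2 * (real w2 / (1 + real w2)) \<le> g / 2 * 1" using g by (intro mult_left_mono) auto
    moreover have "t * real w1 = T * real w1 - g * real w1" unfolding t_def by (simp add: left_diff_distrib)
    moreover have "g * 1 \<le> g * real w1" using g w1_ge by (intro mult_left_mono) auto
    moreover have "T * real w1 + real w2 \<le> d" unfolding w1 w2 by (rule cost)
    ultimately show ?thesis by linarith
  qed
  \<comment> \<open>Total coefficient of the \<open>\<epsilon>\<close> losses:
    \<open>2 * (real n)\<^sup>2\<close> from the number of tails, \<open>6 * real n + 1\<close> from
    the number of cells.\<close>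
  define K where "K = 2 * (real n)\<^sup>2 + 6 * real n + 1"
  have K: "0 < K" unfolding K_def using n0 by (simp add: add_nonneg_pos)
  define \<epsilon> where "\<epsilon> = min ((\<beta> - 1) / 4) (\<Delta> / (2 * K))"
  have \<epsilon>: "0 < \<epsilon>" "4 * \<epsilon> \<le> \<beta> - 1" "K * \<epsilon> \<le> \<Delta> / 2"
  proof -
    show "0 < \<epsilon>" unfolding \<epsilon>_def using \<beta> \<Delta> K by simp
    have "\<epsilon> \<le> (\<beta> - 1) / 4" unfolding \<epsilon>_def by (rule min.cobounded1)
    then show "4 * \<epsilon> \<le> \<beta> - 1" by simp
    have "\<epsilon> \<le> \<Delta> / (2 * K)" unfolding \<epsilon>_def by (rule min.cobounded2)
    then show "K * \<epsilon> \<le> \<Delta> / 2" using K by (simp add: field_simps)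
  qed
  have th_pos: "eventually (\<lambda>\<rho>. 0 < (\<theta> \<rho>)\<^sup>2) at_top" using ok by eventually_elim simp
  have eta_pos: "eventually (\<lambda>\<rho>. 0 < \<eta> \<rho>) at_top" using ok by eventually_elim simp
  have e2: "0 < 2 * \<epsilon>" "0 < g / 2" using \<epsilon> g by auto
  show ?thesis
    using exp_equal_bounds[OF eta eta_pos \<epsilon>(1)] exp_equal_bounds[OF th th_pos e2(1)]
      eventually_const_le_powr[OF \<epsilon>(1), of "2 * C0"] eventually_const_le_powr[OF e2(2), of "2 / (c * m)"]
      eventually_const_le_log[OF z, of "4 * real (n * nr)"] eventually_const_le_log[OF z, of "4 * C0"]
      eventually_gt_at_top[of "1::real"] ok
  proof eventually_elim
    case (elim \<rho>)
    interpret G: prob_space "gauss_mat nr n" by (rule prob_space_gauss_mat)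
    have \<rho>: "1 < \<rho>" "0 < \<rho>" using elim by auto
    define \<sigma> where "\<sigma> = \<rho> powr (- t / 2)"
    define \<tau> where "\<tau> = \<rho> powr (- \<beta> / 2)"
    have \<sigma>: "0 < \<sigma>" "\<sigma> \<le> 1" unfolding \<sigma>_def using \<rho> t powr_mono[of "- t / 2" 0 \<rho>] by simp_all
    have \<tau>: "0 \<le> \<tau>" "\<tau> \<le> 1" unfolding \<tau>_def using \<rho> \<beta> powr_mono[of "- \<beta> / 2" 0 \<rho>] by simp_all
    have eta1: "1 \<le> \<eta> \<rho>" "\<eta> \<rho> \<le> \<rho> powr (r / (2 * real n) + \<epsilon>)" "\<rho> powr (r / (2 * real n) - \<epsilon>) \<le> \<eta> \<rho>" using elim by auto
    have \<theta>0: "\<theta> \<rho> \<noteq> 0" using elim by auto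
    have thB: "\<bar>\<theta> \<rho>\<bar> \<le> \<rho> powr ((1 - r / real n) / 2 + \<epsilon>)"
    proof -
      have "(\<rho> powr ((1 - r / real n) / 2 + \<epsilon>))\<^sup>2 = \<rho> powr (1 - r / real n + 2 * \<epsilon>)"
        unfolding power_eq_powr[OF \<rho>(2)] by (rule arg_cong[where f = "\<lambda>x. \<rho> powr x"]) (simp add: field_simps)
      then have "\<bar>\<theta> \<rho>\<bar>\<^sup>2 \<le> (\<rho> powr ((1 - r / real n) / 2 + \<epsilon>))\<^sup>2" using elim by simp
      then show ?thesis by (rule power2_le_imp_le) simp
    qed
    have prodB: "\<bar>\<theta> \<rho>\<bar> * \<rho> powr y * \<eta> \<rho> \<le> \<rho> powr (1 / 2 + y + 2 * \<epsilon>)" for y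
    proof -
      have "\<bar>\<theta> \<rho>\<bar> * \<rho> powr y * \<eta> \<rho> \<le> \<rho> powr ((1 - r / real n) / 2 + \<epsilon>) * \<rho> powr y * \<rho> powr (r / (2 * real n) + \<epsilon>)"
        using thB eta1 by (intro mult_mono) auto
      also have "\<dots> = \<rho> powr (1 / 2 + y + 2 * \<epsilon>)"
        unfolding powr_add[symmetric] by (rule arg_cong[where f = "\<lambda>x. \<rho> powr x"]) (use n0 in \<open>simp add: field_simps\<close>)
      finally show ?thesis .
    qed
    obtain E where E: "E \<in> sets (gauss_mat nr n)" and good: "\<And>h. h \<in> E \<Longrightarrow> good_channel nr n p \<epsilon>0 \<sigma> \<tau> (to_mat h)"
      and mE: "ennreal (c * ((\<sigma>\<^sup>2) ^ w1 * (\<tau>\<^sup>2) ^ w2)) \<le> emeasure (gauss_mat nr n) E"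
      using prob[OF \<sigma> \<tau>] by blast
    have mE': "c * \<rho> powr (- (t * real w1 + \<beta> * real w2)) \<le> measure (gauss_mat nr n) E"
    proof -
      have "(\<sigma>\<^sup>2) ^ w1 * (\<tau>\<^sup>2) ^ w2 = \<rho> powr (- (t * real w1 + \<beta> * real w2))"
        unfolding \<sigma>_def \<tau>_def power_eq_powr[OF \<rho>(2)] powr_add[symmetric]
        by (rule arg_cong[where f = "\<lambda>x. \<rho> powr x"]) (simp add: field_simps)
      then show ?thesis using mE unfolding G.emeasure_eq_measure by (simp add: ennreal_le_iff)
    qed
    have xi: "C0 * (1 + \<bar>\<theta> \<rho>\<bar> * \<tau> * \<eta> \<rho>)\<^sup>2 \<le> z * log 2 \<rho>"
    proof -
      have "\<bar>\<theta> \<rho>\<bar> * \<tau> * \<eta> \<rho> \<le> \<rho> powr (1 / 2 + - \<beta> / 2 + 2 * \<epsilon>)" unfolding \<tau>_def by (rule prodB)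
      also have "\<dots> \<le> 1" using \<rho> \<epsilon>(2) powr_mono[of "1 / 2 + - \<beta> / 2 + 2 * \<epsilon>" 0 \<rho>] by simp
      finally have "(1 + \<bar>\<theta> \<rho>\<bar> * \<tau> * \<eta> \<rho>)\<^sup>2 \<le> 2\<^sup>2" using \<tau> eta1 by (intro power_mono) auto
      then have "C0 * (1 + \<bar>\<theta> \<rho>\<bar> * \<tau> * \<eta> \<rho>)\<^sup>2 \<le> C0 * 2\<^sup>2" using C0 by (intro mult_left_mono) auto
      then show ?thesis using elim by simp
    qed
    have target: "\<rho> powr x \<le> ((\<eta> \<rho>)\<^sup>2) ^ (n * (n - p)) / (2 * ((C0 * (1 + \<bar>\<theta> \<rho>\<bar> * \<sigma> * \<eta> \<rho>))\<^sup>2) ^ n)"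
    proof -
      have np: "real (n * (n - p)) = real n * (real n - real p)" using p by (simp add: of_nat_diff)
      define u where "u = \<rho> powr ((1 - t) / 2 + 2 * \<epsilon>)"
      have u1: "1 \<le> u" unfolding u_def using \<rho> t \<epsilon> by (intro ge_one_powr_ge_zero) auto
      have "\<bar>\<theta> \<rho>\<bar> * \<sigma> * \<eta> \<rho> \<le> \<rho> powr (1 / 2 + - t / 2 + 2 * \<epsilon>)" unfolding \<sigma>_def by (rule prodB)
      also have "\<dots> = u" unfolding u_def by (rule arg_cong[where f = "\<lambda>x. \<rho> powr x"]) (simp add: field_simps)
      finally have "C0 * (1 + \<bar>\<theta> \<rho>\<bar> * \<sigma> * \<eta> \<rho>) \<le> C0 * (2 * u)" using u1 C0 by (intro mult_left_mono) auto
      also have "\<dots> = (2 * C0) * u" by simp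
      also have "\<dots> \<le> \<rho> powr \<epsilon> * u" using elim u1 by (intro mult_right_mono) auto
      also have "\<dots> = \<rho> powr ((1 - t) / 2 + 3 * \<epsilon>)"
        unfolding u_def powr_add[symmetric] by (rule arg_cong[where f = "\<lambda>x. \<rho> powr x"]) simp
      finally have q1: "C0 * (1 + \<bar>\<theta> \<rho>\<bar> * \<sigma> * \<eta> \<rho>) \<le> \<rho> powr ((1 - t) / 2 + 3 * \<epsilon>)" .
      have q0: "0 < C0 * (1 + \<bar>\<theta> \<rho>\<bar> * \<sigma> * \<eta> \<rho>)"
        using C0 \<sigma> eta1 by (intro mult_pos_pos add_pos_nonneg mult_nonneg_nonneg) auto
      have "2 \<le> \<rho> powr \<epsilon>" using elim C0 by linarith
      then have "2 * ((C0 * (1 + \<bar>\<theta> \<rho>\<bar> * \<sigma> * \<eta> \<rho>))\<^sup>2) ^ n \<le> \<rho> powr \<epsilon> * ((\<rho> powr ((1 - t) / 2 + 3 * \<epsilon>))\<^sup>2) ^ n"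
        using q1 q0 by (intro mult_mono power_mono zero_le_power) auto
      also have "\<dots> = \<rho> powr (real n * (1 - t) + (6 * real n + 1) * \<epsilon>)"
        unfolding power_eq_powr[OF \<rho>(2)] powr_add[symmetric]
        by (rule arg_cong[where f = "\<lambda>x. \<rho> powr x"]) (simp add: field_simps)
      finally have den: "2 * ((C0 * (1 + \<bar>\<theta> \<rho>\<bar> * \<sigma> * \<eta> \<rho>))\<^sup>2) ^ n \<le> \<rho> powr (real n * (1 - t) + (6 * real n + 1) * \<epsilon>)" .
      have "((\<rho> powr (r / (2 * real n) - \<epsilon>))\<^sup>2) ^ (n * (n - p)) \<le> ((\<eta> \<rho>)\<^sup>2) ^ (n * (n - p))"
        using eta1 by (intro power_mono) auto
      moreover have "((\<rho> powr (r / (2 * real n) - \<epsilon>))\<^sup>2) ^ (n * (n - p)) = \<rho> powr (r * (real n - real p) - 2 * real n * (real n - real p) * \<epsilon>)"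
        unfolding power_eq_powr[OF \<rho>(2)] np
        by (rule arg_cong[where f = "\<lambda>x. \<rho> powr x"]) (use n0 in \<open>simp add: field_simps\<close>)
      ultimately have num: "\<rho> powr (r * (real n - real p) - 2 * real n * (real n - real p) * \<epsilon>) \<le> ((\<eta> \<rho>)\<^sup>2) ^ (n * (n - p))" by simp
      have "x \<le> (r * (real n - real p) - 2 * real n * (real n - real p) * \<epsilon>) - (real n * (1 - t) + (6 * real n + 1) * \<epsilon>)"
      proof -
        have "2 * real n * (real n - real p) * \<epsilon> \<le> 2 * (real n)\<^sup>2 * \<epsilon>"
          using \<epsilon>(1) p unfolding power2_eq_square by (intro mult_right_mono) (auto simp: mult.assoc intro!: mult_left_mono)
        moreover have "K * \<epsilon> = 2 * (real n)\<^sup>2 * \<epsilon> + (6 * real n + 1) * \<epsilon>" unfolding K_def by (simp add: algebra_simps)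
        moreover have "real n * (1 - t) = real n * (1 - T) + real n * g" unfolding t_def by (simp add: algebra_simps)
        ultimately show ?thesis using \<epsilon>(3) g(3) \<Delta>_def by linarith
      qed
      then have "\<rho> powr x \<le> \<rho> powr ((r * (real n - real p) - 2 * real n * (real n - real p) * \<epsilon>) - (real n * (1 - t) + (6 * real n + 1) * \<epsilon>))"
        using \<rho> by (intro powr_mono) auto
      also have "\<dots> = \<rho> powr (r * (real n - real p) - 2 * real n * (real n - real p) * \<epsilon>) / \<rho> powr (real n * (1 - t) + (6 * real n + 1) * \<epsilon>)"
        by (rule powr_diff)
      also have "\<dots> \<le> ((\<eta> \<rho>)\<^sup>2) ^ (n * (n - p)) / (2 * ((C0 * (1 + \<bar>\<theta> \<rho>\<bar> * \<sigma> * \<eta> \<rho>))\<^sup>2) ^ n)"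
      proof (rule frac_le[OF _ num _ den])
        have "0 < ((C0 * (1 + \<bar>\<theta> \<rho>\<bar> * \<sigma> * \<eta> \<rho>))\<^sup>2) ^ n" by (rule zero_less_power[OF zero_less_power[OF q0]])
        then show "0 < 2 * ((C0 * (1 + \<bar>\<theta> \<rho>\<bar> * \<sigma> * \<eta> \<rho>))\<^sup>2) ^ n" by (rule mult_pos_pos[OF zero_less_numeral])
      qed simp
      finally show ?thesis .
    qed
    have tail: "measure (gauss_mat nr n) E * m / 2 \<le> sd_tail_prob n nr A ord (\<theta> \<rho>) (\<eta> \<rho>) (z * log 2 \<rho>) x \<rho>"
      unfolding sd_tail_prob_eq[OF n_pos nr_ge A_inv ord_bij] m_def
    proof (rule tail_prob_ge[OF n_pos nr_ge A_inv ord_bij _ \<theta>0 E unit_noise_sets])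
      show "0 \<le> \<eta> \<rho>" using eta1 by simp
      fix h w assume h: "h \<in> E" "h \<notin> singular_event nr n" and w: "w \<in> unit_noise nr n"
      have hs: "h \<in> space (gauss_mat nr n)" using h(1) sets.sets_into_space[OF E] by auto
      have inj: "inj_cmat nr n (to_mat h)" by (rule nonsingular_inj[OF n_pos nr_ge hs h(2)])
      have W: "(\<Sum>c<n. \<Sum>i<nr. (cmod (to_mat w i c))\<^sup>2) \<le> z * log 2 \<rho> / 4" using unit_noise_norm[OF w] elim by linarith
      have "card (symvecs (n * n) (\<eta> \<rho>)) \<le> 2 * card {s \<in> symvecs (n * n) (\<eta> \<rho>).
          ((\<eta> \<rho>)\<^sup>2) ^ (n * (n - p)) / (2 * ((C0 * (1 + \<bar>\<theta> \<rho>\<bar> * \<sigma> * \<eta> \<rho>))\<^sup>2) ^ n) \<le> real (sd_count n nr A ord (\<theta> \<rho>) (\<eta> \<rho>) (z * log 2 \<rho>) (to_mat h) (to_mat w) s)}"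
        by (rule count[OF good[OF h(1)] \<sigma> \<tau>(1) inj \<theta>0 eta1(1) W xi])
      also have "\<dots> \<le> 2 * card {s \<in> symvecs (n * n) (\<eta> \<rho>). \<rho> powr x \<le> real (sd_count n nr A ord (\<theta> \<rho>) (\<eta> \<rho>) (z * log 2 \<rho>) (to_mat h) (to_mat w) s)}"
        using target by (intro mult_left_mono card_mono finite_Collect_conjI disjI1) (auto simp: finite_symvecs)
      finally show "card (symvecs (n * n) (\<eta> \<rho>)) \<le> 2 * card {s \<in> symvecs (n * n) (\<eta> \<rho>). \<rho> powr x \<le> real (sd_count n nr A ord (\<theta> \<rho>) (\<eta> \<rho>) (z * log 2 \<rho>) (to_mat h) (to_mat w) s)}" .
    qed
    have "\<rho> powr (- d) \<le> measure (gauss_mat nr n) E * m / 2"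
    proof -
      have cm: "0 < c * m" using c m by simp
      then have "1 \<le> (c * m / 2) * \<rho> powr (g / 2)" using elim by (simp add: field_simps)
      then have "1 * \<rho> powr (- d) \<le> (c * m / 2) * \<rho> powr (g / 2) * \<rho> powr (- d)" by (intro mult_right_mono) auto
      also have "\<dots> = (c * m / 2) * \<rho> powr (- (d - g / 2))" by (simp only: mult.assoc powr_add[symmetric]) simp
      also have "\<dots> \<le> (c * m / 2) * \<rho> powr (- (t * real w1 + \<beta> * real w2))"
        using cost' \<rho> cm by (intro mult_left_mono powr_mono) auto
      also have "\<dots> = (c * \<rho> powr (- (t * real w1 + \<beta> * real w2))) * (m / 2)" by simp
      also have "\<dots> \<le> measure (gauss_mat nr n) E * (m / 2)" using mE' m by (intro mult_right_mono) auto
      finally show ?thesis by simp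
    qed
    then show ?case using tail by linarith
  qed
qed

end

theorem theorem6:
  fixes n nr :: nat
    and A :: "nat \<Rightarrow> cmat"
    and ord :: "nat \<Rightarrow> nat"
    and \<eta> \<theta> :: "real \<Rightarrow> real \<Rightarrow> real"
    and r z :: real
    and \<Psi> :: "real \<Rightarrow> ereal"
  assumes n_pos: "1 \<le> n" and nr_ge: "n \<le> nr"
    and A_inv: "\<forall>l<n. invertible_cmat n (A l)"
    and ord_bij: "bij_betw ord {..<n} {..<n}"
    and eta_order: "\<forall>r'\<in>{0..real n}. exp_equal (\<eta> r') (r' / (2 * real n))"
    and theta_order: "\<forall>r'\<in>{0..real n}. exp_equal (\<lambda>\<rho>. (\<theta> r' \<rho>)\<^sup>2) (1 - r' / real n)"
    and DMT_optimal: "\<forall>r'\<in>{0..real n}.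
           neg_exponent (\<lambda>\<rho>. err_prob n nr A ord (\<theta> r' \<rho>) (\<eta> r' \<rho>)) (ereal (dstar n nr r'))"
    and r_range: "r \<in> {0..real n}"
    and z_gt: "z > dstar n nr r"
    and Psi_def: "\<forall>x. neg_exponent
           (\<lambda>\<rho>. sd_tail_prob n nr A ord (\<theta> r \<rho>) (\<eta> r \<rho>) (z * log 2 \<rho>) x \<rho>) (\<Psi> x)"
  shows "Inf {ereal x | x. \<Psi> x > ereal (dstar n nr r)}
           = ereal (r * (real n - \<lfloor>r\<rfloor> - 1) + max (real n * \<lfloor>r\<rfloor> - r * (real n - 1)) 0)
       \<and> (\<forall>k::nat. r = real k \<longrightarrow>
           Inf {ereal x | x. \<Psi> x > ereal (dstar n nr r)} = ereal (real k * (real n - real k)))"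
proof -
  obtain k f where k: "k < n" and f: "0 \<le> f" "f \<le> 1" "r = real k + f"
    and d_eq: "dstar n nr r = (real n - real k) * (real nr - real k) - f * (real nr + real n - 2 * real k - 1)"
    and c_eq: "r * (real n - \<lfloor>r\<rfloor> - 1) + max (real n * \<lfloor>r\<rfloor> - r * (real n - 1)) 0
       = r * (real n - 1 - real k) + max (r - real n * f) 0"
    by (rule dstar_eq[OF n_pos r_range])
  define d where "d = dstar n nr r"
  define c where "c = r * (real n - 1 - real k) + max (r - real n * f) 0"
  have r: "0 \<le> r" "r \<le> real n" using r_range by auto
  have kr: "real k + 1 \<le> real n" "real n \<le> real nr" using k nr_ge by linarith+
  \<comment> \<open>The cost with pivot \<open>k\<close> at exponent \<open>1 - f\<close> and all
    later pivots at exponent 1, in the form \<open>tail_exponent_upper\<close> asks for.\<close>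
  have d_eq': "d = (real n - real k - 1) * (real nr - real k - 1) + (1 - f) * (real nr + real n - 2 * real k - 1)"
    unfolding d_def d_eq by (simp add: algebra_simps)
  have d_ge: "(real n - real k - 1) * (real nr - real k - 1) \<le> d"
    unfolding d_eq' using f kr by simp
  have d0: "0 \<le> d" using d_ge kr mult_nonneg_nonneg[of "real n - real k - 1" "real nr - real k - 1"] by linarith
  have z: "0 < z" using z_gt d0 unfolding d_def by linarith
  \<comment> \<open>The diversity gain is finite, so errors do occur, which excludes degenerate
    \<open>\<theta>\<close> and \<open>\<eta>\<close>.\<close>
  have "eventually (\<lambda>\<rho>. err_prob n nr A ord (\<theta> r \<rho>) (\<eta> r \<rho>) \<noteq> 0) at_top"
    by (rule neg_exponent_eventually_nonzero[OF DMT_optimal[rule_format, OF r_range]])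
  then have ok: "eventually (\<lambda>\<rho>. \<theta> r \<rho> \<noteq> 0 \<and> 1 \<le> \<eta> r \<rho>) at_top"
    by (rule eventually_mono) (use err_prob_nonzero[OF n_pos] in blast)
  note eta = eta_order[rule_format, OF r_range] and th = theta_order[rule_format, OF r_range]
  note Psi = Psi_def[rule_format]
  have above: "ereal d < \<Psi> x" if x: "c < x" for x
  proof -
    from tail_exponent_lower[OF n_pos nr_ge A_inv ord_bij ok z eta th k f(3,1,2) r x[unfolded c_def], folded d_eq, folded d_def]
    obtain e where e: "d < e" and ev: "eventually (\<lambda>\<rho>. sd_tail_prob n nr A ord (\<theta> r \<rho>) (\<eta> r \<rho>) (z * log 2 \<rho>) x \<rho> \<le> \<rho> powr (- e)) at_top"
      by (elim exE conjE) rule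
    have "ereal e \<le> \<Psi> x"
      by (rule neg_exponent_ge[OF Psi]) (use ev in \<open>eventually_elim, simp add: sd_tail_prob_def\<close>)
    then show ?thesis using e less_le_trans[of "ereal d" "ereal e" "\<Psi> x"] by simp
  qed
  have below: "\<Psi> x \<le> ereal d" if x: "x < c" for x
  proof -
    \<comment> \<open>With a positive hinge the extremal channel shrinks pivot \<open>k\<close>
      partially. Otherwise that shrinking gains nothing, and pivot \<open>k + 1\<close> is taken at
      exponent 1 instead; on the last segment there is no such pivot and
      \<open>c = 0\<close>.\<close>
    consider "0 < r - real n * f" | "r - real n * f \<le> 0" "k + 1 < n" | "r - real n * f \<le> 0" "k + 1 = n"
      using k linorder_not_less[of 0 "r - real n * f"] le_less[of "k + 1" n] by (simp only: Suc_eq_plus1[symmetric] Suc_le_eq) blast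
    then show ?thesis
    proof cases
      case 1
      \<comment> \<open>The partial exponent \<open>1 - f\<close> must be positive; at
        \<open>f = 1\<close> the hinge would be \<open>r - n \<le> 0\<close>.\<close>
      have "f < 1"
      proof (rule ccontr)
        assume "\<not> f < 1"
        then have "f = 1" using f by simp
        then show False using 1 r by simp
      qed
      then have T: "0 < 1 - f" "1 - f \<le> 1" using f by auto
      show ?thesis
      proof (rule neg_exponent_le[OF Psi], rule tail_exponent_upper[OF n_pos nr_ge A_inv ord_bij ok z eta th r k T])
        show "(1 - f) * (real nr + real n - 2 * real k - 1) + (real nr - real k - 1) * (real n - real k - 1) \<le> d"
          unfolding d_eq' by (simp add: mult.commute)
        show "x < r * (real n - real k) - real n * (1 - (1 - f))" using x 1 unfolding c_def by (simp add: algebra_simps)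
      qed
    next
      case 2
      show ?thesis
      proof (rule neg_exponent_le[OF Psi], rule tail_exponent_upper[OF n_pos nr_ge A_inv ord_bij ok z eta th r 2(2), of 1])
        \<comment> \<open>Full weight of pivot \<open>k + 1\<close> plus its remaining block is the
          whole block behind pivot \<open>k\<close>, which is affordable by
          \<open>d_ge\<close>.\<close>
        have "1 * (real nr + real n - 2 * real (k + 1) - 1) + (real nr - real (k + 1) - 1) * (real n - real (k + 1) - 1)
            = (real n - real k - 1) * (real nr - real k - 1)" by (simp add: algebra_simps)
        then show "1 * (real nr + real n - 2 * real (k + 1) - 1) + (real nr - real (k + 1) - 1) * (real n - real (k + 1) - 1) \<le> d"
          using d_ge by simp
        show "x < r * (real n - real (k + 1)) - real n * (1 - 1)" using x 2 unfolding c_def by (simp add: algebra_simps)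
      qed simp_all
    next
      case 3
      have "real n - 1 - real k = 0" using 3(2) by linarith
      then have "x < 0" using x 3(1) unfolding c_def by simp
      then have le: "\<Psi> x \<le> ereal e" if "0 < e" for e
        using that by (intro neg_exponent_le[OF Psi] tail_negative_threshold[OF n_pos nr_ge A_inv ord_bij ok z])
      \<comment> \<open>Every positive exponent is an upper bound, so the limit is at most 0, hence
        at most \<open>d\<close>.\<close>
      have "\<Psi> x \<le> 0"
      proof (rule ereal_le_epsilon2)
        show "\<Psi> x \<le> 0 + ereal e" if "0 < e" for e using le[OF that] by simp
      qed
      then show ?thesis using d0 order_trans[of "\<Psi> x" 0 "ereal d"] by simp
    qed
  qed
  have Inf_eq: "Inf {ereal x | x. \<Psi> x > ereal d} = ereal c"
  proof (rule antisym)
    show "ereal c \<le> Inf {ereal x | x. \<Psi> x > ereal d}"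
    proof (rule Inf_greatest)
      fix y assume "y \<in> {ereal x | x. \<Psi> x > ereal d}"
      then obtain x where y: "y = ereal x" and "ereal d < \<Psi> x" by blast
      then have "\<not> x < c" using below[of x] by auto
      then show "ereal c \<le> y" unfolding y by simp
    qed
    show "Inf {ereal x | x. \<Psi> x > ereal d} \<le> ereal c"
    proof (rule ereal_le_epsilon2)
      fix e :: real assume "0 < e"
      then have "ereal (c + e) \<in> {ereal x | x. \<Psi> x > ereal d}" using above[of "c + e"] by auto
      from Inf_lower[OF this] show "Inf {ereal x | x. \<Psi> x > ereal d} \<le> ereal c + ereal e" by simp
    qed
  qed
  have Inf_eq': "Inf {ereal x | x. \<Psi> x > ereal (dstar n nr r)}
     = ereal (r * (real n - \<lfloor>r\<rfloor> - 1) + max (real n * \<lfloor>r\<rfloor> - r * (real n - 1)) 0)"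
    unfolding c_eq using Inf_eq unfolding d_def c_def .
  have int: "r * (real n - \<lfloor>r\<rfloor> - 1) + max (real n * \<lfloor>r\<rfloor> - r * (real n - 1)) 0 = real k' * (real n - real k')"
    if "r = real k'" for k' :: nat
    unfolding that by (simp add: algebra_simps)
  show ?thesis
  proof (intro conjI allI impI)
    show "Inf {ereal x | x. \<Psi> x > ereal (dstar n nr r)} = ereal (real k' * (real n - real k'))" if "r = real k'" for k'
      unfolding Inf_eq' by (rule arg_cong[where f = ereal]) (rule int[OF that])
  qed (rule Inf_eq')
qed

end
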